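(* Let $(v,B)$ be a weak solution of the inviscid and irresistive Leray-$\alpha$ MHD model. If $v\in L^3((0,T);B^s_{3,\infty}(\mathbb{T}^3))$ and $B\in L^3((0,T);B^r_{3,\infty}(\mathbb{T}^3))$ with $s,r>0$ and $s+2r>1$, then the weak solution conserves energy: for almost all $t_1,t_2\in(0,T)$ it holds that $$\|v(t_1,\cdot)\|_{L^2}^2+\|B(t_1,\cdot)\|_{L^2}^2=\|v(t_2,\cdot)\|_{L^2}^2+\|B(t_2,\cdot)\|_{L^2}^2 .$$
   Context: Fix $\alpha>0$, $T>0$; $\mathbb{T}^3$ is the flat three-dimensional torus; repeated indices are summed; $\mathcal{D}$ denotes smooth compactly supported functions; $B^s_{3,\infty}$ is the usual Besov space. The inviscid and irresistive Leray-$\alpha$ MHD model is $\partial_tv+(u\cdot\nabla)v+\nabla p+\frac12\nabla|B|^2=(B\cdot\nabla)B$, $\partial_tB+(u\cdot\nabla)B-(B\cdot\nabla)v=0$, $v=u-\alpha^2\Delta u$, $\nabla\cdot u=\nabla\cdot v=\nabla\cdot B=0$. A triplet $v,B\in L^\infty((0,T);L^2(\mathbb{T}^3))$ (vector-valued), $p\in L^\infty((0,T);L^1(\mathbb{T}^3))$ (scalar), with $u=(I-\alpha^2\Delta)^{-1}v$, is a weak solution if for all $\psi\in\mathcal{D}(\mathbb{T}^3\times(0,T);\mathbb{R}^3)$ and $\chi\in\mathcal{D}(\mathbb{T}^3\times(0,T);\mathbb{R})$ $$\int_0^T\!\!\int_{\mathbb{T}^3}\Big[v\cdot\partial_t\psi+v_ju_i\partial_i\psi_j+p\,\nabla\cdot\psi+\tfrac12|B|^2\nabla\cdot\psi-B_iB_j\partial_i\psi_j\Big]dx\,dt=0,$$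 $$\int_0^T\!\!\int_{\mathbb{T}^3}\Big[B\cdot\partial_t\psi+B_ju_i\partial_i\psi_j-v_jB_i\partial_i\psi_j\Big]dx\,dt=0,$$ $$\int_0^T\!\!\int_{\mathbb{T}^3}u_i\partial_i\chi\,dx\,dt=\int_0^T\!\!\int_{\mathbb{T}^3}B_i\partial_i\chi\,dx\,dt=0,$$ with $\int_{\mathbb{T}^3}p(x,t)\,dx=0$. *)

theory Defs
  imports "HOL-Analysis.Analysis"
begin

text \<open>
  The torus is \<open>\<real>\<^sup>3 / \<int>\<^sup>3\<close>: functions on it are functions on \<open>\<real>\<^sup>3\<close> that have period 1 in each
  coordinate, and integrals over it are integrals over the unit cube.
\<close>

definition torus_periodic :: "(real^3 \<Rightarrow> 'b) \<Rightarrow> bool" where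
  "torus_periodic f \<longleftrightarrow> (\<forall>x i. f (x + axis i 1) = f x)"

abbreviation cell :: "(real^3) set" where
  "cell \<equiv> cbox 0 1"

definition Lq :: "real \<Rightarrow> (real^3 \<Rightarrow> 'b::euclidean_space) \<Rightarrow> bool" where
  "Lq q f \<longleftrightarrow> f \<in> borel_measurable borel \<and> torus_periodic f \<and>
     set_integrable lborel cell (\<lambda>x. norm (f x) powr q)"

definition Lq_norm :: "real \<Rightarrow> (real^3 \<Rightarrow> 'b::euclidean_space) \<Rightarrow> real" where
  "Lq_norm q f = (LINT x:cell|lborel. norm (f x) powr q) powr (1 / q)"


text \<open>
  For a positive exponent \<open>s\<close>, not restricted to \<open>s < 1\<close>, the Besov space \<open>B\<^sup>s\<^sub>3\<^sub>,\<^sub>\<infinity>\<close> is given by the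
  modulus of smoothness of an order \<open>m > s\<close>; the space does not depend on the choice of \<open>m\<close>,
  and \<open>0 < s < 1\<close> gives \<open>m = 1\<close>, i.e. the condition \<open>\<parallel>f(\<cdot> + h) - f\<parallel> \<le> C \<bar>h\<bar>\<^sup>s\<close> in \<open>L\<^sup>3\<close>.
\<close>

definition fdiff :: "real^3 \<Rightarrow> (real^3 \<Rightarrow> 'b::ab_group_add) \<Rightarrow> real^3 \<Rightarrow> 'b" where
  "fdiff h f x = f (x + h) - f x"

definition besov_quotient :: "real \<Rightarrow> (real^3 \<Rightarrow> 'b::euclidean_space) \<Rightarrow> real^3 \<Rightarrow> real" where
  "besov_quotient s f h = Lq_norm 3 ((fdiff h ^^ (nat \<lfloor>s\<rfloor> + 1)) f) / norm h powr s"

definition besov :: "real \<Rightarrow> (real^3 \<Rightarrow> 'b::euclidean_space) \<Rightarrow> bool" where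
  "besov s f \<longleftrightarrow> Lq 3 f \<and> bdd_above (besov_quotient s f ` (- {0}))"

definition besov_norm :: "real \<Rightarrow> (real^3 \<Rightarrow> 'b::euclidean_space) \<Rightarrow> real" where
  "besov_norm s f = Lq_norm 3 f + (SUP h \<in> - {0}. besov_quotient s f h)"


text \<open>
  Elements of the spaces over \<open>(0,T)\<close> are given by a jointly Borel measurable representative;
  every (Lebesgue) almost-everywhere class has one.
\<close>

definition torus_field :: "real \<Rightarrow> (real \<Rightarrow> real^3 \<Rightarrow> 'b::euclidean_space) \<Rightarrow> bool" where
  "torus_field T f \<longleftrightarrow>
     (\<lambda>(t, x). f t x) \<in> borel_measurable (restrict_space borel ({0<..<T} \<times> UNIV)) \<and>
     (\<forall>t\<in>{0<..<T}. torus_periodic (f t))"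

definition Linf_Lq :: "real \<Rightarrow> real \<Rightarrow> (real \<Rightarrow> real^3 \<Rightarrow> 'b::euclidean_space) \<Rightarrow> bool" where
  "Linf_Lq T q f \<longleftrightarrow> torus_field T f \<and>
     (\<exists>C. AE t in lebesgue_on {0<..<T}. Lq q (f t) \<and> Lq_norm q (f t) \<le> C)"

definition L3_besov :: "real \<Rightarrow> real \<Rightarrow> (real \<Rightarrow> real^3 \<Rightarrow> 'b::euclidean_space) \<Rightarrow> bool" where
  "L3_besov T s f \<longleftrightarrow> torus_field T f \<and>
     (AE t in lebesgue_on {0<..<T}. besov s (f t)) \<and>
     integrable (lebesgue_on {0<..<T}) (\<lambda>t. besov_norm s (f t) ^ 3)"


definition partial :: "3 \<Rightarrow> (real^3 \<Rightarrow> 'b::real_normed_vector) \<Rightarrow> real^3 \<Rightarrow> 'b" where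
  "partial i f x = frechet_derivative f (at x) (axis i 1)"

definition time_deriv ::
    "(real \<Rightarrow> real^3 \<Rightarrow> 'b::real_normed_vector) \<Rightarrow> real \<Rightarrow> real^3 \<Rightarrow> 'b" where
  "time_deriv f t x = vector_derivative (\<lambda>\<tau>. f \<tau> x) (at t)"

definition divergence :: "(real^3 \<Rightarrow> real^3) \<Rightarrow> real^3 \<Rightarrow> real" where
  "divergence f x = (\<Sum>i\<in>UNIV. partial i f x $ i)"

definition laplacian :: "(real^3 \<Rightarrow> 'b::real_normed_vector) \<Rightarrow> real^3 \<Rightarrow> 'b" where
  "laplacian f x = (\<Sum>i\<in>UNIV. partial i (partial i f) x)"

primrec Ck :: "nat \<Rightarrow> ('a::euclidean_space \<Rightarrow> 'b::real_normed_vector) \<Rightarrow> bool" where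
  "Ck 0 f \<longleftrightarrow> continuous_on UNIV f"
| "Ck (Suc k) f \<longleftrightarrow> (\<forall>x. f differentiable (at x)) \<and>
     (\<forall>b\<in>Basis. Ck k (\<lambda>x. frechet_derivative f (at x) b))"

definition smooth :: "('a::euclidean_space \<Rightarrow> 'b::real_normed_vector) \<Rightarrow> bool" where
  "smooth f \<longleftrightarrow> (\<forall>k. Ck k f)"

text \<open>
  The test functions \<open>\<D>(T\<^sup>3 \<times> (0,T))\<close>, extended by zero in time: the torus being
  compact, only the time support needs to be compact in \<open>(0,T)\<close>.
\<close>

definition test_function :: "real \<Rightarrow> (real \<Rightarrow> real^3 \<Rightarrow> 'b::real_normed_vector) \<Rightarrow> bool" where
  "test_function T \<psi> \<longleftrightarrow> smooth (\<lambda>(t, x). \<psi> t x) \<and> (\<forall>t. torus_periodic (\<psi> t)) \<and>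
     (\<exists>a b. 0 < a \<and> b < T \<and> (\<forall>t x. t \<notin> {a..b} \<longrightarrow> \<psi> t x = 0))"


text \<open>
  \<open>u = (I - \<alpha>\<^sup>2 \<Delta>)\<^sup>-\<^sup>1 w\<close>, i.e. \<open>u - \<alpha>\<^sup>2 \<Delta> u = w\<close> in the sense of distributions on the torus.
  This determines \<open>u\<close> up to a null set.
\<close>

definition helmholtz_inverse :: "real \<Rightarrow> (real^3 \<Rightarrow> real^3) \<Rightarrow> (real^3 \<Rightarrow> real^3) \<Rightarrow> bool" where
  "helmholtz_inverse \<alpha> w u \<longleftrightarrow> Lq 2 u \<and>
     (\<forall>\<phi>::real^3 \<Rightarrow> real. smooth \<phi> \<and> torus_periodic \<phi> \<longrightarrow>
        (LINT x:cell|lborel. (\<phi> x - \<alpha>\<^sup>2 * laplacian \<phi> x) *\<^sub>R u x) =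
        (LINT x:cell|lborel. \<phi> x *\<^sub>R w x))"


definition weak_solution ::
    "real \<Rightarrow> real \<Rightarrow> (real \<Rightarrow> real^3 \<Rightarrow> real^3) \<Rightarrow> (real \<Rightarrow> real^3 \<Rightarrow> real^3) \<Rightarrow>
     (real \<Rightarrow> real^3 \<Rightarrow> real^3) \<Rightarrow> (real \<Rightarrow> real^3 \<Rightarrow> real) \<Rightarrow> bool" where
  "weak_solution \<alpha> T u v B p \<longleftrightarrow>
     Linf_Lq T 2 v \<and> Linf_Lq T 2 B \<and> Linf_Lq T 1 p \<and>
     torus_field T u \<and> (AE t in lebesgue_on {0<..<T}. helmholtz_inverse \<alpha> (v t) (u t)) \<and>
     (\<forall>\<psi>::real \<Rightarrow> real^3 \<Rightarrow> real^3. test_function T \<psi> \<longrightarrow>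
        (LINT t:{0<..<T}|lborel. LINT x:cell|lborel.
           v t x \<bullet> time_deriv \<psi> t x
           + (\<Sum>i\<in>UNIV. \<Sum>j\<in>UNIV. v t x $ j * u t x $ i * partial i (\<psi> t) x $ j)
           + p t x * divergence (\<psi> t) x
           + 1 / 2 * (norm (B t x))\<^sup>2 * divergence (\<psi> t) x
           - (\<Sum>i\<in>UNIV. \<Sum>j\<in>UNIV. B t x $ i * B t x $ j * partial i (\<psi> t) x $ j)) = 0) \<and>
     (\<forall>\<psi>::real \<Rightarrow> real^3 \<Rightarrow> real^3. test_function T \<psi> \<longrightarrow>
        (LINT t:{0<..<T}|lborel. LINT x:cell|lborel.
           B t x \<bullet> time_deriv \<psi> t x
           + (\<Sum>i\<in>UNIV. \<Sum>j\<in>UNIV. B t x $ j * u t x $ i * partial i (\<psi> t) x $ j)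
           - (\<Sum>i\<in>UNIV. \<Sum>j\<in>UNIV. v t x $ j * B t x $ i * partial i (\<psi> t) x $ j)) = 0) \<and>
     (\<forall>\<eta>::real \<Rightarrow> real^3 \<Rightarrow> real. test_function T \<eta> \<longrightarrow>
        (LINT t:{0<..<T}|lborel. LINT x:cell|lborel.
           (\<Sum>i\<in>UNIV. u t x $ i * partial i (\<eta> t) x)) = 0 \<and>
        (LINT t:{0<..<T}|lborel. LINT x:cell|lborel.
           (\<Sum>i\<in>UNIV. B t x $ i * partial i (\<eta> t) x)) = 0) \<and>
     (AE t in lebesgue_on {0<..<T}. (LINT x:cell|lborel. p t x) = 0)"

end

theory Submission
  imports Defs "HOL-Computational_Algebra.Polynomial"
begin

text \<open>
  The proof follows Constantin, E and Titi in the form of Duchon and Robert: mollify the fields in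
  space, compute the rate of change of the mollified energy, and show that it tends to zero. The
  mollifier is chosen so that everything stays within finite sums of Fourier modes.

  The kernel. Let \<open>\<kappa>\<^sub>n\<close> be the product of \<open>cos\<^bsup>2n+2\<^esup> (\<pi> z\<^sub>i)\<close> over the three coordinates, divided by
  its integral. It is a probability density of width \<open>n\<^bsup>-1/2\<^esup>\<close>, and at the same time a finite sum of
  cosines (\<open>cos_kernel\<close>). Hence the mollified energy \<open>\<Sum>\<^sub>j \<integral> v\<^sub>j (\<kappa>\<^sub>n * v\<^sub>j) + B\<^sub>j (\<kappa>\<^sub>n * B\<^sub>j)\<close> is a finite
  combination of squares of Fourier modes (\<open>energy_mode_sum\<close>). The evolution of each mode is found by
  testing the equations with a function of time times a wave; the lemma of du Bois-Reymond makes the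
  mode absolutely continuous, and a chain rule handles its square (\<open>weak_time_derivative\<close>). Moments of
  \<open>\<kappa>\<^sub>n\<close> and of its gradient follow from integration by parts in one variable (\<open>kernel_moment\<close>,
  \<open>kernel_partial_moment\<close>).

  The flux. Summing over the modes, the pressure drops out because \<open>v\<close> is divergence-free, and
  trilinear terms remain (\<open>energy_flux\<close>). Each of them equals
  \<open>-1/2 \<Sum>\<^sub>i \<integral>\<integral> \<partial>\<^sub>i\<kappa>\<^sub>n(x - y) (W\<^sub>i(x) - W\<^sub>i(y)) (f(x) - f(y)) (g(x) - g(y))\<close> (\<open>flux_increments\<close>), and is
  of order \<open>n\<^bsup>(1-\<theta>)/2\<^esup>\<close> where \<open>\<theta>\<close> is the sum of the orders of regularity of \<open>W\<close>, \<open>f\<close> and \<open>g\<close>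
  (\<open>flux_bound\<close>). For the term with two factors \<open>B\<close> and one factor \<open>v\<close> this is where \<open>s + 2 r > 1\<close> is
  used. In the terms transported by \<open>u\<close> the Helmholtz equation provides a full derivative of \<open>u\<close> in
  \<open>L\<^sup>3\<close>, so that any positive regularity of the other two factors suffices. That derivative is
  estimated for mollifications of \<open>u\<close>, by pairing the Helmholtz equation with \<open>\<bar>w\<bar> w\<close>
  (\<open>trig_helmholtz_estimates\<close>), and the resulting bound on the flux passes to the limit
  (\<open>transport_flux_bound\<close>).

  Integrability in time. The flux at time \<open>t\<close> is at most \<open>flux_decay n\<close> times a cubic expression in
  the Besov norms at time \<open>t\<close>, which is integrable by assumption. So the mollified energies at two
  times differ by a quantity that tends to zero, while they converge to the energies.

  Orders of regularity above one. The Besov spaces shrink as the order grows, so both orders may be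
  lowered below one while the sum condition is kept. Since for orders at least one the norm is defined
  by higher differences, this uses Marchaud's inequality (\<open>besov_nikolskii\<close>).
\<close>

section \<open>The torus\<close>

definition torus :: "(real^3) measure" where
  "torus = restrict_space lborel cell"

lemma space_torus [simp]: "space torus = cell"
  by (simp add: torus_def space_restrict_space)

lemma borel_measurable_torus:
  "f \<in> borel_measurable borel \<Longrightarrow> f \<in> borel_measurable torus"
  unfolding torus_def by (intro measurable_restrict_space1) simp

lemma integral_torus:
  fixes f :: "real^3 \<Rightarrow> 'b::{banach, second_countable_topology}"
  shows "integral\<^sup>L torus f = (LINT x:cell|lborel. f x)"
  unfolding torus_def set_lebesgue_integral_def by (intro integral_restrict_space) simp

lemma integrable_torus:
  fixes f :: "real^3 \<Rightarrow> 'b::{banach, second_countable_topology}"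
  shows "integrable torus f \<longleftrightarrow> set_integrable lborel cell f"
  unfolding torus_def set_integrable_def by (intro integrable_restrict_space) simp

lemma nn_integral_torus:
  "(\<integral>\<^sup>+x. f x \<partial>torus) = (\<integral>\<^sup>+x. f x * indicator cell x \<partial>lborel)"
  unfolding torus_def by (intro nn_integral_restrict_space) simp

lemma emeasure_torus: "emeasure torus cell = 1"
proof -
  have "emeasure lborel cell = (\<Prod>b\<in>Basis. (1 - 0 :: real^3) \<bullet> b)"
    by (rule emeasure_lborel_cbox) (auto simp: inner_axis Basis_vec_def)
  also have "(\<Prod>b\<in>Basis. (1 - 0 :: real^3) \<bullet> b) = 1"
    by (intro prod.neutral) (auto simp: Basis_vec_def inner_axis)
  finally show ?thesis by (simp add: torus_def emeasure_restrict_space)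
qed

interpretation torus: finite_measure torus
  by standard (simp add: emeasure_torus)

interpretation torus_pair: pair_sigma_finite torus torus ..

lemma measure_torus [simp]: "measure torus cell = 1"
  by (simp add: measure_def emeasure_torus)

lemma integrable_torus_bounded:
  fixes f :: "real^3 \<Rightarrow> real"
  assumes "f \<in> borel_measurable borel" "\<And>x. \<bar>f x\<bar> \<le> C"
  shows "integrable torus f"
  using assms by (intro torus.integrable_const_bound[where B = C] borel_measurable_torus) auto

lemma integrable_torus_mult_bounded:
  fixes f g :: "real^3 \<Rightarrow> real"
  assumes "integrable torus f" "g \<in> borel_measurable borel" "\<And>x. \<bar>g x\<bar> \<le> C"
  shows "integrable torus (\<lambda>x. g x * f x)" "integrable torus (\<lambda>x. f x * g x)"
proof -
  have [measurable]: "f \<in> borel_measurable torus" using assms by auto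
  have [measurable]: "g \<in> borel_measurable torus" using assms borel_measurable_torus by auto
  show *: "integrable torus (\<lambda>x. g x * f x)"
  proof (rule Bochner_Integration.integrable_bound[where f = "\<lambda>x. C * f x"])
    show "AE x in torus. norm (g x * f x) \<le> norm (C * f x)"
      by (auto simp: abs_mult intro!: mult_right_mono order.trans[OF assms(3) abs_ge_self])
  qed (use assms in auto)
  show "integrable torus (\<lambda>x. f x * g x)" using * by (simp add: mult.commute)
qed

section \<open>Translation invariance\<close>

lemma torus_periodicD: "torus_periodic f \<Longrightarrow> f (x + axis i 1) = f x"
  by (simp add: torus_periodic_def)

lemma torus_periodic_int_axis:
  assumes "torus_periodic f"
  shows "f (x + of_int n *\<^sub>R axis i 1) = f x"
proof -
  have *: "f (x + of_nat m *\<^sub>R axis i 1) = f x" for m x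
  proof (induction m)
    case (Suc m)
    have "f (x + of_nat (Suc m) *\<^sub>R axis i 1) = f ((x + of_nat m *\<^sub>R axis i 1) + axis i 1)"
      by (simp add: algebra_simps)
    also have "\<dots> = f x" using Suc torus_periodicD[OF assms] by simp
    finally show ?case .
  qed simp
  show ?thesis
  proof (cases "n \<ge> 0")
    case True
    then show ?thesis using *[of x "nat n"] by simp
  next
    case False
    then show ?thesis using *[of "x + of_int n *\<^sub>R axis i 1" "nat (- n)"] by (simp add: algebra_simps)
  qed
qed

lemma vec3_axis_sum: "(x :: real^3) = x$1 *\<^sub>R axis 1 1 + x$2 *\<^sub>R axis 2 1 + x$3 *\<^sub>R axis 3 1"
  by (simp add: vec_eq_iff forall_3 axis_def)

lemma torus_periodic_int:
  assumes "torus_periodic f" "\<And>i. k$i \<in> \<int>"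
  shows "f (x + k) = f x"
proof -
  define n where "n i = \<lfloor>k$i\<rfloor>" for i
  have n: "k$i = of_int (n i)" for i using assms(2)[of i] by (simp add: n_def)
  have "x + k = ((x + of_int (n 1) *\<^sub>R axis 1 1) + of_int (n 2) *\<^sub>R axis 2 1) + of_int (n 3) *\<^sub>R axis 3 1"
    by (subst vec3_axis_sum[of k]) (simp add: n)
  then show ?thesis using torus_periodic_int_axis[OF assms(1)] by metis
qed

lemma torus_periodic_shift: "torus_periodic f \<Longrightarrow> torus_periodic (\<lambda>x. f (x + a))"
  unfolding torus_periodic_def by (metis add.assoc add.commute)

lemma borel_measurable_shift: "f \<in> borel_measurable borel \<Longrightarrow> (\<lambda>x::real^3. f (x + a)) \<in> borel_measurable borel"
  by (rule measurable_compose[of "\<lambda>x. x + a" borel borel]) measurable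

lemma torus_representative:
  obtains k where "\<And>i. k$i \<in> \<int>" "(x::real^3) + k \<in> cell"
proof
  show "((\<chi> i. - of_int \<lfloor>x$i\<rfloor>) :: real^3) $ i \<in> \<int>" for i :: 3 by simp
  have "0 \<le> x$i - of_int \<lfloor>x$i\<rfloor> \<and> x$i - of_int \<lfloor>x$i\<rfloor> \<le> 1" for i
    using of_int_floor_le[of "x$i"] real_of_int_floor_add_one_ge[of "x$i"] by linarith
  then show "x + (\<chi> i. - of_int \<lfloor>x$i\<rfloor>) \<in> cell"
    by (simp add: mem_box_cart)
qed

lemma periodic_continuous_bounded:
  fixes f :: "real^3 \<Rightarrow> real"
  assumes "torus_periodic f" "continuous_on UNIV f"
  obtains C where "C > 0" "\<And>x. \<bar>f x\<bar> \<le> C"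
proof -
  have "compact (f ` cell)"
    using assms(2) by (intro compact_continuous_image) (auto intro: continuous_on_subset)
  then obtain C where C: "C > 0" "\<And>x. x \<in> cell \<Longrightarrow> \<bar>f x\<bar> \<le> C"
    by (auto dest!: compact_imp_bounded simp: bounded_pos)
  show ?thesis
  proof
    show "\<bar>f x\<bar> \<le> C" for x
      using torus_representative[of x] C(2) torus_periodic_int[OF assms(1)] by metis
  qed fact
qed

lemma null_hyperplane: "{x :: real^3. x$i = c} \<in> null_sets lborel"
proof -
  have "negligible {x :: real^3. x \<bullet> axis i 1 = c}"
    by (rule negligible_standard_hyperplane) (auto simp: Basis_vec_def)
  then have "{x :: real^3. x$i = c} \<in> null_sets lebesgue"
    by (simp add: inner_axis negligible_iff_null_sets)
  moreover have "closed {x :: real^3. x$i = c}"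
    by (intro closed_Collect_eq continuous_intros)
  ultimately show ?thesis
    by (subst (asm) null_sets_completion_iff) (auto intro: borel_closed)
qed

lemma nn_integral_lborel_shift:
  fixes g :: "real^3 \<Rightarrow> ennreal"
  assumes [measurable]: "g \<in> borel_measurable borel"
  shows "(\<integral>\<^sup>+x. g (x + a) \<partial>lborel) = (\<integral>\<^sup>+x. g x \<partial>lborel)"
proof -
  have "(\<integral>\<^sup>+x. g x \<partial>lborel) = (\<integral>\<^sup>+x. g x \<partial>distr lborel borel ((+) a))"
    by (simp add: lborel_distr_plus)
  also have "\<dots> = (\<integral>\<^sup>+x. g (a + x) \<partial>lborel)"
    by (subst nn_integral_distr) auto
  finally show ?thesis by (simp add: add.commute)
qed

lemma cell_shift_iff:
  "x + d *\<^sub>R axis i 1 \<in> cell \<longleftrightarrow> (\<forall>j. j \<noteq> i \<longrightarrow> 0 \<le> x$j \<and> x$j \<le> 1) \<and> 0 \<le> x$i + d \<and> x$i + d \<le> 1"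
proof -
  have "(\<forall>j. P j) \<longleftrightarrow> (\<forall>j. j \<noteq> i \<longrightarrow> P j) \<and> P i" for P by metis
  note this[of "\<lambda>j. 0 \<le> x$j + d * axis i 1 $ j \<and> x$j + d * axis i 1 $ j \<le> 1"]
  moreover have "d * axis i 1 $ j = (if j = i then d else 0)" for j by (simp add: axis_def)
  ultimately show ?thesis by (auto simp: mem_box_cart)
qed

text \<open>
  The translated cell sticks out of the cell by a slab of width \<open>c\<close>; moving that slab
  back by one period fills the missing part up to a null set.
\<close>

lemma nn_integral_torus_shift_axis:
  fixes f :: "real^3 \<Rightarrow> ennreal"
  assumes [measurable]: "f \<in> borel_measurable borel" and per: "torus_periodic f"
    and c: "0 < c" "c < 1"
  shows "(\<integral>\<^sup>+x. f (x + c *\<^sub>R axis i 1) \<partial>torus) = (\<integral>\<^sup>+x. f x \<partial>torus)"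
proof -
  let ?e = "axis i 1 :: real^3"
  define A where "A = {x. x - c *\<^sub>R ?e \<in> cell \<and> x$i \<le> 1}"
  define A' where "A' = {x. x - c *\<^sub>R ?e \<in> cell \<and> x$i > 1}"
  define A'' where "A'' = {x. x + ?e - c *\<^sub>R ?e \<in> cell \<and> x$i > 0}"
  have cl: "closed {x::real^3. \<forall>j. l j \<le> x$j \<and> x$j \<le> u j}" for l u
    by (intro closed_Collect_all closed_Collect_conj closed_Collect_le continuous_intros)
  have meas: "A \<in> sets borel" "A' \<in> sets borel" "A'' \<in> sets borel"
  proof -
    have m: "(\<lambda>x::real^3. x $ i) \<in> borel_measurable borel"
      by (intro borel_measurable_continuous_onI continuous_intros)
    have B: "{x. x + d *\<^sub>R ?e \<in> cell} \<in> sets borel" for d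
      by (intro borel_closed closed_vimage[of cell "\<lambda>x. x + d *\<^sub>R ?e", unfolded vimage_def]) (auto intro!: continuous_intros)
    have "A = {x. x + (-c) *\<^sub>R ?e \<in> cell} \<inter> {x. x$i \<le> 1}" by (auto simp: A_def)
    moreover have "A' = {x. x + (-c) *\<^sub>R ?e \<in> cell} \<inter> {x. x$i > 1}" by (auto simp: A'_def)
    moreover have "A'' = {x. x + (1-c) *\<^sub>R ?e \<in> cell} \<inter> {x. x$i > 0}" by (auto simp: A''_def algebra_simps)
    moreover have "{x::real^3. x$i \<le> 1} \<in> sets borel" "{x::real^3. x$i > d} \<in> sets borel" for d
      using m by (auto intro!: borel_closed borel_open closed_Collect_le open_Collect_less continuous_intros)
    ultimately show "A \<in> sets borel" "A' \<in> sets borel" "A'' \<in> sets borel"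
      using B by auto
  qed
  note meas[measurable]
  have "(\<integral>\<^sup>+x. f (x + c *\<^sub>R ?e) \<partial>torus) = (\<integral>\<^sup>+x. (\<lambda>y. f y * indicator (A \<union> A') y) (x + c *\<^sub>R ?e) \<partial>lborel)"
    by (auto simp: nn_integral_torus A_def A'_def indicator_def intro!: nn_integral_cong)
  also have "\<dots> = (\<integral>\<^sup>+y. f y * indicator (A \<union> A') y \<partial>lborel)"
    by (rule nn_integral_lborel_shift) measurable
  also have "\<dots> = (\<integral>\<^sup>+y. f y * indicator A y + f y * indicator A' y \<partial>lborel)"
    by (intro nn_integral_cong) (auto simp: A_def A'_def indicator_def)
  also have "\<dots> = (\<integral>\<^sup>+y. f y * indicator A y \<partial>lborel) + (\<integral>\<^sup>+y. f y * indicator A' y \<partial>lborel)"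
    by (intro nn_integral_add) auto
  also have "(\<integral>\<^sup>+y. f y * indicator A' y \<partial>lborel) = (\<integral>\<^sup>+x. (\<lambda>y. f y * indicator A' y) (x + ?e) \<partial>lborel)"
    by (rule nn_integral_lborel_shift[symmetric]) auto
  also have "\<dots> = (\<integral>\<^sup>+x. f x * indicator A'' x \<partial>lborel)"
    by (intro nn_integral_cong) (auto simp: A'_def A''_def indicator_def torus_periodicD[OF per])
  also have "(\<integral>\<^sup>+y. f y * indicator A y \<partial>lborel) + \<dots> = (\<integral>\<^sup>+y. f y * indicator A y + f y * indicator A'' y \<partial>lborel)"
    by (intro nn_integral_add[symmetric]) auto
  also have "\<dots> = (\<integral>\<^sup>+y. f y * indicator cell y \<partial>lborel)"
  proof (rule nn_integral_cong_AE)
    have "AE x::real^3 in lborel. x$i \<noteq> 0" "AE x::real^3 in lborel. x$i \<noteq> c"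
      using AE_not_in[OF null_hyperplane, of i 0] AE_not_in[OF null_hyperplane, of i c] by auto
    then show "AE y in lborel. f y * indicator A y + f y * indicator A'' y = f y * indicator cell y"
    proof eventually_elim
      case (elim x)
      note s = cell_shift_iff[of x "- c" i] cell_shift_iff[of x "1 - c" i] cell_shift_iff[of x 0 i]
      have 1: "x \<in> A \<longleftrightarrow> x \<in> cell \<and> x$i \<ge> c"
        using c elim s(1,3) by (auto simp: A_def)
      have 2: "x \<in> A'' \<longleftrightarrow> x \<in> cell \<and> \<not> x$i \<ge> c"
        using c elim s(2,3) by (auto simp: A''_def algebra_simps)
      show ?case using 1 2 by (auto simp: indicator_def)
    qed
  qed
  finally show ?thesis by (simp add: nn_integral_torus)
qed

lemma nn_integral_torus_shift:
  fixes f :: "real^3 \<Rightarrow> ennreal"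
  assumes "f \<in> borel_measurable borel" "torus_periodic f"
  shows "(\<integral>\<^sup>+x. f (x + a) \<partial>torus) = (\<integral>\<^sup>+x. f x \<partial>torus)"
proof -
  have ax: "(\<integral>\<^sup>+x. f (x + c *\<^sub>R axis i 1) \<partial>torus) = (\<integral>\<^sup>+x. f x \<partial>torus)"
    if "f \<in> borel_measurable borel" "torus_periodic f" for f :: "real^3 \<Rightarrow> ennreal" and c i
  proof -
    have fr: "f (x + c *\<^sub>R axis i 1) = f (x + frac c *\<^sub>R axis i 1)" for x
      using torus_periodic_int_axis[OF that(2), of "x + frac c *\<^sub>R axis i 1" "\<lfloor>c\<rfloor>" i]
      by (simp add: frac_def algebra_simps)
    show ?thesis
    proof (cases "frac c = 0")
      case True show ?thesis unfolding fr True by simp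
    next
      case False
      then have "0 < frac c" "frac c < 1" using frac_lt_1[of c] frac_ge_0[of c] by linarith+
      then show ?thesis unfolding fr using nn_integral_torus_shift_axis[OF that] by blast
    qed
  qed
  have m: "(\<lambda>x. f (x + a)) \<in> borel_measurable borel" for a
    by (rule borel_measurable_shift) fact
  have p: "torus_periodic (\<lambda>x. f (x + a))" for a by (rule torus_periodic_shift) fact
  have "(\<integral>\<^sup>+x. f (x + a) \<partial>torus) = (\<integral>\<^sup>+x. f ((x + a$3 *\<^sub>R axis 3 1) + (a$1 *\<^sub>R axis 1 1 + a$2 *\<^sub>R axis 2 1)) \<partial>torus)"
    by (subst vec3_axis_sum[of a]) (simp add: algebra_simps)
  also have "\<dots> = (\<integral>\<^sup>+x. f ((x + a$2 *\<^sub>R axis 2 1) + a$1 *\<^sub>R axis 1 1) \<partial>torus)"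
    by (subst ax[OF m p]) (simp add: algebra_simps)
  also have "\<dots> = (\<integral>\<^sup>+x. f (x + a$1 *\<^sub>R axis 1 1) \<partial>torus)"
    by (rule ax[OF m p])
  also have "\<dots> = (\<integral>\<^sup>+x. f x \<partial>torus)" by (rule ax[OF assms])
  finally show ?thesis .
qed

lemma integrable_torus_shift:
  fixes f :: "real^3 \<Rightarrow> real"
  assumes m: "f \<in> borel_measurable borel" and p: "torus_periodic f" and i: "integrable torus f"
  shows "integrable torus (\<lambda>x. f (x + a))"
proof (rule integrableI_bounded)
  show "(\<lambda>x. f (x + a)) \<in> borel_measurable torus"
    using m by (intro borel_measurable_torus borel_measurable_shift)
  have "(\<integral>\<^sup>+x. ennreal (norm (f (x + a))) \<partial>torus) = (\<integral>\<^sup>+x. ennreal (norm (f x)) \<partial>torus)"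
    using m p by (intro nn_integral_torus_shift[where f = "\<lambda>x. ennreal (norm (f x))"])
      (auto simp: torus_periodic_def)
  then show "(\<integral>\<^sup>+x. ennreal (norm (f (x + a))) \<partial>torus) < \<infinity>"
    using i by (simp add: integrable_iff_bounded)
qed

lemma integral_torus_shift:
  fixes f :: "real^3 \<Rightarrow> real"
  assumes m: "f \<in> borel_measurable borel" and p: "torus_periodic f"
  shows "(\<integral>x. f (x + a) \<partial>torus) = (\<integral>x. f x \<partial>torus)"
proof (cases "integrable torus f")
  case True
  have *: "(\<integral>\<^sup>+x. ennreal (f (x + a)) \<partial>torus) = (\<integral>\<^sup>+x. ennreal (f x) \<partial>torus)"
    using m p by (intro nn_integral_torus_shift[where f = "\<lambda>x. ennreal (f x)"]) (auto simp: torus_periodic_def)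
  have **: "(\<integral>\<^sup>+x. ennreal (- f (x + a)) \<partial>torus) = (\<integral>\<^sup>+x. ennreal (- f x) \<partial>torus)"
    using m p by (intro nn_integral_torus_shift[where f = "\<lambda>x. ennreal (- f x)"]) (auto simp: torus_periodic_def)
  show ?thesis
    using True integrable_torus_shift[OF m p True] by (simp add: real_lebesgue_integral_def * **)
next
  case False
  have "\<not> integrable torus (\<lambda>x. f (x + a))"
  proof
    assume "integrable torus (\<lambda>x. f (x + a))"
    then have "integrable torus (\<lambda>x. (\<lambda>x. f (x + a)) (x + (-a)))"
      by (rule integrable_torus_shift[of "\<lambda>x. f (x + a)" "- a", OF borel_measurable_shift[OF m] torus_periodic_shift[OF p]])
    then show False using False by simp
  qed
  then show ?thesis using False by (simp add: not_integrable_integral_eq)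
qed

text \<open>
  Substituting \<open>y = x + h\<close> in the inner integral turns a double integral into an average
  over increments \<open>h\<close>; this is how bounds on increments enter.
\<close>

lemma nn_integral_torus_diagonal:
  fixes f :: "real^3 \<Rightarrow> real^3 \<Rightarrow> ennreal"
  assumes [measurable]: "case_prod f \<in> borel_measurable (borel \<Otimes>\<^sub>M borel)" and "\<And>x. torus_periodic (f x)"
  shows "(\<integral>\<^sup>+x. \<integral>\<^sup>+y. f x y \<partial>torus \<partial>torus) = (\<integral>\<^sup>+h. \<integral>\<^sup>+x. f x (x + h) \<partial>torus \<partial>torus)"
proof -
  have [measurable]: "id \<in> torus \<rightarrow>\<^sub>M borel" unfolding id_def
    using borel_measurable_torus[of "\<lambda>x. x"] by simp
  have id2: "(\<lambda>x. x) \<in> torus \<rightarrow>\<^sub>M borel"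
    using borel_measurable_torus[of "\<lambda>x. x"] by simp
  have "(\<integral>\<^sup>+x. \<integral>\<^sup>+y. f x y \<partial>torus \<partial>torus) = (\<integral>\<^sup>+x. \<integral>\<^sup>+h. f x (x + h) \<partial>torus \<partial>torus)"
  proof (rule nn_integral_cong)
    fix x
    have "(\<integral>\<^sup>+h. f x (h + x) \<partial>torus) = (\<integral>\<^sup>+y. f x y \<partial>torus)"
      by (rule nn_integral_torus_shift) (use assms in auto)
    then show "(\<integral>\<^sup>+y. f x y \<partial>torus) = (\<integral>\<^sup>+h. f x (x + h) \<partial>torus)" by (simp add: add.commute)
  qed
  also have "\<dots> = (\<integral>\<^sup>+h. \<integral>\<^sup>+x. f x (x + h) \<partial>torus \<partial>torus)"
  proof (rule torus_pair.Fubini'[symmetric])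
    have "(\<lambda>(x, h). (x, x + h)) \<in> torus \<Otimes>\<^sub>M torus \<rightarrow>\<^sub>M borel \<Otimes>\<^sub>M borel"
      using id2 by measurable
    from measurable_compose[OF this assms(1)]
    show "case_prod (\<lambda>x y. f x (x + y)) \<in> borel_measurable (torus \<Otimes>\<^sub>M torus)" by (simp add: case_prod_unfold)
  qed
  finally show ?thesis .
qed

text \<open>
  The difference quotients have integral zero by translation invariance and are bounded by
  the mean value theorem, so dominated convergence applies. Every integration by parts on the torus
  rests on this.
\<close>

lemma integral_torus_derivative:
  fixes \<phi> \<psi> :: "real^3 \<Rightarrow> real"
  assumes per: "torus_periodic \<phi>" and cont: "continuous_on UNIV \<phi>"
    and perd: "torus_periodic \<psi>" and contd: "continuous_on UNIV \<psi>"
    and D: "\<And>x. ((\<lambda>t. \<phi> (x + t *\<^sub>R axis j 1)) has_real_derivative \<psi> x) (at 0)"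
  shows "(\<integral>x. \<psi> x \<partial>torus) = 0"
proof -
  let ?e = "axis j 1 :: real^3"
  obtain C where C: "C > 0" "\<And>x. \<bar>\<psi> x\<bar> \<le> C" using periodic_continuous_bounded[OF perd contd] by blast
  obtain C0 where C0: "C0 > 0" "\<And>x. \<bar>\<phi> x\<bar> \<le> C0" using periodic_continuous_bounded[OF per cont] by blast
  have mphi: "\<phi> \<in> borel_measurable borel" and mpsi: "\<psi> \<in> borel_measurable borel"
    using cont contd by (auto intro: borel_measurable_continuous_onI)
  have D': "((\<lambda>t. \<phi> (x + t *\<^sub>R ?e)) has_real_derivative \<psi> (x + t *\<^sub>R ?e)) (at t)" for x t
  proof -
    have "((\<lambda>s. \<phi> ((x + t *\<^sub>R ?e) + (s - t) *\<^sub>R ?e)) has_real_derivative \<psi> (x + t *\<^sub>R ?e) * 1) (at t)"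
      by (rule DERIV_chain2[where g = "\<lambda>s. s - t" and f = "\<lambda>t'. \<phi> (x + t *\<^sub>R ?e + t' *\<^sub>R ?e)"])
        (use D in \<open>auto intro!: derivative_eq_intros\<close>)
    then show ?thesis by (simp add: algebra_simps)
  qed
  define q where "q n x = (\<phi> (x + inverse (real (Suc n)) *\<^sub>R ?e) - \<phi> x) * real (Suc n)" for n x
  have qb: "\<bar>q n x\<bar> \<le> C" for n x
  proof -
    have "\<exists>z. z > 0 \<and> z < inverse (real (Suc n)) \<and>
        \<phi> (x + inverse (real (Suc n)) *\<^sub>R ?e) - \<phi> (x + 0 *\<^sub>R ?e) = (inverse (real (Suc n)) - 0) * \<psi> (x + z *\<^sub>R ?e)"
      by (rule MVT2) (use D' in auto)
    then obtain z where "\<phi> (x + inverse (real (Suc n)) *\<^sub>R ?e) - \<phi> x = inverse (real (Suc n)) * \<psi> (x + z *\<^sub>R ?e)"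
      by auto
    then have "q n x = \<psi> (x + z *\<^sub>R ?e)" by (simp add: q_def del: of_nat_Suc)
    then show ?thesis using C(2) by simp
  qed
  have "(\<lambda>n. \<integral>x. q n x \<partial>torus) \<longlonglongrightarrow> (\<integral>x. \<psi> x \<partial>torus)"
  proof (rule integral_dominated_convergence[where w = "\<lambda>_. C"])
    show "\<psi> \<in> borel_measurable torus" using mpsi by (rule borel_measurable_torus)
    show "q n \<in> borel_measurable torus" for n
      unfolding q_def using borel_measurable_shift[OF mphi] mphi
      by (intro borel_measurable_torus borel_measurable_times borel_measurable_diff) auto
    show "AE x in torus. (\<lambda>n. q n x) \<longlonglongrightarrow> \<psi> x"
    proof (rule AE_I2)
      fix x
      have "((\<lambda>t. (\<phi> (x + t *\<^sub>R ?e) - \<phi> x) / t) \<longlongrightarrow> \<psi> x) (at 0)"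
        using D[of x] by (simp add: has_field_derivative_iff)
      moreover have "filterlim (\<lambda>n. inverse (real (Suc n))) (at 0) sequentially"
        using LIMSEQ_inverse_real_of_nat by (auto simp: filterlim_at)
      ultimately have "(\<lambda>n. (\<phi> (x + inverse (real (Suc n)) *\<^sub>R ?e) - \<phi> x) / inverse (real (Suc n))) \<longlonglongrightarrow> \<psi> x"
        by (rule filterlim_compose)
      then show "(\<lambda>n. q n x) \<longlonglongrightarrow> \<psi> x" by (simp add: q_def divide_inverse)
    qed
  qed (use qb in auto)
  moreover have "(\<integral>x. q n x \<partial>torus) = 0" for n
  proof -
    have i: "integrable torus \<phi>" using integrable_torus_bounded[OF mphi C0(2)] .
    have "(\<integral>x. q n x \<partial>torus) = ((\<integral>x. \<phi> (x + inverse (real (Suc n)) *\<^sub>R ?e) \<partial>torus) - (\<integral>x. \<phi> x \<partial>torus)) * real (Suc n)"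
      unfolding q_def using integrable_torus_shift[OF mphi per i] i
      by (simp del: of_nat_Suc)
    then show ?thesis using integral_torus_shift[OF mphi per] by simp
  qed
  ultimately show ?thesis using LIMSEQ_unique by (simp add: tendsto_const_iff)
qed

section \<open>Trigonometric polynomials\<close>

definition lattice :: "(real^3) set" where
  "lattice = {k. \<forall>i. k$i \<in> \<int>}"

text \<open>
  A list of triples (amplitude, frequency, phase) stands for a trigonometric polynomial.
  Differentiation and convolution act on the list, so their results are finite sums of waves by
  construction. Since every wave is a cosine, a derivative is a shift of the phase by \<open>\<pi> / 2\<close>.
\<close>

type_synonym waves = "(real \<times> (real^3) \<times> real) list"

definition wave :: "real^3 \<Rightarrow> real \<Rightarrow> real^3 \<Rightarrow> real" where
  "wave k \<theta> x = cos (2 * pi * (k \<bullet> x) + \<theta>)"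

definition trig :: "waves \<Rightarrow> real^3 \<Rightarrow> real" where
  "trig L x = (\<Sum>(a, k, \<theta>)\<leftarrow>L. a * wave k \<theta> x)"

definition trig_partial :: "3 \<Rightarrow> waves \<Rightarrow> waves" where
  "trig_partial j L = map (\<lambda>(a, k, \<theta>). (2 * pi * k$j * a, k, \<theta> + pi / 2)) L"

definition frequencies :: "waves \<Rightarrow> (real^3) set" where
  "frequencies L = (\<lambda>(a, k, \<theta>). k) ` set L"

definition phases :: "waves \<Rightarrow> real set" where
  "phases L = (\<lambda>(a, k, \<theta>). \<theta>) ` set L"

lemma frequencies_simps [simp]:
  "frequencies [] = {}" "frequencies ((a, k, \<theta>) # L) = insert k (frequencies L)"
  "frequencies (L @ M) = frequencies L \<union> frequencies M"
  by (auto simp: frequencies_def image_Un)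

lemma phases_simps [simp]:
  "phases [] = {}" "phases ((a, k, \<theta>) # L) = insert \<theta> (phases L)"
  "phases (L @ M) = phases L \<union> phases M"
  by (auto simp: phases_def image_Un)

lemma frequencies_trig_partial [simp]: "frequencies (trig_partial j L) = frequencies L"
  by (force simp: frequencies_def trig_partial_def)

lemma trig_simps [simp]:
  "trig [] x = 0" "trig ((a, k, \<theta>) # L) x = a * wave k \<theta> x + trig L x"
  "trig (L @ M) x = trig L x + trig M x"
  by (auto simp: trig_def)

lemma trig_partial_simps [simp]:
  "trig_partial j [] = []"
  "trig_partial j ((a, k, \<theta>) # L) = (2 * pi * k$j * a, k, \<theta> + pi / 2) # trig_partial j L"
  "trig_partial j (L @ M) = trig_partial j L @ trig_partial j M"
  by (auto simp: trig_partial_def)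

lemma abs_wave_le: "\<bar>wave k \<theta> x\<bar> \<le> 1"
  by (simp add: wave_def)

lemma continuous_wave [continuous_intros]: "continuous_on A (wave k \<theta>)"
  unfolding wave_def by (intro continuous_intros)

lemma borel_measurable_wave [measurable]: "wave k \<theta> \<in> borel_measurable borel"
  by (intro borel_measurable_continuous_onI continuous_wave)

lemma torus_periodic_wave: "k \<in> lattice \<Longrightarrow> torus_periodic (wave k \<theta>)"
  unfolding torus_periodic_def
proof (intro allI)
  fix x i assume "k \<in> lattice"
  then obtain n where n: "k$i = of_int n" by (auto simp: lattice_def elim: Ints_cases)
  have "wave k \<theta> (x + axis i 1) = cos ((2 * pi * (k \<bullet> x) + \<theta>) + of_int n * (2 * pi))"
    by (simp add: wave_def inner_add_right inner_axis n algebra_simps)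
  also have "\<dots> = wave k \<theta> x"
    using cos.plus_of_int[of "2 * pi * (k \<bullet> x) + \<theta>" n] by (simp add: wave_def)
  finally show "wave k \<theta> (x + axis i 1) = wave k \<theta> x" .
qed

lemma wave_has_derivative:
  "(wave k \<theta> has_derivative (\<lambda>h. 2 * pi * (k \<bullet> h) * wave k (\<theta> + pi / 2) x)) (at x)"
proof -
  have "wave k (\<theta> + pi / 2) x = - sin (2 * pi * (k \<bullet> x) + \<theta>)"
    unfolding wave_def by (simp add: cos_add add.assoc[symmetric])
  then show ?thesis
    unfolding wave_def by (auto intro!: derivative_eq_intros)
qed

lemma wave_values:
  "wave k 0 x = cos (2 * pi * (k \<bullet> x))"
  "wave k (pi / 2) x = - sin (2 * pi * (k \<bullet> x))"
  "wave k (- pi / 2) x = sin (2 * pi * (k \<bullet> x))"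
  "wave k (\<theta> + pi / 2) x = - sin (2 * pi * (k \<bullet> x) + \<theta>)"
proof -
  show "wave k 0 x = cos (2 * pi * (k \<bullet> x))" "wave k (pi / 2) x = - sin (2 * pi * (k \<bullet> x))"
    by (simp_all add: wave_def cos_add)
  show "wave k (- pi / 2) x = sin (2 * pi * (k \<bullet> x))"
    unfolding wave_def by (subst cos_add) simp
  show "wave k (\<theta> + pi / 2) x = - sin (2 * pi * (k \<bullet> x) + \<theta>)"
    unfolding wave_def by (simp add: cos_add add.assoc[symmetric])
qed

lemma wave_shift: "wave k \<theta> (x + y) = wave k 0 y * wave k \<theta> x - wave k (pi / 2) y * wave k (\<theta> + pi / 2) x"
proof -
  have "wave k \<theta> (x + y) = cos ((2 * pi * (k \<bullet> x) + \<theta>) + 2 * pi * (k \<bullet> y))"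
    by (simp add: wave_def inner_add_right algebra_simps)
  then show ?thesis
    unfolding wave_values cos_add[of "2 * pi * (k \<bullet> x) + \<theta>"] by (simp add: wave_def)
qed

lemma wave_diff_0: "wave k 0 (x - y) = wave k 0 x * wave k 0 y + wave k (- pi / 2) x * wave k (- pi / 2) y"
  unfolding wave_values by (simp add: inner_diff_right right_diff_distrib cos_diff)

lemma wave_diff_pi2:
  "wave k (pi / 2) (x - y) = wave k (pi / 2) x * wave k 0 y + wave k 0 x * wave k (- pi / 2) y"
  unfolding wave_values by (simp add: inner_diff_right right_diff_distrib sin_diff)

lemma wave_uminus_pi2: "wave k (pi / 2) (- x) = - wave k (pi / 2) x"
  by (simp add: wave_values)

lemma wave_uminus_0: "wave k 0 (- x) = wave k 0 x"
  by (simp add: wave_def)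

lemma wave_mult_0: "wave k 0 x * wave l 0 x = 1 / 2 * wave (k + l) 0 x + 1 / 2 * wave (k - l) 0 x"
  by (simp add: wave_def inner_add_left inner_diff_left distrib_left right_diff_distrib cos_add cos_diff)

lemma wave_pi: "wave k (\<theta> + pi) x = - wave k \<theta> x"
  unfolding wave_def by (simp add: add.assoc[symmetric])

lemma continuous_trig [continuous_intros]: "continuous_on A (trig L)"
  by (induction L) (auto intro!: continuous_intros simp: fun_eq_iff[symmetric] split_beta trig_def)

lemma borel_measurable_trig [measurable]: "trig L \<in> borel_measurable borel"
  by (intro borel_measurable_continuous_onI continuous_trig)

lemma torus_periodic_trig: "frequencies L \<subseteq> lattice \<Longrightarrow> torus_periodic (trig L)"
proof (induction L)
  case (Cons z L)
  obtain a k \<theta> where "z = (a, k, \<theta>)" by (cases z)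
  then show ?case using Cons torus_periodic_wave[of k \<theta>] by (simp add: torus_periodic_def)
qed (simp add: torus_periodic_def)

lemma trig_bounded:
  obtains C where "C \<ge> 0" "\<And>x. \<bar>trig L x\<bar> \<le> C"
proof -
  have "\<bar>trig L x\<bar> \<le> (\<Sum>(a, k, \<theta>)\<leftarrow>L. \<bar>a\<bar>)" for x
  proof (induction L)
    case (Cons z L)
    obtain a k \<theta> where z: "z = (a, k, \<theta>)" by (cases z)
    have "\<bar>a * wave k \<theta> x\<bar> \<le> \<bar>a\<bar> * 1" unfolding abs_mult by (intro mult_left_mono abs_wave_le) auto
    then show ?case using Cons by (simp add: z)
  qed simp
  moreover have "(\<Sum>(a, k, \<theta>)\<leftarrow>L. \<bar>a\<bar>) \<ge> 0" by (intro sum_list_nonneg) auto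
  ultimately show ?thesis using that by blast
qed

lemma trig_has_derivative:
  "(trig L has_derivative (\<lambda>h. \<Sum>j\<in>UNIV. h$j * trig (trig_partial j L) x)) (at x)"
proof (induction L)
  case Nil
  then show ?case by (simp add: trig_def)
next
  case (Cons z L)
  obtain a k \<theta> where z: "z = (a, k, \<theta>)" by (cases z)
  have *: "trig (z # L) = (\<lambda>x. a * wave k \<theta> x + trig L x)" by (simp add: z fun_eq_iff)
  have "((\<lambda>x. a * wave k \<theta> x + trig L x) has_derivative
    (\<lambda>h. a * (2 * pi * (k \<bullet> h) * wave k (\<theta> + pi / 2) x) + (\<Sum>j\<in>UNIV. h$j * trig (trig_partial j L) x))) (at x)"
    by (intro derivative_intros wave_has_derivative Cons)
  moreover have "(\<lambda>h. a * (2 * pi * (k \<bullet> h) * wave k (\<theta> + pi / 2) x) + (\<Sum>j\<in>UNIV. h$j * trig (trig_partial j L) x))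
     = (\<lambda>h. \<Sum>j\<in>UNIV. h$j * trig (trig_partial j (z # L)) x)"
    by (auto simp: z fun_eq_iff inner_vec_def sum.distrib algebra_simps sum_distrib_left)
  ultimately show ?case unfolding * by simp
qed

lemma trig_directional_derivative:
  "((\<lambda>t. trig L (x + t *\<^sub>R h)) has_real_derivative (\<Sum>j\<in>UNIV. h$j * trig (trig_partial j L) (x + t *\<^sub>R h))) (at t)"
proof -
  have "((\<lambda>t. trig L (x + t *\<^sub>R h)) has_derivative
     (\<lambda>s. \<Sum>j\<in>UNIV. (s *\<^sub>R h)$j * trig (trig_partial j L) (x + t *\<^sub>R h))) (at t)"
    by (rule has_derivative_compose[OF _ trig_has_derivative]) (auto intro!: derivative_eq_intros)
  moreover have "(\<lambda>s. \<Sum>j\<in>UNIV. (s *\<^sub>R h)$j * trig (trig_partial j L) (x + t *\<^sub>R h))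
     = (*) (\<Sum>j\<in>UNIV. h$j * trig (trig_partial j L) (x + t *\<^sub>R h))"
    by (simp add: fun_eq_iff sum_distrib_left mult_ac)
  ultimately show ?thesis by (simp only: has_field_derivative_def)
qed

lemma trig_partial_derivative:
  "((\<lambda>t. trig L (x + t *\<^sub>R axis j 1)) has_real_derivative trig (trig_partial j L) x) (at 0)"
  using trig_directional_derivative[of L x "axis j 1" 0]
  by (simp add: axis_def if_distrib[of "\<lambda>c. c * _"] sum.delta cong: if_cong)

section \<open>The kernel\<close>

text \<open>
  Comparable to the squared distance from \<open>h\<close> to the nearest lattice point, but a
  trigonometric polynomial itself, so that its moments against powers of cosines can be computed.
\<close>

definition torus_size :: "real^3 \<Rightarrow> real" where
  "torus_size h = (\<Sum>i\<in>UNIV. (sin (pi * h$i))\<^sup>2)"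

text \<open>
  The exponents are allowed to differ between the coordinates because they are raised one
  coordinate at a time when masses of consecutive kernels are compared.
\<close>

definition cos_prod :: "(3 \<Rightarrow> nat) \<Rightarrow> real^3 \<Rightarrow> real" where
  "cos_prod m z = (\<Prod>i\<in>UNIV. cos (pi * z$i) ^ (2 * m i))"

definition cos_mass :: "nat \<Rightarrow> real" where
  "cos_mass n = (\<integral>z. cos_prod (\<lambda>_. n) z \<partial>torus)"

lemma continuous_torus_size [continuous_intros]: "continuous_on A torus_size"
  unfolding torus_size_def by (intro continuous_intros)

lemma continuous_cos_prod [continuous_intros]: "continuous_on A (cos_prod m)"
  unfolding cos_prod_def by (intro continuous_intros)

lemma borel_measurable_torus_size [measurable]: "torus_size \<in> borel_measurable borel"
  by (intro borel_measurable_continuous_onI continuous_torus_size)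

lemma borel_measurable_cos_prod [measurable]: "cos_prod m \<in> borel_measurable borel"
  by (intro borel_measurable_continuous_onI continuous_cos_prod)

lemma torus_size_nonneg: "torus_size h \<ge> 0"
  by (auto simp: torus_size_def intro!: sum_nonneg)

lemma torus_size_le: "torus_size h \<le> 3"
  unfolding torus_size_def sum_3
  using sin_squared_eq[of "pi * h$1"] sin_squared_eq[of "pi * h$2"] sin_squared_eq[of "pi * h$3"]
    zero_le_power2[of "cos (pi * h$1)"] zero_le_power2[of "cos (pi * h$2)"] zero_le_power2[of "cos (pi * h$3)"]
  by linarith

lemma cos_prod_nonneg: "cos_prod m z \<ge> 0"
  unfolding cos_prod_def by (intro prod_nonneg) (auto simp: power_mult)

lemma cos_prod_le_1: "cos_prod m z \<le> 1"
  unfolding cos_prod_def by (intro prod_le_1) (auto simp: power_mult power_le_one abs_square_le_1)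

lemma abs_cos_prod_le_1: "\<bar>cos_prod m z\<bar> \<le> 1"
  using cos_prod_nonneg cos_prod_le_1 by simp

lemma cos_pi_periodic: "cos (pi * (t + 1)) = - cos (pi * t)" "sin (pi * (t + 1)) = - sin (pi * t)"
  by (simp_all add: distrib_left)

lemma cos_prod_split:
  "cos_prod m z = cos (pi * z$j) ^ (2 * m j) * (\<Prod>i\<in>UNIV - {j}. cos (pi * z$i) ^ (2 * m i))"
  unfolding cos_prod_def by (rule prod.remove) auto

lemma cos_prod_upd: "cos_prod (m(j := Suc (m j))) z = (cos (pi * z$j))\<^sup>2 * cos_prod m z"
proof -
  have "(\<Prod>i\<in>UNIV - {j}. cos (pi * z$i) ^ (2 * (m(j := Suc (m j))) i)) = (\<Prod>i\<in>UNIV - {j}. cos (pi * z$i) ^ (2 * m i))"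
    by (intro prod.cong) auto
  then show ?thesis
    unfolding cos_prod_split[of "m(j := Suc (m j))" z j] cos_prod_split[of m z j]
    by (simp add: power2_eq_square)
qed

lemma integrable_cos_prod: "integrable torus (cos_prod m)"
  by (rule integrable_torus_bounded[OF _ abs_cos_prod_le_1]) auto

text \<open>
  Integration by parts in one coordinate; the other factors are constant along it.
\<close>

lemma integral_cos_prod_derivative:
  fixes A A' :: "real \<Rightarrow> real"
  assumes D: "\<And>t. (A has_real_derivative A' t) (at t)" and per: "\<And>t. A (t + 1) = A t" "\<And>t. A' (t + 1) = A' t"
    and cont: "continuous_on UNIV A'"
    and eq: "\<And>z. F z = A' (z$j) * (\<Prod>i\<in>UNIV - {j}. cos (pi * z$i) ^ (2 * m i))"
  shows "(\<integral>z. F z \<partial>torus) = 0"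
proof -
  define R where "R z = (\<Prod>i\<in>UNIV - {j}. cos (pi * z$i) ^ (2 * m i))" for z :: "real^3"
  have Rj: "R (z + t *\<^sub>R axis j 1) = R z" for z t
    unfolding R_def by (intro prod.cong) (auto simp: axis_def)
  have Rp: "R (z + axis i 1) = R z" for z i
  proof -
    have c: "cos (pi * (z + axis i 1)$l) ^ (2 * m l) = cos (pi * z$l) ^ (2 * m l)" for l
      by (cases "l = i") (simp_all add: axis_def cos_pi_periodic power_mult)
    show ?thesis unfolding R_def c ..
  qed
  have Ap: "A ((z + axis i 1)$j) = A (z$j)" "A' ((z + axis i 1)$j) = A' (z$j)" for z :: "real^3" and i
    using per by (cases "i = j"; simp add: axis_def)+
  have contA: "continuous_on UNIV A"
    using D by (meson DERIV_continuous_on has_field_derivative_at_within)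
  have "(\<integral>z. A' (z$j) * R z \<partial>torus) = 0"
  proof (rule integral_torus_derivative[where \<phi> = "\<lambda>z. A (z$j) * R z" and j = j])
    show "torus_periodic (\<lambda>z. A (z$j) * R z)" "torus_periodic (\<lambda>z. A' (z$j) * R z)"
      by (auto simp: torus_periodic_def Rp Ap simp del: vector_add_component)
    show "continuous_on UNIV (\<lambda>z. A (z$j) * R z)" "continuous_on UNIV (\<lambda>z. A' (z$j) * R z)"
      unfolding R_def by (intro continuous_intros continuous_on_compose2[OF contA] continuous_on_compose2[OF cont]; simp)+
    show "((\<lambda>t. A ((x + t *\<^sub>R axis j 1)$j) * R (x + t *\<^sub>R axis j 1)) has_real_derivative A' (x$j) * R x) (at 0)" for x
    proof -
      have "((\<lambda>t. A (x$j + t)) has_real_derivative A' (x$j)) (at 0)"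
        using DERIV_shift[of A "A' (x$j)" "0" "x$j"] D[of "x$j"] by (simp add: add.commute)
      then have "((\<lambda>t. A (x$j + t) * R x) has_real_derivative A' (x$j) * R x) (at 0)"
        by (rule DERIV_cmult_right)
      then show ?thesis by (simp add: Rj)
    qed
  qed
  then show ?thesis unfolding eq R_def .
qed

lemma integrable_cos_prod_mult:
  "g \<in> borel_measurable borel \<Longrightarrow> (\<And>x. \<bar>g x\<bar> \<le> C) \<Longrightarrow> integrable torus (\<lambda>z. cos_prod m z * g z)"
  by (rule integrable_torus_mult_bounded(2)[OF integrable_cos_prod])

lemma DERIV_cos_pi_power:
  "((\<lambda>t. cos (pi * t) ^ k) has_real_derivative real k * cos (pi * t) ^ (k - 1) * (- sin (pi * t) * pi)) (at t)"
  by (rule derivative_eq_intros refl)+ simp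

lemma DERIV_sin_pi_power:
  "((\<lambda>t. sin (pi * t) ^ k) has_real_derivative real k * sin (pi * t) ^ (k - 1) * (cos (pi * t) * pi)) (at t)"
  by (rule derivative_eq_intros refl)+ simp

lemma sin_power4_le_1: "(sin y) ^ 4 \<le> (1::real)"
proof -
  have "((sin y)\<^sup>2)\<^sup>2 \<le> 1\<^sup>2" by (intro power_mono) (auto simp: abs_square_le_1)
  then show ?thesis by simp
qed

text \<open>
  Integrate the derivative of \<open>cos\<^bsup>2n+1\<^esup> sin\<close>.
\<close>

lemma integral_cos_prod_sin2:
  "(\<integral>z. cos_prod m z * (sin (pi * z$j))\<^sup>2 \<partial>torus) = (\<integral>z. cos_prod m z \<partial>torus) / (2 * real (m j) + 2)"
proof -
  let ?n = "m j"
  define A' where "A' t = pi * (cos (pi * t) ^ (2 * ?n) - (2 * real ?n + 2) * (cos (pi * t) ^ (2 * ?n) * (sin (pi * t))\<^sup>2))" for t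
  have i: "integrable torus (\<lambda>z. cos_prod m z * (sin (pi * z$j))\<^sup>2)"
    by (rule integrable_cos_prod_mult[where C = 1]) (auto simp: abs_square_le_1)
  have "(\<integral>z. pi * (cos_prod m z - (2 * real ?n + 2) * (cos_prod m z * (sin (pi * z$j))\<^sup>2)) \<partial>torus) = 0"
  proof (rule integral_cos_prod_derivative[where A = "\<lambda>t. cos (pi * t) ^ (2 * ?n + 1) * sin (pi * t)" and A' = A' and j = j])
    show "((\<lambda>t. cos (pi * t) ^ (2 * ?n + 1) * sin (pi * t)) has_real_derivative A' t) (at t)" for t
    proof -
      have "((\<lambda>t. cos (pi * t) ^ (2 * ?n + 1) * sin (pi * t)) has_real_derivative
         cos (pi * t) ^ (2 * ?n + 1) * (cos (pi * t) * pi) +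
         (real (2 * ?n + 1) * cos (pi * t) ^ (2 * ?n) * (- sin (pi * t) * pi)) * sin (pi * t)) (at t)"
        using DERIV_mult[OF DERIV_cos_pi_power[of "2 * ?n + 1" t] DERIV_sin_pi_power[of 1 t]]
        by (simp add: algebra_simps)
      moreover have "cos (pi * t) ^ (2 * ?n + 1) * (cos (pi * t) * pi) +
         (real (2 * ?n + 1) * cos (pi * t) ^ (2 * ?n) * (- sin (pi * t) * pi)) * sin (pi * t)
         = pi * (cos (pi * t) ^ (2 * ?n) * (cos (pi * t))\<^sup>2 - (2 * real ?n + 1) * (cos (pi * t) ^ (2 * ?n) * (sin (pi * t))\<^sup>2))"
        by (simp add: algebra_simps power2_eq_square)
      moreover have "\<dots> = A' t"
        unfolding A'_def cos_squared_eq by (simp add: algebra_simps)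
      ultimately show ?thesis by simp
    qed
    show "continuous_on UNIV A'" unfolding A'_def by (intro continuous_intros)
    show "A' (t + 1) = A' t" for t unfolding A'_def by (simp add: cos_pi_periodic power_mult)
    show "pi * (cos_prod m z - (2 * real ?n + 2) * (cos_prod m z * (sin (pi * z$j))\<^sup>2))
       = A' (z$j) * (\<Prod>i\<in>UNIV - {j}. cos (pi * z$i) ^ (2 * m i))" for z
      unfolding A'_def cos_prod_split[of m z j] by (simp add: algebra_simps)
  qed (simp add: cos_pi_periodic power_mult)
  then have "(\<integral>z. cos_prod m z \<partial>torus) - (2 * real ?n + 2) * (\<integral>z. cos_prod m z * (sin (pi * z$j))\<^sup>2 \<partial>torus) = 0"
    using i integrable_cos_prod[of m] by simp
  then show ?thesis by (simp add: field_simps)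
qed

text \<open>
  Integrate the derivative of \<open>cos\<^bsup>2n+1\<^esup> sin\<^sup>3\<close>.
\<close>

lemma integral_cos_prod_sin4:
  "(\<integral>z. cos_prod m z * (sin (pi * z$j)) ^ 4 \<partial>torus)
     = 3 * (\<integral>z. cos_prod m z \<partial>torus) / ((2 * real (m j) + 2) * (2 * real (m j) + 4))"
proof -
  let ?n = "m j"
  define A' where "A' t = pi * (3 * (cos (pi * t) ^ (2 * ?n) * (sin (pi * t))\<^sup>2)
     - (2 * real ?n + 4) * (cos (pi * t) ^ (2 * ?n) * (sin (pi * t)) ^ 4))" for t
  have i: "integrable torus (\<lambda>z. cos_prod m z * (sin (pi * z$j))\<^sup>2)"
    by (rule integrable_cos_prod_mult[where C = 1]) (auto simp: abs_square_le_1)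
  have i4: "integrable torus (\<lambda>z. cos_prod m z * (sin (pi * z$j)) ^ 4)"
    by (rule integrable_cos_prod_mult[where C = 1]) (auto simp: sin_power4_le_1)
  have "(\<integral>z. pi * (3 * (cos_prod m z * (sin (pi * z$j))\<^sup>2) - (2 * real ?n + 4) * (cos_prod m z * (sin (pi * z$j)) ^ 4)) \<partial>torus) = 0"
  proof (rule integral_cos_prod_derivative[where A = "\<lambda>t. cos (pi * t) ^ (2 * ?n + 1) * sin (pi * t) ^ 3" and A' = A' and j = j])
    show "((\<lambda>t. cos (pi * t) ^ (2 * ?n + 1) * sin (pi * t) ^ 3) has_real_derivative A' t) (at t)" for t
    proof -
      have "((\<lambda>t. cos (pi * t) ^ (2 * ?n + 1) * sin (pi * t) ^ 3) has_real_derivative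
         cos (pi * t) ^ (2 * ?n + 1) * (3 * sin (pi * t) ^ 2 * (cos (pi * t) * pi)) +
         (real (2 * ?n + 1) * cos (pi * t) ^ (2 * ?n) * (- sin (pi * t) * pi)) * sin (pi * t) ^ 3) (at t)"
        using DERIV_mult[OF DERIV_cos_pi_power[of "2 * ?n + 1" t] DERIV_sin_pi_power[of 3 t]]
        by (simp add: algebra_simps)
      moreover have "cos (pi * t) ^ (2 * ?n + 1) * (3 * sin (pi * t) ^ 2 * (cos (pi * t) * pi)) +
         (real (2 * ?n + 1) * cos (pi * t) ^ (2 * ?n) * (- sin (pi * t) * pi)) * sin (pi * t) ^ 3
         = pi * (3 * (cos (pi * t) ^ (2 * ?n) * (sin (pi * t))\<^sup>2) * (cos (pi * t))\<^sup>2 - (2 * real ?n + 1) * (cos (pi * t) ^ (2 * ?n) * (sin (pi * t)) ^ 4))"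
        by (simp add: algebra_simps power2_eq_square power4_eq_xxxx power3_eq_cube)
      moreover have "\<dots> = A' t"
        unfolding A'_def cos_squared_eq by (simp add: algebra_simps power2_eq_square power4_eq_xxxx)
      ultimately show ?thesis by simp
    qed
    show "continuous_on UNIV A'" unfolding A'_def by (intro continuous_intros)
    show "A' (t + 1) = A' t" for t unfolding A'_def by (simp add: cos_pi_periodic power_mult)
    show "pi * (3 * (cos_prod m z * (sin (pi * z$j))\<^sup>2) - (2 * real ?n + 4) * (cos_prod m z * (sin (pi * z$j)) ^ 4))
       = A' (z$j) * (\<Prod>i\<in>UNIV - {j}. cos (pi * z$i) ^ (2 * m i))" for z
      unfolding A'_def cos_prod_split[of m z j] by (simp add: algebra_simps)
  qed (simp add: cos_pi_periodic power_mult power3_eq_cube)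
  then have "3 * (\<integral>z. cos_prod m z * (sin (pi * z$j))\<^sup>2 \<partial>torus) - (2 * real ?n + 4) * (\<integral>z. cos_prod m z * (sin (pi * z$j)) ^ 4 \<partial>torus) = 0"
    using i i4 by simp
  then have "3 * ((\<integral>z. cos_prod m z \<partial>torus) / (2 * real ?n + 2)) = (2 * real ?n + 4) * (\<integral>z. cos_prod m z * (sin (pi * z$j)) ^ 4 \<partial>torus)"
    unfolding integral_cos_prod_sin2 by simp
  then have "(\<integral>z. cos_prod m z * (sin (pi * z$j)) ^ 4 \<partial>torus) = 3 * ((\<integral>z. cos_prod m z \<partial>torus) / (2 * real ?n + 2)) / (2 * real ?n + 4)"
    by (subst eq_divide_eq) (auto simp: mult.commute)
  then show ?thesis by simp
qed

lemma integral_cos_prod_upd: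
  "(\<integral>z. cos_prod (m(j := Suc (m j))) z \<partial>torus) \<ge> (\<integral>z. cos_prod m z \<partial>torus) / 2"
proof -
  have i: "integrable torus (\<lambda>z. cos_prod m z * (sin (pi * z$j))\<^sup>2)"
    by (rule integrable_cos_prod_mult[where C = 1]) (auto simp: abs_square_le_1)
  have "(\<integral>z. cos_prod (m(j := Suc (m j))) z \<partial>torus) = (\<integral>z. cos_prod m z - cos_prod m z * (sin (pi * z$j))\<^sup>2 \<partial>torus)"
    unfolding cos_prod_upd cos_squared_eq by (simp add: algebra_simps)
  also have "\<dots> = (\<integral>z. cos_prod m z \<partial>torus) - (\<integral>z. cos_prod m z \<partial>torus) / (2 * real (m j) + 2)"
    using i integrable_cos_prod[of m] by (simp add: integral_cos_prod_sin2)
  also have "\<dots> \<ge> (\<integral>z. cos_prod m z \<partial>torus) - (\<integral>z. cos_prod m z \<partial>torus) / 2"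
    by (intro diff_left_mono divide_left_mono integral_nonneg_AE AE_I2 cos_prod_nonneg) auto
  finally show ?thesis by simp
qed

text \<open>
  Each of the three exponents is raised in turn, and each time at least half of the mass
  survives. The point is that the masses, whose size is never computed, are comparable.
\<close>

lemma cos_mass_Suc: "cos_mass (Suc n) \<ge> cos_mass n / 8"
proof -
  define m1 :: "3 \<Rightarrow> nat" where "m1 = (\<lambda>_. n)(1 := Suc n)"
  define m2 where "m2 = m1(2 := Suc n)"
  have "(\<integral>z. cos_prod m1 z \<partial>torus) \<ge> cos_mass n / 2"
    using integral_cos_prod_upd[of "\<lambda>_. n" 1] by (simp add: m1_def cos_mass_def)
  moreover have "(\<integral>z. cos_prod m2 z \<partial>torus) \<ge> (\<integral>z. cos_prod m1 z \<partial>torus) / 2"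
    using integral_cos_prod_upd[of m1 2] by (simp add: m2_def m1_def)
  moreover have "m2(3 := Suc (m2 3)) = (\<lambda>_. Suc n)"
  proof
    fix i :: 3 show "(m2(3 := Suc (m2 3))) i = Suc n"
      using exhaust_3[of i] by (auto simp: m2_def m1_def)
  qed
  then have "cos_mass (Suc n) \<ge> (\<integral>z. cos_prod m2 z \<partial>torus) / 2"
    using integral_cos_prod_upd[of m2 3] by (simp add: cos_mass_def)
  ultimately show ?thesis by simp
qed

lemma cos_mass_pos: "cos_mass n > 0"
proof (induction n)
  case 0
  then show ?case by (simp add: cos_mass_def cos_prod_def)
next
  case (Suc n)
  then show ?case using cos_mass_Suc[of n] by simp
qed

lemma powr_le_one_plus_square: "t \<ge> 0 \<Longrightarrow> 0 \<le> p \<Longrightarrow> p \<le> 2 \<Longrightarrow> t powr p \<le> 1 + t\<^sup>2" for t p :: real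
proof (cases "t \<le> 1")
  case True
  assume "t \<ge> 0" "0 \<le> p" "p \<le> 2"
  then have "t powr p \<le> 1" using True by (simp add: powr_le1)
  then show ?thesis using zero_le_power2[of t] by linarith
next
  case False
  assume "t \<ge> 0" "0 \<le> p" "p \<le> 2"
  then have "t powr p \<le> t powr 2" using False by (intro powr_mono) auto
  then show ?thesis using False by (simp add: powr_numeral)
qed

text \<open>
  The weight \<open>torus_size\<close> has size \<open>1 / n\<close> under the kernel. Powers up to the
  second are dominated by \<open>1 + (n * torus_size)\<^sup>2\<close>, whose integral reduces to fourth powers
  of sines.
\<close>

lemma integral_cos_prod_torus_size:
  assumes "0 \<le> p" "p \<le> 2"
  shows "integrable torus (\<lambda>z. cos_prod (\<lambda>_. n) z * torus_size z powr p)" (is ?A)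
    "(\<integral>z. cos_prod (\<lambda>_. n) z * torus_size z powr p \<partial>torus) \<le> 10 * real (Suc n) powr (- p) * cos_mass n" (is ?B)
proof -
  let ?K = "cos_prod (\<lambda>_. n)" and ?N = "real (Suc n)"
  let ?s = "\<lambda>z j. ?K z * (sin (pi * z$j)) ^ 4"
  show A: ?A
  proof (rule integrable_cos_prod_mult)
    show "\<bar>torus_size z powr p\<bar> \<le> 10" for z
      using powr_le_one_plus_square[OF torus_size_nonneg assms, of z] power_mono[OF torus_size_le torus_size_nonneg, of z 2]
      by simp
  qed measurable
  have i4: "integrable torus (\<lambda>z. ?s z j)" for j
  proof (rule integrable_cos_prod_mult)
    show "\<bar>sin (pi * x $ j) ^ 4\<bar> \<le> 1" for x by (simp add: sin_power4_le_1)
  qed (auto intro!: borel_measurable_continuous_onI continuous_intros)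
  have le: "?K z * torus_size z powr p \<le> ?N powr (- p) * (?K z + ?N\<^sup>2 * (3 * (?s z 1 + ?s z 2 + ?s z 3)))" for z
  proof -
    have "torus_size z powr p = ?N powr (- p) * (?N * torus_size z) powr p"
      using torus_size_nonneg[of z] by (simp add: powr_mult powr_minus mult.assoc[symmetric] del: of_nat_Suc)
    also have "\<dots> \<le> ?N powr (- p) * (1 + (?N * torus_size z)\<^sup>2)"
      using assms torus_size_nonneg[of z] by (intro mult_left_mono powr_le_one_plus_square) (auto intro!: mult_nonneg_nonneg)
    also have "\<dots> \<le> ?N powr (- p) * (1 + ?N\<^sup>2 * (3 * (\<Sum>j\<in>UNIV. (sin (pi * z$j)) ^ 4)))"
    proof -
      have "(a + b + c)\<^sup>2 \<le> 3 * (a\<^sup>2 + b\<^sup>2 + c\<^sup>2)" for a b c :: real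
        using zero_le_power2[of "a - b"] zero_le_power2[of "b - c"] zero_le_power2[of "a - c"]
        by (simp add: power2_eq_square algebra_simps)
      from this[of "(sin (pi * z$1))\<^sup>2" "(sin (pi * z$2))\<^sup>2" "(sin (pi * z$3))\<^sup>2"]
      have "(torus_size z)\<^sup>2 \<le> 3 * (\<Sum>j\<in>UNIV. (sin (pi * z$j)) ^ 4)"
        by (simp add: torus_size_def sum_3 power_mult[symmetric])
      then show ?thesis by (intro mult_left_mono add_left_mono) (auto simp: power_mult_distrib)
    qed
    finally have "?K z * torus_size z powr p \<le> ?K z * (?N powr (- p) * (1 + ?N\<^sup>2 * (3 * (\<Sum>j\<in>UNIV. (sin (pi * z$j)) ^ 4))))"
      using cos_prod_nonneg by (rule mult_left_mono)
    also have "\<dots> = ?N powr (- p) * (?K z + ?N\<^sup>2 * (3 * (?s z 1 + ?s z 2 + ?s z 3)))"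
      by (simp add: sum_3 algebra_simps del: of_nat_Suc)
    finally show ?thesis .
  qed
  have "(\<integral>z. ?K z * torus_size z powr p \<partial>torus) \<le> (\<integral>z. ?N powr (- p) * (?K z + ?N\<^sup>2 * (3 * (?s z 1 + ?s z 2 + ?s z 3))) \<partial>torus)"
    using i4 integrable_cos_prod by (intro integral_mono A le) (auto simp del: of_nat_Suc)
  also have "\<dots> = ?N powr (- p) * (cos_mass n + ?N\<^sup>2 * (3 * (3 * (3 * cos_mass n / ((2 * real n + 2) * (2 * real n + 4))))))"
    using i4 integrable_cos_prod by (simp add: cos_mass_def integral_cos_prod_sin4 del: of_nat_Suc)
  also have "\<dots> \<le> ?N powr (- p) * (10 * cos_mass n)"
  proof (intro mult_left_mono)
    \<comment> \<open>This makes the constant \<open>10 = 1 + 9\<close>.\<close>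
    have "27 * ?N\<^sup>2 \<le> 9 * ((2 * real n + 2) * (2 * real n + 4))"
      by (simp add: power2_eq_square algebra_simps)
    then have "27 * ?N\<^sup>2 / ((2 * real n + 2) * (2 * real n + 4)) \<le> 9"
      by (subst pos_divide_le_eq) (auto intro!: mult_pos_pos)
    then have "cos_mass n * (27 * ?N\<^sup>2 / ((2 * real n + 2) * (2 * real n + 4))) \<le> cos_mass n * 9"
      using cos_mass_pos[of n] by (intro mult_left_mono) auto
    then show "cos_mass n + ?N\<^sup>2 * (3 * (3 * (3 * cos_mass n / ((2 * real n + 2) * (2 * real n + 4))))) \<le> 10 * cos_mass n"
      by (simp add: mult_ac)
  qed simp
  finally show ?B by (simp add: mult_ac)
qed

text \<open>
  Cosine polynomials with all phases zero form an algebra by the product formula for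
  cosines. This makes powers of cosines available as finite sums of waves.
\<close>

definition even_trig :: "(real^3 \<Rightarrow> real) \<Rightarrow> bool" where
  "even_trig f \<longleftrightarrow> (\<exists>L. frequencies L \<subseteq> lattice \<and> phases L \<subseteq> {0} \<and> (\<forall>x. f x = trig L x))"

lemma lattice_add: "k \<in> lattice \<Longrightarrow> l \<in> lattice \<Longrightarrow> k + l \<in> lattice"
  and lattice_diff: "k \<in> lattice \<Longrightarrow> l \<in> lattice \<Longrightarrow> k - l \<in> lattice"
  and lattice_0: "0 \<in> lattice"
  and lattice_axis: "axis i 1 \<in> lattice"
  by (auto simp: lattice_def axis_def)

lemma even_trig_add: "even_trig f \<Longrightarrow> even_trig g \<Longrightarrow> even_trig (\<lambda>x. f x + g x)"
  unfolding even_trig_def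
proof (elim exE conjE)
  fix L M
  assume "frequencies L \<subseteq> lattice" "phases L \<subseteq> {0}" "\<forall>x. f x = trig L x"
    "frequencies M \<subseteq> lattice" "phases M \<subseteq> {0}" "\<forall>x. g x = trig M x"
  then show "\<exists>L. frequencies L \<subseteq> lattice \<and> phases L \<subseteq> {0} \<and> (\<forall>x. f x + g x = trig L x)"
    by (intro exI[of _ "L @ M"]) auto
qed

lemma even_trig_wave: "k \<in> lattice \<Longrightarrow> even_trig (\<lambda>x. c * wave k 0 x)"
  unfolding even_trig_def by (intro exI[of _ "[(c, k, 0)]"]) auto

lemma even_trig_const: "even_trig (\<lambda>x. c)"
  using even_trig_wave[OF lattice_0, of c] by (simp add: wave_def)

lemma even_trig_wave_mult:
  assumes "k \<in> lattice" "even_trig f" shows "even_trig (\<lambda>x. (c * wave k 0 x) * f x)"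
proof -
  have "even_trig (\<lambda>x. (c * wave k 0 x) * trig L x)" if "frequencies L \<subseteq> lattice" "phases L \<subseteq> {0}" for L
    using that
  proof (induction L)
    case Nil
    then show ?case using even_trig_const[of 0] by simp
  next
    case (Cons z L)
    obtain a l \<theta> where z: "z = (a, l, \<theta>)" by (cases z)
    with Cons have th: "\<theta> = 0" "l \<in> lattice" and IH: "even_trig (\<lambda>x. (c * wave k 0 x) * trig L x)" by auto
    have "(\<lambda>x. (c * wave k 0 x) * trig (z # L) x)
      = (\<lambda>x. (c * a / 2 * wave (k + l) 0 x + c * a / 2 * wave (k - l) 0 x) + (c * wave k 0 x) * trig L x)"
    proof
      fix x
      have "(c * wave k 0 x) * trig (z # L) x = c * a * (wave k 0 x * wave l 0 x) + (c * wave k 0 x) * trig L x"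
        by (simp add: z th algebra_simps)
      then show "(c * wave k 0 x) * trig (z # L) x
        = (c * a / 2 * wave (k + l) 0 x + c * a / 2 * wave (k - l) 0 x) + (c * wave k 0 x) * trig L x"
        unfolding wave_mult_0 by (simp add: algebra_simps)
    qed
    then show ?case
      using IH th assms(1) by (simp only:) (intro even_trig_add even_trig_wave lattice_add lattice_diff)
  qed
  then show ?thesis using assms(2) unfolding even_trig_def[of f] by (metis (no_types, lifting) ext)
qed

lemma even_trig_mult: assumes "even_trig f" "even_trig g" shows "even_trig (\<lambda>x. f x * g x)"
proof -
  have "even_trig (\<lambda>x. trig L x * g x)" if "frequencies L \<subseteq> lattice" "phases L \<subseteq> {0}" for L
    using that
  proof (induction L)
    case Nil
    then show ?case using even_trig_const[of 0] by simp
  next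
    case (Cons z L)
    obtain a l \<theta> where z: "z = (a, l, \<theta>)" by (cases z)
    with Cons have "\<theta> = 0" "l \<in> lattice" "even_trig (\<lambda>x. trig L x * g x)" by auto
    then show ?case
      using even_trig_add[OF even_trig_wave_mult[OF _ assms(2), of l a]] by (simp add: z distrib_right)
  qed
  then show ?thesis using assms(1) unfolding even_trig_def[of f] by (metis (no_types, lifting) ext)
qed

lemma even_trig_power: "even_trig f \<Longrightarrow> even_trig (\<lambda>x. f x ^ n)"
  by (induction n) (auto intro: even_trig_mult even_trig_const)

lemma even_trig_prod: "finite I \<Longrightarrow> (\<And>i. i \<in> I \<Longrightarrow> even_trig (f i)) \<Longrightarrow> even_trig (\<lambda>x. \<Prod>i\<in>I. f i x)"
  by (induction I rule: finite_induct) (auto intro: even_trig_mult even_trig_const)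

lemma even_trig_cos_prod: "even_trig (cos_prod m)"
proof -
  have *: "(cos (pi * z$i))\<^sup>2 = 1 / 2 + 1 / 2 * wave (axis i 1) 0 z" for z :: "real^3" and i
    using cos_double_cos[of "pi * z$i"] by (simp add: wave_def inner_axis' mult.assoc field_simps)
  have "cos_prod m = (\<lambda>z. \<Prod>i\<in>UNIV. (1 / 2 + 1 / 2 * wave (axis i 1) 0 z) ^ m i)"
    by (simp add: cos_prod_def power_mult * fun_eq_iff)
  then show ?thesis
    by (simp only:) (intro even_trig_prod even_trig_power even_trig_add even_trig_const even_trig_wave lattice_axis; simp)
qed

text \<open>
  The index is shifted by one because the derivative of \<open>cos\<^bsup>2n+2\<^esup>\<close> is estimated by
  \<open>cos\<^bsup>2n\<^esup>\<close>, which then still is a kernel of the same family.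
\<close>

definition cos_kernel :: "nat \<Rightarrow> waves" where
  "cos_kernel n = (SOME L. frequencies L \<subseteq> lattice \<and> phases L \<subseteq> {0} \<and>
     (\<forall>z. trig L z = cos_prod (\<lambda>_. Suc n) z / cos_mass (Suc n)))"

lemma cos_kernel:
  "frequencies (cos_kernel n) \<subseteq> lattice" "phases (cos_kernel n) \<subseteq> {0}"
  "trig (cos_kernel n) z = cos_prod (\<lambda>_. Suc n) z / cos_mass (Suc n)"
proof -
  have "even_trig (\<lambda>z. 1 / cos_mass (Suc n) * cos_prod (\<lambda>_. Suc n) z)"
    by (intro even_trig_mult even_trig_const even_trig_cos_prod)
  then have "\<exists>L. frequencies L \<subseteq> lattice \<and> phases L \<subseteq> {0} \<and>
     (\<forall>z. trig L z = cos_prod (\<lambda>_. Suc n) z / cos_mass (Suc n))"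
    by (auto simp: even_trig_def)
  from someI_ex[OF this]
  have "frequencies (cos_kernel n) \<subseteq> lattice \<and> phases (cos_kernel n) \<subseteq> {0} \<and>
     (\<forall>z. trig (cos_kernel n) z = cos_prod (\<lambda>_. Suc n) z / cos_mass (Suc n))"
    unfolding cos_kernel_def .
  then show "frequencies (cos_kernel n) \<subseteq> lattice" "phases (cos_kernel n) \<subseteq> {0}"
    "trig (cos_kernel n) z = cos_prod (\<lambda>_. Suc n) z / cos_mass (Suc n)" by auto
qed

lemma kernel_nonneg: "trig (cos_kernel n) z \<ge> 0"
  using cos_prod_nonneg cos_mass_pos[of "Suc n"] by (simp add: cos_kernel)

lemma integrable_trig: "integrable torus (trig L)"
proof -
  obtain C where "\<And>x. \<bar>trig L x\<bar> \<le> C" using trig_bounded by blast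
  then show ?thesis by (rule integrable_torus_bounded[rotated]) auto
qed

lemma integral_kernel: "(\<integral>z. trig (cos_kernel n) z \<partial>torus) = 1"
  using cos_mass_pos[of "Suc n"] by (simp add: cos_kernel cos_mass_def)

lemma torus_size_powr_bound: "0 \<le> p \<Longrightarrow> p \<le> 2 \<Longrightarrow> \<bar>torus_size z powr p\<bar> \<le> 10"
  using powr_le_one_plus_square[OF torus_size_nonneg, of p z] power_mono[OF torus_size_le torus_size_nonneg, of z 2]
  by simp

lemma kernel_moment:
  assumes "0 \<le> p" "p \<le> 2"
  shows "integrable torus (\<lambda>z. trig (cos_kernel n) z * torus_size z powr p)"
    "(\<integral>z. trig (cos_kernel n) z * torus_size z powr p \<partial>torus) \<le> 10 * real (Suc n) powr (- p)"
proof -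
  show "integrable torus (\<lambda>z. trig (cos_kernel n) z * torus_size z powr p)"
    by (rule integrable_torus_mult_bounded(2)[OF integrable_trig _ torus_size_powr_bound[OF assms]]) measurable
  have "(\<integral>z. trig (cos_kernel n) z * torus_size z powr p \<partial>torus)
     = (\<integral>z. cos_prod (\<lambda>_. Suc n) z * torus_size z powr p \<partial>torus) / cos_mass (Suc n)"
    by (simp add: cos_kernel)
  also have "\<dots> \<le> (10 * real (Suc (Suc n)) powr (- p) * cos_mass (Suc n)) / cos_mass (Suc n)"
    using cos_mass_pos[of "Suc n"] by (intro divide_right_mono integral_cos_prod_torus_size assms) auto
  also have "\<dots> \<le> 10 * real (Suc n) powr (- p)"
    using cos_mass_pos[of "Suc n"] assms by (simp add: powr_mono2' del: of_nat_Suc)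
  finally show "(\<integral>z. trig (cos_kernel n) z * torus_size z powr p \<partial>torus) \<le> 10 * real (Suc n) powr (- p)" .
qed

text \<open>
  One cosine is spent to differentiate, and the sine that appears is at most the square
  root of \<open>torus_size\<close>; the remaining product is the kernel of index one less. The factor 16
  is \<open>2 * 8\<close>, the 8 coming from the comparison of masses.
\<close>

lemma abs_kernel_partial_le:
  "\<bar>trig (trig_partial j (cos_kernel n)) z\<bar> \<le> 16 * pi * real (Suc n) * (cos_prod (\<lambda>_. n) z * torus_size z powr (1 / 2)) / cos_mass n"
proof -
  define R where "R z = (\<Prod>i\<in>UNIV - {j}. cos (pi * z$i) ^ (2 * Suc n))" for z :: "real^3"
  define R0 where "R0 z = (\<Prod>i\<in>UNIV - {j}. cos (pi * z$i) ^ (2 * n))" for z :: "real^3"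
  have Rj: "R (z + t *\<^sub>R axis j 1) = R z" for t
    unfolding R_def by (intro prod.cong) (auto simp: axis_def)
  have K: "trig (cos_kernel n) z = cos (pi * z$j) ^ (2 * Suc n) * R z / cos_mass (Suc n)" for z
    unfolding cos_kernel cos_prod_split[of "\<lambda>_. Suc n" z j] R_def ..
  have "((\<lambda>t. cos (pi * (z$j + t)) ^ (2 * Suc n) * R z / cos_mass (Suc n)) has_real_derivative
     (real (2 * Suc n) * cos (pi * z$j) ^ (2 * n + 1) * (- sin (pi * z$j) * pi)) * R z / cos_mass (Suc n)) (at 0)"
  proof (intro DERIV_cdivide DERIV_cmult_right)
    have "((\<lambda>t. cos (pi * (t + z$j)) ^ (2 * Suc n)) has_real_derivative
       real (2 * Suc n) * cos (pi * z$j) ^ (2 * Suc n - 1) * (- sin (pi * z$j) * pi)) (at 0)"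
      using DERIV_cos_pi_power[of "2 * Suc n" "0 + z$j"]
      by (subst (asm) DERIV_shift) (simp only: add_0)
    moreover have "2 * Suc n - 1 = 2 * n + 1" by simp
    ultimately show "((\<lambda>t. cos (pi * (z$j + t)) ^ (2 * Suc n)) has_real_derivative
       real (2 * Suc n) * cos (pi * z$j) ^ (2 * n + 1) * (- sin (pi * z$j) * pi)) (at 0)"
      by (simp only: add.commute)
  qed
  then have "((\<lambda>t. trig (cos_kernel n) (z + t *\<^sub>R axis j 1)) has_real_derivative
     (real (2 * Suc n) * cos (pi * z$j) ^ (2 * n + 1) * (- sin (pi * z$j) * pi)) * R z / cos_mass (Suc n)) (at 0)"
    by (simp add: K Rj del: of_nat_Suc)
  from DERIV_unique[OF trig_partial_derivative this]
  have "\<bar>trig (trig_partial j (cos_kernel n)) z\<bar>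
     = real (2 * Suc n) * pi * (\<bar>cos (pi * z$j) ^ (2 * n + 1)\<bar> * \<bar>sin (pi * z$j)\<bar> * \<bar>R z\<bar>) / cos_mass (Suc n)"
    using cos_mass_pos[of "Suc n"] by (simp add: abs_mult del: of_nat_Suc power_Suc)
  also have "\<dots> \<le> real (2 * Suc n) * pi * (cos (pi * z$j) ^ (2 * n) * torus_size z powr (1 / 2) * R0 z) / cos_mass (Suc n)"
  proof (intro divide_right_mono mult_left_mono mult_mono)
    have e: "\<bar>cos (pi * z$i) ^ (2 * n)\<bar> = cos (pi * z$i) ^ (2 * n)" for i by (simp add: power_mult)
    show "\<bar>cos (pi * z$j) ^ (2 * n + 1)\<bar> \<le> cos (pi * z$j) ^ (2 * n)"
      using mult_right_le_one_le[of "\<bar>cos (pi * z$j) ^ (2 * n)\<bar>" "\<bar>cos (pi * z$j)\<bar>"] e[of j]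
      by (simp add: abs_mult mult.commute)
    have "(sin (pi * z$j))\<^sup>2 \<le> torus_size z"
      unfolding torus_size_def by (rule member_le_sum) auto
    then show "\<bar>sin (pi * z$j)\<bar> \<le> torus_size z powr (1 / 2)"
      using torus_size_nonneg[of z] by (simp add: powr_half_sqrt real_le_rsqrt)
    have "\<bar>R z\<bar> = (\<Prod>i\<in>UNIV - {j}. cos (pi * z$i) ^ (2 * Suc n))"
      unfolding R_def abs_prod power_mult by (simp del: power_Suc)
    also have "\<dots> \<le> R0 z" unfolding R0_def
    proof (rule prod_mono, intro conjI)
      fix i
      show "0 \<le> cos (pi * z $ i) ^ (2 * Suc n)" unfolding power_mult by simp
      have "((cos (pi * z $ i))\<^sup>2) ^ Suc n \<le> ((cos (pi * z $ i))\<^sup>2) ^ n"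
        by (intro power_decreasing) (auto simp: abs_square_le_1)
      then show "cos (pi * z $ i) ^ (2 * Suc n) \<le> cos (pi * z $ i) ^ (2 * n)" unfolding power_mult .
    qed
    finally show "\<bar>R z\<bar> \<le> R0 z" .
  qed (use cos_mass_pos[of "Suc n"] in \<open>auto simp: power_mult\<close>)
  also have "\<dots> = 2 * pi * real (Suc n) * (cos_prod (\<lambda>_. n) z * torus_size z powr (1 / 2)) / cos_mass (Suc n)"
    unfolding cos_prod_split[of "\<lambda>_. n" z j] R0_def by simp
  also have "\<dots> \<le> 2 * pi * real (Suc n) * (cos_prod (\<lambda>_. n) z * torus_size z powr (1 / 2)) / (cos_mass n / 8)"
    using cos_mass_pos[of n] cos_mass_Suc[of n] cos_prod_nonneg by (intro divide_left_mono) auto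
  finally show ?thesis by (simp add: mult_ac del: of_nat_Suc)
qed

text \<open>
  Differentiation costs a factor \<open>n\<close> and gains \<open>torus_size\<^bsup>1/2\<^esup>\<close>, hence in
  total the inverse \<open>n\<^bsup>1/2\<^esup>\<close> of the width of the kernel. The upper bound on \<open>q\<close> is the
  second moment available for the kernel, less the gained half.
\<close>

lemma kernel_partial_moment:
  assumes "0 \<le> q" "q \<le> 3 / 2"
  shows "integrable torus (\<lambda>z. \<bar>trig (trig_partial j (cos_kernel n)) z\<bar> * torus_size z powr q)"
    "(\<integral>z. \<bar>trig (trig_partial j (cos_kernel n)) z\<bar> * torus_size z powr q \<partial>torus) \<le> 160 * pi * real (Suc n) powr (1 / 2 - q)"
proof -
  let ?D = "\<lambda>z. \<bar>trig (trig_partial j (cos_kernel n)) z\<bar>" and ?N = "real (Suc n)"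
  have q: "0 \<le> q" "q \<le> 2" and q': "0 \<le> q + 1 / 2" "q + 1 / 2 \<le> 2" using assms by auto
  show i: "integrable torus (\<lambda>z. ?D z * torus_size z powr q)"
    using integrable_trig by (intro integrable_torus_mult_bounded(2)[OF _ _ torus_size_powr_bound[OF q]]) auto
  have "(\<integral>z. ?D z * torus_size z powr q \<partial>torus)
     \<le> (\<integral>z. 16 * pi * ?N / cos_mass n * (cos_prod (\<lambda>_. n) z * torus_size z powr (q + 1 / 2)) \<partial>torus)"
  proof (intro integral_mono i integrable_mult_right integral_cos_prod_torus_size(1) q')
    fix z
    have "?D z * torus_size z powr q \<le> 16 * pi * ?N * (cos_prod (\<lambda>_. n) z * torus_size z powr (1 / 2)) / cos_mass n * torus_size z powr q"
      by (intro mult_right_mono abs_kernel_partial_le) auto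
    then show "?D z * torus_size z powr q \<le> 16 * pi * ?N / cos_mass n * (cos_prod (\<lambda>_. n) z * torus_size z powr (q + 1 / 2))"
      by (simp add: powr_add mult_ac del: of_nat_Suc)
  qed
  also have "\<dots> = 16 * pi * ?N / cos_mass n * (\<integral>z. cos_prod (\<lambda>_. n) z * torus_size z powr (q + 1 / 2) \<partial>torus)"
    by simp
  also have "\<dots> \<le> 16 * pi * ?N / cos_mass n * (10 * ?N powr (- (q + 1 / 2)) * cos_mass n)"
    using cos_mass_pos[of n] by (intro mult_left_mono integral_cos_prod_torus_size(2) q') auto
  also have "\<dots> = 160 * pi * (?N powr 1 * ?N powr (- (q + 1 / 2)))"
    using cos_mass_pos[of n] by simp
  also have "\<dots> = 160 * pi * ?N powr (1 / 2 - q)"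
    unfolding powr_add[symmetric] by simp
  finally show "(\<integral>z. ?D z * torus_size z powr q \<partial>torus) \<le> 160 * pi * ?N powr (1 / 2 - q)" .
qed

text \<open>
  A crude form of Jordan's inequality: near zero by the mean value theorem, and beyond
  \<open>1 / 6\<close> because the sine is already at least one half.
\<close>

lemma sin_pi_ge: assumes "0 \<le> y" "y \<le> 1 / 2" shows "y \<le> sin (pi * y)"
proof (cases "y \<le> 1 / 6")
  case True
  show ?thesis
  proof (cases "y = 0")
    case False
    then have "0 < pi * y" using assms by simp
    from MVT2[OF this, of sin cos] obtain z where z: "0 < z" "z < pi * y" "sin (pi * y) = pi * y * cos z"
      by (auto simp: DERIV_sin)
    have "z \<le> pi / 3"
    proof -
      have "pi * y \<le> pi * (1 / 6)" using True by (intro mult_left_mono) auto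
      then show ?thesis using z(2) pi_gt_zero by linarith
    qed
    then have "cos (pi / 3) \<le> cos z" using z(1) by (intro cos_monotone_0_pi_le) auto
    then have "1 / 2 \<le> cos z" by (simp add: cos_60)
    then have "2 * (1 / 2) \<le> pi * cos z" using pi_ge_two by (intro mult_mono) auto
    then have "y * 1 \<le> y * (pi * cos z)" using assms by (intro mult_left_mono) auto
    then show ?thesis using z(3) by (simp add: mult_ac)
  qed simp
next
  case False
  have "sin (pi / 6) \<le> sin (pi * y)"
  proof (rule sin_monotone_2pi_le)
    show "pi / 6 \<le> pi * y" "pi * y \<le> pi / 2"
      using False assms mult_left_mono[of "1 / 6" y pi] mult_left_mono[of y "1 / 2" pi] by auto
    show "- (pi / 2) \<le> pi / 6" by (rule order_trans[of _ 0]) auto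
  qed
  then show ?thesis using assms by (simp add: sin_30)
qed

text \<open>
  Rounding each coordinate to the nearest integer leaves a remainder that is at most the
  absolute value of the corresponding sine.
\<close>

lemma lattice_nearest:
  obtains k where "k \<in> lattice" "norm (h + k) \<le> sqrt (torus_size h)"
proof
  define k where "k = ((\<chi> i. - of_int (round (h$i))) :: real^3)"
  show "k \<in> lattice" by (simp add: k_def lattice_def)
  have "((h + k)$i)\<^sup>2 \<le> (sin (pi * h$i))\<^sup>2" for i
  proof -
    let ?y = "h$i - of_int (round (h$i))"
    have y: "\<bar>?y\<bar> \<le> 1 / 2" using of_int_round_abs_le[of "h$i"] by (simp add: abs_minus_commute)
    have "(sin (pi * ?y))\<^sup>2 = (sin (pi * h$i))\<^sup>2"
    proof -
      have "sin (pi * ?y) = sin (pi * h$i) * cos (pi * of_int (round (h$i)))"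
        by (simp add: right_diff_distrib sin_diff)
      moreover have "(cos (pi * of_int n))\<^sup>2 = 1" for n
        by (simp add: cos_squared_eq)
      ultimately show ?thesis by (simp add: power_mult_distrib)
    qed
    moreover have "\<bar>?y\<bar> \<le> \<bar>sin (pi * ?y)\<bar>"
    proof (cases "?y \<ge> 0")
      case True then show ?thesis using sin_pi_ge[of ?y] y by auto
    next
      case False
      then have "- ?y \<le> sin (pi * (- ?y))" using sin_pi_ge[of "- ?y"] y by auto
      moreover have "sin (pi * (- ?y)) = - sin (pi * ?y)" unfolding mult_minus_right sin_minus ..
      ultimately have "- ?y \<le> - sin (pi * ?y)" by (simp only:)
      then show ?thesis using False by linarith
    qed
    ultimately show ?thesis unfolding k_def abs_le_square_iff by simp
  qed
  then have "(\<Sum>i\<in>UNIV. ((h + k)$i)\<^sup>2) \<le> torus_size h"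
    unfolding torus_size_def by (intro sum_mono) auto
  then show "norm (h + k) \<le> sqrt (torus_size h)"
    by (simp add: norm_vec_def L2_set_def)
qed

section \<open>The space L3\<close>

definition L3 :: "(real^3 \<Rightarrow> real) \<Rightarrow> bool" where
  "L3 f \<longleftrightarrow> f \<in> borel_measurable borel \<and> torus_periodic f \<and> integrable torus (\<lambda>x. \<bar>f x\<bar> ^ 3)"

text \<open>
  The cube lies above its tangent at \<open>m\<close>; with \<open>m\<close> a mean, integration gives Jensen's
  inequality.
\<close>

lemma cube_tangent: "0 \<le> t \<Longrightarrow> 0 \<le> m \<Longrightarrow> m ^ 3 + 3 * m\<^sup>2 * (t - m) \<le> t ^ 3" for t m :: real
proof -
  assume "0 \<le> t" "0 \<le> m"
  then have "0 \<le> (t - m)\<^sup>2 * (t + 2 * m)" by simp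
  then show ?thesis by (simp add: power2_eq_square power3_eq_cube algebra_simps)
qed

lemma cube_mean:
  fixes a b c :: real assumes "a \<ge> 0" "b \<ge> 0" "c \<ge> 0"
  shows "a * b * c \<le> (a ^ 3 + b ^ 3 + c ^ 3) / 3"
proof -
  have "0 \<le> (a + b + c) * ((a - b)\<^sup>2 + (b - c)\<^sup>2 + (a - c)\<^sup>2)" using assms by simp
  then show ?thesis by (simp add: power2_eq_square power3_eq_cube algebra_simps)
qed

lemma one_le_cube:
  fixes t :: real assumes t: "0 \<le> t"
  shows "t \<le> 1 + t ^ 3" "t\<^sup>2 \<le> 1 + t ^ 3"
proof -
  have "t * 3 \<le> 2 + t ^ 3" "t\<^sup>2 * 3 \<le> 1 + 2 * t ^ 3" and "0 \<le> t ^ 3"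
    using cube_mean[of t 1 1] cube_mean[of t t 1] t by (auto simp: power2_eq_square)
  then show "t \<le> 1 + t ^ 3" "t\<^sup>2 \<le> 1 + t ^ 3" by linarith+
qed

lemma L3D:
  assumes "L3 f"
  shows "f \<in> borel_measurable borel" "torus_periodic f" "integrable torus (\<lambda>x. \<bar>f x\<bar> ^ 3)" "f \<in> borel_measurable torus"
  using assms borel_measurable_torus by (auto simp: L3_def)

lemma integrable_torus_dominated:
  fixes f g :: "real^3 \<Rightarrow> real"
  assumes "integrable torus g" "f \<in> borel_measurable torus" "\<And>x. \<bar>f x\<bar> \<le> g x"
  shows "integrable torus f"
  by (rule Bochner_Integration.integrable_bound[OF assms(1,2)]) (auto intro!: order.trans[OF assms(3) abs_ge_self])

lemma L3_integrable_mult3: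
  assumes "L3 f" "L3 g" "L3 h" shows "integrable torus (\<lambda>x. f x * g x * h x)"
proof (rule integrable_torus_dominated)
  show "integrable torus (\<lambda>x. (\<bar>f x\<bar> ^ 3 + \<bar>g x\<bar> ^ 3 + \<bar>h x\<bar> ^ 3) / 3)"
    using assms[THEN L3D(3)] by simp
  show "(\<lambda>x. f x * g x * h x) \<in> borel_measurable torus" using assms[THEN L3D(4)] by measurable
  show "\<bar>f x * g x * h x\<bar> \<le> (\<bar>f x\<bar> ^ 3 + \<bar>g x\<bar> ^ 3 + \<bar>h x\<bar> ^ 3) / 3" for x
    using cube_mean[of "\<bar>f x\<bar>" "\<bar>g x\<bar>" "\<bar>h x\<bar>"] by (simp add: abs_mult)
qed

lemma L3_const: "L3 (\<lambda>x. c)"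
  by (simp add: L3_def torus_periodic_def)

lemma L3_integrable_mult: "L3 f \<Longrightarrow> L3 g \<Longrightarrow> integrable torus (\<lambda>x. f x * g x)"
  using L3_integrable_mult3[OF _ _ L3_const[of 1]] by simp

lemma L3_integrable: "L3 f \<Longrightarrow> integrable torus f"
  using L3_integrable_mult[OF _ L3_const[of 1]] by simp

lemma L3_bounded: 
  assumes "f \<in> borel_measurable borel" "torus_periodic f" "\<And>x. \<bar>f x\<bar> \<le> C"
  shows "L3 f"
  unfolding L3_def
proof (intro conjI assms integrable_torus_bounded)
  show "\<bar>\<bar>f x\<bar> ^ 3\<bar> \<le> C ^ 3" for x using assms(3)[of x] by (simp add: power_mono)
qed (use assms(1) in auto)

lemma L3_trig: "frequencies L \<subseteq> lattice \<Longrightarrow> L3 (trig L)"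
proof -
  assume "frequencies L \<subseteq> lattice"
  moreover obtain C where "\<And>x. \<bar>trig L x\<bar> \<le> C" using trig_bounded by blast
  ultimately show ?thesis by (intro L3_bounded torus_periodic_trig) auto
qed

lemma L3_wave: "k \<in> lattice \<Longrightarrow> L3 (wave k \<theta>)"
  by (intro L3_bounded[where C = 1] torus_periodic_wave abs_wave_le) auto

text \<open>
  Removes the shift by \<open>e\<close> that keeps the norms occurring in denominators positive.
\<close>

lemma le_limit_at_right:
  fixes F :: "real \<Rightarrow> real"
  assumes "\<And>e. e > 0 \<Longrightarrow> A \<le> F e" "continuous_on UNIV F"
  shows "A \<le> F 0"
proof (rule tendsto_lowerbound)
  show "(F \<longlongrightarrow> F 0) (at_right 0)"
    using assms(2) by (auto simp: continuous_on_def intro: tendsto_within_subset)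
  show "\<forall>\<^sub>F e in at_right 0. A \<le> F e"
    using assms(1) by (auto simp: eventually_at_filter)
qed simp

text \<open>
  Hoelder's inequality, from the inequality between the arithmetic and geometric mean of
  three numbers after normalisation.
\<close>

lemma L3_trilinear:
  assumes L: "L3 f" "L3 g" "L3 h" and XYZ: "X \<ge> 0" "Y \<ge> 0" "Z \<ge> 0"
    and b: "(\<integral>x. \<bar>f x\<bar> ^ 3 \<partial>torus) \<le> X ^ 3" "(\<integral>x. \<bar>g x\<bar> ^ 3 \<partial>torus) \<le> Y ^ 3" "(\<integral>x. \<bar>h x\<bar> ^ 3 \<partial>torus) \<le> Z ^ 3"
  shows "(\<integral>x. \<bar>f x * g x * h x\<bar> \<partial>torus) \<le> X * Y * Z"
proof -
  have "(\<integral>x. \<bar>f x * g x * h x\<bar> \<partial>torus) \<le> (X + e) * (Y + e) * (Z + e)" if e: "e > 0" for e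
  proof -
    let ?X = "X + e" and ?Y = "Y + e" and ?Z = "Z + e"
    have pos: "?X > 0" "?Y > 0" "?Z > 0" using XYZ e by auto
    note i = L[THEN L3D(3)]
    have le: "\<bar>f x * g x * h x\<bar> \<le> ?X * ?Y * ?Z * ((\<bar>f x\<bar> ^ 3 / ?X ^ 3 + \<bar>g x\<bar> ^ 3 / ?Y ^ 3 + \<bar>h x\<bar> ^ 3 / ?Z ^ 3) / 3)" for x
    proof -
      have "\<bar>f x * g x * h x\<bar> = ?X * ?Y * ?Z * ((\<bar>f x\<bar> / ?X) * (\<bar>g x\<bar> / ?Y) * (\<bar>h x\<bar> / ?Z))"
        using pos by (simp add: abs_mult)
      also have "\<dots> \<le> ?X * ?Y * ?Z * (((\<bar>f x\<bar> / ?X) ^ 3 + (\<bar>g x\<bar> / ?Y) ^ 3 + (\<bar>h x\<bar> / ?Z) ^ 3) / 3)"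
        using pos by (intro mult_left_mono cube_mean) auto
      finally show ?thesis by (simp add: power_divide)
    qed
    have 1: "I / V ^ 3 \<le> 1" if "I \<le> U ^ 3" "U \<ge> 0" "V = U + e" for I U V
    proof -
      have "I \<le> V ^ 3" using that(2,3) e by (intro order_trans[OF that(1) power_mono]) auto
      then show ?thesis using that e by simp
    qed
    have "(\<integral>x. \<bar>f x * g x * h x\<bar> \<partial>torus) \<le> (\<integral>x. ?X * ?Y * ?Z * ((\<bar>f x\<bar> ^ 3 / ?X ^ 3 + \<bar>g x\<bar> ^ 3 / ?Y ^ 3 + \<bar>h x\<bar> ^ 3 / ?Z ^ 3) / 3) \<partial>torus)"
      using i L3_integrable_mult3[OF L] by (intro integral_mono le) auto
    also have "\<dots> = ?X * ?Y * ?Z * (((\<integral>x. \<bar>f x\<bar> ^ 3 \<partial>torus) / ?X ^ 3 + (\<integral>x. \<bar>g x\<bar> ^ 3 \<partial>torus) / ?Y ^ 3 + (\<integral>x. \<bar>h x\<bar> ^ 3 \<partial>torus) / ?Z ^ 3) / 3)"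
      using i by simp
    also have "\<dots> \<le> ?X * ?Y * ?Z * 1"
    proof (rule mult_left_mono)
      show "((\<integral>x. \<bar>f x\<bar> ^ 3 \<partial>torus) / ?X ^ 3 + (\<integral>x. \<bar>g x\<bar> ^ 3 \<partial>torus) / ?Y ^ 3 + (\<integral>x. \<bar>h x\<bar> ^ 3 \<partial>torus) / ?Z ^ 3) / 3 \<le> 1"
        using add_mono[OF add_mono[OF 1[OF b(1) XYZ(1) refl] 1[OF b(2) XYZ(2) refl]] 1[OF b(3) XYZ(3) refl]]
        by (subst pos_divide_le_eq) auto
    qed (use pos in simp)
    finally show ?thesis by simp
  qed
  moreover have "continuous_on UNIV (\<lambda>e. (X + e) * (Y + e) * (Z + e))" by (intro continuous_intros)
  ultimately have "(\<integral>x. \<bar>f x * g x * h x\<bar> \<partial>torus) \<le> (\<lambda>e. (X + e) * (Y + e) * (Z + e)) 0"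
    by (rule le_limit_at_right)
  then show ?thesis by simp
qed

text \<open>
  Convexity of the cube with weights \<open>X / (X + Y)\<close> and \<open>Y / (X + Y)\<close>; integrating it
  with \<open>X\<close>, \<open>Y\<close> the norms yields Minkowski's inequality.
\<close>

lemma cube_add_le: "X > 0 \<Longrightarrow> Y > 0 \<Longrightarrow> \<bar>a + b\<bar> ^ 3 \<le> (X + Y)\<^sup>2 * (\<bar>a\<bar> ^ 3 / X\<^sup>2 + \<bar>b\<bar> ^ 3 / Y\<^sup>2)" for a b X Y :: real
proof -
  assume pos: "X > 0" "Y > 0"
  define m where "m = (\<bar>a\<bar> + \<bar>b\<bar>) / (X + Y)"
  have m: "m \<ge> 0" "m * (X + Y) = \<bar>a\<bar> + \<bar>b\<bar>" using pos by (auto simp: m_def)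
  have "X * (m ^ 3 + 3 * m\<^sup>2 * (\<bar>a\<bar> / X - m)) + Y * (m ^ 3 + 3 * m\<^sup>2 * (\<bar>b\<bar> / Y - m)) \<le> X * (\<bar>a\<bar> / X) ^ 3 + Y * (\<bar>b\<bar> / Y) ^ 3"
    using pos m by (intro add_mono mult_left_mono cube_tangent) auto
  moreover have "X * (m ^ 3 + 3 * m\<^sup>2 * (\<bar>a\<bar> / X - m)) + Y * (m ^ 3 + 3 * m\<^sup>2 * (\<bar>b\<bar> / Y - m))
     = (X + Y) * m ^ 3 + 3 * m\<^sup>2 * ((\<bar>a\<bar> + \<bar>b\<bar>) - m * (X + Y))"
    using pos by (simp add: field_simps)
  moreover have "X * (\<bar>a\<bar> / X) ^ 3 = \<bar>a\<bar> ^ 3 / X\<^sup>2" "Y * (\<bar>b\<bar> / Y) ^ 3 = \<bar>b\<bar> ^ 3 / Y\<^sup>2"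
    using pos by (simp_all add: power_divide power2_eq_square power3_eq_cube)
  ultimately have "(X + Y)\<^sup>2 * ((X + Y) * m ^ 3) \<le> (X + Y)\<^sup>2 * (\<bar>a\<bar> ^ 3 / X\<^sup>2 + \<bar>b\<bar> ^ 3 / Y\<^sup>2)"
    unfolding m(2) by (intro mult_left_mono) auto
  moreover have "(X + Y)\<^sup>2 * ((X + Y) * m ^ 3) = (\<bar>a\<bar> + \<bar>b\<bar>) ^ 3"
    unfolding m(2)[symmetric] by (simp add: power_mult_distrib power2_eq_square power3_eq_cube)
  moreover have "\<bar>a + b\<bar> ^ 3 \<le> (\<bar>a\<bar> + \<bar>b\<bar>) ^ 3" by (intro power_mono) auto
  ultimately show ?thesis by linarith
qed

lemma L3_add: assumes "L3 f" "L3 g" shows "L3 (\<lambda>x. f x + g x)"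
  unfolding L3_def
proof (intro conjI)
  show "torus_periodic (\<lambda>x. f x + g x)" using assms by (simp add: L3_def torus_periodic_def)
  show "integrable torus (\<lambda>x. \<bar>f x + g x\<bar> ^ 3)"
  proof (rule integrable_torus_dominated)
    show "integrable torus (\<lambda>x. (1 + 1)\<^sup>2 * (\<bar>f x\<bar> ^ 3 / 1\<^sup>2 + \<bar>g x\<bar> ^ 3 / 1\<^sup>2))"
      using assms[THEN L3D(3)] by simp
    show "\<bar>\<bar>f x + g x\<bar> ^ 3\<bar> \<le> (1 + 1)\<^sup>2 * (\<bar>f x\<bar> ^ 3 / 1\<^sup>2 + \<bar>g x\<bar> ^ 3 / 1\<^sup>2)" for x
      using cube_add_le[of 1 1 "f x" "g x"] by simp
  qed (use assms[THEN L3D(4)] in measurable)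
qed (use assms[THEN L3D(1)] in measurable)

lemma L3_cmult: "L3 f \<Longrightarrow> L3 (\<lambda>x. c * f x)"
  by (auto simp: L3_def torus_periodic_def abs_mult power_mult_distrib)

lemma L3_diff: "L3 f \<Longrightarrow> L3 g \<Longrightarrow> L3 (\<lambda>x. f x - g x)"
  using L3_add[OF _ L3_cmult[of g "-1"]] by simp

lemma L3_shift: "L3 f \<Longrightarrow> L3 (\<lambda>x. f (x + h))"
  unfolding L3_def
proof (intro conjI borel_measurable_shift torus_periodic_shift; elim conjE)
  assume "f \<in> borel_measurable borel" "torus_periodic f" "integrable torus (\<lambda>x. \<bar>f x\<bar> ^ 3)"
  then show "integrable torus (\<lambda>x. \<bar>f (x + h)\<bar> ^ 3)"
    by (intro integrable_torus_shift[where f = "\<lambda>x. \<bar>f x\<bar> ^ 3"]) (auto simp: torus_periodic_def)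
qed

lemma L3_increment: "L3 f \<Longrightarrow> L3 (\<lambda>x. f (x + h) - f x)"
  by (intro L3_diff L3_shift)

lemma L3_mult_bounded:
  assumes "L3 f" "g \<in> borel_measurable borel" "torus_periodic g" "\<And>x. \<bar>g x\<bar> \<le> C"
  shows "L3 (\<lambda>x. f x * g x)"
  unfolding L3_def
proof (intro conjI)
  show "torus_periodic (\<lambda>x. f x * g x)" using assms by (simp add: L3_def torus_periodic_def)
  show "integrable torus (\<lambda>x. \<bar>f x * g x\<bar> ^ 3)"
    unfolding abs_mult power_mult_distrib
  proof (rule integrable_torus_mult_bounded(2))
    show "\<bar>\<bar>g x\<bar> ^ 3\<bar> \<le> C ^ 3" for x using assms(4)[of x] by (simp add: power_mono)
  qed (use assms in \<open>auto dest: L3D\<close>)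
qed (use assms in \<open>auto dest: L3D\<close>)

lemma L3_minkowski:
  assumes L: "L3 f" "L3 g" and XY: "X \<ge> 0" "Y \<ge> 0"
    and b: "(\<integral>x. \<bar>f x\<bar> ^ 3 \<partial>torus) \<le> X ^ 3" "(\<integral>x. \<bar>g x\<bar> ^ 3 \<partial>torus) \<le> Y ^ 3"
  shows "(\<integral>x. \<bar>f x + g x\<bar> ^ 3 \<partial>torus) \<le> (X + Y) ^ 3"
proof -
  have "(\<integral>x. \<bar>f x + g x\<bar> ^ 3 \<partial>torus) \<le> (X + e + (Y + e)) ^ 3" if e: "e > 0" for e
  proof -
    let ?X = "X + e" and ?Y = "Y + e"
    have pos: "?X > 0" "?Y > 0" using XY e by auto
    note i = L[THEN L3D(3)]
    have 1: "I / V\<^sup>2 \<le> V" if "I \<le> U ^ 3" "U \<ge> 0" "V = U + e" for I U V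
    proof -
      have "I \<le> V ^ 3" using that(2,3) e by (intro order_trans[OF that(1) power_mono]) auto
      then show ?thesis using that e by (simp add: pos_divide_le_eq power2_eq_square power3_eq_cube)
    qed
    have "(\<integral>x. \<bar>f x + g x\<bar> ^ 3 \<partial>torus) \<le> (\<integral>x. (?X + ?Y)\<^sup>2 * (\<bar>f x\<bar> ^ 3 / ?X\<^sup>2 + \<bar>g x\<bar> ^ 3 / ?Y\<^sup>2) \<partial>torus)"
      using i L3D(3)[OF L3_add[OF L]] pos by (intro integral_mono cube_add_le) auto
    also have "\<dots> = (?X + ?Y)\<^sup>2 * ((\<integral>x. \<bar>f x\<bar> ^ 3 \<partial>torus) / ?X\<^sup>2 + (\<integral>x. \<bar>g x\<bar> ^ 3 \<partial>torus) / ?Y\<^sup>2)"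
      using i by simp
    also have "\<dots> \<le> (?X + ?Y)\<^sup>2 * (?X + ?Y)"
      using 1[OF b(1) XY(1) refl] 1[OF b(2) XY(2) refl] by (intro mult_left_mono add_mono) auto
    finally show ?thesis by (simp add: power2_eq_square power3_eq_cube)
  qed
  moreover have "continuous_on UNIV (\<lambda>e. (X + e + (Y + e)) ^ 3)" by (intro continuous_intros)
  ultimately have "(\<integral>x. \<bar>f x + g x\<bar> ^ 3 \<partial>torus) \<le> (\<lambda>e. (X + e + (Y + e)) ^ 3) 0"
    by (rule le_limit_at_right)
  then show ?thesis by simp
qed

text \<open>
  The ball of radius \<open>N\<close> in the Besov space of order below one, with bounds stated for
  cubes of norms so that no roots appear.
\<close>

definition nikolskii :: "real \<Rightarrow> real \<Rightarrow> (real^3 \<Rightarrow> real) \<Rightarrow> bool" where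
  "nikolskii \<sigma> N f \<longleftrightarrow> L3 f \<and> 0 \<le> N \<and> (\<integral>x. \<bar>f x\<bar> ^ 3 \<partial>torus) \<le> N ^ 3 \<and>
     (\<forall>h. (\<integral>x. \<bar>f (x + h) - f x\<bar> ^ 3 \<partial>torus) \<le> (N * norm h powr \<sigma>) ^ 3)"

text \<open>
  By periodicity the increment may be taken over the shortest representative of \<open>h\<close>,
  whose squared length is at most \<open>torus_size h\<close>.
\<close>

lemma nikolskii_torus_size:
  assumes "nikolskii \<sigma> N f" "\<sigma> \<ge> 0"
  shows "(\<integral>x. \<bar>f (x + h) - f x\<bar> ^ 3 \<partial>torus) \<le> (N * torus_size h powr (\<sigma> / 2)) ^ 3"
proof -
  obtain k where k: "k \<in> lattice" "norm (h + k) \<le> sqrt (torus_size h)" using lattice_nearest by blast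
  have per: "torus_periodic f" using assms(1) by (auto simp: nikolskii_def L3_def)
  have "f (x + h) = f (x + (h + k))" for x
    using torus_periodic_int[OF per, of k "x + h"] k(1) by (simp add: lattice_def add.assoc)
  then have "(\<integral>x. \<bar>f (x + h) - f x\<bar> ^ 3 \<partial>torus) = (\<integral>x. \<bar>f (x + (h + k)) - f x\<bar> ^ 3 \<partial>torus)" by simp
  also have "\<dots> \<le> (N * norm (h + k) powr \<sigma>) ^ 3" using assms(1) by (auto simp: nikolskii_def)
  also have "\<dots> \<le> (N * sqrt (torus_size h) powr \<sigma>) ^ 3"
    using assms k by (intro power_mono mult_left_mono powr_mono2) (auto simp: nikolskii_def)
  also have "sqrt (torus_size h) powr \<sigma> = torus_size h powr (\<sigma> / 2)"
    by (simp add: powr_half_sqrt[symmetric] torus_size_nonneg powr_powr)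
  finally show ?thesis .
qed

section \<open>Convolution with a trigonometric kernel\<close>

text \<open>
  The addition theorem splits each \<open>a cos (2\<pi> k \<bullet> (x - y))\<close> into two products of a wave
  in \<open>x\<close> and a wave in \<open>y\<close>; integration in \<open>y\<close> against \<open>g\<close> leaves two waves in \<open>x\<close>.
  The phases of \<open>L\<close> are taken to be zero. The convolution thus depends on finitely many
  modes of \<open>g\<close> only.
\<close>

definition mollify :: "waves \<Rightarrow> (real^3 \<Rightarrow> real) \<Rightarrow> waves" where
  "mollify L g = concat (map (\<lambda>(a, k, \<theta>).
     [(a * (\<integral>y. g y * wave k 0 y \<partial>torus), k, 0), (a * (\<integral>y. g y * wave k (- pi / 2) y \<partial>torus), k, - pi / 2)]) L)"

lemma mollify_simps [simp]:
  "mollify [] g = []"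
  "mollify ((a, k, \<theta>) # L) g = (a * (\<integral>y. g y * wave k 0 y \<partial>torus), k, 0)
     # (a * (\<integral>y. g y * wave k (- pi / 2) y \<partial>torus), k, - pi / 2) # mollify L g"
  by (simp_all add: mollify_def)

lemma frequencies_mollify [simp]: "frequencies (mollify L g) = frequencies L"
  by (induction L) auto

lemma integrable_mult_wave: "integrable torus g \<Longrightarrow> integrable torus (\<lambda>y. g y * wave k \<theta> y)"
  by (rule integrable_torus_mult_bounded(2)[OF _ _ abs_wave_le]) auto

lemma integrable_mult_trig: "integrable torus g \<Longrightarrow> integrable torus (\<lambda>y. g y * trig L y)"
proof -
  assume "integrable torus g"
  moreover obtain C where "\<And>x. \<bar>trig L x\<bar> \<le> C" using trig_bounded by blast
  ultimately show ?thesis by (intro integrable_torus_mult_bounded(2)) auto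
qed

lemma integrable_mult_trig_diff: "integrable torus g \<Longrightarrow> integrable torus (\<lambda>y. trig L (x - y) * g y)"
proof -
  assume "integrable torus g"
  moreover obtain C where "\<And>x. \<bar>trig L x\<bar> \<le> C" using trig_bounded by blast
  moreover have "(\<lambda>y. trig L (x - y)) \<in> borel_measurable borel" by (rule measurable_compose[of _ _ borel]) auto
  ultimately show ?thesis by (intro integrable_torus_mult_bounded(1)) auto
qed

lemma trig_mollify:
  assumes "integrable torus g" "phases L \<subseteq> {0}"
  shows "trig (mollify L g) x = (\<integral>y. trig L (x - y) * g y \<partial>torus)"
  using assms(2)
proof (induction L)
  case (Cons z L)
  obtain a k \<theta> where "z = (a, k, \<theta>)" by (cases z)
  with Cons have z: "z = (a, k, 0)" and IH: "trig (mollify L g) x = (\<integral>y. trig L (x - y) * g y \<partial>torus)" by auto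
  note w = integrable_mult_wave[OF assms(1)]
  have "(\<integral>y. trig (z # L) (x - y) * g y \<partial>torus) =
    (\<integral>y. (a * wave k 0 x * (g y * wave k 0 y) + a * wave k (- pi / 2) x * (g y * wave k (- pi / 2) y)) + trig L (x - y) * g y \<partial>torus)"
    by (intro Bochner_Integration.integral_cong refl) (simp add: z wave_diff_0 algebra_simps)
  also have "\<dots> = (a * wave k 0 x * (\<integral>y. g y * wave k 0 y \<partial>torus) + a * wave k (- pi / 2) x * (\<integral>y. g y * wave k (- pi / 2) y \<partial>torus))
      + (\<integral>y. trig L (x - y) * g y \<partial>torus)"
    using w integrable_mult_trig_diff[OF assms(1), of L x]
    by (subst Bochner_Integration.integral_add) (auto simp del: minus_divide_left)
  finally show ?case using IH by (simp add: z)
qed simp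

lemma trig_partial_mollify:
  assumes "integrable torus g" "phases L \<subseteq> {0}"
  shows "trig (trig_partial j (mollify L g)) x = (\<integral>y. trig (trig_partial j L) (x - y) * g y \<partial>torus)"
  using assms(2)
proof (induction L)
  case (Cons z L)
  obtain a k \<theta> where "z = (a, k, \<theta>)" by (cases z)
  with Cons have z: "z = (a, k, 0)"
    and IH: "trig (trig_partial j (mollify L g)) x = (\<integral>y. trig (trig_partial j L) (x - y) * g y \<partial>torus)" by auto
  note w = integrable_mult_wave[OF assms(1)]
  let ?a = "2 * pi * k$j * a"
  have "(\<integral>y. trig (trig_partial j (z # L)) (x - y) * g y \<partial>torus) =
    (\<integral>y. (?a * wave k (pi / 2) x * (g y * wave k 0 y) + ?a * wave k 0 x * (g y * wave k (- pi / 2) y)) + trig (trig_partial j L) (x - y) * g y \<partial>torus)"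
    by (intro Bochner_Integration.integral_cong refl) (simp add: z wave_diff_pi2 algebra_simps)
  also have "\<dots> = (?a * wave k (pi / 2) x * (\<integral>y. g y * wave k 0 y \<partial>torus) + ?a * wave k 0 x * (\<integral>y. g y * wave k (- pi / 2) y \<partial>torus))
      + (\<integral>y. trig (trig_partial j L) (x - y) * g y \<partial>torus)"
    using w integrable_mult_trig_diff[OF assms(1), of "trig_partial j L" x]
    by (subst Bochner_Integration.integral_add) (auto simp del: minus_divide_left)
  finally show ?case using IH by (simp add: z algebra_simps)
qed simp

lemma trig_even: "phases L \<subseteq> {0} \<Longrightarrow> trig L (- x) = trig L x"
  by (induction L) (auto simp: wave_uminus_0)

lemma trig_partial_odd: "phases L \<subseteq> {0} \<Longrightarrow> trig (trig_partial j L) (- x) = - trig (trig_partial j L) x"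
  by (induction L) (auto simp: wave_uminus_pi2)

lemma integral_trig_partial: "frequencies L \<subseteq> lattice \<Longrightarrow> (\<integral>x. trig (trig_partial j L) x \<partial>torus) = 0"
  by (intro integral_torus_derivative[where \<phi> = "trig L" and j = j] trig_partial_derivative)
     (auto intro!: torus_periodic_trig continuous_intros)

lemma id_torus_borel: "(\<lambda>x. x) \<in> torus \<rightarrow>\<^sub>M borel"
  using borel_measurable_torus[of "\<lambda>x. x"] by simp

lemma measurable_torus_diff:
  "\<kappa> \<in> borel_measurable borel \<Longrightarrow> (\<lambda>(x, y). \<kappa> (x - y) :: real) \<in> borel_measurable (torus \<Otimes>\<^sub>M torus)"
proof -
  assume k: "\<kappa> \<in> borel_measurable borel"
  have "(\<lambda>(x, y). x - y) \<in> torus \<Otimes>\<^sub>M torus \<rightarrow>\<^sub>M borel"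
    using id_torus_borel by measurable
  from measurable_compose[OF this k] show ?thesis by (simp add: case_prod_unfold)
qed

lemma integrable_torus_pair:
  fixes F G \<kappa> :: "real^3 \<Rightarrow> real"
  assumes "integrable torus F" "integrable torus G" "\<kappa> \<in> borel_measurable borel" "\<And>x. \<bar>\<kappa> x\<bar> \<le> C"
  shows "integrable (torus \<Otimes>\<^sub>M torus) (\<lambda>(x, y). \<kappa> (x - y) * (F x * G y))"
proof (rule integrableI_bounded)
  have [measurable]: "F \<in> borel_measurable torus" "G \<in> borel_measurable torus" using assms by auto
  note [measurable] = measurable_torus_diff[OF assms(3)]
  show m: "(\<lambda>(x, y). \<kappa> (x - y) * (F x * G y)) \<in> borel_measurable (torus \<Otimes>\<^sub>M torus)"
    by measurable
  have "(\<integral>\<^sup>+z. ennreal (norm (case z of (x, y) \<Rightarrow> \<kappa> (x - y) * (F x * G y))) \<partial>(torus \<Otimes>\<^sub>M torus))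
    = (\<integral>\<^sup>+x. \<integral>\<^sup>+y. ennreal (norm (\<kappa> (x - y) * (F x * G y))) \<partial>torus \<partial>torus)"
    using m by (subst torus.nn_integral_fst[symmetric]) (auto simp: measurable_split_conv)
  also have "\<dots> \<le> (\<integral>\<^sup>+x. \<integral>\<^sup>+y. ennreal C * (ennreal \<bar>F x\<bar> * ennreal \<bar>G y\<bar>) \<partial>torus \<partial>torus)"
  proof (intro nn_integral_mono)
    fix x y
    have C: "C \<ge> 0" using assms(4)[of 0] by linarith
    have "norm (\<kappa> (x - y) * (F x * G y)) \<le> C * (\<bar>F x\<bar> * \<bar>G y\<bar>)"
      using assms(4)[of "x - y"] by (simp add: abs_mult mult_right_mono)
    then show "ennreal (norm (\<kappa> (x - y) * (F x * G y))) \<le> ennreal C * (ennreal \<bar>F x\<bar> * ennreal \<bar>G y\<bar>)"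
      using C by (simp add: ennreal_mult[symmetric])
  qed
  also have "\<dots> = ennreal C * ((\<integral>\<^sup>+x. ennreal \<bar>F x\<bar> \<partial>torus) * (\<integral>\<^sup>+y. ennreal \<bar>G y\<bar> \<partial>torus))"
    by (simp add: nn_integral_cmult nn_integral_multc)
  also have "\<dots> < \<infinity>"
    using assms(1,2) by (auto simp: integrable_iff_bounded ennreal_mult_less_top)
  finally show "(\<integral>\<^sup>+z. ennreal (norm (case z of (x, y) \<Rightarrow> \<kappa> (x - y) * (F x * G y))) \<partial>(torus \<Otimes>\<^sub>M torus)) < \<infinity>" .
qed

text \<open>
  The bilinear form in which all eight terms of the increment identity are expressed; it
  is antisymmetric because the derivative of an even kernel is odd.
\<close>

definition cross_partial :: "waves \<Rightarrow> 3 \<Rightarrow> (real^3 \<Rightarrow> real) \<Rightarrow> (real^3 \<Rightarrow> real) \<Rightarrow> real" where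
  "cross_partial L j F G = (\<integral>(x, y). trig (trig_partial j L) (x - y) * (F x * G y) \<partial>(torus \<Otimes>\<^sub>M torus))"

lemma cross_partial_integrable:
  assumes "integrable torus F" "integrable torus G"
  shows "integrable (torus \<Otimes>\<^sub>M torus) (\<lambda>(x, y). trig L (x - y) * (F x * G y))"
proof -
  obtain C where "\<And>x. \<bar>trig L x\<bar> \<le> C" using trig_bounded by blast
  then show ?thesis by (intro integrable_torus_pair assms) auto
qed

lemma cross_partial_eq:
  assumes "integrable torus F" "integrable torus G" "phases L \<subseteq> {0}"
  shows "cross_partial L j F G = (\<integral>x. F x * trig (trig_partial j (mollify L G)) x \<partial>torus)"
proof -
  have "cross_partial L j F G = (\<integral>x. \<integral>y. trig (trig_partial j L) (x - y) * (F x * G y) \<partial>torus \<partial>torus)"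
    unfolding cross_partial_def
    using torus_pair.integral_fst'[OF cross_partial_integrable[OF assms(1,2), of "trig_partial j L"]] by simp
  also have "\<dots> = (\<integral>x. F x * (\<integral>y. trig (trig_partial j L) (x - y) * G y \<partial>torus) \<partial>torus)"
    by (simp add: mult.left_commute)
  finally show ?thesis by (simp add: trig_partial_mollify[OF assms(2,3)])
qed

lemma cross_partial_swap:
  assumes "phases L \<subseteq> {0}" "integrable torus F" "integrable torus G"
  shows "cross_partial L j F G = - cross_partial L j G F"
proof -
  have m: "(\<lambda>(x, y). trig (trig_partial j L) (x - y) * (F x * G y)) \<in> borel_measurable (torus \<Otimes>\<^sub>M torus)"
    using cross_partial_integrable[OF assms(2,3)] by (rule borel_measurable_integrable)
  have "cross_partial L j F G = (\<integral>(x, y). trig (trig_partial j L) (y - x) * (F y * G x) \<partial>(torus \<Otimes>\<^sub>M torus))"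
    unfolding cross_partial_def using torus_pair.integral_product_swap[OF m] by (simp add: case_prod_unfold)
  also have "\<dots> = (\<integral>(x, y). - (trig (trig_partial j L) (x - y) * (G x * F y)) \<partial>(torus \<Otimes>\<^sub>M torus))"
  proof (intro Bochner_Integration.integral_cong refl, clarify)
    fix x y
    show "trig (trig_partial j L) (y - x) * (F y * G x) = - (trig (trig_partial j L) (x - y) * (G x * F y))"
      using trig_partial_odd[OF assms(1), of j "x - y"] by (simp add: mult.commute)
  qed
  finally show ?thesis unfolding cross_partial_def by (simp add: case_prod_unfold)
qed

lemma cross_partial_one:
  assumes "frequencies L \<subseteq> lattice" "phases L \<subseteq> {0}" "integrable torus F"
  shows "cross_partial L j F (\<lambda>_. 1) = 0"
proof -
  have "cross_partial L j (\<lambda>_. 1) F = (\<integral>x. trig (trig_partial j (mollify L F)) x \<partial>torus)"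
    using assms by (simp add: cross_partial_eq)
  also have "\<dots> = 0" using assms by (intro integral_trig_partial) simp
  finally show ?thesis using cross_partial_swap[OF assms(2,3), of "\<lambda>_. 1" j] by simp
qed

text \<open>
  Divergence zero in the sense of distributions, tested with waves.
\<close>

definition div_free :: "(3 \<Rightarrow> real^3 \<Rightarrow> real) \<Rightarrow> bool" where
  "div_free W \<longleftrightarrow> (\<forall>k\<in>lattice. \<forall>\<theta>. (\<Sum>i\<in>UNIV. k$i * (\<integral>x. W i x * wave k \<theta> x \<partial>torus)) = 0)"

lemma div_free_trig:
  assumes "div_free W" "\<And>i. integrable torus (W i)" "frequencies L \<subseteq> lattice"
  shows "(\<Sum>i\<in>UNIV. \<integral>x. W i x * trig (trig_partial i L) x \<partial>torus) = 0"
  using assms(3)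
proof (induction L)
  case (Cons z L)
  obtain a k \<theta> where z: "z = (a, k, \<theta>)" by (cases z)
  with Cons have k: "k \<in> lattice" and IH: "(\<Sum>i\<in>UNIV. \<integral>x. W i x * trig (trig_partial i L) x \<partial>torus) = 0" by auto
  have "(\<integral>x. W i x * trig (trig_partial i (z # L)) x \<partial>torus)
     = 2 * pi * a * (k$i * (\<integral>x. W i x * wave k (\<theta> + pi / 2) x \<partial>torus)) + (\<integral>x. W i x * trig (trig_partial i L) x \<partial>torus)" for i
  proof -
    have "(\<integral>x. W i x * trig (trig_partial i (z # L)) x \<partial>torus)
     = (\<integral>x. 2 * pi * a * k$i * (W i x * wave k (\<theta> + pi / 2) x) + W i x * trig (trig_partial i L) x \<partial>torus)"
      by (simp add: z algebra_simps)
    then show ?thesis using integrable_mult_wave[OF assms(2)] integrable_mult_trig[OF assms(2)] by simp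
  qed
  then have "(\<Sum>i\<in>UNIV. \<integral>x. W i x * trig (trig_partial i (z # L)) x \<partial>torus)
     = 2 * pi * a * (\<Sum>i\<in>UNIV. k$i * (\<integral>x. W i x * wave k (\<theta> + pi / 2) x \<partial>torus)) + (\<Sum>i\<in>UNIV. \<integral>x. W i x * trig (trig_partial i L) x \<partial>torus)"
    by (simp add: sum.distrib sum_distrib_left)
  then show ?case using assms(1) k IH by (simp add: div_free_def)
qed simp

text \<open>
  The rate at which transport by \<open>W\<close> changes the mollified product of \<open>f\<close> and \<open>g\<close>:
  the field \<open>W f\<close> paired with the gradient of the mollified \<open>g\<close>, and vice versa.
\<close>

definition flux :: "waves \<Rightarrow> (3 \<Rightarrow> real^3 \<Rightarrow> real) \<Rightarrow> (real^3 \<Rightarrow> real) \<Rightarrow> (real^3 \<Rightarrow> real) \<Rightarrow> real" where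
  "flux L W f g = (\<Sum>i\<in>UNIV. (\<integral>x. W i x * f x * trig (trig_partial i (mollify L g)) x \<partial>torus)
      + (\<integral>x. W i x * g x * trig (trig_partial i (mollify L f)) x \<partial>torus))"

text \<open>
  The Duchon-Robert identity. Expanding the product of the three increments gives eight
  terms. Those with all functions at one point vanish because the derivative of the kernel has mean
  zero, those with \<open>W\<close> alone at one point vanish because \<open>W\<close> is divergence-free, and the
  four others make up minus twice the flux because the derivative of the kernel is odd.
\<close>

lemma flux_increments:
  assumes L: "frequencies L \<subseteq> lattice" "phases L \<subseteq> {0}" and W: "div_free W" "\<And>i. L3 (W i)" and fg: "L3 f" "L3 g"
  shows "flux L W f g = - (1 / 2) * (\<Sum>i\<in>UNIV. \<integral>(x, y). trig (trig_partial i L) (x - y) *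
      ((W i x - W i y) * (f x - f y) * (g x - g y)) \<partial>(torus \<Otimes>\<^sub>M torus))"
    and "integrable (torus \<Otimes>\<^sub>M torus) (\<lambda>(x, y). trig (trig_partial i L) (x - y) * ((W i x - W i y) * (f x - f y) * (g x - g y)))"
proof -
  let ?J = "cross_partial L"
  let ?k = "\<lambda>i F G. \<lambda>(x, y). trig (trig_partial i L) (x - y) * (F x * G y)"
  note i1 = L3_integrable[OF W(2)] L3_integrable[OF fg(1)] L3_integrable[OF fg(2)]
    L3_integrable_mult[OF W(2) fg(1)] L3_integrable_mult[OF W(2) fg(2)] L3_integrable_mult[OF fg]
    L3_integrable_mult3[OF W(2) fg]
  have one: "integrable torus (\<lambda>_. 1::real)" by simp
  have ex: "(\<lambda>(x, y). trig (trig_partial i L) (x - y) * ((W i x - W i y) * (f x - f y) * (g x - g y))) =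
    (\<lambda>z. ?k i (\<lambda>x. W i x * f x * g x) (\<lambda>_. 1) z - ?k i (\<lambda>x. W i x * f x) g z - ?k i (\<lambda>x. W i x * g x) f z
      + ?k i (W i) (\<lambda>y. f y * g y) z - ?k i (\<lambda>x. f x * g x) (W i) z + ?k i f (\<lambda>y. W i y * g y) z
      + ?k i g (\<lambda>y. W i y * f y) z - ?k i (\<lambda>_. 1) (\<lambda>y. W i y * f y * g y) z)" for i
    by (auto simp: fun_eq_iff algebra_simps)
  note int = cross_partial_integrable[OF i1(7) one] cross_partial_integrable[OF i1(4) i1(3)] cross_partial_integrable[OF i1(5) i1(2)]
    cross_partial_integrable[OF i1(1) i1(6)] cross_partial_integrable[OF i1(6) i1(1)] cross_partial_integrable[OF i1(2) i1(5)]
    cross_partial_integrable[OF i1(3) i1(4)] cross_partial_integrable[OF one i1(7)]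
  show "integrable (torus \<Otimes>\<^sub>M torus) (\<lambda>(x, y). trig (trig_partial i L) (x - y) * ((W i x - W i y) * (f x - f y) * (g x - g y)))"
    unfolding ex by (intro Bochner_Integration.integrable_add Bochner_Integration.integrable_diff int)
  have "(\<integral>(x, y). trig (trig_partial i L) (x - y) * ((W i x - W i y) * (f x - f y) * (g x - g y)) \<partial>(torus \<Otimes>\<^sub>M torus))
    = ?J i (\<lambda>x. W i x * f x * g x) (\<lambda>_. 1) - ?J i (\<lambda>x. W i x * f x) g - ?J i (\<lambda>x. W i x * g x) f
      + ?J i (W i) (\<lambda>y. f y * g y) - ?J i (\<lambda>x. f x * g x) (W i) + ?J i f (\<lambda>y. W i y * g y)
      + ?J i g (\<lambda>y. W i y * f y) - ?J i (\<lambda>_. 1) (\<lambda>y. W i y * f y * g y)" for i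
    unfolding ex cross_partial_def
    by (simp only: Bochner_Integration.integral_add Bochner_Integration.integral_diff int
        Bochner_Integration.integrable_add Bochner_Integration.integrable_diff)
  also have "\<dots> i = 2 * ?J i (W i) (\<lambda>y. f y * g y) - 2 * (?J i (\<lambda>x. W i x * f x) g + ?J i (\<lambda>x. W i x * g x) f)" for i
    using cross_partial_one[OF L i1(7)] cross_partial_swap[OF L(2) i1(7) one]
      cross_partial_swap[OF L(2) i1(1) i1(6)] cross_partial_swap[OF L(2) i1(2) i1(5)] cross_partial_swap[OF L(2) i1(3) i1(4)]
    by simp
  finally have *: "(\<Sum>i\<in>UNIV. \<integral>(x, y). trig (trig_partial i L) (x - y) * ((W i x - W i y) * (f x - f y) * (g x - g y)) \<partial>(torus \<Otimes>\<^sub>M torus))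
    = 2 * (\<Sum>i\<in>UNIV. ?J i (W i) (\<lambda>y. f y * g y)) - 2 * (\<Sum>i\<in>UNIV. ?J i (\<lambda>x. W i x * f x) g + ?J i (\<lambda>x. W i x * g x) f)"
    by (simp add: sum_subtractf sum_distrib_left)
  have "(\<Sum>i\<in>UNIV. ?J i (W i) (\<lambda>y. f y * g y)) = 0"
    using div_free_trig[OF W(1) i1(1), of "mollify L (\<lambda>y. f y * g y)"] L
    by (simp add: cross_partial_eq[OF i1(1) i1(6) L(2)])
  moreover have "(\<Sum>i\<in>UNIV. ?J i (\<lambda>x. W i x * f x) g + ?J i (\<lambda>x. W i x * g x) f) = flux L W f g"
    unfolding flux_def by (simp add: cross_partial_eq[OF i1(4) i1(3) L(2)] cross_partial_eq[OF i1(5) i1(2) L(2)])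
  ultimately show "flux L W f g = - (1 / 2) * (\<Sum>i\<in>UNIV. \<integral>(x, y). trig (trig_partial i L) (x - y) *
      ((W i x - W i y) * (f x - f y) * (g x - g y)) \<partial>(torus \<Otimes>\<^sub>M torus))"
    unfolding * by simp
qed

text \<open>
  Reduces a double integral to a one-dimensional bound \<open>M h\<close> for increments by \<open>h\<close>. The
  bound is integrated against the kernel, so only moments of the kernel matter afterwards.
\<close>

lemma pair_bound:
  fixes A :: "real^3 \<Rightarrow> real^3 \<Rightarrow> real" and \<kappa> :: "real^3 \<Rightarrow> real"
  assumes \<kappa>: "\<kappa> \<in> borel_measurable borel" "torus_periodic \<kappa>" "\<And>h. \<bar>\<kappa> (- h)\<bar> = \<bar>\<kappa> h\<bar>"
    and A: "case_prod A \<in> borel_measurable (borel \<Otimes>\<^sub>M borel)" "\<And>x. torus_periodic (A x)"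
    and i: "\<And>h. integrable torus (\<lambda>x. A x (x + h))" and M: "\<And>h. (\<integral>x. \<bar>A x (x + h)\<bar> \<partial>torus) \<le> M h"
    and iM: "integrable torus (\<lambda>h. \<bar>\<kappa> h\<bar> * M h)"
    and iA: "integrable (torus \<Otimes>\<^sub>M torus) (\<lambda>(x, y). \<kappa> (x - y) * A x y)"
  shows "\<bar>\<integral>(x, y). \<kappa> (x - y) * A x y \<partial>(torus \<Otimes>\<^sub>M torus)\<bar> \<le> (\<integral>h. \<bar>\<kappa> h\<bar> * M h \<partial>torus)"
proof -
  have M0: "M h \<ge> 0" for h
    by (rule order_trans[OF _ M]) (auto intro!: integral_nonneg_AE)
  let ?F = "\<lambda>(x, y). \<kappa> (x - y) * A x y"
  have kd: "(\<lambda>(x, y). \<kappa> (x - y)) \<in> borel_measurable (borel \<Otimes>\<^sub>M borel)"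
  proof -
    have "(\<lambda>(x, y). x - y :: real^3) \<in> borel \<Otimes>\<^sub>M borel \<rightarrow>\<^sub>M borel" by measurable
    from measurable_compose[OF this \<kappa>(1)] show ?thesis by (simp add: case_prod_unfold)
  qed
  have "ennreal (norm (integral\<^sup>L (torus \<Otimes>\<^sub>M torus) ?F)) \<le> (\<integral>\<^sup>+z. ennreal (norm (?F z)) \<partial>(torus \<Otimes>\<^sub>M torus))"
    by (rule integral_norm_bound_ennreal[OF iA])
  also have "\<dots> = (\<integral>\<^sup>+x. \<integral>\<^sup>+y. ennreal (norm (?F (x, y))) \<partial>torus \<partial>torus)"
    using iA by (subst torus.nn_integral_fst[symmetric]) auto
  also have "\<dots> = (\<integral>\<^sup>+x. \<integral>\<^sup>+y. ennreal (\<bar>\<kappa> (x - y)\<bar> * \<bar>A x y\<bar>) \<partial>torus \<partial>torus)"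
    by (simp add: abs_mult)
  also have "\<dots> = (\<integral>\<^sup>+h. \<integral>\<^sup>+x. ennreal (\<bar>\<kappa> (x - (x + h))\<bar> * \<bar>A x (x + h)\<bar>) \<partial>torus \<partial>torus)"
  proof (rule nn_integral_torus_diagonal)
    show "(\<lambda>(x, y). ennreal (\<bar>\<kappa> (x - y)\<bar> * \<bar>A x y\<bar>)) \<in> borel_measurable (borel \<Otimes>\<^sub>M borel)"
      using kd A(1) by measurable
    have "\<kappa> (x - (y + axis j 1)) = \<kappa> (x - y)" for x y j
      using torus_periodicD[OF \<kappa>(2), of "x - (y + axis j 1)" j] by simp
    then show "torus_periodic (\<lambda>y. ennreal (\<bar>\<kappa> (x - y)\<bar> * \<bar>A x y\<bar>))" for x
      using A(2) by (simp add: torus_periodic_def)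
  qed
  also have "\<dots> = (\<integral>\<^sup>+h. ennreal (\<bar>\<kappa> h\<bar> * (\<integral>x. \<bar>A x (x + h)\<bar> \<partial>torus)) \<partial>torus)"
  proof (rule nn_integral_cong)
    fix h
    have "(\<integral>\<^sup>+x. ennreal (\<bar>\<kappa> (x - (x + h))\<bar> * \<bar>A x (x + h)\<bar>) \<partial>torus) = (\<integral>\<^sup>+x. ennreal (\<bar>\<kappa> h\<bar> * \<bar>A x (x + h)\<bar>) \<partial>torus)"
      by (simp add: \<kappa>(3))
    also have "\<dots> = ennreal (\<integral>x. \<bar>\<kappa> h\<bar> * \<bar>A x (x + h)\<bar> \<partial>torus)"
      using i by (intro nn_integral_eq_integral) auto
    finally show "(\<integral>\<^sup>+x. ennreal (\<bar>\<kappa> (x - (x + h))\<bar> * \<bar>A x (x + h)\<bar>) \<partial>torus) = ennreal (\<bar>\<kappa> h\<bar> * (\<integral>x. \<bar>A x (x + h)\<bar> \<partial>torus))"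
      by simp
  qed
  also have "\<dots> \<le> (\<integral>\<^sup>+h. ennreal (\<bar>\<kappa> h\<bar> * M h) \<partial>torus)"
    by (intro nn_integral_mono ennreal_leI mult_left_mono M) auto
  also have "\<dots> = ennreal (\<integral>h. \<bar>\<kappa> h\<bar> * M h \<partial>torus)"
    using M0 by (intro nn_integral_eq_integral iM) auto
  finally show ?thesis
    using M0 by (subst (asm) ennreal_le_iff) (auto intro!: integral_nonneg_AE)
qed

text \<open>
  Three increments of orders \<open>a\<close>, \<open>b\<close>, \<open>c\<close> at distance \<open>n\<^bsup>-1/2\<^esup>\<close> against one
  derivative of the kernel: the flux tends to zero as soon as \<open>a + b + c\<close> exceeds one. The constant
  is 160 from the kernel, times three directions, times one half.
\<close>

lemma flux_bound:
  assumes W: "div_free W" "\<And>i. nikolskii a NW (W i)" and f: "nikolskii b Nf f" and g: "nikolskii c Ng g"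
    and abc: "a \<ge> 0" "b \<ge> 0" "c \<ge> 0" "a + b + c \<le> 3"
  shows "\<bar>flux (cos_kernel n) W f g\<bar> \<le> 240 * pi * real (Suc n) powr ((1 - (a + b + c)) / 2) * (NW * Nf * Ng)"
proof -
  have L: "L3 (W i)" "L3 f" "L3 g" for i using W f g by (auto simp: nikolskii_def)
  have N: "NW \<ge> 0" "Nf \<ge> 0" "Ng \<ge> 0" using W(2)[of 1] f g by (auto simp: nikolskii_def)
  note incr = flux_increments[OF cos_kernel(1,2) W(1) L(1) L(2,3)]
  let ?A = "\<lambda>i x y. (W i x - W i y) * (f x - f y) * (g x - g y)"
  let ?q = "(a + b + c) / 2"
  have one: "\<bar>\<integral>(x, y). trig (trig_partial i (cos_kernel n)) (x - y) * ?A i x y \<partial>(torus \<Otimes>\<^sub>M torus)\<bar>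
     \<le> NW * Nf * Ng * (160 * pi * real (Suc n) powr (1 / 2 - ?q))" for i
  proof -
    let ?d = "trig (trig_partial i (cos_kernel n))"
    have eq: "?A i x (x + h) = - ((W i (x + h) - W i x) * (f (x + h) - f x) * (g (x + h) - g x))" for x h
      by (simp add: algebra_simps)
    note inc = L3_increment[OF L(1)[of i]] L3_increment[OF L(2)] L3_increment[OF L(3)]
    note km = kernel_partial_moment[of ?q i n]
    have "\<bar>\<integral>(x, y). ?d (x - y) * ?A i x y \<partial>(torus \<Otimes>\<^sub>M torus)\<bar>
       \<le> (\<integral>h. \<bar>?d h\<bar> * (NW * Nf * Ng * torus_size h powr ?q) \<partial>torus)"
    proof (rule pair_bound)
      show "torus_periodic ?d" by (intro torus_periodic_trig) (simp add: cos_kernel)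
      show "\<bar>?d (- h)\<bar> = \<bar>?d h\<bar>" for h by (simp add: trig_partial_odd cos_kernel(2))
      have [measurable]: "W i \<in> borel_measurable borel" "f \<in> borel_measurable borel" "g \<in> borel_measurable borel"
        using L L3D by auto
      show "(\<lambda>(x, y). ?A i x y) \<in> borel_measurable (borel \<Otimes>\<^sub>M borel)" by measurable
      show "torus_periodic (\<lambda>y. ?A i x y)" for x
        using L[THEN L3D(2)] by (simp add: torus_periodic_def)
      show "integrable torus (\<lambda>x. ?A i x (x + h))" for h
        unfolding eq using L3_integrable_mult3[OF inc, of h h h] by simp
      show "(\<integral>x. \<bar>?A i x (x + h)\<bar> \<partial>torus) \<le> NW * Nf * Ng * torus_size h powr ?q" for h
      proof -
        have "(\<integral>x. \<bar>?A i x (x + h)\<bar> \<partial>torus)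
          \<le> (NW * torus_size h powr (a / 2)) * (Nf * torus_size h powr (b / 2)) * (Ng * torus_size h powr (c / 2))"
          unfolding eq abs_minus_cancel
          by (rule L3_trilinear[OF inc]) (use N W(2) f g abc nikolskii_torus_size in auto)
        also have "\<dots> = NW * Nf * Ng * torus_size h powr ?q"
          by (simp add: powr_add add_divide_distrib mult_ac)
        finally show ?thesis .
      qed
      show "integrable torus (\<lambda>h. \<bar>?d h\<bar> * (NW * Nf * Ng * torus_size h powr ?q))"
        using integrable_mult_right[of "NW * Nf * Ng", OF km(1)] abc by (simp add: mult_ac)
      show "integrable (torus \<Otimes>\<^sub>M torus) (\<lambda>(x, y). ?d (x - y) * ?A i x y)" by (rule incr(2))
    qed auto
    also have "\<dots> = NW * Nf * Ng * (\<integral>h. \<bar>?d h\<bar> * torus_size h powr ?q \<partial>torus)"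
      by (simp add: mult.left_commute)
    also have "\<dots> \<le> NW * Nf * Ng * (160 * pi * real (Suc n) powr (1 / 2 - ?q))"
      using abc N by (intro mult_left_mono km(2)) auto
    finally show ?thesis .
  qed
  have "\<bar>flux (cos_kernel n) W f g\<bar> = 1 / 2 * \<bar>\<Sum>i\<in>UNIV. \<integral>(x, y). trig (trig_partial i (cos_kernel n)) (x - y) * ?A i x y \<partial>(torus \<Otimes>\<^sub>M torus)\<bar>"
    unfolding incr(1) by (simp add: abs_mult)
  also have "\<dots> \<le> 1 / 2 * (\<Sum>i\<in>(UNIV::3 set). NW * Nf * Ng * (160 * pi * real (Suc n) powr (1 / 2 - ?q)))"
    by (intro mult_left_mono order_trans[OF sum_abs] sum_mono one) auto
  also have "\<dots> = 240 * pi * real (Suc n) powr (1 / 2 - ?q) * (NW * Nf * Ng)"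
    by simp
  finally show ?thesis by (simp add: diff_divide_distrib)
qed

section \<open>Approximation by convolution\<close>

lemma mollify_symmetric:
  assumes "integrable torus f" "integrable torus g"
  shows "(\<integral>x. f x * trig (mollify L g) x \<partial>torus) = (\<integral>x. trig (mollify L f) x * g x \<partial>torus)"
proof (induction L)
  case (Cons z L)
  obtain a k \<theta> where z: "z = (a, k, \<theta>)" by (cases z)
  have exp: "(\<integral>x. f x * trig (mollify (z # L) g) x \<partial>torus)
     = a * (\<integral>y. g y * wave k 0 y \<partial>torus) * (\<integral>x. f x * wave k 0 x \<partial>torus)
     + a * (\<integral>y. g y * wave k (- pi / 2) y \<partial>torus) * (\<integral>x. f x * wave k (- pi / 2) x \<partial>torus)
     + (\<integral>x. f x * trig (mollify L g) x \<partial>torus)" if "integrable torus f" for f g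
  proof -
    have "(\<integral>x. f x * trig (mollify (z # L) g) x \<partial>torus) = (\<integral>x. a * (\<integral>y. g y * wave k 0 y \<partial>torus) * (f x * wave k 0 x)
        + a * (\<integral>y. g y * wave k (- pi / 2) y \<partial>torus) * (f x * wave k (- pi / 2) x) + f x * trig (mollify L g) x \<partial>torus)"
      by (simp add: z algebra_simps)
    then show ?thesis
      using integrable_mult_wave[OF that] integrable_mult_trig[OF that] by (simp del: minus_divide_left)
  qed
  have "(\<integral>x. g x * trig (mollify L f) x \<partial>torus) = (\<integral>x. f x * trig (mollify L g) x \<partial>torus)"
    using Cons by (simp add: mult.commute)
  then have "(\<integral>x. f x * trig (mollify (z # L) g) x \<partial>torus) = (\<integral>x. g x * trig (mollify (z # L) f) x \<partial>torus)"
    unfolding exp[OF assms(1)] exp[OF assms(2)] by simp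
  then show ?case by (simp add: mult.commute)
qed simp

lemma integral_trig_shift:
  assumes "frequencies L \<subseteq> lattice" "phases L \<subseteq> {0}"
  shows "(\<integral>y. trig L (x - y) \<partial>torus) = (\<integral>y. trig L y \<partial>torus)"
proof -
  have "(\<integral>y. trig L (x - y) \<partial>torus) = (\<integral>y. trig L (y + (- x)) \<partial>torus)"
    using trig_even[OF assms(2), of "x - _"] by (simp add: minus_diff_eq)
  also have "\<dots> = (\<integral>y. trig L y \<partial>torus)"
    by (rule integral_torus_shift) (use assms in \<open>auto intro: torus_periodic_trig\<close>)
  finally show ?thesis .
qed

lemma integral_kernel_diff: "(\<integral>y. trig (cos_kernel n) (x - y) \<partial>torus) = 1"
  by (simp only: integral_trig_shift cos_kernel(1,2) integral_kernel)

lemma trig_mollify_one: "trig (mollify (cos_kernel n) (\<lambda>_. 1)) x = 1"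
  by (subst trig_mollify[OF _ cos_kernel(2)]) (auto simp: integral_kernel_diff)

lemma integral_mollify:
  "integrable torus f \<Longrightarrow> (\<integral>x. trig (mollify (cos_kernel n) f) x \<partial>torus) = (\<integral>x. f x \<partial>torus)"
  using mollify_symmetric[of f "\<lambda>_. 1" "cos_kernel n"] by (simp add: trig_mollify_one)

lemma mollify_jensen_cube:
  assumes "L3 f" shows "(\<integral>x. \<bar>trig (mollify (cos_kernel n) f) x\<bar> ^ 3 \<partial>torus) \<le> (\<integral>x. \<bar>f x\<bar> ^ 3 \<partial>torus)"
proof -
  let ?K = "cos_kernel n"
  have i: "integrable torus f" "integrable torus (\<lambda>x. \<bar>f x\<bar>)" "integrable torus (\<lambda>x. \<bar>f x\<bar> ^ 3)"
    using L3_integrable[OF assms] L3D[OF assms] by auto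
  have one: "integrable torus (\<lambda>_. 1::real)" by simp
  \<comment> \<open>Pointwise Jensen: integrate the tangent of the cube at the local mean \<open>m\<close>.\<close>
  have "\<bar>trig (mollify ?K f) x\<bar> ^ 3 \<le> trig (mollify ?K (\<lambda>x. \<bar>f x\<bar> ^ 3)) x" for x
  proof -
    define m where "m = (\<integral>y. trig ?K (x - y) * \<bar>f y\<bar> \<partial>torus)"
    note ik = integrable_mult_trig_diff[of _ ?K x]
    have m0: "m \<ge> 0" unfolding m_def by (intro integral_nonneg_AE AE_I2 mult_nonneg_nonneg kernel_nonneg) auto
    have "\<bar>trig (mollify ?K f) x\<bar> \<le> (\<integral>y. \<bar>trig ?K (x - y) * f y\<bar> \<partial>torus)"
      unfolding trig_mollify[OF i(1) cos_kernel(2)] by (rule integral_abs_bound)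
    also have "\<dots> = m" unfolding m_def by (simp add: abs_mult kernel_nonneg)
    finally have "\<bar>trig (mollify ?K f) x\<bar> ^ 3 \<le> m ^ 3" by (intro power_mono) auto
    also have "m ^ 3 = (\<integral>y. (m ^ 3 - 3 * m\<^sup>2 * m) * (trig ?K (x - y) * 1) + 3 * m\<^sup>2 * (trig ?K (x - y) * \<bar>f y\<bar>) \<partial>torus)"
      using ik[OF one] ik[OF i(2)] by (simp add: integral_kernel_diff m_def[symmetric])
    also have "\<dots> \<le> (\<integral>y. trig ?K (x - y) * \<bar>f y\<bar> ^ 3 \<partial>torus)"
    proof (rule integral_mono)
      show "integrable torus (\<lambda>y. (m ^ 3 - 3 * m\<^sup>2 * m) * (trig ?K (x - y) * 1) + 3 * m\<^sup>2 * (trig ?K (x - y) * \<bar>f y\<bar>))"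
        using ik[OF one] ik[OF i(2)] by simp
      show "integrable torus (\<lambda>y. trig ?K (x - y) * \<bar>f y\<bar> ^ 3)" by (rule ik[OF i(3)])
      fix y
      have "trig ?K (x - y) * (m ^ 3 + 3 * m\<^sup>2 * (\<bar>f y\<bar> - m)) \<le> trig ?K (x - y) * \<bar>f y\<bar> ^ 3"
        by (intro mult_left_mono cube_tangent kernel_nonneg m0) auto
      then show "(m ^ 3 - 3 * m\<^sup>2 * m) * (trig ?K (x - y) * 1) + 3 * m\<^sup>2 * (trig ?K (x - y) * \<bar>f y\<bar>) \<le> trig ?K (x - y) * \<bar>f y\<bar> ^ 3"
        by (simp add: algebra_simps)
    qed
    also have "\<dots> = trig (mollify ?K (\<lambda>x. \<bar>f x\<bar> ^ 3)) x" by (simp add: trig_mollify[OF i(3) cos_kernel(2)])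
    finally show ?thesis .
  qed
  then have "(\<integral>x. \<bar>trig (mollify ?K f) x\<bar> ^ 3 \<partial>torus) \<le> (\<integral>x. trig (mollify ?K (\<lambda>x. \<bar>f x\<bar> ^ 3)) x \<partial>torus)"
    by (intro integral_mono L3D(3) L3_trig integrable_trig) (auto simp: cos_kernel)
  also have "\<dots> = (\<integral>x. \<bar>f x\<bar> ^ 3 \<partial>torus)" by (rule integral_mollify[OF i(3)])
  finally show ?thesis .
qed

lemma mollify_jensen_square:
  assumes "L3 f" shows "(\<integral>x. (trig (mollify (cos_kernel n) f) x)\<^sup>2 \<partial>torus) \<le> (\<integral>x. (f x)\<^sup>2 \<partial>torus)"
proof -
  let ?K = "cos_kernel n"
  have i: "integrable torus f" "integrable torus (\<lambda>x. (f x)\<^sup>2)"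
    using L3_integrable[OF assms] L3_integrable_mult[OF assms assms] by (auto simp: power2_eq_square)
  have one: "integrable torus (\<lambda>_. 1::real)" by simp
  \<comment> \<open>The tangent of the square at the local mean lies below it by \<open>(f y - m)\<^sup>2 \<ge> 0\<close>.\<close>
  have "(trig (mollify ?K f) x)\<^sup>2 \<le> trig (mollify ?K (\<lambda>x. (f x)\<^sup>2)) x" for x
  proof -
    define m where "m = trig (mollify ?K f) x"
    have m: "m = (\<integral>y. trig ?K (x - y) * f y \<partial>torus)"
      unfolding m_def trig_mollify[OF i(1) cos_kernel(2)] ..
    note ik = integrable_mult_trig_diff[of _ ?K x]
    have "m\<^sup>2 = (\<integral>y. - m\<^sup>2 * (trig ?K (x - y) * 1) + 2 * m * (trig ?K (x - y) * f y) \<partial>torus)"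
      using ik[OF one] ik[OF i(1)] by (simp add: integral_kernel_diff m[symmetric] power2_eq_square)
    also have "\<dots> \<le> (\<integral>y. trig ?K (x - y) * (f y)\<^sup>2 \<partial>torus)"
    proof (rule integral_mono)
      show "integrable torus (\<lambda>y. - m\<^sup>2 * (trig ?K (x - y) * 1) + 2 * m * (trig ?K (x - y) * f y))"
        using ik[OF one] ik[OF i(1)] by simp
      show "integrable torus (\<lambda>y. trig ?K (x - y) * (f y)\<^sup>2)" by (rule ik[OF i(2)])
      fix y
      have "0 \<le> trig ?K (x - y) * (f y - m)\<^sup>2" by (intro mult_nonneg_nonneg kernel_nonneg) auto
      then show "- m\<^sup>2 * (trig ?K (x - y) * 1) + 2 * m * (trig ?K (x - y) * f y) \<le> trig ?K (x - y) * (f y)\<^sup>2"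
        by (simp add: power2_eq_square algebra_simps)
    qed
    also have "\<dots> = trig (mollify ?K (\<lambda>x. (f x)\<^sup>2)) x" by (simp add: trig_mollify[OF i(2) cos_kernel(2)])
    finally show ?thesis by (simp add: m_def)
  qed
  then have "(\<integral>x. (trig (mollify ?K f) x)\<^sup>2 \<partial>torus) \<le> (\<integral>x. trig (mollify ?K (\<lambda>x. (f x)\<^sup>2)) x \<partial>torus)"
    using L3_integrable_mult[OF L3_trig L3_trig, of "mollify ?K f" "mollify ?K f"]
    by (intro integral_mono integrable_trig) (auto simp: cos_kernel power2_eq_square)
  also have "\<dots> = (\<integral>x. (f x)\<^sup>2 \<partial>torus)" by (rule integral_mollify[OF i(2)])
  finally show ?thesis .
qed

lemma trig_mean_value:
  "\<exists>\<xi>. 0 < \<xi> \<and> \<xi> < 1 \<and> trig L (x + h) - trig L x = (\<Sum>j\<in>UNIV. h$j * trig (trig_partial j L) (x + \<xi> *\<^sub>R h))"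
  using MVT2[of 0 1 "\<lambda>t. trig L (x + t *\<^sub>R h)" "\<lambda>t. \<Sum>j\<in>UNIV. h$j * trig (trig_partial j L) (x + t *\<^sub>R h)"]
    trig_directional_derivative[of L x h] by auto

lemma trig_lipschitz:
  obtains C where "C \<ge> 0" "\<And>x h. \<bar>trig L (x + h) - trig L x\<bar> \<le> C * norm h"
proof -
  have "\<exists>C. \<forall>j x. C \<ge> 0 \<and> \<bar>trig (trig_partial j L) x\<bar> \<le> C"
  proof -
    have "\<forall>j. \<exists>C. C \<ge> 0 \<and> (\<forall>x. \<bar>trig (trig_partial j L) x\<bar> \<le> C)" using trig_bounded by metis
    then obtain C where C: "\<And>j. C j \<ge> 0" "\<And>j x. \<bar>trig (trig_partial j L) x\<bar> \<le> C j" by metis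
    have "C j \<le> (\<Sum>j\<in>UNIV. C j)" for j :: 3 using C(1) by (intro member_le_sum) auto
    then show ?thesis using C by (intro exI[of _ "\<Sum>j\<in>UNIV. C j"]) (meson order_trans)
  qed
  then obtain C where C: "C \<ge> 0" "\<And>j x. \<bar>trig (trig_partial j L) x\<bar> \<le> C" by blast
  show ?thesis
  proof
    show "3 * C \<ge> 0" using C by simp
    fix x h
    obtain \<xi> where "trig L (x + h) - trig L x = (\<Sum>j\<in>UNIV. h$j * trig (trig_partial j L) (x + \<xi> *\<^sub>R h))"
      using trig_mean_value[of L x h] by blast
    also have "\<bar>\<dots>\<bar> \<le> (\<Sum>j\<in>(UNIV :: 3 set). norm h * C)"
      by (intro order_trans[OF sum_abs] sum_mono) (auto simp: abs_mult intro!: mult_mono C component_le_norm_cart)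
    finally show "\<bar>trig L (x + h) - trig L x\<bar> \<le> 3 * C * norm h" by (simp add: mult_ac)
  qed
qed

lemma le_powr_min:
  fixes a b t \<sigma> :: real
  assumes "0 \<le> a" "0 \<le> b" "0 \<le> t" "0 \<le> \<sigma>" "\<sigma> \<le> 1" "x \<le> a * t" "x \<le> b" "t \<noteq> 0"
  shows "x \<le> (a + b) * t powr \<sigma>"
proof (cases "t \<le> 1")
  case True
  then have "t powr 1 \<le> t powr \<sigma>" using assms by (intro powr_mono') auto
  then have "a * t \<le> a * t powr \<sigma>" using assms by (intro mult_left_mono) auto
  moreover have "0 \<le> b * t powr \<sigma>" using assms by simp
  ultimately show ?thesis using assms(6) unfolding distrib_right by linarith
next
  case False
  then have "1 \<le> t powr \<sigma>" using assms by (intro ge_one_powr_ge_zero) auto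
  then have "b * 1 \<le> b * t powr \<sigma>" using assms by (intro mult_left_mono) auto
  moreover have "0 \<le> a * t powr \<sigma>" using assms by simp
  ultimately show ?thesis using assms(7) unfolding distrib_right by linarith
qed

text \<open>
  Needed to use \<open>f\<close> times a wave as a single test function in weak limits. The increment
  of the product is split by the Leibniz rule; a trigonometric polynomial is bounded and Lipschitz,
  hence Hoelder of every order up to one.
\<close>

lemma nikolskii_mult_trig:
  assumes f: "nikolskii \<sigma> N f" and s: "0 \<le> \<sigma>" "\<sigma> \<le> 1" and fr: "frequencies L \<subseteq> lattice"
  obtains N' where "nikolskii \<sigma> N' (\<lambda>x. f x * trig L x)"
proof -
  obtain C where C: "C \<ge> 0" "\<And>x. \<bar>trig L x\<bar> \<le> C" using trig_bounded by blast
  obtain C' where C': "C' \<ge> 0" "\<And>x h. \<bar>trig L (x + h) - trig L x\<bar> \<le> C' * norm h" using trig_lipschitz by blast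
  have L: "L3 f" and N: "N \<ge> 0" and fN: "(\<integral>x. \<bar>f x\<bar> ^ 3 \<partial>torus) \<le> N ^ 3"
    and fh: "\<And>h. (\<integral>x. \<bar>f (x + h) - f x\<bar> ^ 3 \<partial>torus) \<le> (N * norm h powr \<sigma>) ^ 3" using f by (auto simp: nikolskii_def)
  let ?T = "trig L"
  have pT: "torus_periodic ?T" using fr by (rule torus_periodic_trig)
  have mb: "L3 (\<lambda>x. F x * g x)" "(\<integral>x. \<bar>F x * g x\<bar> ^ 3 \<partial>torus) \<le> (X * D) ^ 3"
    if "L3 F" "g \<in> borel_measurable borel" "torus_periodic g" "\<And>x. \<bar>g x\<bar> \<le> D" "(\<integral>x. \<bar>F x\<bar> ^ 3 \<partial>torus) \<le> X ^ 3" for F g D X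
  proof -
    show l: "L3 (\<lambda>x. F x * g x)" by (rule L3_mult_bounded[OF that(1-4)])
    have D: "D \<ge> 0" using that(4)[of 0] by linarith
    have "(\<integral>x. \<bar>F x * g x\<bar> ^ 3 \<partial>torus) \<le> (\<integral>x. \<bar>F x\<bar> ^ 3 * D ^ 3 \<partial>torus)"
      using L3D(3)[OF l] L3D(3)[OF that(1)] that(4)
      by (intro integral_mono) (auto simp: abs_mult power_mult_distrib intro!: mult_left_mono power_mono)
    also have "\<dots> \<le> X ^ 3 * D ^ 3" using that(5) D by (simp add: mult_right_mono)
    finally show "(\<integral>x. \<bar>F x * g x\<bar> ^ 3 \<partial>torus) \<le> (X * D) ^ 3" by (simp add: power_mult_distrib)
  qed
  have "nikolskii \<sigma> (N * C + N * (C' + 2 * C)) (\<lambda>x. f x * ?T x)"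
    unfolding nikolskii_def
  proof (intro conjI allI)
    show "L3 (\<lambda>x. f x * ?T x)" by (rule mb(1)[OF L _ pT C(2) fN]) auto
    show "0 \<le> N * C + N * (C' + 2 * C)" using N C C' by simp
    have "(\<integral>x. \<bar>f x * ?T x\<bar> ^ 3 \<partial>torus) \<le> (N * C) ^ 3" by (rule mb(2)[OF L _ pT C(2) fN]) auto
    also have "\<dots> \<le> (N * C + N * (C' + 2 * C)) ^ 3" using N C C' by (intro power_mono) auto
    finally show "(\<integral>x. \<bar>f x * ?T x\<bar> ^ 3 \<partial>torus) \<le> (N * C + N * (C' + 2 * C)) ^ 3" .
    fix h
    show "(\<integral>x. \<bar>f (x + h) * ?T (x + h) - f x * ?T x\<bar> ^ 3 \<partial>torus) \<le> ((N * C + N * (C' + 2 * C)) * norm h powr \<sigma>) ^ 3"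
    proof (cases "h = 0")
      case False
      have Tm: "(\<lambda>x. ?T (x + h)) \<in> borel_measurable borel" by (rule borel_measurable_shift) auto
      have dm: "(\<lambda>x. ?T (x + h) - ?T x) \<in> borel_measurable borel" using Tm by measurable
      have dp: "torus_periodic (\<lambda>x. ?T (x + h) - ?T x)"
        using pT torus_periodic_shift[OF pT, of h] by (simp add: torus_periodic_def)
      have db: "\<bar>?T (x + h) - ?T x\<bar> \<le> (C' + 2 * C) * norm h powr \<sigma>" for x
      proof (rule le_powr_min)
        show "\<bar>?T (x + h) - ?T x\<bar> \<le> 2 * C" using C(2)[of "x + h"] C(2)[of x] by linarith
      qed (use C C' s False in auto)
      note 1 = mb[OF L3_increment[OF L, of h] Tm torus_periodic_shift[OF pT] C(2) fh]
      note 2 = mb[OF L dm dp db fN]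
      have "(\<integral>x. \<bar>(f (x + h) - f x) * ?T (x + h) + f x * (?T (x + h) - ?T x)\<bar> ^ 3 \<partial>torus)
         \<le> (N * norm h powr \<sigma> * C + N * ((C' + 2 * C) * norm h powr \<sigma>)) ^ 3"
        by (rule L3_minkowski[OF 1(1) 2(1) _ _ 1(2) 2(2)]) (use N C C' in auto)
      then show ?thesis by (simp add: algebra_simps)
    qed (simp)
  qed
  then show ?thesis using that by blast
qed

text \<open>
  A weak form of Hoelder's inequality between \<open>L\<^sup>2\<close> and \<open>L\<^sup>3\<close>. Being linear in the norm of
  \<open>d\<close>, it makes the pairing small when \<open>d\<close> is a small increment and \<open>u\<close> is fixed.
\<close>

lemma pairing_square_cube:
  assumes u: "u \<in> borel_measurable torus" "integrable torus (\<lambda>x. (u x)\<^sup>2)" and d: "L3 d"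
    and X: "X \<ge> 0" "(\<integral>x. \<bar>d x\<bar> ^ 3 \<partial>torus) \<le> X ^ 3"
  shows "integrable torus (\<lambda>x. u x * d x)" "(\<integral>x. \<bar>u x * d x\<bar> \<partial>torus) \<le> ((\<integral>x. (u x)\<^sup>2 \<partial>torus) + 2) * X"
proof -
  note d3 = L3D(3)[OF d]
  have le: "\<bar>u x * d x\<bar> \<le> Y * ((u x)\<^sup>2 + 1 + \<bar>d x\<bar> ^ 3 / Y ^ 3)" if Y: "Y > 0" for x Y
  proof -
    let ?t = "\<bar>d x\<bar> / Y"
    have "0 \<le> (\<bar>u x\<bar> - ?t)\<^sup>2" by simp
    then have "\<bar>u x\<bar> * ?t \<le> (u x)\<^sup>2 + ?t\<^sup>2"
      using zero_le_power2[of "u x"] zero_le_power2[of ?t] unfolding power2_diff power2_abs by linarith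
    moreover have "?t\<^sup>2 \<le> 1 + ?t ^ 3" using Y by (intro one_le_cube) auto
    ultimately have "Y * (\<bar>u x\<bar> * ?t) \<le> Y * ((u x)\<^sup>2 + 1 + ?t ^ 3)" using Y by (intro mult_left_mono) auto
    then show ?thesis using Y by (simp add: abs_mult power_divide)
  qed
  show i: "integrable torus (\<lambda>x. u x * d x)"
  proof (rule integrable_torus_dominated)
    show "integrable torus (\<lambda>x. 1 * ((u x)\<^sup>2 + 1 + \<bar>d x\<bar> ^ 3 / 1 ^ 3))" using u d3 by simp
    show "(\<lambda>x. u x * d x) \<in> borel_measurable torus" using u(1) L3D(4)[OF d] by measurable
    show "\<bar>u x * d x\<bar> \<le> 1 * ((u x)\<^sup>2 + 1 + \<bar>d x\<bar> ^ 3 / 1 ^ 3)" for x by (rule le) simp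
  qed
  have "(\<integral>x. \<bar>u x * d x\<bar> \<partial>torus) \<le> ((\<integral>x. (u x)\<^sup>2 \<partial>torus) + 2) * (X + e)" if e: "e > 0" for e
  proof -
    let ?Y = "X + e"
    have Y: "?Y > 0" using X e by simp
    have "(\<integral>x. \<bar>d x\<bar> ^ 3 \<partial>torus) \<le> ?Y ^ 3" using X e by (intro order_trans[OF X(2) power_mono]) auto
    then have 1: "(\<integral>x. \<bar>d x\<bar> ^ 3 \<partial>torus) / ?Y ^ 3 \<le> 1" using Y by simp
    have "(\<integral>x. \<bar>u x * d x\<bar> \<partial>torus) \<le> (\<integral>x. ?Y * ((u x)\<^sup>2 + 1 + \<bar>d x\<bar> ^ 3 / ?Y ^ 3) \<partial>torus)"
      using u i d3 by (intro integral_mono le Y) auto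
    also have "\<dots> = ?Y * ((\<integral>x. (u x)\<^sup>2 \<partial>torus) + 1 + (\<integral>x. \<bar>d x\<bar> ^ 3 \<partial>torus) / ?Y ^ 3)"
      using u d3 by simp
    also have "\<dots> \<le> ?Y * ((\<integral>x. (u x)\<^sup>2 \<partial>torus) + 1 + 1)"
      using 1 Y by (intro mult_left_mono add_left_mono) auto
    finally show ?thesis by (simp add: algebra_simps)
  qed
  moreover have "continuous_on UNIV (\<lambda>e. ((\<integral>x. (u x)\<^sup>2 \<partial>torus) + 2) * (X + e))" by (intro continuous_intros)
  ultimately have "(\<integral>x. \<bar>u x * d x\<bar> \<partial>torus) \<le> (\<lambda>e. ((\<integral>x. (u x)\<^sup>2 \<partial>torus) + 2) * (X + e)) 0"
    by (rule le_limit_at_right)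
  then show "(\<integral>x. \<bar>u x * d x\<bar> \<partial>torus) \<le> ((\<integral>x. (u x)\<^sup>2 \<partial>torus) + 2) * X" by simp
qed

lemma integrable_of_square:
  fixes u :: "real^3 \<Rightarrow> real"
  assumes "u \<in> borel_measurable torus" "integrable torus (\<lambda>x. (u x)\<^sup>2)"
  shows "integrable torus u"
  using pairing_square_cube(1)[OF assms L3_const[of 1], of 1] by simp

lemma powr_tendsto_0: "p < 0 \<Longrightarrow> (\<lambda>n. real (Suc n) powr p) \<longlonglongrightarrow> 0"
  by (intro tendsto_neg_powr filterlim_compose[OF filterlim_real_sequentially filterlim_Suc])

text \<open>
  Moving the convolution to \<open>G\<close> expresses the error through increments of \<open>G\<close>. Hence
  \<open>u\<close> is allowed to be merely square integrable.
\<close>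

lemma mollify_weak_limit:
  assumes u: "u \<in> borel_measurable borel" "torus_periodic u" "integrable torus (\<lambda>x. (u x)\<^sup>2)"
    and G: "nikolskii \<sigma> N G" and s: "0 < \<sigma>" "\<sigma> \<le> 1"
  shows "(\<lambda>m. \<integral>x. trig (mollify (cos_kernel m) u) x * G x \<partial>torus) \<longlonglongrightarrow> (\<integral>x. u x * G x \<partial>torus)"
proof -
  have ut: "u \<in> borel_measurable torus" by (rule borel_measurable_torus) fact
  have L: "L3 G" and N: "N \<ge> 0" using G by (auto simp: nikolskii_def)
  have ui: "integrable torus u" by (rule integrable_of_square[OF ut u(3)])
  have Gi: "integrable torus G" by (rule L3_integrable[OF L])
  have GN: "(\<integral>x. \<bar>G x\<bar> ^ 3 \<partial>torus) \<le> N ^ 3" using G by (auto simp: nikolskii_def)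
  have uG: "integrable torus (\<lambda>x. u x * G x)" by (rule pairing_square_cube(1)[OF ut u(3) L N GN])
  have one: "integrable torus (\<lambda>_. 1::real)" by simp
  let ?U = "(\<integral>x. (u x)\<^sup>2 \<partial>torus) + 2"
  have U0: "?U \<ge> 0" by (intro add_nonneg_nonneg integral_nonneg_AE) auto
  have bound: "\<bar>(\<integral>x. trig (mollify (cos_kernel m) u) x * G x \<partial>torus) - (\<integral>x. u x * G x \<partial>torus)\<bar>
     \<le> ?U * N * (10 * real (Suc m) powr (- (\<sigma> / 2)))" for m
  proof -
    let ?k = "trig (cos_kernel m)"
    let ?A = "\<lambda>x y. u x * (G y - G x)"
    note p1 = cross_partial_integrable[OF ui Gi, of "cos_kernel m"] and p2 = cross_partial_integrable[OF uG one, of "cos_kernel m"]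
    have ex: "(\<lambda>(x, y). ?k (x - y) * ?A x y) = (\<lambda>z. (case z of (x, y) \<Rightarrow> ?k (x - y) * (u x * G y)) - (case z of (x, y) \<Rightarrow> ?k (x - y) * (u x * G x * 1)))"
      by (auto simp: fun_eq_iff algebra_simps)
    have ip: "integrable (torus \<Otimes>\<^sub>M torus) (\<lambda>(x, y). ?k (x - y) * ?A x y)"
      unfolding ex using p1 p2 by (intro Bochner_Integration.integrable_diff) auto
    have "(\<integral>(x, y). ?k (x - y) * ?A x y \<partial>(torus \<Otimes>\<^sub>M torus)) = (\<integral>x. \<integral>y. ?k (x - y) * ?A x y \<partial>torus \<partial>torus)"
      using torus_pair.integral_fst'[OF ip] by simp
    also have "\<dots> = (\<integral>x. u x * trig (mollify (cos_kernel m) G) x - u x * G x \<partial>torus)"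
    proof (intro Bochner_Integration.integral_cong refl)
      fix x
      have "(\<integral>y. ?k (x - y) * ?A x y \<partial>torus) = (\<integral>y. u x * (?k (x - y) * G y) - u x * G x * (?k (x - y) * 1) \<partial>torus)"
        by (intro Bochner_Integration.integral_cong refl) (simp add: algebra_simps)
      also have "\<dots> = u x * trig (mollify (cos_kernel m) G) x - u x * G x"
        using integrable_mult_trig_diff[OF Gi, of "cos_kernel m" x] integrable_mult_trig_diff[OF one, of "cos_kernel m" x]
        by (simp add: trig_mollify[OF Gi cos_kernel(2)] integral_kernel_diff)
      finally show "(\<integral>y. ?k (x - y) * ?A x y \<partial>torus) = u x * trig (mollify (cos_kernel m) G) x - u x * G x" .
    qed
    also have "\<dots> = (\<integral>x. trig (mollify (cos_kernel m) u) x * G x \<partial>torus) - (\<integral>x. u x * G x \<partial>torus)"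
      using uG integrable_mult_trig[OF ui] by (simp add: mollify_symmetric[OF ui Gi])
    finally have "\<bar>(\<integral>x. trig (mollify (cos_kernel m) u) x * G x \<partial>torus) - (\<integral>x. u x * G x \<partial>torus)\<bar>
       = \<bar>\<integral>(x, y). ?k (x - y) * ?A x y \<partial>(torus \<Otimes>\<^sub>M torus)\<bar>" by simp
    also have "\<dots> \<le> (\<integral>h. \<bar>?k h\<bar> * (?U * (N * torus_size h powr (\<sigma> / 2))) \<partial>torus)"
    proof (rule pair_bound[OF _ _ _ _ _ _ _ _ ip])
      show "torus_periodic ?k" by (intro torus_periodic_trig cos_kernel)
      show "\<bar>?k (- h)\<bar> = \<bar>?k h\<bar>" for h by (simp add: trig_even cos_kernel(2))
      have [measurable]: "u \<in> borel_measurable borel" "G \<in> borel_measurable borel" using u L3D(1)[OF L] by auto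
      show "(\<lambda>(x, y). ?A x y) \<in> borel_measurable (borel \<Otimes>\<^sub>M borel)" by measurable
      show "torus_periodic (\<lambda>y. ?A x y)" for x
        using L3D(2)[OF L] by (simp add: torus_periodic_def)
      have "(\<integral>x. \<bar>G (x + h) - G x\<bar> ^ 3 \<partial>torus) \<le> (N * torus_size h powr (\<sigma> / 2)) ^ 3" for h
        using nikolskii_torus_size[OF G] s by auto
      note ps = pairing_square_cube[OF ut u(3) L3_increment[OF L] _ this]
      show "integrable torus (\<lambda>x. ?A x (x + h))" for h by (rule ps(1)) (use N in auto)
      show "(\<integral>x. \<bar>?A x (x + h)\<bar> \<partial>torus) \<le> ?U * (N * torus_size h powr (\<sigma> / 2))" for h
        by (rule ps(2)) (use N in auto)
      show "integrable torus (\<lambda>h. \<bar>?k h\<bar> * (?U * (N * torus_size h powr (\<sigma> / 2))))"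
        using integrable_mult_right[of "?U * N", OF kernel_moment(1)[of "\<sigma> / 2" m]] s
        by (simp add: mult_ac kernel_nonneg)
    qed auto
    also have "\<dots> = ?U * N * (\<integral>h. ?k h * torus_size h powr (\<sigma> / 2) \<partial>torus)"
      by (subst integral_mult_right_zero[symmetric]) (simp add: mult_ac kernel_nonneg)
    also have "\<dots> \<le> ?U * N * (10 * real (Suc m) powr (- (\<sigma> / 2)))"
      using s N U0 by (intro mult_left_mono kernel_moment(2)) auto
    finally show ?thesis .
  qed
  have "- (\<sigma> / 2) < 0" using s by simp
  from powr_tendsto_0[OF this]
  have "(\<lambda>m. ?U * N * (10 * real (Suc m) powr (- (\<sigma> / 2)))) \<longlonglongrightarrow> ?U * N * (10 * 0)"
    by (intro tendsto_mult tendsto_const)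
  then have g0: "(\<lambda>m. ?U * N * (10 * real (Suc m) powr (- (\<sigma> / 2)))) \<longlonglongrightarrow> 0" by simp
  have "(\<lambda>m. (\<integral>x. trig (mollify (cos_kernel m) u) x * G x \<partial>torus) - (\<integral>x. u x * G x \<partial>torus)) \<longlonglongrightarrow> 0"
    using bound unfolding real_norm_def[symmetric]
    by (intro Lim_null_comparison[OF _ g0] always_eventually allI)
  then show ?thesis by (simp add: LIM_zero_iff)
qed

section \<open>Helmholtz filter\<close>

definition trig_smult :: "real \<Rightarrow> waves \<Rightarrow> waves" where
  "trig_smult c L = map (\<lambda>(a, k, \<theta>). (c * a, k, \<theta>)) L"

lemma trig_smult [simp]: "trig (trig_smult c L) x = c * trig L x"
  by (induction L) (auto simp: trig_smult_def algebra_simps)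

lemma frequencies_smult [simp]: "frequencies (trig_smult c L) = frequencies L"
  by (induction L) (auto simp: trig_smult_def)

lemma trig_smult_append [simp]: "trig_smult c (L @ M) = trig_smult c L @ trig_smult c M"
  by (simp add: trig_smult_def)

lemma trig_partial_commute: "trig_partial i (trig_partial j L) = trig_partial j (trig_partial i L)"
  by (induction L) (auto simp: algebra_simps)

lemma DERIV_mult_abs: "((\<lambda>y. y * \<bar>y\<bar>) has_real_derivative 2 * \<bar>y\<bar>) (at y)" for y :: real
proof -
  consider "y > 0" | "y < 0" | "y = 0" by linarith
  then show ?thesis
  proof cases
    case 1
    have "((\<lambda>y. y * y) has_real_derivative 2 * \<bar>y\<bar>) (at y)"
      using 1 by (auto intro!: derivative_eq_intros)
    then show ?thesis
      by (rule has_field_derivative_transform_within_open[where S = "{0<..}"]) (use 1 in auto)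
  next
    case 2
    have "((\<lambda>y. - (y * y)) has_real_derivative 2 * \<bar>y\<bar>) (at y)"
      using 2 by (auto intro!: derivative_eq_intros)
    then show ?thesis
      by (rule has_field_derivative_transform_within_open[where S = "{..<0}"]) (use 2 in auto)
  next
    case 3
    have "((\<lambda>h. \<bar>h\<bar>) \<longlongrightarrow> 0) (at (0::real))" by (auto intro!: tendsto_eq_intros)
    then have "((\<lambda>h. (h * \<bar>h\<bar> - 0) / (h - 0)) \<longlongrightarrow> 0) (at (0::real))"
      by (rule Lim_transform_eventually) (auto simp: eventually_at_filter)
    then show ?thesis by (simp add: 3 has_field_derivative_iff)
  qed
qed

lemma integrable_torus_continuous:
  fixes f :: "real^3 \<Rightarrow> real"
  assumes "continuous_on UNIV f" shows "integrable torus f"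
  unfolding integrable_torus set_integrable_def scaleR_conv_of_real
  using borel_integrable_compact[of cell f] assms
  by (auto simp: indicator_times_eq_if intro: continuous_on_subset)

text \<open>
  Integration by parts against a nonlinear function of a trigonometric polynomial.
\<close>

lemma trig_partial_derivative_mult:
  assumes D: "\<And>y. ((g :: real \<Rightarrow> real) has_real_derivative g' y) (at y)"
    and fr: "frequencies L \<subseteq> lattice" "frequencies M \<subseteq> lattice" and c: "continuous_on UNIV g'"
  shows "(\<integral>x. trig (trig_partial j L) x * g (trig M x) \<partial>torus)
    = - (\<integral>x. trig L x * (g' (trig M x) * trig (trig_partial j M) x) \<partial>torus)"
proof -
  have cg: "continuous_on UNIV g"
    using D by (meson DERIV_continuous_on has_field_derivative_at_within)
  have cont: "continuous_on UNIV (\<lambda>x. g (trig M x))" "continuous_on UNIV (\<lambda>x. g' (trig M x))"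
    by (rule continuous_on_compose2[OF cg] continuous_on_compose2[OF c]; auto intro: continuous_trig)+
  have i1: "integrable torus (\<lambda>x. trig (trig_partial j L) x * g (trig M x))"
    by (intro integrable_torus_continuous continuous_intros cont)
  have i2: "integrable torus (\<lambda>x. trig L x * (g' (trig M x) * trig (trig_partial j M) x))"
    by (intro integrable_torus_continuous continuous_intros cont)
  note p = torus_periodic_trig[OF fr(1)] torus_periodic_trig[OF fr(2)]
    torus_periodic_trig[of "trig_partial j L"] torus_periodic_trig[of "trig_partial j M"]
  have "(\<integral>x. trig (trig_partial j L) x * g (trig M x) + trig L x * (g' (trig M x) * trig (trig_partial j M) x) \<partial>torus) = 0"
  proof (rule integral_torus_derivative[where \<phi> = "\<lambda>x. trig L x * g (trig M x)" and j = j])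
    show "torus_periodic (\<lambda>x. trig L x * g (trig M x))"
      "torus_periodic (\<lambda>x. trig (trig_partial j L) x * g (trig M x) + trig L x * (g' (trig M x) * trig (trig_partial j M) x))"
      using p fr by (simp_all add: torus_periodic_def)
    show "continuous_on UNIV (\<lambda>x. trig L x * g (trig M x))"
      "continuous_on UNIV (\<lambda>x. trig (trig_partial j L) x * g (trig M x) + trig L x * (g' (trig M x) * trig (trig_partial j M) x))"
      by (intro continuous_intros cont)+
    fix x
    have "((\<lambda>t. g (trig M (x + t *\<^sub>R axis j 1))) has_real_derivative g' (trig M x) * trig (trig_partial j M) x) (at 0)"
    proof -
      have "(g has_real_derivative g' (trig M x)) (at (trig M (x + 0 *\<^sub>R axis j 1)))" using D by simp
      from DERIV_chain2[OF this trig_partial_derivative] show ?thesis .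
    qed
    from DERIV_mult[OF trig_partial_derivative[of L x j] this]
    show "((\<lambda>t. trig L (x + t *\<^sub>R axis j 1) * g (trig M (x + t *\<^sub>R axis j 1))) has_real_derivative
       trig (trig_partial j L) x * g (trig M x) + trig L x * (g' (trig M x) * trig (trig_partial j M) x)) (at 0)"
      by (simp add: algebra_simps)
  qed
  then show ?thesis using i1 i2 by simp
qed

text \<open>
  Here \<open>V\<close> is \<open>M - \<alpha>\<^sup>2 \<Delta>M\<close>. Pairing with \<open>M\<close> and with \<open>\<bar>M\<bar> M\<close> makes the
  Laplacian contribute with a good sign, which gives the bounds on \<open>M\<close>. For the bound on the
  derivative \<open>W\<close> the differentiated equation is paired with \<open>\<bar>W\<bar> W\<close>, the derivative is moved off
  \<open>V\<close>, and the term \<open>\<bar>W\<bar> \<bar>\<partial>W\<bar>\<^sup>2\<close> is absorbed on the left.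
\<close>

lemma trig_helmholtz_estimates:
  assumes fr: "frequencies M \<subseteq> lattice" and \<alpha>: "\<alpha> > 0"
    and V: "V = M @ trig_smult (- \<alpha>\<^sup>2)
       (trig_partial 1 (trig_partial 1 M) @ trig_partial 2 (trig_partial 2 M) @ trig_partial 3 (trig_partial 3 M))"
  shows "(\<integral>x. (trig M x)\<^sup>2 \<partial>torus) \<le> (\<integral>x. (trig V x)\<^sup>2 \<partial>torus)"
    "(\<integral>x. \<bar>trig M x\<bar> ^ 3 \<partial>torus) \<le> (\<integral>x. \<bar>trig V x\<bar> ^ 3 \<partial>torus)"
    "(\<integral>x. \<bar>trig (trig_partial k M) x\<bar> ^ 3 \<partial>torus) \<le> (1 / \<alpha>) ^ 3 * (\<integral>x. \<bar>trig V x\<bar> ^ 3 \<partial>torus)"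
proof -
  have frV: "frequencies V \<subseteq> lattice" using fr by (simp add: V)
  have tV: "trig V x = trig M x - \<alpha>\<^sup>2 * (\<Sum>j\<in>UNIV. trig (trig_partial j (trig_partial j M)) x)" for x
    by (simp add: V trig_smult sum_3 algebra_simps)
  have pV: "trig (trig_partial k V) x = trig (trig_partial k M) x - \<alpha>\<^sup>2 * (\<Sum>j\<in>UNIV. trig (trig_partial j (trig_partial j (trig_partial k M))) x)" for x
  proof -
    have m: "trig_partial k (trig_smult c L) = trig_smult c (trig_partial k L)" for L c
      by (induction L) (auto simp: trig_smult_def)
    have "trig (trig_partial k V) x = trig (trig_partial k M) x - \<alpha>\<^sup>2 * (\<Sum>j\<in>UNIV. trig (trig_partial k (trig_partial j (trig_partial j M))) x)"
      by (simp add: V m trig_smult sum_3 algebra_simps)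
    moreover have "trig_partial k (trig_partial j (trig_partial j M)) = trig_partial j (trig_partial j (trig_partial k M))" for j
      by (metis trig_partial_commute)
    ultimately show ?thesis by simp
  qed
  note ic = integrable_torus_continuous
  note ci = continuous_intros
  have id: "((\<lambda>y. y) has_real_derivative 1) (at y)" for y :: real by simp
  show "(\<integral>x. (trig M x)\<^sup>2 \<partial>torus) \<le> (\<integral>x. (trig V x)\<^sup>2 \<partial>torus)"
  proof -
    have p: "(\<integral>x. trig (trig_partial j (trig_partial j M)) x * trig M x \<partial>torus) = - (\<integral>x. (trig (trig_partial j M) x)\<^sup>2 \<partial>torus)" for j
      using trig_partial_derivative_mult[OF id, of "trig_partial j M" M j] fr by (simp add: power2_eq_square)
    have i: "integrable torus (\<lambda>x. trig (trig_partial j (trig_partial j M)) x * trig M x)" for j by (intro ic ci)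
    have "(\<integral>x. trig V x * trig M x \<partial>torus) = (\<integral>x. (trig M x)\<^sup>2 - \<alpha>\<^sup>2 * (\<Sum>j\<in>UNIV. trig (trig_partial j (trig_partial j M)) x * trig M x) \<partial>torus)"
      by (simp add: tV algebra_simps power2_eq_square sum_distrib_left sum_distrib_right)
    also have "\<dots> = (\<integral>x. (trig M x)\<^sup>2 \<partial>torus) + \<alpha>\<^sup>2 * (\<Sum>j\<in>UNIV. \<integral>x. (trig (trig_partial j M) x)\<^sup>2 \<partial>torus)"
      using i ic[of "\<lambda>x. (trig M x)\<^sup>2"] by (simp add: p sum_negf ci)
    finally have "(\<integral>x. (trig M x)\<^sup>2 \<partial>torus) \<le> (\<integral>x. trig V x * trig M x \<partial>torus)"
      by (auto intro!: mult_nonneg_nonneg sum_nonneg integral_nonneg_AE)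
    also have "\<dots> \<le> (\<integral>x. 1 / 2 * (trig V x)\<^sup>2 + 1 / 2 * (trig M x)\<^sup>2 \<partial>torus)"
    proof (rule integral_mono)
      show "trig V x * trig M x \<le> 1 / 2 * (trig V x)\<^sup>2 + 1 / 2 * (trig M x)\<^sup>2" for x
        using zero_le_power2[of "trig V x - trig M x"] by (simp add: power2_diff)
    qed (intro ic ci)+
    also have "\<dots> = 1 / 2 * (\<integral>x. (trig V x)\<^sup>2 \<partial>torus) + 1 / 2 * (\<integral>x. (trig M x)\<^sup>2 \<partial>torus)"
      using ic[of "\<lambda>x. (trig M x)\<^sup>2"] ic[of "\<lambda>x. (trig V x)\<^sup>2"] by (simp add: ci)
    finally show ?thesis by simp
  qed
  have ca: "continuous_on UNIV (\<lambda>y::real. 2 * \<bar>y\<bar>)" by (intro ci)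
  have p: "(\<integral>x. trig (trig_partial j (trig_partial j W)) x * (trig W x * \<bar>trig W x\<bar>) \<partial>torus)
      = - 2 * (\<integral>x. \<bar>trig W x\<bar> * (trig (trig_partial j W) x)\<^sup>2 \<partial>torus)" if "frequencies W \<subseteq> lattice" for j W
    using trig_partial_derivative_mult[OF DERIV_mult_abs _ that ca, of "trig_partial j W" j] that by (simp add: power2_eq_square mult_ac)
  have i: "integrable torus (\<lambda>x. trig (trig_partial j (trig_partial j W)) x * (trig W x * \<bar>trig W x\<bar>))" for j W by (intro ic ci)
  have i3: "integrable torus (\<lambda>x. \<bar>trig W x\<bar> ^ 3)" for W by (intro ic ci)
  have cube: "t * (t * \<bar>t\<bar>) = \<bar>t\<bar> ^ 3" for t :: real by (cases "t \<ge> 0") (simp_all add: power3_eq_cube)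
  have energy: "(\<integral>x. F x * (trig W x * \<bar>trig W x\<bar>) \<partial>torus) = (\<integral>x. \<bar>trig W x\<bar> ^ 3 \<partial>torus)
      + 2 * \<alpha>\<^sup>2 * (\<Sum>j\<in>UNIV. \<integral>x. \<bar>trig W x\<bar> * (trig (trig_partial j W) x)\<^sup>2 \<partial>torus)"
    if W: "frequencies W \<subseteq> lattice" and F: "\<And>x. F x = trig W x - \<alpha>\<^sup>2 * (\<Sum>j\<in>UNIV. trig (trig_partial j (trig_partial j W)) x)" for F W
  proof -
    have "(\<integral>x. F x * (trig W x * \<bar>trig W x\<bar>) \<partial>torus) = (\<integral>x. \<bar>trig W x\<bar> ^ 3 - \<alpha>\<^sup>2 * (\<Sum>j\<in>UNIV. trig (trig_partial j (trig_partial j W)) x * (trig W x * \<bar>trig W x\<bar>)) \<partial>torus)"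
      by (simp add: F left_diff_distrib cube mult.assoc sum_distrib_right)
    also have "\<dots> = (\<integral>x. \<bar>trig W x\<bar> ^ 3 \<partial>torus) - \<alpha>\<^sup>2 * (\<Sum>j\<in>UNIV. - 2 * (\<integral>x. \<bar>trig W x\<bar> * (trig (trig_partial j W) x)\<^sup>2 \<partial>torus))"
      using i i3 by (simp add: p[OF W])
    finally show ?thesis by (simp add: sum_negf sum_distrib_left[symmetric])
  qed
  have nn: "0 \<le> (\<Sum>j\<in>UNIV. \<integral>x. \<bar>trig W x\<bar> * (trig (trig_partial j W) x)\<^sup>2 \<partial>torus)" for W
    by (intro sum_nonneg integral_nonneg_AE) auto
  show "(\<integral>x. \<bar>trig M x\<bar> ^ 3 \<partial>torus) \<le> (\<integral>x. \<bar>trig V x\<bar> ^ 3 \<partial>torus)"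
  proof -
    have "(\<integral>x. \<bar>trig M x\<bar> ^ 3 \<partial>torus) \<le> (\<integral>x. trig V x * (trig M x * \<bar>trig M x\<bar>) \<partial>torus)"
      unfolding energy[OF fr tV] using nn[of M] by simp
    also have "\<dots> \<le> (\<integral>x. 1 / 3 * \<bar>trig V x\<bar> ^ 3 + 2 / 3 * \<bar>trig M x\<bar> ^ 3 \<partial>torus)"
    proof (rule integral_mono)
      show "trig V x * (trig M x * \<bar>trig M x\<bar>) \<le> 1 / 3 * \<bar>trig V x\<bar> ^ 3 + 2 / 3 * \<bar>trig M x\<bar> ^ 3" for x
      proof -
        have "trig V x * (trig M x * \<bar>trig M x\<bar>) \<le> \<bar>trig V x\<bar> * \<bar>trig M x\<bar> * \<bar>trig M x\<bar>"
          using abs_ge_self[of "trig V x * (trig M x * \<bar>trig M x\<bar>)"] by (simp only: abs_mult abs_idempotent mult.assoc)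
        also have "\<dots> \<le> (\<bar>trig V x\<bar> ^ 3 + \<bar>trig M x\<bar> ^ 3 + \<bar>trig M x\<bar> ^ 3) / 3"
          by (rule cube_mean) auto
        also have "\<dots> = 1 / 3 * \<bar>trig V x\<bar> ^ 3 + 2 / 3 * \<bar>trig M x\<bar> ^ 3" by simp
        finally show ?thesis .
      qed
    qed (intro ic ci)+
    also have "\<dots> = 1 / 3 * (\<integral>x. \<bar>trig V x\<bar> ^ 3 \<partial>torus) + 2 / 3 * (\<integral>x. \<bar>trig M x\<bar> ^ 3 \<partial>torus)"
      using i3 by simp
    finally show ?thesis by simp
  qed
  show "(\<integral>x. \<bar>trig (trig_partial k M) x\<bar> ^ 3 \<partial>torus) \<le> (1 / \<alpha>) ^ 3 * (\<integral>x. \<bar>trig V x\<bar> ^ 3 \<partial>torus)"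
  proof -
    let ?W = "trig_partial k M"
    have W: "frequencies ?W \<subseteq> lattice" using fr by simp
    let ?D = "\<lambda>j. \<integral>x. \<bar>trig ?W x\<bar> * (trig (trig_partial j ?W) x)\<^sup>2 \<partial>torus"
    have "(\<integral>x. \<bar>trig ?W x\<bar> ^ 3 \<partial>torus) + 2 * \<alpha>\<^sup>2 * ?D k \<le> (\<integral>x. \<bar>trig ?W x\<bar> ^ 3 \<partial>torus) + 2 * \<alpha>\<^sup>2 * (\<Sum>j\<in>UNIV. ?D j)"
      by (intro add_left_mono mult_left_mono member_le_sum integral_nonneg_AE) auto
    also have "\<dots> = (\<integral>x. trig (trig_partial k V) x * (trig ?W x * \<bar>trig ?W x\<bar>) \<partial>torus)"
      using energy[OF W pV] by simp
    also have "\<dots> = - (\<integral>x. trig V x * (2 * \<bar>trig ?W x\<bar> * trig (trig_partial k ?W) x) \<partial>torus)"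
      using trig_partial_derivative_mult[OF DERIV_mult_abs frV W ca, of k] by simp
    also have "\<dots> = (\<integral>x. - (trig V x * (2 * \<bar>trig ?W x\<bar> * trig (trig_partial k ?W) x)) \<partial>torus)" by simp
    also have "\<dots> \<le> (\<integral>x. 2 * \<alpha>\<^sup>2 * (\<bar>trig ?W x\<bar> * (trig (trig_partial k ?W) x)\<^sup>2) + (2 / 3 * ((1 / \<alpha>) ^ 3 * \<bar>trig V x\<bar> ^ 3) + 1 / 3 * \<bar>trig ?W x\<bar> ^ 3) \<partial>torus)"
    proof (rule integral_mono)
      fix x
      let ?w = "\<bar>trig ?W x\<bar>" and ?v = "trig V x" and ?d = "trig (trig_partial k ?W) x"
      have "- (?v * ?d) * 2 \<le> 2 * (\<alpha> * ?d)\<^sup>2 + (1 / \<alpha> * ?v)\<^sup>2"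
      proof -
        have "0 \<le> (1 / \<alpha> * ?v + \<alpha> * ?d)\<^sup>2" "0 \<le> (\<alpha> * ?d)\<^sup>2" by simp_all
        moreover have "(1 / \<alpha> * ?v) * (\<alpha> * ?d) = ?v * ?d" using \<alpha> by simp
        ultimately show ?thesis unfolding power2_sum by linarith
      qed
      then have "?w * (- (?v * ?d) * 2) \<le> ?w * (2 * (\<alpha> * ?d)\<^sup>2 + (1 / \<alpha> * ?v)\<^sup>2)" by (intro mult_left_mono) auto
      moreover have "?w * (1 / \<alpha> * ?v)\<^sup>2 \<le> 2 / 3 * ((1 / \<alpha>) ^ 3 * \<bar>?v\<bar> ^ 3) + 1 / 3 * ?w ^ 3"
      proof -
        have "(1 / \<alpha> * \<bar>?v\<bar>) * (1 / \<alpha> * \<bar>?v\<bar>) * ?w \<le> ((1 / \<alpha> * \<bar>?v\<bar>) ^ 3 + (1 / \<alpha> * \<bar>?v\<bar>) ^ 3 + ?w ^ 3) / 3"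
          using \<alpha> by (intro cube_mean) auto
        moreover have "?w * (1 / \<alpha> * ?v)\<^sup>2 = (1 / \<alpha> * \<bar>?v\<bar>) * (1 / \<alpha> * \<bar>?v\<bar>) * ?w" by (simp add: power2_eq_square)
        moreover have "(1 / \<alpha> * \<bar>?v\<bar>) ^ 3 = (1 / \<alpha>) ^ 3 * \<bar>?v\<bar> ^ 3" by (rule power_mult_distrib)
        ultimately have "?w * (1 / \<alpha> * ?v)\<^sup>2 \<le> ((1 / \<alpha>) ^ 3 * \<bar>?v\<bar> ^ 3 + (1 / \<alpha>) ^ 3 * \<bar>?v\<bar> ^ 3 + ?w ^ 3) / 3" by (simp only:)
        also have "\<dots> = 2 / 3 * ((1 / \<alpha>) ^ 3 * \<bar>?v\<bar> ^ 3) + 1 / 3 * ?w ^ 3" by simp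
        finally show ?thesis .
      qed
      moreover have "- (?v * (2 * ?w * ?d)) = ?w * (- (?v * ?d) * 2)" "?w * (2 * (\<alpha> * ?d)\<^sup>2 + (1 / \<alpha> * ?v)\<^sup>2) = 2 * \<alpha>\<^sup>2 * (?w * ?d\<^sup>2) + ?w * (1 / \<alpha> * ?v)\<^sup>2"
        by (simp_all add: algebra_simps power_mult_distrib)
      ultimately show "- (?v * (2 * ?w * ?d)) \<le> 2 * \<alpha>\<^sup>2 * (?w * ?d\<^sup>2) + (2 / 3 * ((1 / \<alpha>) ^ 3 * \<bar>?v\<bar> ^ 3) + 1 / 3 * ?w ^ 3)"
        by linarith
    qed (intro ic ci)+
    also have "\<dots> = 2 * \<alpha>\<^sup>2 * ?D k + (2 / 3 * ((1 / \<alpha>) ^ 3 * (\<integral>x. \<bar>trig V x\<bar> ^ 3 \<partial>torus)) + 1 / 3 * (\<integral>x. \<bar>trig ?W x\<bar> ^ 3 \<partial>torus))"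
    proof -
      have "integrable torus (\<lambda>x. \<bar>trig ?W x\<bar> * (trig (trig_partial k ?W) x)\<^sup>2)" by (intro ic ci)
      then show ?thesis using i3 by simp
    qed
    finally show ?thesis by simp
  qed
qed

lemma LIMSEQ_le_const2_all: "X \<longlonglongrightarrow> l \<Longrightarrow> (\<And>n. X n \<le> c) \<Longrightarrow> l \<le> c" for l c :: real
  by (auto intro: LIMSEQ_le_const2)

text \<open>
  The Helmholtz equation on the level of Fourier modes.
\<close>

definition helmholtz_waves :: "real \<Rightarrow> (real^3 \<Rightarrow> real) \<Rightarrow> (real^3 \<Rightarrow> real) \<Rightarrow> bool" where
  "helmholtz_waves \<alpha> u v \<longleftrightarrow> (\<forall>k\<in>lattice. \<forall>\<theta>.
     (1 + \<alpha>\<^sup>2 * (2 * pi)\<^sup>2 * (k \<bullet> k)) * (\<integral>x. u x * wave k \<theta> x \<partial>torus) = (\<integral>x. v x * wave k \<theta> x \<partial>torus))"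

text \<open>
  Convolution acts on each mode separately and so commutes with the Helmholtz operator.
\<close>

lemma helmholtz_mollify:
  assumes h: "helmholtz_waves \<alpha> u v" and L: "frequencies L \<subseteq> lattice"
    and M: "M = mollify L u"
  shows "trig (M @ trig_smult (- \<alpha>\<^sup>2)
       (trig_partial 1 (trig_partial 1 M) @ trig_partial 2 (trig_partial 2 M) @ trig_partial 3 (trig_partial 3 M))) x
    = trig (mollify L v) x"
proof -
  have pp: "trig (trig_partial j (trig_partial j ((a, k, \<theta>) # N))) x
     = - ((2 * pi)\<^sup>2 * (k$j)\<^sup>2) * (a * wave k \<theta> x) + trig (trig_partial j (trig_partial j N)) x" for a k \<theta> N j
  proof -
    have "wave k (\<theta> + pi / 2 + pi / 2) x = - wave k \<theta> x"
      using wave_pi[of k \<theta> x] by (simp add: add.assoc)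
    then show ?thesis by (simp add: power2_eq_square)
  qed
  have kk: "k \<bullet> k = (k$1)\<^sup>2 + (k$2)\<^sup>2 + (k$3)\<^sup>2" for k :: "real^3"
    by (simp add: inner_vec_def sum_3 power2_eq_square)
  have "trig M x - \<alpha>\<^sup>2 * (trig (trig_partial 1 (trig_partial 1 M)) x + trig (trig_partial 2 (trig_partial 2 M)) x + trig (trig_partial 3 (trig_partial 3 M)) x)
     = trig (mollify L v) x"
    using L unfolding M
  proof (induction L)
    case (Cons z L)
    obtain a k \<theta> where z: "z = (a, k, \<theta>)" by (cases z)
    with Cons have k: "k \<in> lattice" by auto
    let ?u = "\<lambda>\<theta>. \<integral>x. u x * wave k \<theta> x \<partial>torus" and ?v = "\<lambda>\<theta>. \<integral>x. v x * wave k \<theta> x \<partial>torus"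
    have "?v \<theta> = (1 + \<alpha>\<^sup>2 * (2 * pi)\<^sup>2 * ((k$1)\<^sup>2 + (k$2)\<^sup>2 + (k$3)\<^sup>2)) * ?u \<theta>" for \<theta>
      using h k by (simp add: helmholtz_waves_def kk)
    note v = this[of 0] this[of "- pi / 2"]
    have IH: "trig (mollify L v) x = trig (mollify L u) x - \<alpha>\<^sup>2 * (trig (trig_partial 1 (trig_partial 1 (mollify L u))) x
       + trig (trig_partial 2 (trig_partial 2 (mollify L u))) x + trig (trig_partial 3 (trig_partial 3 (mollify L u))) x)"
    proof (rule Cons.IH[symmetric])
      show "frequencies L \<subseteq> lattice" using Cons.prems z by simp
    qed
    show ?case unfolding z mollify_simps pp trig_simps v IH
      by (simp add: algebra_simps)
  qed simp
  then show ?thesis by (simp add: trig_smult algebra_simps)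
qed

lemma L3_increment_iterate:
  assumes f: "L3 f" and z: "(\<integral>x. \<bar>f (x + z) - f x\<bar> ^ 3 \<partial>torus) \<le> X ^ 3" "X \<ge> 0"
  shows "(\<integral>x. \<bar>f (x + real m *\<^sub>R z) - f x\<bar> ^ 3 \<partial>torus) \<le> (real m * X) ^ 3"
proof (induction m)
  case (Suc m)
  note d = L3_increment[OF f, of "real m *\<^sub>R z"]
  have "(\<integral>x. \<bar>f ((x + z) + real m *\<^sub>R z) - f (x + z)\<bar> ^ 3 \<partial>torus) = (\<integral>x. \<bar>f (x + real m *\<^sub>R z) - f x\<bar> ^ 3 \<partial>torus)"
    by (rule integral_torus_shift[where f = "\<lambda>x. \<bar>f (x + real m *\<^sub>R z) - f x\<bar> ^ 3"])
       (use L3D[OF d] in \<open>auto simp: torus_periodic_def\<close>)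
  with Suc have 1: "(\<integral>x. \<bar>f ((x + z) + real m *\<^sub>R z) - f (x + z)\<bar> ^ 3 \<partial>torus) \<le> (real m * X) ^ 3" by simp
  have "(\<integral>x. \<bar>(f ((x + z) + real m *\<^sub>R z) - f (x + z)) + (f (x + z) - f x)\<bar> ^ 3 \<partial>torus) \<le> (real m * X + X) ^ 3"
    by (rule L3_minkowski[OF L3_shift[OF d] L3_increment[OF f] _ _ 1 z(1)]) (use z in auto)
  then show ?case by (simp add: algebra_simps)
qed simp

text \<open>
  Taylor's formula gives this bound up to an error quadratic in the increment. Splitting
  \<open>h\<close> into \<open>m\<close> equal steps multiplies that error by \<open>1 / m\<close>, and \<open>m\<close> tends to infinity.
\<close>

lemma trig_increment_bound:
  assumes fr: "frequencies L \<subseteq> lattice" and W: "W \<ge> 0" "\<And>j. (\<integral>x. \<bar>trig (trig_partial j L) x\<bar> ^ 3 \<partial>torus) \<le> W ^ 3"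
  shows "(\<integral>x. \<bar>trig L (x + h) - trig L x\<bar> ^ 3 \<partial>torus) \<le> (3 * W * norm h) ^ 3"
proof -
  have "\<forall>j. \<exists>C. C \<ge> 0 \<and> (\<forall>x h. \<bar>trig (trig_partial j L) (x + h) - trig (trig_partial j L) x\<bar> \<le> C * norm h)"
    using trig_lipschitz by metis
  then obtain C where C: "\<And>j. C j \<ge> 0" "\<And>j x h. \<bar>trig (trig_partial j L) (x + h) - trig (trig_partial j L) x\<bar> \<le> C j * norm h"
    by metis
  define D where "D = (\<Sum>j\<in>UNIV. C j)"
  have D: "D \<ge> 0" unfolding D_def using C by (intro sum_nonneg) auto
  \<comment> \<open>First-order Taylor expansion; \<open>D\<close> is a Lipschitz constant of the gradient and drops out in the limit.\<close>
  have small: "(\<integral>x. \<bar>trig L (x + z) - trig L x\<bar> ^ 3 \<partial>torus) \<le> (3 * W * norm z + D * (norm z)\<^sup>2) ^ 3" for z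
  proof -
    let ?l = "\<lambda>x. z$1 * trig (trig_partial 1 L) x + z$2 * trig (trig_partial 2 L) x + z$3 * trig (trig_partial 3 L) x"
    have Lj: "L3 (\<lambda>x. z$j * trig (trig_partial j L) x)" for j using fr by (intro L3_cmult L3_trig) simp
    have bj: "(\<integral>x. \<bar>z$j * trig (trig_partial j L) x\<bar> ^ 3 \<partial>torus) \<le> (norm z * W) ^ 3" for j
    proof -
      have "(\<integral>x. \<bar>z$j * trig (trig_partial j L) x\<bar> ^ 3 \<partial>torus) = \<bar>z$j\<bar> ^ 3 * (\<integral>x. \<bar>trig (trig_partial j L) x\<bar> ^ 3 \<partial>torus)"
        by (simp add: abs_mult power_mult_distrib)
      also have "\<dots> \<le> norm z ^ 3 * W ^ 3"
        using W by (intro mult_mono power_mono component_le_norm_cart) (auto intro!: integral_nonneg_AE)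
      finally show ?thesis by (simp add: power_mult_distrib)
    qed
    have W0: "norm z * W \<ge> 0" using W by simp
    have l: "(\<integral>x. \<bar>?l x\<bar> ^ 3 \<partial>torus) \<le> (norm z * W + norm z * W + norm z * W) ^ 3"
      by (intro L3_minkowski L3_add Lj bj W0 add_nonneg_nonneg)
    have Ll: "L3 ?l" by (intro L3_add Lj)
    have err: "\<bar>trig L (x + z) - trig L x - ?l x\<bar> \<le> D * (norm z)\<^sup>2" for x
    proof -
      obtain \<xi> where \<xi>: "0 < \<xi>" "\<xi> < 1" "trig L (x + z) - trig L x = (\<Sum>j\<in>UNIV. z$j * trig (trig_partial j L) (x + \<xi> *\<^sub>R z))"
        using trig_mean_value[of L x z] by blast
      have "trig L (x + z) - trig L x - ?l x = (\<Sum>j\<in>UNIV. z$j * (trig (trig_partial j L) (x + \<xi> *\<^sub>R z) - trig (trig_partial j L) x))"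
        unfolding \<xi>(3) by (simp add: sum_3 algebra_simps)
      also have "\<bar>\<dots>\<bar> \<le> (\<Sum>j\<in>UNIV. norm z * (C j * norm z))"
      proof (intro order_trans[OF sum_abs] sum_mono)
        fix j
        have "\<bar>trig (trig_partial j L) (x + \<xi> *\<^sub>R z) - trig (trig_partial j L) x\<bar> \<le> C j * norm (\<xi> *\<^sub>R z)" by (rule C)
        also have "\<dots> \<le> C j * norm z" using \<xi> C(1) by (intro mult_left_mono) (auto intro: mult_left_le_one_le)
        finally show "\<bar>z$j * (trig (trig_partial j L) (x + \<xi> *\<^sub>R z) - trig (trig_partial j L) x)\<bar> \<le> norm z * (C j * norm z)"
          unfolding abs_mult by (intro mult_mono component_le_norm_cart) auto
      qed
      also have "\<dots> = D * (norm z)\<^sup>2"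
        unfolding D_def by (simp add: sum_distrib_right sum_distrib_left power2_eq_square mult_ac)
      finally show ?thesis .
    qed
    have Le: "L3 (\<lambda>x. trig L (x + z) - trig L x - ?l x)"
      by (intro L3_diff[OF L3_increment Ll] L3_trig fr)
    have e: "(\<integral>x. \<bar>trig L (x + z) - trig L x - ?l x\<bar> ^ 3 \<partial>torus) \<le> (D * (norm z)\<^sup>2) ^ 3"
    proof -
      have "(\<integral>x. \<bar>trig L (x + z) - trig L x - ?l x\<bar> ^ 3 \<partial>torus) \<le> (\<integral>x. (D * (norm z)\<^sup>2) ^ 3 \<partial>torus)"
        using L3D(3)[OF Le] by (intro integral_mono power_mono err) auto
      then show ?thesis by simp
    qed
    have "(\<integral>x. \<bar>?l x + (trig L (x + z) - trig L x - ?l x)\<bar> ^ 3 \<partial>torus) \<le> ((norm z * W + norm z * W + norm z * W) + D * (norm z)\<^sup>2) ^ 3"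
      by (rule L3_minkowski[OF Ll Le _ _ l e]) (use W(1) D in auto)
    then show ?thesis by (simp add: algebra_simps)
  qed
  have "(\<integral>x. \<bar>trig L (x + h) - trig L x\<bar> ^ 3 \<partial>torus) \<le> (3 * W * norm h + D * (norm h)\<^sup>2 * inverse (real (Suc m))) ^ 3" for m
  proof -
    let ?m = "real (Suc m)" and ?z = "inverse (real (Suc m)) *\<^sub>R h"
    have "(\<integral>x. \<bar>trig L (x + ?m *\<^sub>R ?z) - trig L x\<bar> ^ 3 \<partial>torus) \<le> (?m * (3 * W * norm ?z + D * (norm ?z)\<^sup>2)) ^ 3"
      by (rule L3_increment_iterate[OF L3_trig[OF fr] small]) (use W D in auto)
    moreover have "?m *\<^sub>R ?z = h" by (simp del: of_nat_Suc)
    moreover have "?m * (3 * W * norm ?z + D * (norm ?z)\<^sup>2) = 3 * W * norm h + D * (norm h)\<^sup>2 * inverse (real (Suc m))"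
    proof -
      define r where "r = inverse ?m"
      have mr: "?m * r = 1" and r: "r > 0" by (simp_all add: r_def)
      have "?m * (3 * W * (r * norm h) + D * (r * norm h)\<^sup>2) = (?m * r) * (3 * W * norm h + D * (norm h)\<^sup>2 * r)"
        by (simp add: algebra_simps power2_eq_square)
      then show ?thesis using r unfolding mr by (simp add: r_def[symmetric] del: of_nat_Suc)
    qed
    ultimately show ?thesis by simp
  qed
  moreover have "(\<lambda>m. (3 * W * norm h + D * (norm h)\<^sup>2 * inverse (real (Suc m))) ^ 3) \<longlonglongrightarrow> (3 * W * norm h + D * (norm h)\<^sup>2 * 0) ^ 3"
    by (intro tendsto_intros LIMSEQ_inverse_real_of_nat)
  ultimately show ?thesis
    using LIMSEQ_le_const by fastforce
qed

text \<open>
  The filtered velocity gains one full order of regularity from the Helmholtz equation,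
  with a bound that depends on \<open>v\<close> only. It is proved for the mollified \<open>u\<close>, which is smooth,
  and is uniform in \<open>m\<close>.
\<close>

lemma helmholtz_nikolskii:
  assumes h: "helmholtz_waves \<alpha> u v" and \<alpha>: "\<alpha> > 0"
    and v: "L3 v" "N \<ge> 0" "(\<integral>x. \<bar>v x\<bar> ^ 3 \<partial>torus) \<le> N ^ 3"
  shows "nikolskii 1 (N * (1 + 3 / \<alpha>)) (trig (mollify (cos_kernel m) u))"
    and "(\<integral>x. (trig (mollify (cos_kernel m) u) x)\<^sup>2 \<partial>torus) \<le> (\<integral>x. (v x)\<^sup>2 \<partial>torus)"
proof -
  let ?M = "mollify (cos_kernel m) u"
  have fr: "frequencies ?M \<subseteq> lattice" by (simp add: cos_kernel)
  note est = trig_helmholtz_estimates[OF fr \<alpha> refl, unfolded helmholtz_mollify[OF h cos_kernel(1) refl]]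
  note jc = order_trans[OF mollify_jensen_cube[OF v(1), of m] v(3)]
  show "(\<integral>x. (trig ?M x)\<^sup>2 \<partial>torus) \<le> (\<integral>x. (v x)\<^sup>2 \<partial>torus)"
    using est(1) mollify_jensen_square[OF v(1)] by (rule order_trans)
  have M3: "(\<integral>x. \<bar>trig ?M x\<bar> ^ 3 \<partial>torus) \<le> N ^ 3"
    using est(2) jc by (rule order_trans)
  have "(\<integral>x. \<bar>trig (trig_partial j ?M) x\<bar> ^ 3 \<partial>torus) \<le> (1 / \<alpha> * N) ^ 3" for j
  proof -
    have "(1 / \<alpha>) ^ 3 * (\<integral>x. \<bar>trig (mollify (cos_kernel m) v) x\<bar> ^ 3 \<partial>torus) \<le> (1 / \<alpha>) ^ 3 * N ^ 3"
      using jc \<alpha> by (intro mult_left_mono) auto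
    then show ?thesis using est(3)[of j] by (simp only: power_mult_distrib)
  qed
  note inc = trig_increment_bound[OF fr _ this]
  show "nikolskii 1 (N * (1 + 3 / \<alpha>)) (trig ?M)"
    unfolding nikolskii_def
  proof (intro conjI allI)
    show "L3 (trig ?M)" by (rule L3_trig[OF fr])
    show "0 \<le> N * (1 + 3 / \<alpha>)" using v \<alpha> by simp
    have "N ^ 3 \<le> (N * (1 + 3 / \<alpha>)) ^ 3" using v \<alpha> by (intro power_mono) (auto simp: distrib_left)
    then show "(\<integral>x. \<bar>trig ?M x\<bar> ^ 3 \<partial>torus) \<le> (N * (1 + 3 / \<alpha>)) ^ 3" using M3 by (rule order_trans[rotated])
    show "(\<integral>x. \<bar>trig ?M (x + h) - trig ?M x\<bar> ^ 3 \<partial>torus) \<le> (N * (1 + 3 / \<alpha>) * norm h powr 1) ^ 3" for h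
    proof (rule order_trans[OF inc])
      show "0 \<le> 1 / \<alpha> * N" using v \<alpha> by simp
      have "3 * (1 / \<alpha> * N) * norm h \<le> N * (1 + 3 / \<alpha>) * norm h"
        using v \<alpha> by (intro mult_right_mono) (auto simp: distrib_left mult.commute)
      then show "(3 * (1 / \<alpha> * N) * norm h) ^ 3 \<le> (N * (1 + 3 / \<alpha>) * norm h powr 1) ^ 3"
        using v \<alpha> by (intro power_mono) auto
    qed
  qed
qed

text \<open>
  By the addition theorem every translate of a wave is a combination of the wave and its
  shift by a quarter period, and convolution averages translates.
\<close>

lemma mollify_wave:
  assumes k: "k \<in> lattice"
  obtains A B where "\<And>x. trig (mollify (cos_kernel m) (wave k \<theta>)) x = A * wave k \<theta> x + B * wave k (\<theta> + pi / 2) x"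
proof -
  let ?k = "trig (cos_kernel m)"
  have iw: "integrable torus (wave k \<theta>)" by (rule L3_integrable[OF L3_wave[OF k]])
  have i: "integrable torus (\<lambda>h. ?k h * wave k \<phi> h)" for \<phi>
    by (rule integrable_mult_wave[OF integrable_trig])
  have "trig (mollify (cos_kernel m) (wave k \<theta>)) x
     = (\<integral>h. ?k h * wave k 0 h \<partial>torus) * wave k \<theta> x + (- (\<integral>h. ?k h * wave k (pi / 2) h \<partial>torus)) * wave k (\<theta> + pi / 2) x" for x
  proof -
    have "trig (mollify (cos_kernel m) (wave k \<theta>)) x = (\<integral>y. ?k (x - y) * wave k \<theta> y \<partial>torus)"
      by (rule trig_mollify[OF iw cos_kernel(2)])
    also have "\<dots> = (\<integral>h. ?k (x - (h + x)) * wave k \<theta> (h + x) \<partial>torus)"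
    proof (rule integral_torus_shift[symmetric])
      have "(\<lambda>y. ?k (x - y)) \<in> borel_measurable borel" by (rule measurable_compose[of _ _ borel]) auto
      then show "(\<lambda>y. ?k (x - y) * wave k \<theta> y) \<in> borel_measurable borel" by measurable
      have "?k (x - (y + axis j 1)) = ?k (x - y)" for y j
        using torus_periodicD[OF torus_periodic_trig[OF cos_kernel(1)[of m]], of "x - (y + axis j 1)" j] by simp
      then show "torus_periodic (\<lambda>y. ?k (x - y) * wave k \<theta> y)"
        using torus_periodic_wave[OF k] by (simp add: torus_periodic_def)
    qed
    also have "\<dots> = (\<integral>h. wave k \<theta> x * (?k h * wave k 0 h) - wave k (\<theta> + pi / 2) x * (?k h * wave k (pi / 2) h) \<partial>torus)"
    proof (intro Bochner_Integration.integral_cong refl)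
      fix h
      have "x - (h + x) = - h" "h + x = x + h" by simp_all
      then show "?k (x - (h + x)) * wave k \<theta> (h + x)
        = wave k \<theta> x * (?k h * wave k 0 h) - wave k (\<theta> + pi / 2) x * (?k h * wave k (pi / 2) h)"
        by (simp only: trig_even[OF cos_kernel(2)] wave_shift[of k \<theta> x h]) (simp add: right_diff_distrib mult_ac)
    qed
    also have "\<dots> = wave k \<theta> x * (\<integral>h. ?k h * wave k 0 h \<partial>torus) - wave k (\<theta> + pi / 2) x * (\<integral>h. ?k h * wave k (pi / 2) h \<partial>torus)"
      using i by simp
    finally show ?thesis by simp
  qed
  then show ?thesis using that by blast
qed

lemma div_free_mollify:
  assumes W: "div_free W" "\<And>i. integrable torus (W i)"
  shows "div_free (\<lambda>i. trig (mollify (cos_kernel m) (W i)))"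
  unfolding div_free_def
proof (intro ballI allI)
  fix k \<theta> assume k: "k \<in> lattice"
  obtain A B where AB: "\<And>x. trig (mollify (cos_kernel m) (wave k \<theta>)) x = A * wave k \<theta> x + B * wave k (\<theta> + pi / 2) x"
    using mollify_wave[OF k] by blast
  have "(\<integral>x. trig (mollify (cos_kernel m) (W i)) x * wave k \<theta> x \<partial>torus)
     = A * (\<integral>x. W i x * wave k \<theta> x \<partial>torus) + B * (\<integral>x. W i x * wave k (\<theta> + pi / 2) x \<partial>torus)" for i
  proof -
    have "(\<integral>x. trig (mollify (cos_kernel m) (W i)) x * wave k \<theta> x \<partial>torus) = (\<integral>x. W i x * trig (mollify (cos_kernel m) (wave k \<theta>)) x \<partial>torus)"
      by (rule mollify_symmetric[symmetric, OF W(2) L3_integrable[OF L3_wave[OF k]]])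
    also have "\<dots> = (\<integral>x. A * (W i x * wave k \<theta> x) + B * (W i x * wave k (\<theta> + pi / 2) x) \<partial>torus)"
      by (simp add: AB algebra_simps)
    finally show ?thesis using integrable_mult_wave[OF W(2)] by simp
  qed
  then have "(\<Sum>i\<in>UNIV. k$i * (\<integral>x. trig (mollify (cos_kernel m) (W i)) x * wave k \<theta> x \<partial>torus))
     = A * (\<Sum>i\<in>UNIV. k$i * (\<integral>x. W i x * wave k \<theta> x \<partial>torus)) + B * (\<Sum>i\<in>UNIV. k$i * (\<integral>x. W i x * wave k (\<theta> + pi / 2) x \<partial>torus))"
    by (simp add: sum.distrib sum_distrib_left algebra_simps)
  then show "(\<Sum>i\<in>UNIV. k$i * (\<integral>x. trig (mollify (cos_kernel m) (W i)) x * wave k \<theta> x \<partial>torus)) = 0"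
    using W(1) k by (simp add: div_free_def)
qed

text \<open>
  The regularity bound is available for mollifications of \<open>u\<close> only, and passes to \<open>u\<close>
  through the weak limit, as the flux is linear in \<open>u\<close> for fixed \<open>n\<close>. One derivative on \<open>u\<close> makes
  the sum of the orders exceed one for every positive \<open>\<sigma>\<close>.
\<close>

lemma transport_flux_bound:
  assumes \<alpha>: "\<alpha> > 0" and u: "\<And>i. u i \<in> borel_measurable borel" "\<And>i. torus_periodic (u i)" "\<And>i. integrable torus (\<lambda>x. (u i x)\<^sup>2)"
    and div: "div_free u" and h: "\<And>i. helmholtz_waves \<alpha> (u i) (v i)"
    and v: "\<And>i. L3 (v i)" "N \<ge> 0" "\<And>i. (\<integral>x. \<bar>v i x\<bar> ^ 3 \<partial>torus) \<le> N ^ 3"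
    and f: "nikolskii \<sigma> Nf f" and s: "0 < \<sigma>" "\<sigma> \<le> 1"
  shows "\<bar>flux (cos_kernel n) u f f\<bar> \<le> 240 * pi * real (Suc n) powr (- \<sigma>) * (N * (1 + 3 / \<alpha>) * Nf * Nf)"
proof -
  let ?u = "\<lambda>m i. trig (mollify (cos_kernel m) (u i))"
  let ?T = "\<lambda>i. trig (trig_partial i (mollify (cos_kernel n) f))"
  have ui: "integrable torus (u i)" for i
    by (rule integrable_of_square[OF borel_measurable_torus[OF u(1)] u(3)])
  have "(\<lambda>m. flux (cos_kernel n) (?u m) f f) \<longlonglongrightarrow> flux (cos_kernel n) u f f"
    unfolding flux_def
  proof (intro tendsto_sum tendsto_add)
    fix i
    obtain N' where "nikolskii \<sigma> N' (\<lambda>x. f x * ?T i x)"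
      by (rule nikolskii_mult_trig[OF f, of "trig_partial i (mollify (cos_kernel n) f)"]) (use s in \<open>auto simp: cos_kernel(1)\<close>)
    from mollify_weak_limit[OF u this s]
    show "(\<lambda>m. \<integral>x. ?u m i x * f x * ?T i x \<partial>torus) \<longlonglongrightarrow> (\<integral>x. u i x * f x * ?T i x \<partial>torus)"
      by (simp add: mult.assoc)
    then show "(\<lambda>m. \<integral>x. ?u m i x * f x * ?T i x \<partial>torus) \<longlonglongrightarrow> (\<integral>x. u i x * f x * ?T i x \<partial>torus)" .
  qed
  then have "(\<lambda>m. \<bar>flux (cos_kernel n) (?u m) f f\<bar>) \<longlonglongrightarrow> \<bar>flux (cos_kernel n) u f f\<bar>"
    by (rule tendsto_rabs)
  moreover have "\<bar>flux (cos_kernel n) (?u m) f f\<bar> \<le> 240 * pi * real (Suc n) powr (- \<sigma>) * (N * (1 + 3 / \<alpha>) * Nf * Nf)" for m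
  proof -
    have "\<bar>flux (cos_kernel n) (?u m) f f\<bar>
       \<le> 240 * pi * real (Suc n) powr ((1 - (1 + \<sigma> + \<sigma>)) / 2) * (N * (1 + 3 / \<alpha>) * Nf * Nf)"
      by (rule flux_bound[OF div_free_mollify[OF div ui] helmholtz_nikolskii(1)[OF h \<alpha> v] f f]) (use s in auto)
    moreover have "(1 - (1 + \<sigma> + \<sigma>)) / 2 = - \<sigma>" by simp
    ultimately show ?thesis by simp
  qed
  ultimately show ?thesis by (rule LIMSEQ_le_const2_all)
qed

text \<open>
  The norm of \<open>u\<close> is kept out of the bound, because a bound uniform in time is available
  for \<open>v\<close> and not, a priori, for \<open>u\<close>.
\<close>

lemma transport_pairing_bound:
  assumes \<alpha>: "\<alpha> > 0" and u: "u \<in> borel_measurable borel" "torus_periodic u" "integrable torus (\<lambda>x. (u x)\<^sup>2)"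
    and h: "helmholtz_waves \<alpha> u v" and v: "L3 v" and f: "nikolskii \<sigma> Nf f" and s: "0 < \<sigma>" "\<sigma> \<le> 1"
    and fr: "frequencies L \<subseteq> lattice" and C: "\<And>x. \<bar>trig L x\<bar> \<le> C"
  shows "\<bar>\<integral>x. u x * (f x * trig L x) \<partial>torus\<bar> \<le> (\<integral>x. (v x)\<^sup>2 \<partial>torus) + C\<^sup>2 * (\<integral>x. (f x)\<^sup>2 \<partial>torus)"
proof -
  define N where "N = (\<integral>x. \<bar>v x\<bar> ^ 3 \<partial>torus)"
  have "N \<ge> 0" unfolding N_def by (intro integral_nonneg_AE) auto
  then have N: "root 3 N \<ge> 0" "(\<integral>x. \<bar>v x\<bar> ^ 3 \<partial>torus) \<le> root 3 N ^ 3" by (auto simp: N_def[symmetric])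
  obtain N' where nk: "nikolskii \<sigma> N' (\<lambda>x. f x * trig L x)"
    by (rule nikolskii_mult_trig[OF f _ _ fr]) (use s in auto)
  have Lf: "L3 f" and LG: "L3 (\<lambda>x. f x * trig L x)" using f nk by (auto simp: nikolskii_def)
  let ?u = "\<lambda>m. trig (mollify (cos_kernel m) u)"
  have "(\<lambda>m. \<bar>\<integral>x. ?u m x * (f x * trig L x) \<partial>torus\<bar>) \<longlonglongrightarrow> \<bar>\<integral>x. u x * (f x * trig L x) \<partial>torus\<bar>"
    by (intro tendsto_rabs mollify_weak_limit[OF u nk s])
  moreover have "\<bar>\<integral>x. ?u m x * (f x * trig L x) \<partial>torus\<bar> \<le> (\<integral>x. (v x)\<^sup>2 \<partial>torus) + C\<^sup>2 * (\<integral>x. (f x)\<^sup>2 \<partial>torus)" for m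
  proof -
    have Lu: "L3 (?u m)" by (intro L3_trig) (simp add: cos_kernel(1))
    have "\<bar>\<integral>x. ?u m x * (f x * trig L x) \<partial>torus\<bar> \<le> (\<integral>x. \<bar>?u m x * (f x * trig L x)\<bar> \<partial>torus)"
      by (rule integral_abs_bound)
    also have "\<dots> \<le> (\<integral>x. (?u m x)\<^sup>2 + C\<^sup>2 * (f x)\<^sup>2 \<partial>torus)"
    proof (rule integral_mono)
      show "integrable torus (\<lambda>x. \<bar>?u m x * (f x * trig L x)\<bar>)"
        using L3_integrable_mult[OF Lu LG] by simp
      show "integrable torus (\<lambda>x. (?u m x)\<^sup>2 + C\<^sup>2 * (f x)\<^sup>2)"
        using L3_integrable_mult[OF Lu Lu] L3_integrable_mult[OF Lf Lf] by (simp add: power2_eq_square)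
      fix x
      have "\<bar>f x * trig L x\<bar> \<le> C * \<bar>f x\<bar>"
        using mult_left_mono[OF C[of x] abs_ge_zero[of "f x"]] by (simp add: abs_mult mult.commute)
      then have "\<bar>?u m x * (f x * trig L x)\<bar> \<le> \<bar>?u m x\<bar> * (C * \<bar>f x\<bar>)" unfolding abs_mult[of "?u m x"] by (intro mult_left_mono) auto
      also have "\<dots> \<le> (?u m x)\<^sup>2 + (C * \<bar>f x\<bar>)\<^sup>2"
        using zero_le_power2[of "\<bar>?u m x\<bar> - C * \<bar>f x\<bar>"] zero_le_power2[of "?u m x"] zero_le_power2[of "C * \<bar>f x\<bar>"]
        unfolding power2_diff power2_abs by linarith
      finally show "\<bar>?u m x * (f x * trig L x)\<bar> \<le> (?u m x)\<^sup>2 + C\<^sup>2 * (f x)\<^sup>2" by (simp add: power_mult_distrib)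
    qed
    also have "\<dots> = (\<integral>x. (?u m x)\<^sup>2 \<partial>torus) + C\<^sup>2 * (\<integral>x. (f x)\<^sup>2 \<partial>torus)"
      using L3_integrable_mult[OF Lu Lu] L3_integrable_mult[OF Lf Lf] by (simp add: power2_eq_square)
    also have "\<dots> \<le> (\<integral>x. (v x)\<^sup>2 \<partial>torus) + C\<^sup>2 * (\<integral>x. (f x)\<^sup>2 \<partial>torus)"
      using helmholtz_nikolskii(2)[OF h \<alpha> v N] by simp
    finally show ?thesis .
  qed
  ultimately show ?thesis by (rule LIMSEQ_le_const2_all)
qed

lemma kernel_energy_limit:
  assumes f: "nikolskii \<sigma> N f" and s: "0 < \<sigma>" "\<sigma> \<le> 1"
  shows "(\<lambda>n. \<integral>x. f x * trig (mollify (cos_kernel n) f) x \<partial>torus) \<longlonglongrightarrow> (\<integral>x. (f x)\<^sup>2 \<partial>torus)"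
proof -
  have L: "L3 f" using f by (simp add: nikolskii_def)
  have i2: "integrable torus (\<lambda>x. (f x)\<^sup>2)" using L3_integrable_mult[OF L L] by (simp add: power2_eq_square)
  show ?thesis
    using mollify_weak_limit[OF L3D(1,2)[OF L] i2 f s] by (simp add: power2_eq_square mult.commute)
qed

section \<open>Besov spaces\<close>

definition L3_norm :: "(real^3 \<Rightarrow> real) \<Rightarrow> real" where
  "L3_norm f = root 3 (\<integral>x. \<bar>f x\<bar> ^ 3 \<partial>torus)"

lemma L3_norm_nonneg [simp]: "L3_norm f \<ge> 0"
  by (auto simp: L3_norm_def intro!: integral_nonneg_AE)

lemma L3_norm_cube: "L3_norm f ^ 3 = (\<integral>x. \<bar>f x\<bar> ^ 3 \<partial>torus)"
  by (auto simp: L3_norm_def intro!: integral_nonneg_AE)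

lemma L3_norm_le_iff: "X \<ge> 0 \<Longrightarrow> L3_norm f \<le> X \<longleftrightarrow> (\<integral>x. \<bar>f x\<bar> ^ 3 \<partial>torus) \<le> X ^ 3"
  unfolding L3_norm_cube[symmetric] by (simp add: power_mono_iff)

lemma L3_norm_triangle: "L3 f \<Longrightarrow> L3 g \<Longrightarrow> L3_norm (\<lambda>x. f x + g x) \<le> L3_norm f + L3_norm g"
  by (subst L3_norm_le_iff) (auto intro!: L3_minkowski simp: L3_norm_cube)

lemma L3_norm_cmult: "L3_norm (\<lambda>x. c * f x) = \<bar>c\<bar> * L3_norm f"
proof -
  have "(\<integral>x. \<bar>c * f x\<bar> ^ 3 \<partial>torus) = \<bar>c\<bar> ^ 3 * (\<integral>x. \<bar>f x\<bar> ^ 3 \<partial>torus)"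
    by (simp add: abs_mult power_mult_distrib)
  then show ?thesis by (simp add: L3_norm_def real_root_mult real_root_pos2)
qed

lemma L3_norm_diff: "L3 f \<Longrightarrow> L3 g \<Longrightarrow> L3_norm (\<lambda>x. f x - g x) \<le> L3_norm f + L3_norm g"
  using L3_norm_triangle[OF _ L3_cmult[of g "-1"], of f] L3_norm_cmult[of "-1" g] by simp

lemma L3_norm_shift: "L3 f \<Longrightarrow> L3_norm (\<lambda>x. f (x + h)) = L3_norm f"
proof -
  assume "L3 f"
  then have "(\<integral>x. \<bar>f (x + h)\<bar> ^ 3 \<partial>torus) = (\<integral>x. \<bar>f x\<bar> ^ 3 \<partial>torus)"
    by (intro integral_torus_shift[where f = "\<lambda>x. \<bar>f x\<bar> ^ 3"]) (auto simp: L3_def torus_periodic_def)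
  then show ?thesis by (simp add: L3_norm_def)
qed

lemma L3_fdiff: "L3 f \<Longrightarrow> L3 (fdiff h f)"
  unfolding fdiff_def by (rule L3_increment)

lemma L3_fdiff_power: "L3 f \<Longrightarrow> L3 ((fdiff h ^^ k) f)"
  by (induction k) (auto intro: L3_fdiff)

lemma L3_norm_fdiff: "L3 f \<Longrightarrow> L3_norm (fdiff h f) \<le> 2 * L3_norm f"
  unfolding fdiff_def using L3_norm_diff[OF L3_shift, of f f h] by (simp add: L3_norm_shift)

lemma L3_norm_fdiff_power: "L3 f \<Longrightarrow> L3_norm ((fdiff h ^^ k) f) \<le> 2 ^ k * L3_norm f"
proof (induction k)
  case (Suc k)
  have "L3_norm (fdiff h ((fdiff h ^^ k) f)) \<le> 2 * L3_norm ((fdiff h ^^ k) f)"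
    by (intro L3_norm_fdiff L3_fdiff_power Suc)
  also have "\<dots> \<le> 2 * (2 ^ k * L3_norm f)" using Suc by simp
  finally show ?case by simp
qed simp

lemma fdiff_power_linear:
  fixes f g :: "real^3 \<Rightarrow> real"
  shows "(fdiff h ^^ k) (\<lambda>x. a * f x + b * g x) = (\<lambda>x. a * (fdiff h ^^ k) f x + b * (fdiff h ^^ k) g x)"
proof (induction k)
  case (Suc k)
  then show ?case by (simp add: fdiff_def fun_eq_iff algebra_simps)
qed simp

lemma fdiff_double: "fdiff (2 *\<^sub>R h) f = (\<lambda>x. 2 * fdiff h f x + 1 * (fdiff h ^^ 2) f x)" for f :: "real^3 \<Rightarrow> real"
  by (simp add: fdiff_def fun_eq_iff numeral_2_eq_2 scaleR_2 add.assoc algebra_simps)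

text \<open>
  From \<open>\<Delta>\<^bsub>2h\<^esub> = 2 \<Delta>\<^bsub>h\<^esub> + \<Delta>\<^bsub>h\<^esub>\<^sup>2\<close>: the \<open>k\<close>-th power is \<open>2\<^sup>k \<Delta>\<^bsub>h\<^esub>\<^sup>k\<close> up to
  terms with at least \<open>k + 1\<close> differences.
\<close>

lemma fdiff_double_power:
  assumes "L3 g"
  shows "L3_norm (\<lambda>x. (fdiff (2 *\<^sub>R h) ^^ k) g x - 2 ^ k * (fdiff h ^^ k) g x) \<le> 5 ^ k * L3_norm ((fdiff h ^^ Suc k) g)"
  using assms
proof (induction k arbitrary: g)
  case 0
  have "L3_norm (\<lambda>x. 0) = 0" by (simp add: L3_norm_def)
  then show ?case by simp
next
  case (Suc k)
  note L = L3_fdiff_power[OF Suc.prems]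
  have comm: "(fdiff h ^^ j) (fdiff (2 *\<^sub>R h) g) = (\<lambda>x. 2 * (fdiff h ^^ (Suc j)) g x + 1 * (fdiff h ^^ (Suc (Suc j))) g x)" for j
    unfolding fdiff_double fdiff_power_linear by (simp add: funpow_swap1 numeral_2_eq_2)
  have eq: "(\<lambda>x. (fdiff (2 *\<^sub>R h) ^^ Suc k) g x - 2 ^ Suc k * (fdiff h ^^ Suc k) g x)
    = (\<lambda>x. ((fdiff (2 *\<^sub>R h) ^^ k) (fdiff (2 *\<^sub>R h) g) x - 2 ^ k * (fdiff h ^^ k) (fdiff (2 *\<^sub>R h) g) x) + 2 ^ k * (fdiff h ^^ Suc (Suc k)) g x)"
    unfolding comm funpow_Suc_right o_def by (simp add: fun_eq_iff algebra_simps)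
  have "L3_norm (\<lambda>x. (fdiff (2 *\<^sub>R h) ^^ Suc k) g x - 2 ^ Suc k * (fdiff h ^^ Suc k) g x)
     \<le> L3_norm (\<lambda>x. (fdiff (2 *\<^sub>R h) ^^ k) (fdiff (2 *\<^sub>R h) g) x - 2 ^ k * (fdiff h ^^ k) (fdiff (2 *\<^sub>R h) g) x)
     + L3_norm (\<lambda>x. 2 ^ k * (fdiff h ^^ Suc (Suc k)) g x)"
    unfolding eq by (intro L3_norm_triangle L3_diff L3_cmult L3_fdiff_power L3_fdiff Suc.prems)
  also have "\<dots> \<le> 5 ^ k * L3_norm ((fdiff h ^^ Suc k) (fdiff (2 *\<^sub>R h) g)) + 2 ^ k * L3_norm ((fdiff h ^^ Suc (Suc k)) g)"
    using Suc.IH[OF L3_fdiff[OF Suc.prems], of "2 *\<^sub>R h"] by (simp only: L3_norm_cmult) simp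
  also have "\<dots> \<le> 5 ^ k * (4 * L3_norm ((fdiff h ^^ Suc (Suc k)) g)) + 2 ^ k * L3_norm ((fdiff h ^^ Suc (Suc k)) g)"
  proof -
    let ?p = "(fdiff h ^^ Suc (Suc k)) g"
    have "L3_norm ((fdiff h ^^ Suc k) (fdiff (2 *\<^sub>R h) g)) \<le> L3_norm (\<lambda>x. 2 * ?p x) + L3_norm (\<lambda>x. 1 * (fdiff h ^^ Suc (Suc (Suc k))) g x)"
      unfolding comm by (intro L3_norm_triangle L3_cmult L3_fdiff_power Suc.prems)
    also have "\<dots> \<le> 2 * L3_norm ?p + 2 * L3_norm ?p"
      unfolding L3_norm_cmult using L3_norm_fdiff[OF L[where h = h and k = "Suc (Suc k)"], of h] by simp
    finally show ?thesis by (intro add_right_mono mult_left_mono) auto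
  qed
  also have "\<dots> = (4 * 5 ^ k + 2 ^ k) * L3_norm ((fdiff h ^^ Suc (Suc k)) g)" by (simp only: algebra_simps)
  also have "\<dots> \<le> 5 ^ Suc k * L3_norm ((fdiff h ^^ Suc (Suc k)) g)"
    using power_mono[of 2 "5::real" k] by (intro mult_right_mono) auto
  finally show ?case .
qed

text \<open>
  With \<open>w h\<close> the norm of the \<open>k\<close>-th difference, doubling the step gives
  \<open>2 w h \<le> w (2 h) + O(\<bar>h\<bar>\<^sup>\<sigma>)\<close>. As \<open>w\<close> is bounded and \<open>\<sigma> < 1\<close>, iterating over the steps
  \<open>2\<^sup>n h\<close> sums a geometric series with ratio \<open>2\<^bsup>\<sigma>-1\<^esup>\<close>.
\<close>

lemma marchaud_step:
  assumes L: "L3 f" and \<sigma>: "0 < \<sigma>" "\<sigma> < 1" and k: "k \<ge> 1" and A: "A \<ge> 0"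
    and b: "\<And>h. L3_norm ((fdiff h ^^ Suc k) f) \<le> A * norm h powr \<sigma>"
  shows "L3_norm ((fdiff h ^^ k) f) \<le> 5 ^ k / (1 - 2 powr (\<sigma> - 1)) * A * norm h powr \<sigma>"
proof -
  define \<rho> where "\<rho> = 2 powr (\<sigma> - 1)"
  have \<rho>: "0 < \<rho>" "\<rho> < 1" using \<sigma> powr_less_mono[of "\<sigma> - 1" 0 2] by (auto simp: \<rho>_def)
  have two: "2 powr \<sigma> = 2 * \<rho>" by (simp add: \<rho>_def powr_diff)
  define B where "B = 5 ^ k * A / (1 - \<rho>)"
  have B: "B \<ge> 0" "B = \<rho> * B + 5 ^ k * A"
    using A \<rho> by (auto simp: B_def field_simps)
  define M where "M = 2 ^ k * L3_norm f"
  have M: "M \<ge> 0" by (simp add: M_def)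
  let ?w = "\<lambda>h. L3_norm ((fdiff h ^^ k) f)"
  note Lk = L3_fdiff_power[OF L]
  have step: "2 * ?w h \<le> ?w (2 *\<^sub>R h) + 2 * (5 ^ k * A * norm h powr \<sigma>)" for h
  proof -
    have "2 ^ k * ?w h = L3_norm (\<lambda>x. 2 ^ k * (fdiff h ^^ k) f x)" by (simp only: L3_norm_cmult) simp
    also have "\<dots> = L3_norm (\<lambda>x. (fdiff (2 *\<^sub>R h) ^^ k) f x - ((fdiff (2 *\<^sub>R h) ^^ k) f x - 2 ^ k * (fdiff h ^^ k) f x))" by simp
    also have "\<dots> \<le> ?w (2 *\<^sub>R h) + L3_norm (\<lambda>x. (fdiff (2 *\<^sub>R h) ^^ k) f x - 2 ^ k * (fdiff h ^^ k) f x)"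
      by (intro L3_norm_diff L3_diff L3_cmult Lk)
    also have "\<dots> \<le> ?w (2 *\<^sub>R h) + 5 ^ k * (A * norm h powr \<sigma>)"
      by (intro add_left_mono order_trans[OF fdiff_double_power[OF L]] mult_left_mono b) auto
    finally have 1: "2 ^ k * ?w h \<le> ?w (2 *\<^sub>R h) + 5 ^ k * (A * norm h powr \<sigma>)" .
    have "2 ^ 1 \<le> (2::real) ^ k" using k by (intro power_increasing) auto
    then have "2 * ?w h \<le> 2 ^ k * ?w h" by (intro mult_right_mono) auto
    moreover have "0 \<le> 5 ^ k * (A * norm h powr \<sigma>)" using A by simp
    ultimately show ?thesis using 1 unfolding mult.assoc by linarith
  qed
  \<comment> \<open>\<open>B\<close> is the fixed point of \<open>B = \<rho> B + 5\<^sup>k A\<close>, to which the iteration converges.\<close>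
  have claim: "?w h \<le> M * (1 / 2) ^ n + B * norm h powr \<sigma>" for n h
  proof (induction n arbitrary: h)
    case 0
    have "?w h \<le> M" unfolding M_def by (rule L3_norm_fdiff_power[OF L])
    moreover have "0 \<le> B * norm h powr \<sigma>" using B by simp
    ultimately show ?case by simp
  next
    case (Suc n)
    have "?w (2 *\<^sub>R h) \<le> M * (1 / 2) ^ n + B * (2 * \<rho> * norm h powr \<sigma>)"
      using Suc[of "2 *\<^sub>R h"] by (simp add: powr_mult two)
    then have "2 * ?w h \<le> 2 * (M * (1 / 2) ^ Suc n + (\<rho> * B + 5 ^ k * A) * norm h powr \<sigma>)"
      using step[of h] by (simp add: algebra_simps)
    then show ?case using B(2) by simp
  qed
  have "(\<lambda>n. M * (1 / 2) ^ n + B * norm h powr \<sigma>) \<longlonglongrightarrow> M * 0 + B * norm h powr \<sigma>"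
    by (intro tendsto_intros LIMSEQ_power_zero) auto
  then have "?w h \<le> M * 0 + B * norm h powr \<sigma>"
    by (rule LIMSEQ_le_const) (use claim in blast)
  then show ?thesis by (simp add: B_def \<rho>_def)
qed

text \<open>
  Marchaud's inequality, descending one difference at a time.
\<close>

lemma marchaud:
  assumes \<sigma>: "0 < \<sigma>" "\<sigma> < 1"
  shows "\<exists>C\<ge>0. \<forall>f A. L3 f \<and> A \<ge> 0 \<and> (\<forall>h. L3_norm ((fdiff h ^^ Suc m) f) \<le> A * norm h powr \<sigma>) \<longrightarrow>
    (\<forall>h. L3_norm (fdiff h f) \<le> C * A * norm h powr \<sigma>)"
proof (induction m)
  case 0
  then show ?case by (intro exI[of _ 1]) auto
next
  case (Suc m)
  then obtain C where C: "C \<ge> 0" "\<And>f A h. L3 f \<Longrightarrow> A \<ge> 0 \<Longrightarrow> (\<And>h. L3_norm ((fdiff h ^^ Suc m) f) \<le> A * norm h powr \<sigma>) \<Longrightarrow>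
     L3_norm (fdiff h f) \<le> C * A * norm h powr \<sigma>" by blast
  let ?D = "5 ^ Suc m / (1 - 2 powr (\<sigma> - 1)) :: real"
  have D: "?D \<ge> 0" using \<sigma> powr_less_mono[of "\<sigma> - 1" 0 2] by auto
  show ?case
  proof (intro exI[of _ "C * ?D"] conjI allI impI)
    show "0 \<le> C * ?D" using C D by (intro mult_nonneg_nonneg)
    fix f A h assume "L3 f \<and> A \<ge> 0 \<and> (\<forall>h. L3_norm ((fdiff h ^^ Suc (Suc m)) f) \<le> A * norm h powr \<sigma>)"
    then have f: "L3 f" "A \<ge> 0" "\<And>h. L3_norm ((fdiff h ^^ Suc (Suc m)) f) \<le> A * norm h powr \<sigma>" by auto
    have "L3_norm ((fdiff h ^^ Suc m) f) \<le> ?D * A * norm h powr \<sigma>" for h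
      by (rule marchaud_step[OF f(1) \<sigma> _ f(2,3)]) auto
    from C(2)[OF f(1) _ this] D f(2)
    have "L3_norm (fdiff h f) \<le> C * (?D * A) * norm h powr \<sigma>" by (metis mult_nonneg_nonneg)
    then show "L3_norm (fdiff h f) \<le> C * ?D * A * norm h powr \<sigma>" by (simp only: mult.assoc)
  qed
qed

lemma borel_measurable_vec_component:
  fixes f :: "'a \<Rightarrow> real^3"
  shows "f \<in> borel_measurable M \<Longrightarrow> (\<lambda>x. f x $ j) \<in> borel_measurable M"
  by (rule measurable_compose[of f M borel]) (auto intro!: borel_measurable_continuous_onI continuous_intros)

lemma Lq_norm_cube: "Lq_norm 3 f ^ 3 = (\<integral>x. norm (f x) ^ 3 \<partial>torus)"
proof -
  have I: "(LINT x:cell|lborel. norm (f x) powr 3) = (\<integral>x. norm (f x) ^ 3 \<partial>torus)"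
    unfolding integral_torus[symmetric] by simp
  have "0 \<le> (\<integral>x. norm (f x) ^ 3 \<partial>torus)" by (intro integral_nonneg_AE) auto
  then show ?thesis unfolding Lq_norm_def I
    by (cases "(\<integral>x. norm (f x) ^ 3 \<partial>torus) = 0") (simp_all add: powr_power)
qed

lemma Lq_component:
  fixes f :: "real^3 \<Rightarrow> real^3"
  assumes "Lq 3 f"
  shows "L3 (\<lambda>x. f x $ j)" "integrable torus (\<lambda>x. norm (f x) ^ 3)"
    "(\<integral>x. norm (f x) ^ 3 \<partial>torus) = Lq_norm 3 f ^ 3"
proof -
  have m: "f \<in> borel_measurable borel" and p: "torus_periodic f" and i: "integrable torus (\<lambda>x. norm (f x) ^ 3)"
    using assms by (auto simp: Lq_def integrable_torus[symmetric])
  show "integrable torus (\<lambda>x. norm (f x) ^ 3)" by fact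
  show "L3 (\<lambda>x. f x $ j)" unfolding L3_def
  proof (intro conjI)
    show mj: "(\<lambda>x. f x $ j) \<in> borel_measurable borel" by (rule borel_measurable_vec_component[OF m])
    show "torus_periodic (\<lambda>x. f x $ j)" using p by (simp add: torus_periodic_def)
    show "integrable torus (\<lambda>x. \<bar>f x $ j\<bar> ^ 3)"
    proof (rule integrable_torus_dominated[OF i])
      show "(\<lambda>x. \<bar>f x $ j\<bar> ^ 3) \<in> borel_measurable torus" by (rule borel_measurable_torus) (use mj in measurable)
      show "\<bar>\<bar>f x $ j\<bar> ^ 3\<bar> \<le> norm (f x) ^ 3" for x by (simp add: power_mono component_le_norm_cart)
    qed
  qed
  show "(\<integral>x. norm (f x) ^ 3 \<partial>torus) = Lq_norm 3 f ^ 3" by (rule Lq_norm_cube[symmetric])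
qed

lemma L3_norm_component:
  assumes "\<And>j. L3 (\<lambda>x. g x $ j)"
  shows "L3_norm (\<lambda>x. g x $ j) \<le> Lq_norm 3 (g :: real^3 \<Rightarrow> real^3)"
proof -
  have a: "L3 (\<lambda>x. \<bar>g x $ i\<bar>)" for i
    using assms[of i] by (auto simp: L3_def torus_periodic_def)
  have "L3 (\<lambda>x. \<bar>g x $ 1\<bar> + \<bar>g x $ 2\<bar> + \<bar>g x $ 3\<bar>)" by (intro L3_add a)
  from L3D(3)[OF this] have i: "integrable torus (\<lambda>x. \<bar>\<bar>g x $ 1\<bar> + \<bar>g x $ 2\<bar> + \<bar>g x $ 3\<bar>\<bar> ^ 3)" .
  have m: "g \<in> borel_measurable borel"
    using assms by (subst borel_measurable_euclidean_space) (auto simp: L3_def Basis_vec_def inner_axis)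
  have ig: "integrable torus (\<lambda>x. norm (g x) ^ 3)"
  proof (rule integrable_torus_dominated[OF i])
    show "(\<lambda>x. norm (g x) ^ 3) \<in> borel_measurable torus" by (rule borel_measurable_torus) (use m in measurable)
    show "\<bar>norm (g x) ^ 3\<bar> \<le> \<bar>\<bar>g x $ 1\<bar> + \<bar>g x $ 2\<bar> + \<bar>g x $ 3\<bar>\<bar> ^ 3" for x
      using norm_le_l1_cart[of "g x"] by (simp add: sum_3 power_mono)
  qed
  have "(\<integral>x. \<bar>g x $ j\<bar> ^ 3 \<partial>torus) \<le> (\<integral>x. norm (g x) ^ 3 \<partial>torus)"
    by (intro integral_mono L3D(3) assms ig power_mono component_le_norm_cart) auto
  moreover have "0 \<le> Lq_norm 3 g" by (simp add: Lq_norm_def)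
  ultimately show ?thesis
    by (subst L3_norm_le_iff) (simp_all only: Lq_norm_cube)
qed

lemma fdiff_power_component: "((fdiff h ^^ k) f x) $ j = (fdiff h ^^ k) (\<lambda>x. f x $ j) x" for f :: "real^3 \<Rightarrow> real^3"
  by (induction k arbitrary: x) (auto simp: fdiff_def)

text \<open>
  Lowering the order of regularity is harmless for small increments because
  \<open>\<bar>h\<bar>\<^sup>s \<le> \<bar>h\<bar>\<^sup>\<sigma>\<close>, and for large ones because differences are bounded by the norm. The definition
  uses differences of order above \<open>s\<close>; they are reduced to first differences afterwards.
\<close>

lemma besov_nikolskii:
  assumes \<sigma>: "0 < \<sigma>" "\<sigma> < 1" "\<sigma> \<le> s"
  shows "\<exists>C\<ge>0. \<forall>f :: real^3 \<Rightarrow> real^3. besov s f \<longrightarrow> besov_norm s f \<ge> 0 \<and> (\<forall>j. nikolskii \<sigma> (C * besov_norm s f) (\<lambda>x. f x $ j))"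
proof -
  let ?m = "nat \<lfloor>s\<rfloor>"
  obtain C where C: "C \<ge> 0" "\<And>f A h. L3 f \<Longrightarrow> A \<ge> 0 \<Longrightarrow> (\<And>h. L3_norm ((fdiff h ^^ Suc ?m) f) \<le> A * norm h powr \<sigma>) \<Longrightarrow>
     L3_norm (fdiff h f) \<le> C * A * norm h powr \<sigma>" using marchaud[OF \<sigma>(1,2), of ?m] by blast
  let ?D = "1 + C * (1 + 2 ^ Suc ?m)"
  show ?thesis
  proof (intro exI[of _ ?D] conjI allI impI)
    show "0 \<le> ?D" using C by simp
    fix f :: "real^3 \<Rightarrow> real^3"
    assume "besov s f"
    then have f: "Lq 3 f" and bdd: "bdd_above (besov_quotient s f ` (- {0}))" by (auto simp: besov_def)
    let ?N = "besov_norm s f"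
    have q0: "besov_quotient s f h \<ge> 0" for h by (simp add: besov_quotient_def Lq_norm_def)
    have qle: "besov_quotient s f h \<le> (SUP h \<in> - {0}. besov_quotient s f h)" if "h \<noteq> 0" for h
      using that bdd by (intro cSUP_upper) auto
    have S0: "0 \<le> (SUP h \<in> - {0}. besov_quotient s f h)"
      using order_trans[OF q0 qle[of "axis 1 1"]] by simp
    have n0: "Lq_norm 3 f \<ge> 0" by (simp add: Lq_norm_def)
    show N0: "?N \<ge> 0" using S0 n0 by (simp add: besov_norm_def)
    have fN: "Lq_norm 3 f \<le> ?N" using S0 by (simp add: besov_norm_def)
    have qN: "besov_quotient s f h \<le> ?N" if "h \<noteq> 0" for h using qle[OF that] n0 by (simp add: besov_norm_def)
    fix j
    let ?f = "\<lambda>x. f x $ j"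
    note L = Lq_component(1)[OF f]
    have fj: "L3_norm ?f \<le> ?N" using L3_norm_component[OF L] fN by (rule order_trans)
    have "L3_norm ((fdiff h ^^ Suc ?m) ?f) \<le> (?N + 2 ^ Suc ?m * ?N) * norm h powr \<sigma>" for h
    proof (cases "h = 0")
      case True
      have "(fdiff 0 ^^ Suc ?m) ?f = (\<lambda>x. 0)" by (simp add: fdiff_def fun_eq_iff)
      then show ?thesis by (simp add: True L3_norm_def)
    next
      case False
      have "L3_norm ((fdiff h ^^ Suc ?m) ?f) = L3_norm (\<lambda>x. (fdiff h ^^ Suc ?m) f x $ j)" by (simp only: fdiff_power_component)
      also have "\<dots> \<le> Lq_norm 3 ((fdiff h ^^ Suc ?m) f)"
        by (rule L3_norm_component) (simp only: fdiff_power_component L3_fdiff_power L)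
      also have "\<dots> \<le> ?N * norm h powr s"
        using qN[OF False] False by (simp add: besov_quotient_def divide_le_eq)
      finally have 1: "L3_norm ((fdiff h ^^ Suc ?m) ?f) \<le> ?N * norm h powr s" .
      have 2: "L3_norm ((fdiff h ^^ Suc ?m) ?f) \<le> 2 ^ Suc ?m * ?N"
        by (rule order_trans[OF L3_norm_fdiff_power[OF L] mult_left_mono[OF fj]]) simp
      have p2: "0 \<le> 2 ^ Suc ?m * ?N" using N0 by simp
      show ?thesis
      proof (cases "norm h \<le> 1")
        case True
        then have "norm h powr s \<le> norm h powr \<sigma>" using \<sigma> False by (intro powr_mono') auto
        then have "?N * norm h powr s \<le> ?N * norm h powr \<sigma>" using N0 by (intro mult_left_mono)
        also have "\<dots> \<le> (?N + 2 ^ Suc ?m * ?N) * norm h powr \<sigma>" using p2 by (intro mult_right_mono) auto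
        finally show ?thesis using 1 by (rule order_trans[rotated])
      next
        case False
        then have "1 \<le> norm h powr \<sigma>" using \<sigma> by (intro ge_one_powr_ge_zero) auto
        then have "2 ^ Suc ?m * ?N * 1 \<le> (?N + 2 ^ Suc ?m * ?N) * norm h powr \<sigma>"
          using N0 p2 by (intro mult_mono) auto
        then show ?thesis using 2 by linarith
      qed
    qed
    from C(2)[OF L _ this] N0
    have inc: "L3_norm (fdiff h ?f) \<le> C * (?N + 2 ^ Suc ?m * ?N) * norm h powr \<sigma>" for h :: "real^3" by auto
    show "nikolskii \<sigma> (?D * ?N) ?f"
      unfolding nikolskii_def
    proof (intro conjI allI L)
      show D0: "0 \<le> ?D * ?N" using N0 C by (intro mult_nonneg_nonneg) auto
      have "?N \<le> ?D * ?N" using N0 C by (simp add: distrib_right)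
      then have "L3_norm ?f \<le> ?D * ?N" using fj by linarith
      then show "(\<integral>x. \<bar>?f x\<bar> ^ 3 \<partial>torus) \<le> (?D * ?N) ^ 3" using D0 by (simp add: L3_norm_le_iff)
      fix h :: "real^3"
      have "C * (?N + 2 ^ Suc ?m * ?N) * norm h powr \<sigma> \<le> ?D * ?N * norm h powr \<sigma>"
        using N0 by (intro mult_right_mono) (auto simp: algebra_simps)
      then have "L3_norm (fdiff h ?f) \<le> ?D * ?N * norm h powr \<sigma>" using inc[of h] by linarith
      then show "(\<integral>x. \<bar>?f (x + h) - ?f x\<bar> ^ 3 \<partial>torus) \<le> (?D * ?N * norm h powr \<sigma>) ^ 3"
        using D0 by (subst (asm) L3_norm_le_iff) (auto simp: fdiff_def intro!: mult_nonneg_nonneg)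
    qed
  qed
qed

section \<open>Smooth functions\<close>

lemma Ck_Suc_imp: "Ck (Suc k) f \<Longrightarrow> Ck k f"
proof (induction k arbitrary: f)
  case 0
  then show ?case
    by (auto intro!: differentiable_imp_continuous_on simp: differentiable_on_def intro: differentiable_at_withinI)
next
  case (Suc k)
  then show ?case by (metis Ck.simps(2))
qed

lemma Ck_const: "Ck k (\<lambda>x. c)"
  by (induction k arbitrary: c) auto

lemma Ck_SucI:
  assumes "\<And>x. (f has_derivative f' x) (at x)" "\<And>b. b \<in> Basis \<Longrightarrow> Ck k (\<lambda>x. f' x b)"
  shows "Ck (Suc k) f"
proof -
  have "frechet_derivative f (at x) = f' x" for x using frechet_derivative_at[OF assms(1)] by simp
  then show ?thesis using assms by (auto simp: differentiable_def)
qed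

lemma Ck_SucD: "Ck (Suc k) f \<Longrightarrow> (f has_derivative frechet_derivative f (at x)) (at x)"
  by (simp add: frechet_derivative_works)

lemma Ck_add: "Ck k f \<Longrightarrow> Ck k g \<Longrightarrow> Ck k (\<lambda>x. f x + g x)"
proof (induction k arbitrary: f g)
  case 0
  then show ?case by (auto intro: continuous_intros)
next
  case (Suc k)
  show ?case
    by (rule Ck_SucI[OF has_derivative_add[OF Ck_SucD[OF Suc.prems(1)] Ck_SucD[OF Suc.prems(2)]]])
       (use Suc in auto)
qed

lemma Ck_mult:
  fixes f g :: "'a::euclidean_space \<Rightarrow> real"
  shows "Ck k f \<Longrightarrow> Ck k g \<Longrightarrow> Ck k (\<lambda>x. f x * g x)"
proof (induction k arbitrary: f g)
  case 0
  then show ?case by (auto intro: continuous_intros)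
next
  case (Suc k)
  show ?case
    by (rule Ck_SucI[OF has_derivative_mult[OF Ck_SucD[OF Suc.prems(1)] Ck_SucD[OF Suc.prems(2)]]])
       (use Suc Ck_Suc_imp[OF Suc.prems(1)] Ck_Suc_imp[OF Suc.prems(2)] in \<open>auto intro!: Ck_add\<close>)
qed

lemma Ck_scaleR_const:
  fixes f :: "'a::euclidean_space \<Rightarrow> real"
  shows "Ck k f \<Longrightarrow> Ck k (\<lambda>x. f x *\<^sub>R w)"
proof (induction k arbitrary: f)
  case 0
  then show ?case by (auto intro: continuous_intros)
next
  case (Suc k)
  show ?case
    by (rule Ck_SucI[OF has_derivative_scaleR_left[OF Ck_SucD[OF Suc.prems(1)]]]) (use Suc in auto)
qed

lemma Ck_compose_affine:
  fixes f :: "real \<Rightarrow> real" and A :: "'a::euclidean_space \<Rightarrow> real"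
  assumes A: "\<And>x. (A has_derivative A') (at x)"
  shows "Ck k f \<Longrightarrow> Ck k (\<lambda>x. f (A x))"
proof (induction k arbitrary: f)
  case 0
  have "continuous_on UNIV A" using A by (meson has_derivative_at_withinI has_derivative_continuous_on)
  with 0 show ?case by (auto intro: continuous_on_compose2)
next
  case (Suc k)
  have D: "((\<lambda>x. f (A x)) has_derivative (\<lambda>h. frechet_derivative f (at (A x)) (A' h))) (at x)" for x
    by (rule has_derivative_compose[OF A Ck_SucD[OF Suc.prems]])
  show ?case
  proof (rule Ck_SucI[OF D])
    fix b :: 'a assume "b \<in> Basis"
    have "frechet_derivative f (at (A x)) (A' b) = A' b * frechet_derivative f (at (A x)) 1" for x
      using linear_scale[OF has_derivative_linear[OF Ck_SucD[OF Suc.prems, of "A x"]], of "A' b" 1] by simp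
    then show "Ck k (\<lambda>x. frechet_derivative f (at (A x)) (A' b))"
      using Suc by (auto intro!: Ck_mult[OF Ck_const])
  qed
qed

text \<open>
  A family that is closed under derivatives consists of smooth functions; this replaces
  explicit formulas for higher derivatives.
\<close>

lemma Ck_derivative_closed:
  fixes S :: "(real \<Rightarrow> real) set"
  assumes "\<And>f. f \<in> S \<Longrightarrow> \<exists>f'\<in>S. \<forall>x. (f has_real_derivative f' x) (at x)"
  shows "f \<in> S \<Longrightarrow> Ck k f"
proof (induction k arbitrary: f)
  case 0
  then obtain f' where "\<And>x. (f has_real_derivative f' x) (at x)" using assms by blast
  then show ?case by (auto intro: DERIV_continuous_on has_field_derivative_at_within)
next
  case (Suc k)
  then obtain f' where "f' \<in> S" "\<And>x. (f has_real_derivative f' x) (at x)" using assms by blast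
  then show ?case using Suc.IH
    by (intro Ck_SucI[where f' = "\<lambda>x. (*) (f' x)"]) (auto simp: has_field_derivative_def)
qed

text \<open>
  The classical \<open>exp (-1 / x)\<close> with a polynomial factor, which makes the family closed
  under derivatives.
\<close>

definition flat :: "real poly \<Rightarrow> real \<Rightarrow> real" where
  "flat p x = (if x > 0 then poly p (1 / x) * exp (- (1 / x)) else 0)"

lemma poly_exp_decay: "((\<lambda>y. y ^ k * poly p y * exp (- y)) \<longlongrightarrow> 0) (at_top :: real filter)"
proof (induction p arbitrary: k)
  case 0
  then show ?case by simp
next
  case (pCons a p)
  have "((\<lambda>y. a * (y ^ k / exp y) + y ^ Suc k * poly p y * exp (- y)) \<longlongrightarrow> a * 0 + 0) at_top"
    by (intro tendsto_add tendsto_mult tendsto_const tendsto_power_div_exp_0 pCons)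
  then show ?case by (simp add: exp_minus field_simps)
qed

lemma DERIV_flat: "(flat p has_real_derivative flat (pCons 0 (pCons 0 (p - pderiv p))) x) (at x)"
proof -
  let ?q = "pCons 0 (pCons 0 (p - pderiv p))"
  consider "x > 0" | "x < 0" | "x = 0" by linarith
  then show ?thesis
  proof cases
    case 1
    have "((\<lambda>x. poly p (1 / x) * exp (- (1 / x))) has_real_derivative
       (poly (pderiv p) (1 / x) * (- (1 / x\<^sup>2))) * exp (- (1 / x)) + (exp (- (1 / x)) * (1 / x\<^sup>2)) * poly p (1 / x)) (at x)"
    proof (rule DERIV_mult)
      have i: "((\<lambda>x. 1 / x) has_real_derivative - (1 / x\<^sup>2)) (at x)"
        using 1 by (auto intro!: derivative_eq_intros simp: power2_eq_square)
      show "((\<lambda>x. poly p (1 / x)) has_real_derivative poly (pderiv p) (1 / x) * (- (1 / x\<^sup>2))) (at x)"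
        by (rule DERIV_chain2[OF poly_DERIV i])
      have "((\<lambda>x. - (1 / x)) has_real_derivative - (- (1 / x\<^sup>2))) (at x)" by (rule DERIV_minus[OF i])
      from DERIV_chain2[OF DERIV_exp this]
      show "((\<lambda>x. exp (- (1 / x))) has_real_derivative exp (- (1 / x)) * (1 / x\<^sup>2)) (at x)" by simp
    qed
    moreover have "(poly (pderiv p) (1 / x) * (- (1 / x\<^sup>2))) * exp (- (1 / x)) + (exp (- (1 / x)) * (1 / x\<^sup>2)) * poly p (1 / x)
      = flat ?q x" using 1 by (simp add: flat_def algebra_simps power2_eq_square)
    ultimately have "((\<lambda>x. poly p (1 / x) * exp (- (1 / x))) has_real_derivative flat ?q x) (at x)" by simp
    then show ?thesis
      by (rule has_field_derivative_transform_within_open[where S = "{0<..}"]) (use 1 in \<open>auto simp: flat_def\<close>)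
  next
    case 2
    have "((\<lambda>x. 0) has_real_derivative flat ?q x) (at x)" using 2 by (simp add: flat_def)
    then show ?thesis
      by (rule has_field_derivative_transform_within_open[where S = "{..<0}"]) (use 2 in \<open>auto simp: flat_def\<close>)
  next
    case 3
    have "((\<lambda>h. flat p h / h) \<longlongrightarrow> 0) (at_right 0)"
    proof -
      have "((\<lambda>h. (inverse h) ^ 1 * poly p (inverse h) * exp (- inverse h)) \<longlongrightarrow> 0) (at_right (0::real))"
        by (rule filterlim_compose[OF poly_exp_decay filterlim_inverse_at_top_right])
      moreover have "\<forall>\<^sub>F h in at_right (0::real). (inverse h) ^ 1 * poly p (inverse h) * exp (- inverse h) = flat p h / h"
        by (auto simp: eventually_at_filter flat_def divide_inverse)
      ultimately show ?thesis by (rule Lim_transform_eventually)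
    qed
    moreover have "((\<lambda>h. flat p h / h) \<longlongrightarrow> 0) (at_left 0)"
    proof (rule Lim_transform_eventually)
      show "((\<lambda>h. 0) \<longlongrightarrow> 0) (at_left (0::real))" by simp
      show "\<forall>\<^sub>F h in at_left (0::real). 0 = flat p h / h"
        by (auto simp: eventually_at_filter flat_def)
    qed
    ultimately have "((\<lambda>h. flat p h / h) \<longlongrightarrow> 0) (at 0)"
      by (rule filterlim_split_at_real[rotated])
    then show ?thesis unfolding 3 has_field_derivative_iff by (simp add: flat_def)
  qed
qed

lemma Ck_flat: "Ck k (flat p)"
  by (rule Ck_derivative_closed[where S = "range flat"]) (auto intro: DERIV_flat)

lemma Ck_cos_affine: "Ck k (\<lambda>y::real. c * cos (a * y + d))"
proof (rule Ck_derivative_closed[where S = "{f. \<exists>c d. f = (\<lambda>y::real. c * cos (a * y + d))}"])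
  fix f assume "f \<in> {f. \<exists>c d. f = (\<lambda>y::real. c * cos (a * y + d))}"
  then obtain c d where f: "f = (\<lambda>y. c * cos (a * y + d))" by blast
  show "\<exists>f'\<in>{f. \<exists>c d. f = (\<lambda>y::real. c * cos (a * y + d))}. \<forall>x. (f has_real_derivative f' x) (at x)"
  proof (rule bexI)
    have "cos (a * x + (d + pi / 2)) = - sin (a * x + d)" for x
      by (simp add: add.assoc[symmetric] cos_add)
    then show "\<forall>x. (f has_real_derivative c * a * cos (a * x + (d + pi / 2))) (at x)"
      unfolding f by (auto intro!: derivative_eq_intros)
  qed blast
qed blast

lemma smooth_wave: "smooth (wave k \<theta>)"
  unfolding smooth_def
proof
  fix n
  have "Ck n (\<lambda>x. (\<lambda>y. 1 * cos (2 * pi * y + \<theta>)) (k \<bullet> x))"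
    by (rule Ck_compose_affine[OF _ Ck_cos_affine]) (auto intro!: derivative_eq_intros)
  moreover have "(\<lambda>x. (\<lambda>y. 1 * cos (2 * pi * y + \<theta>)) (k \<bullet> x)) = wave k \<theta>"
    by (simp add: wave_def fun_eq_iff)
  ultimately show "Ck n (wave k \<theta>)" by simp
qed

text \<open>
  The time factors of test functions that are products of a function of time and a wave.
\<close>

definition time_test :: "real \<Rightarrow> (real \<Rightarrow> real) \<Rightarrow> bool" where
  "time_test T \<eta> \<longleftrightarrow> (\<forall>k. Ck k \<eta>) \<and> (\<exists>a b. 0 < a \<and> b < T \<and> (\<forall>t. t \<notin> {a..b} \<longrightarrow> \<eta> t = 0))"

lemma test_function_wave:
  assumes "time_test T \<eta>" "k \<in> lattice"
  shows "test_function T (\<lambda>t x. (\<eta> t * wave k \<theta> x) *\<^sub>R w)"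
  unfolding test_function_def smooth_def
proof (intro conjI allI)
  fix n
  have "Ck n (\<lambda>z :: real \<times> (real^3). \<eta> (fst z))"
    by (rule Ck_compose_affine[of fst fst]) (use assms in \<open>auto simp: time_test_def intro!: derivative_eq_intros\<close>)
  moreover have "Ck n (\<lambda>z :: real \<times> (real^3). (\<lambda>y. 1 * cos (2 * pi * y + \<theta>)) (k \<bullet> snd z))"
    by (rule Ck_compose_affine[OF _ Ck_cos_affine]) (auto intro!: derivative_eq_intros)
  then have "Ck n (\<lambda>z :: real \<times> (real^3). wave k \<theta> (snd z))" by (simp add: wave_def[abs_def])
  ultimately have "Ck n (\<lambda>z :: real \<times> (real^3). (\<eta> (fst z) * wave k \<theta> (snd z)) *\<^sub>R w)"
    by (intro Ck_scaleR_const Ck_mult)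
  then show "Ck n (\<lambda>(t, x). (\<eta> t * wave k \<theta> x) *\<^sub>R w)" by (simp add: case_prod_unfold)
next
  show "torus_periodic (\<lambda>x. (\<eta> t * wave k \<theta> x) *\<^sub>R w)" for t
    using torus_periodic_wave[OF assms(2)] by (simp add: torus_periodic_def)
  show "\<exists>a b. 0 < a \<and> b < T \<and> (\<forall>t x. t \<notin> {a..b} \<longrightarrow> (\<eta> t * wave k \<theta> x) *\<^sub>R w = 0)"
    using assms(1) unfolding time_test_def by (metis mult_zero_left scaleR_zero_left)
qed

section \<open>Weak time derivatives\<close>

lemma time_test_lincomb: "time_test T f \<Longrightarrow> time_test T g \<Longrightarrow> time_test T (\<lambda>t. f t + c * g t)"
  unfolding time_test_def
proof (elim conjE exE, intro conjI allI)
  fix a b a' b' k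
  assume *: "\<forall>k. Ck k f" "\<forall>k. Ck k g" "0 < a" "0 < a'" "b < T" "b' < T"
    "\<forall>t. t \<notin> {a..b} \<longrightarrow> f t = 0" "\<forall>t. t \<notin> {a'..b'} \<longrightarrow> g t = 0"
  then show "Ck k (\<lambda>t. f t + c * g t)" by (intro Ck_add Ck_mult Ck_const) auto
  show "\<exists>a b. 0 < a \<and> b < T \<and> (\<forall>t. t \<notin> {a..b} \<longrightarrow> f t + c * g t = 0)"
  proof (intro exI conjI allI impI)
    show "0 < min a a'" "max b b' < T" using * by auto
    fix t assume "t \<notin> {min a a'..max b b'}"
    then have "t \<notin> {a..b}" "t \<notin> {a'..b'}" by auto
    then have "f t = 0" "g t = 0" using *(7,8) by blast+
    then show "f t + c * g t = 0" by simp
  qed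
qed

lemma time_test_facts:
  assumes "time_test T \<eta>"
  shows "continuous_on UNIV \<eta>" "\<eta> \<in> borel_measurable borel" "\<exists>C. \<forall>t. \<bar>\<eta> t\<bar> \<le> C" "integrable lborel \<eta>"
    "\<And>t. t \<notin> {0<..<T} \<Longrightarrow> \<eta> t = 0"
proof -
  obtain a b where ab: "0 < a" "b < T" "\<And>t. t \<notin> {a..b} \<Longrightarrow> \<eta> t = 0"
    using assms unfolding time_test_def by blast
  have "Ck 0 \<eta>" using assms unfolding time_test_def by blast
  then show c: "continuous_on UNIV \<eta>" by simp
  then show m: "\<eta> \<in> borel_measurable borel" by (rule borel_measurable_continuous_onI)
  have "compact (\<eta> ` {a..b})" using c by (intro compact_continuous_image) (auto intro: continuous_on_subset)
  then obtain C where C: "C > 0" "\<And>t. t \<in> {a..b} \<Longrightarrow> \<bar>\<eta> t\<bar> \<le> C"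
    by (auto dest!: compact_imp_bounded simp: bounded_pos)
  then show "\<exists>C. \<forall>t. \<bar>\<eta> t\<bar> \<le> C" using ab(3) by (metis abs_zero less_imp_le)
  have "integrable lborel (\<lambda>t. indicator {a..b} t *\<^sub>R \<eta> t)"
    using borel_integrable_compact[of "{a..b}" \<eta>] c by (auto intro: continuous_on_subset simp: indicator_times_eq_if)
  moreover have "(\<lambda>t. indicator {a..b} t *\<^sub>R \<eta> t) = \<eta>" using ab(3) by (auto simp: indicator_def fun_eq_iff)
  ultimately show "integrable lborel \<eta>" by simp
  show "\<eta> t = 0" if "t \<notin> {0<..<T}" for t using ab that by auto
qed

text \<open>
  Approximates the indicator of \<open>(a, c)\<close> from inside: the margin \<open>(c - a) / (n + 3)\<close> is
  less than half the length, and the flanks are stretched by \<open>n + 1\<close>.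
\<close>

definition plateau :: "nat \<Rightarrow> real \<Rightarrow> real \<Rightarrow> real \<Rightarrow> real" where
  "plateau n a c t = flat 1 (real (Suc n) * (t - a - (c - a) / real (n + 3)))
     * flat 1 (real (Suc n) * (c - (c - a) / real (n + 3) - t))"

lemma flat_1_bounds: "0 \<le> flat 1 x" "flat 1 x \<le> 1"
  by (auto simp: flat_def)

lemma plateau_bounds: "0 \<le> plateau n a c t" "plateau n a c t \<le> 1"
  by (auto simp: plateau_def flat_1_bounds mult_le_one)

lemma plateau_zero:
  assumes "a < c" "t \<notin> {a + (c - a) / real (n + 3)..c - (c - a) / real (n + 3)}"
  shows "plateau n a c t = 0"
proof -
  have "t - a - (c - a) / real (n + 3) \<le> 0 \<or> c - (c - a) / real (n + 3) - t \<le> 0" using assms by auto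
  then show ?thesis by (auto simp: plateau_def flat_def zero_less_mult_iff)
qed

lemma time_test_plateau:
  assumes "0 \<le> a" "a < c" "c \<le> T" shows "time_test T (plateau n a c)"
  unfolding time_test_def
proof (intro conjI allI)
  have *: "plateau n a c = (\<lambda>t. flat 1 (real (Suc n) * (t - a - (c - a) / real (n + 3)))
     * flat 1 (real (Suc n) * (c - (c - a) / real (n + 3) - t)))" by (simp add: plateau_def fun_eq_iff)
  have "((\<lambda>t. real (Suc n) * (t - a - d)) has_derivative (\<lambda>h. real (Suc n) * h)) (at x)"
    "((\<lambda>t. real (Suc n) * (c - d - t)) has_derivative (\<lambda>h. real (Suc n) * - h)) (at x)" for d x
    by (auto intro!: derivative_eq_intros)
  then show "Ck k (plateau n a c)" for k
    unfolding * by (intro Ck_mult Ck_compose_affine[OF _ Ck_flat])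
  have d: "0 < (c - a) / real (n + 3)" using assms by simp
  show "\<exists>a' b'. 0 < a' \<and> b' < T \<and> (\<forall>t. t \<notin> {a'..b'} \<longrightarrow> plateau n a c t = 0)"
  proof (intro exI conjI allI impI)
    show "0 < a + (c - a) / real (n + 3)" "c - (c - a) / real (n + 3) < T" using assms d by linarith+
  qed (rule plateau_zero[OF assms(2)])
qed

lemma plateau_tendsto:
  assumes "a < c" shows "(\<lambda>n. plateau n a c t) \<longlonglongrightarrow> indicator {a<..<c} t"
proof (cases "t \<in> {a<..<c}")
  case True
  have lim: "(\<lambda>n. flat 1 (real (Suc n) * (s - (c - a) / real (n + 3)))) \<longlonglongrightarrow> 1" if "s > 0" for s
  proof -
    have "(\<lambda>n. s - (c - a) / real (n + 3)) \<longlonglongrightarrow> s - 0"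
      by (intro tendsto_diff tendsto_const tendsto_divide_0[OF tendsto_const] filterlim_at_top_imp_at_infinity
          filterlim_compose[OF filterlim_real_sequentially filterlim_add_const_nat_at_top])
    then have top: "filterlim (\<lambda>n. (s - (c - a) / real (n + 3)) * real (Suc n)) at_top sequentially"
      by (intro filterlim_tendsto_pos_mult_at_top[where c = s] filterlim_compose[OF filterlim_real_sequentially filterlim_Suc])
         (use that in auto)
    then have "(\<lambda>n. exp (- inverse ((s - (c - a) / real (n + 3)) * real (Suc n)))) \<longlonglongrightarrow> exp (- 0)"
      by (intro tendsto_exp tendsto_minus tendsto_inverse_0_at_top)
    moreover have "\<forall>\<^sub>F n in sequentially. (s - (c - a) / real (n + 3)) * real (Suc n) > 0"
      using top by (rule filterlim_at_top_dense[THEN iffD1, rule_format])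
    then have "\<forall>\<^sub>F n in sequentially. exp (- inverse ((s - (c - a) / real (n + 3)) * real (Suc n)))
        = flat 1 (real (Suc n) * (s - (c - a) / real (n + 3)))"
      by eventually_elim (simp add: flat_def divide_inverse mult.commute)
    ultimately show ?thesis using Lim_transform_eventually by fastforce
  qed
  have "(\<lambda>n. plateau n a c t) \<longlonglongrightarrow> 1 * 1"
    unfolding plateau_def
    using lim[of "t - a"] lim[of "c - t"] True by (intro tendsto_mult) (auto simp: algebra_simps)
  then show ?thesis using True by simp
next
  case False
  have "plateau n a c t = 0" for n
  proof (rule plateau_zero[OF assms])
    have "0 < (c - a) / real (n + 3)" using assms by simp
    then show "t \<notin> {a + (c - a) / real (n + 3)..c - (c - a) / real (n + 3)}" using False by auto
  qed
  then show ?thesis using False by simp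
qed

lemma integrable_mult_bounded_lborel:
  fixes h g :: "real \<Rightarrow> real"
  assumes "integrable lborel h" "g \<in> borel_measurable borel" "\<And>t. \<bar>g t\<bar> \<le> C"
  shows "integrable lborel (\<lambda>t. g t * h t)"
proof (rule Bochner_Integration.integrable_bound[where f = "\<lambda>t. C * h t"])
  show "AE t in lborel. norm (g t * h t) \<le> norm (C * h t)"
    by (auto simp: abs_mult intro!: mult_right_mono order.trans[OF assms(3) abs_ge_self])
qed (use assms in auto)

text \<open>
  Half-open intervals generate the Borel sets and are stable under intersection, so the
  integral vanishes over every Borel set.
\<close>

lemma AE_zero_of_intervals:
  fixes h :: "real \<Rightarrow> real"
  assumes i: "integrable lborel h" and z: "\<And>p q. (\<integral>t. indicator {p<..q} t * h t \<partial>lborel) = 0"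
  shows "AE t in lborel. h t = 0"
proof -
  have si: "set_integrable lborel A h" if "A \<in> sets borel" for A
    unfolding set_integrable_def using i that by (intro integrable_mult_indicator) auto
  have lim: "(\<lambda>n. \<integral>t. indicator {- real n<..real n} t * h t \<partial>lborel) \<longlonglongrightarrow> (\<integral>t. h t \<partial>lborel)"
  proof (rule integral_dominated_convergence[where w = "\<lambda>t. \<bar>h t\<bar>"])
    show "AE t in lborel. (\<lambda>n. indicator {- real n<..real n} t * h t) \<longlonglongrightarrow> h t"
    proof (rule AE_I2)
      fix t :: real
      obtain N where N: "\<bar>t\<bar> < real N" using reals_Archimedean2 by blast
      have "\<forall>\<^sub>F n in sequentially. indicator {- real n<..real n} t * h t = h t"
        using eventually_ge_at_top[of N] by eventually_elim (use N in \<open>auto simp: indicator_def\<close>)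
      then show "(\<lambda>n. indicator {- real n<..real n} t * h t) \<longlonglongrightarrow> h t"
        by (rule tendsto_eventually)
    qed
  qed (use i in \<open>auto simp: indicator_def\<close>)
  then have tot: "(\<integral>t. h t \<partial>lborel) = 0"
    unfolding z using LIMSEQ_unique tendsto_const by blast
  have all: "(LINT t:A|lborel. h t) = 0" if "A \<in> sets borel" for A
  proof -
    have "A \<in> sigma_sets UNIV (range (\<lambda>(a, b). {a<..b::real}))"
      using that by (simp add: borel_sigma_sets_Ioc)
    then show ?thesis
    proof (induction rule: sigma_sets_induct_disjoint[rotated 2, consumes 1])
      case 5
      show "Int_stable (range (\<lambda>(a, b). {a<..b::real}))"
      proof (rule Int_stableI)
        fix X Y assume "X \<in> range (\<lambda>(a, b). {a<..b::real})" "Y \<in> range (\<lambda>(a, b). {a<..b::real})"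
        then obtain a b c d where "X = {a<..b}" "Y = {c<..d}" by auto
        then have "X \<inter> Y = (\<lambda>(a, b). {a<..b}) (max a c, min b d)" by auto
        then show "X \<inter> Y \<in> range (\<lambda>(a, b). {a<..b})" by (rule image_eqI) simp
      qed
    next
      case (3 A)
      then have A: "A \<in> sets borel" by (simp add: borel_sigma_sets_Ioc)
      have "(LINT t:A \<union> (UNIV - A)|lborel. h t) = (LINT t:A|lborel. h t) + (LINT t:UNIV - A|lborel. h t)"
        using A by (intro set_integral_Un si) auto
      moreover have "(LINT t:A \<union> (UNIV - A)|lborel. h t) = 0" using tot by (simp add: set_lebesgue_integral_def)
      ultimately show ?case using 3 by simp
    next
      case (4 A)
      then have A: "A i \<in> sets borel" for i by (auto simp: borel_sigma_sets_Ioc)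
      then have "(LINT t:(\<Union>i. A i)|lborel. h t) = (\<Sum>i. LINT t:A i|lborel. h t)"
        using 4 by (intro lebesgue_integral_countable_add si) (auto simp: disjoint_family_on_def)
      then show ?case using 4 by simp
    qed (use z in \<open>auto simp: set_lebesgue_integral_def\<close>)
  qed
  show ?thesis
    by (rule density_unique_real[where f' = "\<lambda>_. 0", OF i]) (use all in auto)
qed

text \<open>
  The plateaus are admissible and converge boundedly to indicators of intervals.
\<close>

lemma fundamental_lemma:
  fixes h :: "real \<Rightarrow> real"
  assumes i: "integrable lborel h" and z: "\<And>\<eta>. time_test T \<eta> \<Longrightarrow> (\<integral>t. \<eta> t * h t \<partial>lborel) = 0"
    and out: "\<And>t. t \<notin> {0<..<T} \<Longrightarrow> h t = 0"
  shows "AE t in lborel. h t = 0"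
proof (rule AE_zero_of_intervals[OF i])
  fix p q :: real
  define a c where "a = max p 0" and "c = min q T"
  show "(\<integral>t. indicator {p<..q} t * h t \<partial>lborel) = 0"
  proof (cases "a < c")
    case False
    then have "(\<lambda>t. indicator {p<..q} t * h t) = (\<lambda>_. 0)"
      using out by (intro ext) (auto simp: a_def c_def indicator_def)
    then show ?thesis by simp
  next
    case True
    have "(\<lambda>n. \<integral>t. plateau n a c t * h t \<partial>lborel) \<longlonglongrightarrow> (\<integral>t. indicator {p<..q} t * h t \<partial>lborel)"
    proof (rule integral_dominated_convergence[where w = "\<lambda>t. \<bar>h t\<bar>"])
      have "AE t in lborel. t \<noteq> q" by (rule AE_lborel_singleton)
      then show "AE t in lborel. (\<lambda>n. plateau n a c t * h t) \<longlonglongrightarrow> indicator {p<..q} t * h t"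
      proof eventually_elim
        case (elim t)
        have "(\<lambda>n. plateau n a c t * h t) \<longlonglongrightarrow> indicator {a<..<c} t * h t"
          by (intro tendsto_mult plateau_tendsto True tendsto_const)
        moreover have "indicator {a<..<c} t * h t = indicator {p<..q} t * h t"
          using out[of t] elim by (auto simp: a_def c_def indicator_def)
        ultimately show ?case by simp
      qed
      show "AE t in lborel. norm (plateau n a c t * h t) \<le> \<bar>h t\<bar>" for n
        using plateau_bounds[of n a c] by (auto simp: abs_mult intro!: mult_left_le_one_le)
      have "plateau n a c \<in> borel_measurable borel" for n
        by (intro time_test_facts(2)[of T] time_test_plateau True) (auto simp: a_def c_def)
      then show "(\<lambda>t. plateau n a c t * h t) \<in> borel_measurable lborel" for n using i by simp
    qed (use i in auto)
    moreover have "(\<integral>t. plateau n a c t * h t \<partial>lborel) = 0" for n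
      by (intro z time_test_plateau True) (auto simp: a_def c_def)
    ultimately show ?thesis by (simp add: LIMSEQ_const_iff)
  qed
qed

definition primitive :: "(real \<Rightarrow> real) \<Rightarrow> real \<Rightarrow> real" where
  "primitive F t = (\<integral>s. indicator {..<t} s * F s \<partial>lborel)"

lemma integrable_indicator_mult: "integrable lborel F \<Longrightarrow> A \<in> sets borel \<Longrightarrow> integrable lborel (\<lambda>s. indicator A s * F s)"
  for F :: "real \<Rightarrow> real"
  by (rule integrable_mult_bounded_lborel[where C = 1]) (auto simp: indicator_def)

lemma primitive_diff:
  assumes "integrable lborel F" "s \<le> t"
  shows "primitive F t - primitive F s = (\<integral>\<tau>. indicator {s..<t} \<tau> * F \<tau> \<partial>lborel)"
proof -
  have "primitive F t - primitive F s = (\<integral>\<tau>. indicator {..<t} \<tau> * F \<tau> - indicator {..<s} \<tau> * F \<tau> \<partial>lborel)"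
    unfolding primitive_def using assms by (simp add: integrable_indicator_mult)
  also have "\<dots> = (\<integral>\<tau>. indicator {s..<t} \<tau> * F \<tau> \<partial>lborel)"
    using assms(2) by (intro Bochner_Integration.integral_cong) (auto simp: indicator_def)
  finally show ?thesis .
qed

text \<open>
  The primitive has compact support because the integral of \<open>\<phi>\<close> vanishes.
\<close>

lemma primitive_time_test:
  assumes \<phi>: "time_test T \<phi>" and z: "(\<integral>t. \<phi> t \<partial>lborel) = 0"
  shows "time_test T (primitive \<phi>)" "\<And>t. (primitive \<phi> has_real_derivative \<phi> t) (at t)"
proof -
  note f = time_test_facts[OF \<phi>]
  obtain a b where ab: "0 < a" "b < T" "\<And>t. t \<notin> {a..b} \<Longrightarrow> \<phi> t = 0"
    using \<phi> unfolding time_test_def by blast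
  show D: "(primitive \<phi> has_real_derivative \<phi> t) (at t)" for t
  proof -
    define l u where "l = min t a - 1" and "u = t + 1"
    have eq: "primitive \<phi> x = integral {l..x} \<phi>" if "x \<in> {l<..<u}" for x
    proof -
      have si: "set_integrable lborel {l..x} \<phi>"
        unfolding set_integrable_def using f(4) by (intro integrable_mult_indicator) auto
      have out: "\<phi> s = 0" if "s < l" for s 
      proof (rule ab(3))
        have "l \<le> a - 1" by (simp add: l_def)
        then show "s \<notin> {a..b}" using that by auto
      qed
      have "primitive \<phi> x = (LINT s:{l..x}|lborel. \<phi> s)"
        unfolding primitive_def set_lebesgue_integral_def
      proof (rule integral_cong_AE)
        have "AE s in lborel. s \<noteq> x" by (rule AE_lborel_singleton)
        then show "AE s in lborel. indicator {..<x} s * \<phi> s = indicator {l..x} s *\<^sub>R \<phi> s"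
        proof eventually_elim
          case (elim s)
          then show ?case using out[of s] by (cases "s < l") (auto simp: indicator_def)
        qed
      qed (use f(2) in auto)
      then show ?thesis using set_borel_integral_eq_integral(2)[OF si] by simp
    qed
    have "((\<lambda>x. integral {l..x} \<phi>) has_real_derivative \<phi> t) (at t within {l..u})"
      by (rule integral_has_real_derivative) (use f(1) in \<open>auto intro: continuous_on_subset simp: l_def u_def\<close>)
    then have "((\<lambda>x. integral {l..x} \<phi>) has_real_derivative \<phi> t) (at t)"
      by (subst (asm) at_within_interior) (auto simp: l_def u_def)
    then show ?thesis
      by (rule has_field_derivative_transform_within_open[where S = "{l<..<u}"]) (auto simp: eq, auto simp: l_def u_def)
  qed
  show "time_test T (primitive \<phi>)"
    unfolding time_test_def
  proof (intro conjI allI)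
    fix k
    have "Ck (Suc k) (primitive \<phi>)"
      by (rule Ck_SucI[where f' = "\<lambda>x. (*) (\<phi> x)"])
         (use D \<phi> in \<open>auto simp: has_field_derivative_def time_test_def\<close>)
    then show "Ck k (primitive \<phi>)" by (rule Ck_Suc_imp)
  next
    have "primitive \<phi> t = 0" if "t \<notin> {a..b}" for t
    proof (cases "t < a")
      case True
      then have eq: "(\<lambda>s. indicator {..<t} s * \<phi> s) = (\<lambda>_. 0)"
        using ab(3) by (intro ext) (auto simp: indicator_def)
      show ?thesis unfolding primitive_def eq by simp
    next
      case False
      then have eq: "(\<lambda>s. indicator {..<t} s * \<phi> s) = \<phi>"
        using ab(3) that by (intro ext) (auto simp: indicator_def)
      show ?thesis unfolding primitive_def eq by (rule z)
    qed
    then show "\<exists>a b. 0 < a \<and> b < T \<and> (\<forall>t. t \<notin> {a..b} \<longrightarrow> primitive \<phi> t = 0)" using ab by blast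
  qed
qed

lemma primitive_bounded: "integrable lborel F \<Longrightarrow> \<bar>primitive F t\<bar> \<le> (\<integral>s. \<bar>F s\<bar> \<partial>lborel)"
proof -
  assume F: "integrable lborel F"
  have "\<bar>primitive F t\<bar> \<le> (\<integral>s. \<bar>indicator {..<t} s * F s\<bar> \<partial>lborel)"
    unfolding primitive_def by (rule integral_abs_bound)
  also have "\<dots> \<le> (\<integral>s. \<bar>F s\<bar> \<partial>lborel)"
    using integrable_indicator_mult[OF F, of "{..<t}"] F by (intro integral_mono) (auto simp: indicator_def)
  finally show ?thesis .
qed

lemma borel_measurable_primitive: "integrable lborel F \<Longrightarrow> primitive F \<in> borel_measurable borel"
proof -
  assume "integrable lborel F"
  then have [measurable]: "F \<in> borel_measurable borel" by auto
  have m: "(\<lambda>(t, s). indicator {..<t} s * F s) \<in> borel_measurable (borel \<Otimes>\<^sub>M lborel)"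
  proof -
    have "(\<lambda>(t, s). indicator {..<t} s * F s) = (\<lambda>z. if snd z < fst z then F (snd z) else 0)"
      by (auto simp: fun_eq_iff indicator_def)
    moreover have "(\<lambda>z :: real \<times> real. if snd z < fst z then F (snd z) else 0) \<in> borel_measurable (borel \<Otimes>\<^sub>M lborel)"
      by measurable
    ultimately show ?thesis by simp
  qed
  show ?thesis unfolding primitive_def[abs_def]
    by (rule lborel.borel_measurable_lebesgue_integral[OF m])
qed

text \<open>
  Fubini's theorem on the half-plane \<open>s < t\<close>.
\<close>

lemma primitive_duality:
  assumes \<phi>: "integrable lborel \<phi>" "(\<integral>t. \<phi> t \<partial>lborel) = 0" and F: "integrable lborel F"
  shows "(\<integral>t. primitive \<phi> t * F t \<partial>lborel) = - (\<integral>t. \<phi> t * primitive F t \<partial>lborel)"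
proof -
  have [measurable]: "\<phi> \<in> borel_measurable borel" "F \<in> borel_measurable borel" using \<phi> F by auto
  let ?f = "\<lambda>(t, s). (indicator {..<t} s * \<phi> s) * F t"
  have f: "?f = (\<lambda>z. if snd z < fst z then \<phi> (snd z) * F (fst z) else 0)" by (auto simp: fun_eq_iff indicator_def)
  have m: "?f \<in> borel_measurable (lborel \<Otimes>\<^sub>M lborel)" unfolding f by measurable
  have int: "integrable (lborel \<Otimes>\<^sub>M lborel) ?f"
  proof (rule integrableI_bounded[OF m])
    have "(\<integral>\<^sup>+z. ennreal (norm (?f z)) \<partial>(lborel \<Otimes>\<^sub>M lborel)) = (\<integral>\<^sup>+t. \<integral>\<^sup>+s. ennreal (norm (?f (t, s))) \<partial>lborel \<partial>lborel)"
      using m by (subst lborel.nn_integral_fst[symmetric]) auto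
    also have "\<dots> \<le> (\<integral>\<^sup>+t. \<integral>\<^sup>+s. ennreal \<bar>F t\<bar> * ennreal \<bar>\<phi> s\<bar> \<partial>lborel \<partial>lborel)"
      by (intro nn_integral_mono) (auto simp: indicator_def ennreal_mult[symmetric] abs_mult mult.commute)
    also have "\<dots> = (\<integral>\<^sup>+t. ennreal \<bar>F t\<bar> \<partial>lborel) * (\<integral>\<^sup>+s. ennreal \<bar>\<phi> s\<bar> \<partial>lborel)"
      by (simp add: nn_integral_cmult nn_integral_multc)
    also have "\<dots> < \<infinity>" using \<phi>(1) F by (auto simp: integrable_iff_bounded ennreal_mult_less_top)
    finally show "(\<integral>\<^sup>+z. ennreal (norm (?f z)) \<partial>(lborel \<Otimes>\<^sub>M lborel)) < \<infinity>" .
  qed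
  have "(\<integral>t. primitive \<phi> t * F t \<partial>lborel) = (\<integral>t. \<integral>s. (indicator {..<t} s * \<phi> s) * F t \<partial>lborel \<partial>lborel)"
    by (simp add: primitive_def)
  also have "\<dots> = (\<integral>s. \<integral>t. (indicator {..<t} s * \<phi> s) * F t \<partial>lborel \<partial>lborel)"
    using lborel_pair.Fubini_integral[OF int] by simp
  also have "\<dots> = (\<integral>s. \<phi> s * ((\<integral>t. F t \<partial>lborel) - primitive F s) \<partial>lborel)"
  proof (intro Bochner_Integration.integral_cong refl)
    fix s
    have "(\<integral>t. F t \<partial>lborel) - primitive F s = (\<integral>t. F t - indicator {..<s} t * F t \<partial>lborel)"
      unfolding primitive_def using F by (simp add: integrable_indicator_mult)
    also have "\<dots> = (\<integral>t. indicator {..<t} s * F t \<partial>lborel)"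
    proof (rule integral_cong_AE)
      have "AE t in lborel. t \<noteq> s" by (rule AE_lborel_singleton)
      then show "AE t in lborel. F t - indicator {..<s} t * F t = indicator {..<t} s * F t"
        by eventually_elim (auto simp: indicator_def)
      have "(\<lambda>t. indicator {..<t} s * F t) = (\<lambda>t. indicator {s<..} t * F t)" by (auto simp: indicator_def)
      then show "(\<lambda>t. indicator {..<t} s * F t) \<in> borel_measurable lborel" by simp
    qed simp
    finally have "(\<integral>t. F t \<partial>lborel) - primitive F s = (\<integral>t. indicator {..<t} s * F t \<partial>lborel)" .
    moreover have "(\<integral>t. (indicator {..<t} s * \<phi> s) * F t \<partial>lborel) = (\<integral>t. \<phi> s * (indicator {..<t} s * F t) \<partial>lborel)"
      by (simp add: mult_ac)
    ultimately show "(\<integral>t. (indicator {..<t} s * \<phi> s) * F t \<partial>lborel) = \<phi> s * ((\<integral>t. F t \<partial>lborel) - primitive F s)" by simp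
  qed
  also have "\<dots> = (\<integral>s. (\<integral>t. F t \<partial>lborel) * \<phi> s - primitive F s * \<phi> s \<partial>lborel)" by (simp add: algebra_simps)
  also have "\<dots> = - (\<integral>s. \<phi> s * primitive F s \<partial>lborel)"
    using \<phi> integrable_mult_bounded_lborel[OF \<phi>(1) borel_measurable_primitive[OF F] primitive_bounded[OF F]]
    by (simp add: mult.commute)
  finally show ?thesis .
qed

text \<open>
  Subtracting the primitive of \<open>F\<close> leaves a function orthogonal to all derivatives of
  test functions, that is, to all test functions with integral zero. Every test function is one of
  these plus a multiple of a fixed one; this multiple yields the constant.
\<close>

lemma du_Bois_Reymond:
  fixes g F :: "real \<Rightarrow> real"
  assumes T: "T > 0" and g: "integrable lborel g" "\<And>t. t \<notin> {0<..<T} \<Longrightarrow> g t = 0" and F: "integrable lborel F"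
    and weak: "\<And>\<eta> \<eta>'. time_test T \<eta> \<Longrightarrow> (\<And>t. (\<eta> has_real_derivative \<eta>' t) (at t)) \<Longrightarrow> time_test T \<eta>' \<Longrightarrow>
      (\<integral>t. \<eta>' t * g t + \<eta> t * F t \<partial>lborel) = 0"
  shows "\<exists>c. AE t in lborel. t \<in> {0<..<T} \<longrightarrow> g t = c + primitive F t"
proof -
  define D where "D t = indicator {0<..<T} t * (g t - primitive F t)" for t
  have iD: "integrable lborel D"
  proof -
    have "integrable lborel (\<lambda>t. primitive F t * indicator {0<..<T} t)"
      by (rule integrable_mult_bounded_lborel[OF _ borel_measurable_primitive[OF F] primitive_bounded[OF F]]) (use T in \<open>auto intro!: integrable_real_indicator\<close>)
    moreover have "D = (\<lambda>t. g t - primitive F t * indicator {0<..<T} t)" using g(2) by (auto simp: D_def indicator_def fun_eq_iff)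
    ultimately show ?thesis using g by simp
  qed
  have tD: "(\<integral>t. \<phi> t * D t \<partial>lborel) = 0" if \<phi>: "time_test T \<phi>" "(\<integral>t. \<phi> t \<partial>lborel) = 0" for \<phi>
  proof -
    note f = time_test_facts[OF \<phi>(1)]
    note p = primitive_time_test[OF \<phi>]
    obtain C where C: "\<And>t. \<bar>\<phi> t\<bar> \<le> C" using f(3) by blast
    obtain C' where C': "\<And>t. \<bar>primitive \<phi> t\<bar> \<le> C'" using time_test_facts(3)[OF p(1)] by blast
    have i1: "integrable lborel (\<lambda>t. \<phi> t * g t)" by (rule integrable_mult_bounded_lborel[OF g(1) f(2) C])
    have i2: "integrable lborel (\<lambda>t. primitive \<phi> t * F t)"
      by (rule integrable_mult_bounded_lborel[OF F time_test_facts(2)[OF p(1)] C'])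
    have i3: "integrable lborel (\<lambda>t. \<phi> t * primitive F t)"
      using integrable_mult_bounded_lborel[OF f(4) borel_measurable_primitive[OF F] primitive_bounded[OF F]] by (simp add: mult.commute)
    have "\<phi> t * D t = \<phi> t * g t - \<phi> t * primitive F t" for t
      using f(5)[of t] by (cases "t \<in> {0<..<T}") (auto simp: D_def algebra_simps)
    then have "(\<integral>t. \<phi> t * D t \<partial>lborel) = (\<integral>t. \<phi> t * g t \<partial>lborel) - (\<integral>t. \<phi> t * primitive F t \<partial>lborel)"
      using i1 i3 by simp
    also have "\<dots> = (\<integral>t. \<phi> t * g t + primitive \<phi> t * F t \<partial>lborel)"
      using i1 i2 by (simp add: primitive_duality[OF f(4) \<phi>(2) F])
    also have "\<dots> = 0" by (rule weak[OF p \<phi>(1)])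
    finally show ?thesis .
  qed
  \<comment> \<open>The plateaus tend to the indicator of \<open>(0, T)\<close>, so one of them has nonzero integral.\<close>
  obtain \<theta>0 where \<theta>0: "time_test T \<theta>0" "(\<integral>t. \<theta>0 t \<partial>lborel) \<noteq> 0"
  proof -
    have "\<exists>n. (\<integral>t. plateau n 0 T t \<partial>lborel) \<noteq> 0"
    proof (rule ccontr)
      assume "\<not> ?thesis"
      then have z: "(\<integral>t. plateau n 0 T t \<partial>lborel) = 0" for n by simp
      have "(\<lambda>n. \<integral>t. plateau n 0 T t \<partial>lborel) \<longlonglongrightarrow> (\<integral>t. indicator {0<..<T} t \<partial>lborel)"
      proof (rule integral_dominated_convergence[where w = "indicator {0<..<T}"])
        show "AE t in lborel. norm (plateau n 0 T t) \<le> indicator {0<..<T} t" for n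
          using plateau_bounds[of n 0 T] time_test_facts(5)[OF time_test_plateau[of 0 T T n]] T
          by (auto simp: indicator_def)
        show "plateau n 0 T \<in> borel_measurable lborel" for n
          using time_test_facts(2)[OF time_test_plateau[of 0 T T n]] T by simp
      qed (use plateau_tendsto[OF T] T in \<open>auto intro!: integrable_real_indicator\<close>)
      then have "(\<integral>t. indicator {0<..<T} t \<partial>lborel) = (0::real)" unfolding z by (simp add: LIMSEQ_const_iff)
      then show False using T by simp
    qed
    then show ?thesis using that time_test_plateau[of 0 T T] T by auto
  qed
  define c where "c = (\<integral>t. \<theta>0 t * D t \<partial>lborel) / (\<integral>t. \<theta>0 t \<partial>lborel)"
  have "AE t in lborel. D t - c * indicator {0<..<T} t = 0"
  proof (rule fundamental_lemma[where T = T])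
    show "integrable lborel (\<lambda>t. D t - c * indicator {0<..<T} t)"
      using T by (intro Bochner_Integration.integrable_diff iD integrable_mult_right integrable_real_indicator) auto
    show "D t - c * indicator {0<..<T} t = 0" if "t \<notin> {0<..<T}" for t using that by (simp add: D_def)
    fix \<eta> assume \<eta>: "time_test T \<eta>"
    define m where "m = - ((\<integral>t. \<eta> t \<partial>lborel) / (\<integral>t. \<theta>0 t \<partial>lborel))"
    note f = time_test_facts[OF \<eta>] and f0 = time_test_facts[OF \<theta>0(1)]
    obtain C where C: "\<And>t. \<bar>\<eta> t\<bar> \<le> C" using f(3) by blast
    obtain C0 where C0: "\<And>t. \<bar>\<theta>0 t\<bar> \<le> C0" using f0(3) by blast
    have i: "integrable lborel (\<lambda>t. \<eta> t * D t)" "integrable lborel (\<lambda>t. \<theta>0 t * D t)"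
      using integrable_mult_bounded_lborel[OF iD f(2) C] integrable_mult_bounded_lborel[OF iD f0(2) C0] by auto
    have "(\<integral>t. (\<eta> t + m * \<theta>0 t) * D t \<partial>lborel) = 0"
      by (rule tD[OF time_test_lincomb[OF \<eta> \<theta>0(1)]]) (use f(4) f0(4) \<theta>0(2) in \<open>simp add: m_def\<close>)
    moreover have "(\<integral>t. (\<eta> t + m * \<theta>0 t) * D t \<partial>lborel) = (\<integral>t. \<eta> t * D t \<partial>lborel) + m * (\<integral>t. \<theta>0 t * D t \<partial>lborel)"
      using i by (simp add: distrib_right mult.assoc)
    ultimately have "(\<integral>t. \<eta> t * D t \<partial>lborel) = c * (\<integral>t. \<eta> t \<partial>lborel)" by (simp add: c_def m_def)
    moreover have "\<eta> t * (D t - c * indicator {0<..<T} t) = \<eta> t * D t - c * \<eta> t" for t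
      using f(5)[of t] by (cases "t \<in> {0<..<T}") (auto simp: algebra_simps)
    ultimately show "(\<integral>t. \<eta> t * (D t - c * indicator {0<..<T} t) \<partial>lborel) = 0"
      using i f(4) by simp
  qed
  then have "AE t in lborel. t \<in> {0<..<T} \<longrightarrow> g t = c + primitive F t"
    by eventually_elim (auto simp: D_def indicator_def)
  then show ?thesis by blast
qed

lemma constant_of_quadratic_modulus:
  fixes H :: "real \<Rightarrow> real"
  assumes "\<And>s t. s \<le> t \<Longrightarrow> \<bar>H t - H s\<bar> \<le> M * (t - s)\<^sup>2"
  shows "H t = H s"
proof -
  have b: "\<bar>H t - H s\<bar> \<le> M * (t - s)\<^sup>2" for s t
    using assms[of s t] assms[of t s] by (cases "s \<le> t") (auto simp: abs_minus_commute power2_commute)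
  have "(H has_real_derivative 0) (at x)" for x
    unfolding has_field_derivative_iff
  proof (rule Lim_null_comparison)
    show "\<forall>\<^sub>F y in at x. norm ((H y - H x) / (y - x)) \<le> M * \<bar>y - x\<bar>"
      unfolding eventually_at_filter
    proof (intro always_eventually allI impI)
      fix y assume "y \<noteq> x"
      then show "norm ((H y - H x) / (y - x)) \<le> M * \<bar>y - x\<bar>"
        using b[of y x] by (simp add: divide_le_eq power2_eq_square mult.assoc abs_mult[symmetric])
    qed
    have "((\<lambda>y. M * \<bar>y - x\<bar>) \<longlongrightarrow> M * \<bar>x - x\<bar>) (at x)" by (intro tendsto_intros)
    then show "((\<lambda>y. M * \<bar>y - x\<bar>) \<longlongrightarrow> 0) (at x)" by simp
  qed
  then show ?thesis using DERIV_isconst_all by blast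
qed

text \<open>
  The chain rule for the square of an absolutely continuous function with bounded
  derivative. The defect between the two sides is quadratic in the length of the interval, and a
  function with quadratic modulus of continuity is constant.
\<close>

lemma primitive_square:
  assumes F: "integrable lborel F" and C: "AE t in lborel. \<bar>F t\<bar> \<le> C" and C0: "C \<ge> 0" and st: "s \<le> t"
  shows "(c + primitive F t)\<^sup>2 - (c + primitive F s)\<^sup>2 = (\<integral>\<tau>. indicator {s..<t} \<tau> * (2 * (c + primitive F \<tau>) * F \<tau>) \<partial>lborel)"
proof -
  let ?G = "\<lambda>t. c + primitive F t"
  let ?I = "\<lambda>\<tau>. 2 * ?G \<tau> * F \<tau>"
  have mG: "?G \<in> borel_measurable borel" using borel_measurable_primitive[OF F] by simp
  have bG: "\<bar>2 * ?G \<tau>\<bar> \<le> 2 * (\<bar>c\<bar> + (\<integral>s. \<bar>F s\<bar> \<partial>lborel))" for \<tau>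
  proof -
    have "\<bar>2 * ?G \<tau>\<bar> = 2 * \<bar>?G \<tau>\<bar>" by (subst abs_mult) simp
    moreover have "\<bar>?G \<tau>\<bar> \<le> \<bar>c\<bar> + \<bar>primitive F \<tau>\<bar>" by (rule abs_triangle_ineq)
    ultimately show ?thesis using primitive_bounded[OF F, of \<tau>] by argo
  qed
  have I: "integrable lborel ?I"
    by (rule integrable_mult_bounded_lborel[OF F _ bG]) (use mG in measurable)
  have small: "\<bar>\<integral>\<tau>. indicator {p..<q} \<tau> * F \<tau> \<partial>lborel\<bar> \<le> C * (q - p)" if "p \<le> q" for p q
  proof -
    have "\<bar>\<integral>\<tau>. indicator {p..<q} \<tau> * F \<tau> \<partial>lborel\<bar> \<le> (\<integral>\<tau>. \<bar>indicator {p..<q} \<tau> * F \<tau>\<bar> \<partial>lborel)" by (rule integral_abs_bound)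
    also have "\<dots> \<le> (\<integral>\<tau>. C * indicator {p..<q} \<tau> \<partial>lborel)"
    proof (rule integral_mono_AE)
      show "AE \<tau> in lborel. \<bar>indicator {p..<q} \<tau> * F \<tau>\<bar> \<le> C * indicator {p..<q} \<tau>"
        using C by eventually_elim (auto simp: indicator_def)
    qed (use integrable_indicator_mult[OF F] that in auto)
    finally show ?thesis using that by simp
  qed
  have lip: "\<bar>?G q - ?G p\<bar> \<le> C * (q - p)" if "p \<le> q" for p q
    using small[OF that] primitive_diff[OF F that] by simp
  \<comment> \<open>The defect in the chain rule.\<close>
  define H where "H t = (?G t)\<^sup>2 - primitive ?I t" for t
  have "\<bar>H q - H p\<bar> \<le> (2 * C * C) * (q - p)\<^sup>2" if pq: "p \<le> q" for p q
  proof -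
    let ?i = "indicator {p..<q} :: real \<Rightarrow> real"
    have "H q - H p = (?G q + ?G p) * (?G q - ?G p) - (primitive ?I q - primitive ?I p)"
      by (simp add: H_def power2_eq_square algebra_simps)
    also have "?G q - ?G p = (\<integral>\<tau>. ?i \<tau> * F \<tau> \<partial>lborel)" using primitive_diff[OF F pq] by simp
    also have "primitive ?I q - primitive ?I p = (\<integral>\<tau>. ?i \<tau> * ?I \<tau> \<partial>lborel)" by (rule primitive_diff[OF I pq])
    also have "(?G q + ?G p) * (\<integral>\<tau>. ?i \<tau> * F \<tau> \<partial>lborel) - (\<integral>\<tau>. ?i \<tau> * ?I \<tau> \<partial>lborel)
       = (\<integral>\<tau>. (?G q + ?G p) * (?i \<tau> * F \<tau>) - ?i \<tau> * ?I \<tau> \<partial>lborel)"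
      using integrable_indicator_mult[OF F, of "{p..<q}"] integrable_indicator_mult[OF I, of "{p..<q}"] by simp
    finally have "\<bar>H q - H p\<bar> = \<bar>\<integral>\<tau>. (?G q + ?G p) * (?i \<tau> * F \<tau>) - ?i \<tau> * ?I \<tau> \<partial>lborel\<bar>" by simp
    also have "\<dots> \<le> (\<integral>\<tau>. \<bar>(?G q + ?G p) * (?i \<tau> * F \<tau>) - ?i \<tau> * ?I \<tau>\<bar> \<partial>lborel)" by (rule integral_abs_bound)
    also have "\<dots> \<le> (\<integral>\<tau>. (2 * (C * (q - p)) * C) * ?i \<tau> \<partial>lborel)"
    proof (rule integral_mono_AE)
      show "integrable lborel (\<lambda>\<tau>. \<bar>(?G q + ?G p) * (?i \<tau> * F \<tau>) - ?i \<tau> * ?I \<tau>\<bar>)"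
        using integrable_indicator_mult[OF F, of "{p..<q}"] integrable_indicator_mult[OF I, of "{p..<q}"] by simp
      show "integrable lborel (\<lambda>\<tau>. (2 * (C * (q - p)) * C) * ?i \<tau>)"
        by (intro integrable_mult_right integrable_real_indicator) (use pq in auto)
      show "AE \<tau> in lborel. \<bar>(?G q + ?G p) * (?i \<tau> * F \<tau>) - ?i \<tau> * ?I \<tau>\<bar> \<le> (2 * (C * (q - p)) * C) * ?i \<tau>"
        using C
      proof eventually_elim
        case (elim \<tau>)
        show ?case
        proof (cases "\<tau> \<in> {p..<q}")
          case True
          have "\<bar>?G q - ?G \<tau>\<bar> \<le> C * (q - \<tau>)" "\<bar>?G \<tau> - ?G p\<bar> \<le> C * (\<tau> - p)" using lip True by auto
          moreover have "C * (q - \<tau>) \<le> C * (q - p)" "C * (\<tau> - p) \<le> C * (q - p)" using True C0 by (auto intro!: mult_left_mono)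
          moreover have "\<bar>a + d - 2 * b\<bar> \<le> 2 * z" if "\<bar>a - b\<bar> \<le> x" "\<bar>b - d\<bar> \<le> y" "x \<le> z" "y \<le> z" for a b d x y z :: real
            using that by linarith
          ultimately have "\<bar>?G q + ?G p - 2 * ?G \<tau>\<bar> \<le> 2 * (C * (q - p))" by blast
          then have "\<bar>?G q + ?G p - 2 * ?G \<tau>\<bar> * \<bar>F \<tau>\<bar> \<le> 2 * (C * (q - p)) * C"
            using elim C0 pq by (intro mult_mono) auto
          moreover have "(?G q + ?G p) * (?i \<tau> * F \<tau>) - ?i \<tau> * ?I \<tau> = (?G q + ?G p - 2 * ?G \<tau>) * F \<tau>"
            using True by (simp add: algebra_simps)
          ultimately show ?thesis using True by (simp only: abs_mult) simp
        qed simp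
      qed
    qed
    also have "\<dots> = (2 * C * C) * (q - p)\<^sup>2" using pq by (simp add: power2_eq_square)
    finally show ?thesis .
  qed
  from constant_of_quadratic_modulus[OF this, of t s]
  show ?thesis using primitive_diff[OF I st] by (simp add: H_def)
qed

section \<open>Mode sums\<close>

lemma sum_phases: "(\<Sum>\<theta>\<in>{0, - pi / 2}. h \<theta>) = h 0 + (h (- pi / 2) :: real)"
  by simp

text \<open>
  One mode of the kernel contributes products of one mode of each argument.
\<close>

lemma flux_Cons:
  assumes "\<And>i. integrable torus (\<lambda>x. W i x * f x)" "\<And>i. integrable torus (\<lambda>x. W i x * g x)"
  shows "flux ((a, k, \<phi>) # L) W f g = (\<Sum>\<theta>\<in>{0, - pi / 2}. a * (2 * pi) *
      ((\<integral>x. g x * wave k \<theta> x \<partial>torus) * (\<Sum>i\<in>UNIV. k$i * (\<integral>x. W i x * f x * wave k (\<theta> + pi / 2) x \<partial>torus))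
       + (\<integral>x. f x * wave k \<theta> x \<partial>torus) * (\<Sum>i\<in>UNIV. k$i * (\<integral>x. W i x * g x * wave k (\<theta> + pi / 2) x \<partial>torus))))
     + flux L W f g"
proof -
  have one: "(\<integral>x. F x * trig (trig_partial i (mollify ((a, k, \<phi>) # L) h)) x \<partial>torus)
     = a * (2 * pi) * (k$i * ((\<integral>x. h x * wave k 0 x \<partial>torus) * (\<integral>x. F x * wave k (0 + pi / 2) x \<partial>torus)
        + (\<integral>x. h x * wave k (- pi / 2) x \<partial>torus) * (\<integral>x. F x * wave k (- pi / 2 + pi / 2) x \<partial>torus)))
      + (\<integral>x. F x * trig (trig_partial i (mollify L h)) x \<partial>torus)" if F: "integrable torus F" for F h i
  proof -
    let ?h0 = "\<integral>x. h x * wave k 0 x \<partial>torus" and ?h1 = "\<integral>x. h x * wave k (- pi / 2) x \<partial>torus"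
    have "(\<integral>x. F x * trig (trig_partial i (mollify ((a, k, \<phi>) # L) h)) x \<partial>torus)
      = (\<integral>x. a * (2 * pi) * k$i * ?h0 * (F x * wave k (0 + pi / 2) x) + a * (2 * pi) * k$i * ?h1 * (F x * wave k (- pi / 2 + pi / 2) x)
          + F x * trig (trig_partial i (mollify L h)) x \<partial>torus)"
      by (intro Bochner_Integration.integral_cong refl) (simp only: mollify_simps trig_partial_simps trig_simps, simp only: algebra_simps)
    also have "\<dots> = a * (2 * pi) * k$i * ?h0 * (\<integral>x. F x * wave k (0 + pi / 2) x \<partial>torus)
        + a * (2 * pi) * k$i * ?h1 * (\<integral>x. F x * wave k (- pi / 2 + pi / 2) x \<partial>torus)
          + (\<integral>x. F x * trig (trig_partial i (mollify L h)) x \<partial>torus)"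
      using integrable_mult_wave[OF F] integrable_mult_trig[OF F]
      by (simp only: Bochner_Integration.integral_add Bochner_Integration.integrable_add integrable_mult_right integral_mult_right_zero)
    finally show ?thesis by (simp only: algebra_simps)
  qed
  show ?thesis
    unfolding flux_def one[OF assms(1)] one[OF assms(2)] sum_phases sum_3 by (simp add: algebra_simps)
qed

text \<open>
  Plancherel's formula for a kernel with finitely many frequencies; the phases \<open>0\<close> and
  \<open>-\<pi> / 2\<close> are the cosine and sine modes.
\<close>

lemma energy_mode_sum:
  assumes "integrable torus f"
  shows "(\<integral>x. f x * trig (mollify L f) x \<partial>torus) = (\<Sum>(a, k, \<phi>)\<leftarrow>L. a * (\<Sum>\<theta>\<in>{0, - pi / 2}. (\<integral>x. f x * wave k \<theta> x \<partial>torus)\<^sup>2))"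
proof (induction L)
  case (Cons z L)
  obtain a k \<phi> where z: "z = (a, k, \<phi>)" by (cases z)
  let ?h0 = "\<integral>x. f x * wave k 0 x \<partial>torus" and ?h1 = "\<integral>x. f x * wave k (- pi / 2) x \<partial>torus"
  have "(\<integral>x. f x * trig (mollify (z # L) f) x \<partial>torus)
    = (\<integral>x. a * ?h0 * (f x * wave k 0 x) + a * ?h1 * (f x * wave k (- pi / 2) x) + f x * trig (mollify L f) x \<partial>torus)"
    by (intro Bochner_Integration.integral_cong refl) (simp only: z mollify_simps trig_simps, simp only: algebra_simps)
  also have "\<dots> = a * ?h0 * ?h0 + a * ?h1 * ?h1 + (\<integral>x. f x * trig (mollify L f) x \<partial>torus)"
    using integrable_mult_wave[OF assms] integrable_mult_trig[OF assms]
    by (simp only: Bochner_Integration.integral_add Bochner_Integration.integrable_add integrable_mult_right integral_mult_right_zero)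
  finally show ?case
    using Cons by (simp only: z list.map sum_list.Cons case_prod_conv sum_phases) (simp add: power2_eq_square algebra_simps)
qed simp

text \<open>
  The right-hand side of the momentum equation for component \<open>j\<close>, paired with a wave;
  the phase shift is the derivative moved onto the wave.
\<close>

definition momentum_rate :: "(3 \<Rightarrow> real^3 \<Rightarrow> real) \<Rightarrow> (3 \<Rightarrow> real^3 \<Rightarrow> real) \<Rightarrow> (3 \<Rightarrow> real^3 \<Rightarrow> real) \<Rightarrow> (real^3 \<Rightarrow> real) \<Rightarrow>
    real^3 \<Rightarrow> real \<Rightarrow> 3 \<Rightarrow> real" where
  "momentum_rate u v B P k \<theta> j = 2 * pi * ((\<Sum>i\<in>UNIV. k$i * (\<integral>x. u i x * v j x * wave k (\<theta> + pi / 2) x \<partial>torus))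
     + k$j * (\<integral>x. P x * wave k (\<theta> + pi / 2) x \<partial>torus)
     - (\<Sum>i\<in>UNIV. k$i * (\<integral>x. B i x * B j x * wave k (\<theta> + pi / 2) x \<partial>torus)))"

definition induction_rate :: "(3 \<Rightarrow> real^3 \<Rightarrow> real) \<Rightarrow> (3 \<Rightarrow> real^3 \<Rightarrow> real) \<Rightarrow> (3 \<Rightarrow> real^3 \<Rightarrow> real) \<Rightarrow>
    real^3 \<Rightarrow> real \<Rightarrow> 3 \<Rightarrow> real" where
  "induction_rate u v B k \<theta> j = 2 * pi * ((\<Sum>i\<in>UNIV. k$i * (\<integral>x. u i x * B j x * wave k (\<theta> + pi / 2) x \<partial>torus))
     - (\<Sum>i\<in>UNIV. k$i * (\<integral>x. B i x * v j x * wave k (\<theta> + pi / 2) x \<partial>torus)))"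

text \<open>
  The pressure contributes a multiple of \<open>\<Sum>\<^sub>j k\<^sub>j\<close> times the modes of \<open>v\<^sub>j\<close>, which
  is zero as \<open>v\<close> is divergence-free. The two terms with the magnetic field as transporting field
  combine to a flux that is symmetric in \<open>v\<close> and \<open>B\<close>.
\<close>

lemma energy_flux:
  assumes v: "\<And>j. L3 (v j)" and B: "\<And>j. L3 (B j)" and uv: "\<And>i j. integrable torus (\<lambda>x. u i x * v j x)"
    and uB: "\<And>i j. integrable torus (\<lambda>x. u i x * B j x)" and div: "div_free v" and L: "frequencies L \<subseteq> lattice"
  shows "(\<Sum>(a, k, \<phi>)\<leftarrow>L. a * (\<Sum>\<theta>\<in>{0, - pi / 2}. \<Sum>j\<in>UNIV.
      2 * (\<integral>x. v j x * wave k \<theta> x \<partial>torus) * momentum_rate u v B P k \<theta> j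
      + 2 * (\<integral>x. B j x * wave k \<theta> x \<partial>torus) * induction_rate u v B k \<theta> j))
    = (\<Sum>j\<in>UNIV. flux L u (v j) (v j) + flux L u (B j) (B j) - 2 * flux L B (v j) (B j))"
  using L
proof (induction L)
  case Nil
  then show ?case by (simp add: flux_def)
next
  case (Cons z L)
  obtain a k \<phi> where z: "z = (a, k, \<phi>)" by (cases z)
  with Cons have k: "k \<in> lattice" by auto
  note BB = L3_integrable_mult[OF B B] and Bv = L3_integrable_mult[OF B v]
  let ?w = "\<lambda>f \<theta>. \<integral>x. f x * wave k \<theta> x \<partial>torus"
  let ?t = "\<lambda>W f \<theta>. \<Sum>i\<in>UNIV. k$i * (\<integral>x. W i x * f x * wave k (\<theta> + pi / 2) x \<partial>torus)"
  have mode: "(\<Sum>j\<in>UNIV. 2 * ?w (v j) \<theta> * momentum_rate u v B P k \<theta> j + 2 * ?w (B j) \<theta> * induction_rate u v B k \<theta> j)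
    = (\<Sum>j\<in>UNIV. 2 * pi * (2 * (?w (v j) \<theta> * ?t u (v j) \<theta>)) + 2 * pi * (2 * (?w (B j) \<theta> * ?t u (B j) \<theta>))
        - 2 * (2 * pi * (?w (B j) \<theta> * ?t B (v j) \<theta> + ?w (v j) \<theta> * ?t B (B j) \<theta>)))" for \<theta>
  proof -
    have "(\<Sum>j\<in>UNIV. 2 * ?w (v j) \<theta> * momentum_rate u v B P k \<theta> j + 2 * ?w (B j) \<theta> * induction_rate u v B k \<theta> j)
      = (\<Sum>j\<in>UNIV. (2 * pi * (2 * (?w (v j) \<theta> * ?t u (v j) \<theta>)) + 2 * pi * (2 * (?w (B j) \<theta> * ?t u (B j) \<theta>))
        - 2 * (2 * pi * (?w (B j) \<theta> * ?t B (v j) \<theta> + ?w (v j) \<theta> * ?t B (B j) \<theta>)))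
        + 4 * pi * ?w P (\<theta> + pi / 2) * (k$j * ?w (v j) \<theta>))"
      unfolding momentum_rate_def induction_rate_def
      by (intro sum.cong refl) (simp only: algebra_simps)
    also have "\<dots> = (\<Sum>j\<in>UNIV. 2 * pi * (2 * (?w (v j) \<theta> * ?t u (v j) \<theta>)) + 2 * pi * (2 * (?w (B j) \<theta> * ?t u (B j) \<theta>))
        - 2 * (2 * pi * (?w (B j) \<theta> * ?t B (v j) \<theta> + ?w (v j) \<theta> * ?t B (B j) \<theta>)))
        + 4 * pi * ?w P (\<theta> + pi / 2) * (\<Sum>j\<in>UNIV. k$j * ?w (v j) \<theta>)"
      by (simp only: sum.distrib[of _ "\<lambda>j. 4 * pi * ?w P (\<theta> + pi / 2) * (k$j * ?w (v j) \<theta>)"] sum_distrib_left[symmetric])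
    finally show ?thesis using div k by (simp add: div_free_def)
  qed
  have fl: "flux (z # L) u (v j) (v j) + flux (z # L) u (B j) (B j) - 2 * flux (z # L) B (v j) (B j)
     = (\<Sum>\<theta>\<in>{0, - pi / 2}. a * (2 * pi * (2 * (?w (v j) \<theta> * ?t u (v j) \<theta>)) + 2 * pi * (2 * (?w (B j) \<theta> * ?t u (B j) \<theta>))
        - 2 * (2 * pi * (?w (B j) \<theta> * ?t B (v j) \<theta> + ?w (v j) \<theta> * ?t B (B j) \<theta>))))
       + (flux L u (v j) (v j) + flux L u (B j) (B j) - 2 * flux L B (v j) (B j))" for j
    unfolding z flux_Cons[OF uv uv] flux_Cons[OF uB uB] flux_Cons[OF Bv BB]
    unfolding sum_phases by (simp add: algebra_simps)
  have "frequencies L \<subseteq> lattice" using Cons.prems z by simp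
  note IH = Cons.IH[OF this]
  let ?X = "\<lambda>\<theta> j. 2 * pi * (2 * (?w (v j) \<theta> * ?t u (v j) \<theta>)) + 2 * pi * (2 * (?w (B j) \<theta> * ?t u (B j) \<theta>))
        - 2 * (2 * pi * (?w (B j) \<theta> * ?t B (v j) \<theta> + ?w (v j) \<theta> * ?t B (B j) \<theta>))"
  have swap: "a * (\<Sum>\<theta>\<in>{0, - pi / 2}. \<Sum>j\<in>UNIV. ?X \<theta> j) = (\<Sum>j\<in>UNIV. \<Sum>\<theta>\<in>{0, - pi / 2}. a * ?X \<theta> j)"
    unfolding sum.swap[of _ UNIV "{0, - pi / 2}"] sum_distrib_left ..
  show ?case
    unfolding fl
    by (simp only: z list.map sum_list.Cons case_prod_conv mode IH swap
        sum.distrib[of _ "\<lambda>j. flux L u (v j) (v j) + flux L u (B j) (B j) - 2 * flux L B (v j) (B j)"])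
qed

section \<open>Time evolution\<close>

text \<open>
  \<open>E\<close> agrees almost everywhere with an absolutely continuous function whose derivative
  is \<open>D\<close>. The integrated form is stable under linear combinations.
\<close>

definition evolves :: "real \<Rightarrow> (real \<Rightarrow> real) \<Rightarrow> (real \<Rightarrow> real) \<Rightarrow> bool" where
  "evolves T E D \<longleftrightarrow> (\<exists>G D'. integrable lborel D' \<and> (AE t in lborel. t \<in> {0<..<T} \<longrightarrow> E t = G t \<and> D t = D' t) \<and>
     (\<forall>s t. s \<le> t \<longrightarrow> G t - G s = (\<integral>\<tau>. indicator {s..<t} \<tau> * D' \<tau> \<partial>lborel)))"

lemma evolves_zero: "evolves T (\<lambda>_. 0) (\<lambda>_. 0)"
  unfolding evolves_def by (intro exI[of _ "\<lambda>_. 0"]) auto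

lemma evolves_cong:
  assumes "evolves T E D" "AE t in lborel. t \<in> {0<..<T} \<longrightarrow> E t = E' t \<and> D t = D' t"
  shows "evolves T E' D'"
proof -
  from assms(1) obtain G X where G: "integrable lborel X" "AE t in lborel. t \<in> {0<..<T} \<longrightarrow> E t = G t \<and> D t = X t"
    "\<forall>s t. s \<le> t \<longrightarrow> G t - G s = (\<integral>\<tau>. indicator {s..<t} \<tau> * X \<tau> \<partial>lborel)"
    unfolding evolves_def by blast
  have "AE t in lborel. t \<in> {0<..<T} \<longrightarrow> E' t = G t \<and> D' t = X t"
    using G(2) assms(2) by eventually_elim auto
  then show ?thesis unfolding evolves_def using G(1,3) by blast
qed

lemma evolves_add:
  assumes "evolves T E D" "evolves T E' D'"
  shows "evolves T (\<lambda>t. E t + E' t) (\<lambda>t. D t + D' t)"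
proof -
  from assms(1) obtain G X where i1: "integrable lborel X"
    and G1: "AE t in lborel. t \<in> {0<..<T} \<longrightarrow> E t = G t \<and> D t = X t"
    "\<forall>s t. s \<le> t \<longrightarrow> G t - G s = (\<integral>\<tau>. indicator {s..<t} \<tau> * X \<tau> \<partial>lborel)"
    unfolding evolves_def by blast
  from assms(2) obtain G' X' where i2: "integrable lborel X'"
    and G2: "AE t in lborel. t \<in> {0<..<T} \<longrightarrow> E' t = G' t \<and> D' t = X' t"
    "\<forall>s t. s \<le> t \<longrightarrow> G' t - G' s = (\<integral>\<tau>. indicator {s..<t} \<tau> * X' \<tau> \<partial>lborel)"
    unfolding evolves_def by blast
  show ?thesis unfolding evolves_def
  proof (intro exI conjI allI impI)
    show "integrable lborel (\<lambda>t. X t + X' t)" using i1 i2 by simp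
    show "AE t in lborel. t \<in> {0<..<T} \<longrightarrow> E t + E' t = G t + G' t \<and> D t + D' t = X t + X' t"
      using G1(1) G2(1) by eventually_elim auto
    fix s t :: real assume "s \<le> t"
    then have "G t - G s = (\<integral>\<tau>. indicator {s..<t} \<tau> * X \<tau> \<partial>lborel)" "G' t - G' s = (\<integral>\<tau>. indicator {s..<t} \<tau> * X' \<tau> \<partial>lborel)"
      using G1(2) G2(2) by blast+
    then show "G t + G' t - (G s + G' s) = (\<integral>\<tau>. indicator {s..<t} \<tau> * (X \<tau> + X' \<tau>) \<partial>lborel)"
      using integrable_indicator_mult[OF i1, of "{s..<t}"] integrable_indicator_mult[OF i2, of "{s..<t}"]
      by (simp add: distrib_left)
  qed
qed

lemma evolves_cmult:
  assumes "evolves T E D" shows "evolves T (\<lambda>t. c * E t) (\<lambda>t. c * D t)"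
proof -
  from assms obtain G X where i: "integrable lborel X"
    and G: "AE t in lborel. t \<in> {0<..<T} \<longrightarrow> E t = G t \<and> D t = X t"
    "\<forall>s t. s \<le> t \<longrightarrow> G t - G s = (\<integral>\<tau>. indicator {s..<t} \<tau> * X \<tau> \<partial>lborel)"
    unfolding evolves_def by blast
  show ?thesis unfolding evolves_def
  proof (intro exI conjI allI impI)
    show "integrable lborel (\<lambda>t. c * X t)" using i by simp
    show "AE t in lborel. t \<in> {0<..<T} \<longrightarrow> c * E t = c * G t \<and> c * D t = c * X t"
      using G(1) by eventually_elim auto
    fix s t :: real assume "s \<le> t"
    then have "c * (G t - G s) = c * (\<integral>\<tau>. indicator {s..<t} \<tau> * X \<tau> \<partial>lborel)" using G(2) by simp
    also have "\<dots> = (\<integral>\<tau>. c * (indicator {s..<t} \<tau> * X \<tau>) \<partial>lborel)" by simp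
    finally show "c * G t - c * G s = (\<integral>\<tau>. indicator {s..<t} \<tau> * (c * X \<tau>) \<partial>lborel)"
      by (simp add: right_diff_distrib mult.left_commute)
  qed
qed

lemma evolves_sum: "finite I \<Longrightarrow> (\<And>i. i \<in> I \<Longrightarrow> evolves T (E i) (D i)) \<Longrightarrow> evolves T (\<lambda>t. \<Sum>i\<in>I. E i t) (\<lambda>t. \<Sum>i\<in>I. D i t)"
  by (induction I rule: finite_induct) (auto intro: evolves_zero evolves_add)

lemma evolves_sum_list:
  "(\<And>z. z \<in> set L \<Longrightarrow> evolves T (E z) (D z)) \<Longrightarrow> evolves T (\<lambda>t. \<Sum>z\<leftarrow>L. E z t) (\<lambda>t. \<Sum>z\<leftarrow>L. D z t)"
  by (induction L) (auto intro: evolves_zero evolves_add)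

abbreviation cylinder :: "real \<Rightarrow> (real \<times> (real^3)) measure" where
  "cylinder T \<equiv> restrict_space borel ({0<..<T} \<times> UNIV)"

lemma borel_measurable_torus_integral:
  fixes A :: "real \<Rightarrow> real^3 \<Rightarrow> real"
  assumes "(\<lambda>z. A (fst z) (snd z)) \<in> borel_measurable (cylinder T)"
  shows "(\<lambda>t. indicator {0<..<T} t * (\<integral>x. A t x \<partial>torus)) \<in> borel_measurable borel"
proof -
  have "{0<..<T} \<times> (UNIV :: (real^3) set) \<in> sets borel"
    by (intro borel_open open_Times) auto
  then have "(\<lambda>z :: real \<times> (real^3). indicator ({0<..<T} \<times> UNIV) z *\<^sub>R A (fst z) (snd z)) \<in> borel_measurable borel"
    using assms by (subst (asm) borel_measurable_restrict_space_iff) auto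
  then have "(\<lambda>z. indicator {0<..<T} (fst z) * A (fst z) (snd z)) \<in> borel_measurable (borel \<Otimes>\<^sub>M borel)"
    unfolding borel_prod by (auto simp: indicator_times)
  moreover have "(\<lambda>z. (fst z, snd z)) \<in> borel \<Otimes>\<^sub>M torus \<rightarrow>\<^sub>M (borel \<Otimes>\<^sub>M borel :: (real \<times> (real^3)) measure)"
    using measurable_compose[OF measurable_snd id_torus_borel] by (intro measurable_Pair measurable_fst) auto
  ultimately have "(\<lambda>(t, x). indicator {0<..<T} t * A t x) \<in> borel_measurable (borel \<Otimes>\<^sub>M torus)"
    by (auto dest: measurable_compose simp: case_prod_unfold)
  then have "(\<lambda>t. \<integral>x. indicator {0<..<T} t * A t x \<partial>torus) \<in> borel_measurable borel"
    by (rule torus.borel_measurable_lebesgue_integral)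
  then show ?thesis by simp
qed

lemma integrable_time_bounded:
  fixes a :: "real \<Rightarrow> real"
  assumes "T > 0" "(\<lambda>t. indicator {0<..<T} t * a t) \<in> borel_measurable borel" "AE t in lborel. t \<in> {0<..<T} \<longrightarrow> \<bar>a t\<bar> \<le> C"
  shows "integrable lborel (\<lambda>t. indicator {0<..<T} t * a t)"
proof (rule Bochner_Integration.integrable_bound[where f = "\<lambda>t. C * indicator {0<..<T} t"])
  show "integrable lborel (\<lambda>t. C * indicator {0<..<T} t)"
    by (intro integrable_mult_right integrable_real_indicator) (use assms(1) in auto)
  show "AE t in lborel. norm (indicator {0<..<T} t * a t) \<le> norm (C * indicator {0<..<T} t)"
    using assms(3) by eventually_elim (auto simp: indicator_def)
qed (use assms(2) in simp)

text \<open>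
  The weak equation for one mode makes it absolutely continuous, and its square
  satisfies the chain rule. The bound \<open>C\<close> on the derivative is what the chain rule asks for.
\<close>

lemma weak_time_derivative:
  fixes A \<Phi> :: "real \<Rightarrow> real^3 \<Rightarrow> real"
  assumes T: "T > 0" and C: "C \<ge> 0"
    and mA: "(\<lambda>z. A (fst z) (snd z)) \<in> borel_measurable (cylinder T)"
    and mF: "(\<lambda>z. \<Phi> (fst z) (snd z)) \<in> borel_measurable (cylinder T)"
    and iA: "AE t in lborel. t \<in> {0<..<T} \<longrightarrow> integrable torus (A t) \<and> \<bar>\<integral>x. A t x \<partial>torus\<bar> \<le> C"
    and iF: "AE t in lborel. t \<in> {0<..<T} \<longrightarrow> integrable torus (\<Phi> t) \<and> \<bar>\<integral>x. \<Phi> t x \<partial>torus\<bar> \<le> C"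
    and weak: "\<And>\<eta> \<eta>'. time_test T \<eta> \<Longrightarrow> (\<And>t. (\<eta> has_real_derivative \<eta>' t) (at t)) \<Longrightarrow> time_test T \<eta>' \<Longrightarrow>
      (LINT t:{0<..<T}|lborel. LINT x:cell|lborel. \<eta>' t * A t x + \<eta> t * \<Phi> t x) = 0"
  shows "evolves T (\<lambda>t. (\<integral>x. A t x \<partial>torus)\<^sup>2)
     (\<lambda>t. 2 * (\<integral>x. A t x \<partial>torus) * (\<integral>x. \<Phi> t x \<partial>torus))"
proof -
  define a where "a t = indicator {0<..<T} t * (\<integral>x. A t x \<partial>torus)" for t
  define F where "F t = indicator {0<..<T} t * (\<integral>x. \<Phi> t x \<partial>torus)" for t
  have ma: "a \<in> borel_measurable borel" and mf: "F \<in> borel_measurable borel"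
    unfolding a_def[abs_def] F_def[abs_def] using borel_measurable_torus_integral[OF mA] borel_measurable_torus_integral[OF mF] by auto
  have ba: "AE t in lborel. t \<in> {0<..<T} \<longrightarrow> \<bar>\<integral>x. A t x \<partial>torus\<bar> \<le> C" using iA by eventually_elim auto
  have bf: "AE t in lborel. t \<in> {0<..<T} \<longrightarrow> \<bar>\<integral>x. \<Phi> t x \<partial>torus\<bar> \<le> C" using iF by eventually_elim auto
  have ia: "integrable lborel a" unfolding a_def[abs_def]
    by (rule integrable_time_bounded[OF T _ ba]) (use ma in \<open>simp add: a_def[abs_def]\<close>)
  have iFF: "integrable lborel F" unfolding F_def[abs_def]
    by (rule integrable_time_bounded[OF T _ bf]) (use mf in \<open>simp add: F_def[abs_def]\<close>)
  have bF: "AE t in lborel. \<bar>F t\<bar> \<le> C" using bf by eventually_elim (use C in \<open>auto simp: F_def indicator_def\<close>)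
  have "\<exists>c. AE t in lborel. t \<in> {0<..<T} \<longrightarrow> a t = c + primitive F t"
  proof (rule du_Bois_Reymond[OF T ia _ iFF])
    show "a t = 0" if "t \<notin> {0<..<T}" for t using that by (simp add: a_def)
    fix \<eta> \<eta>' assume \<eta>: "time_test T \<eta>" "\<And>t. (\<eta> has_real_derivative \<eta>' t) (at t)" "time_test T \<eta>'"
    have "(\<integral>t. \<eta>' t * a t + \<eta> t * F t \<partial>lborel) = (LINT t:{0<..<T}|lborel. LINT x:cell|lborel. \<eta>' t * A t x + \<eta> t * \<Phi> t x)"
      unfolding set_lebesgue_integral_def[of lborel "{0<..<T}"] integral_torus[symmetric]
    proof (rule integral_cong_AE)
      show "AE t in lborel. \<eta>' t * a t + \<eta> t * F t = indicator {0<..<T} t *\<^sub>R (\<integral>x. \<eta>' t * A t x + \<eta> t * \<Phi> t x \<partial>torus)"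
        using iA iF by eventually_elim (auto simp: a_def F_def indicator_def)
      show "(\<lambda>t. \<eta>' t * a t + \<eta> t * F t) \<in> borel_measurable lborel"
        using ma mf time_test_facts(2)[OF \<eta>(1)] time_test_facts(2)[OF \<eta>(3)] by measurable
      have e: "(\<lambda>z. \<eta> (fst z)) \<in> borel_measurable (cylinder T)" "(\<lambda>z. \<eta>' (fst z)) \<in> borel_measurable (cylinder T)"
        by (intro measurable_restrict_space1 borel_measurable_continuous_onI continuous_on_compose2[OF time_test_facts(1)[OF \<eta>(1)]]
            continuous_on_compose2[OF time_test_facts(1)[OF \<eta>(3)]] continuous_intros; simp)+
      have "(\<lambda>z. \<eta>' (fst z) * A (fst z) (snd z) + \<eta> (fst z) * \<Phi> (fst z) (snd z)) \<in> borel_measurable (cylinder T)"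
        using e mA mF by measurable
      from borel_measurable_torus_integral[of "\<lambda>t x. \<eta>' t * A t x + \<eta> t * \<Phi> t x", OF this]
      show "(\<lambda>t. indicator {0<..<T} t *\<^sub>R (\<integral>x. \<eta>' t * A t x + \<eta> t * \<Phi> t x \<partial>torus)) \<in> borel_measurable lborel" by simp
    qed
    then show "(\<integral>t. \<eta>' t * a t + \<eta> t * F t \<partial>lborel) = 0" using weak[OF \<eta>] by simp
  qed
  then obtain c where c: "AE t in lborel. t \<in> {0<..<T} \<longrightarrow> a t = c + primitive F t" by blast
  show ?thesis unfolding evolves_def
  proof (intro exI conjI allI impI)
    show "AE t in lborel. t \<in> {0<..<T} \<longrightarrow> (\<integral>x. A t x \<partial>torus)\<^sup>2 = (c + primitive F t)\<^sup>2 \<and>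
        2 * (\<integral>x. A t x \<partial>torus) * (\<integral>x. \<Phi> t x \<partial>torus) = 2 * (c + primitive F t) * F t"
      using c by eventually_elim (auto simp: a_def F_def)
    show "integrable lborel (\<lambda>t. 2 * (c + primitive F t) * F t)"
    proof (rule integrable_mult_bounded_lborel[OF iFF])
      show "(\<lambda>t. 2 * (c + primitive F t)) \<in> borel_measurable borel" using borel_measurable_primitive[OF iFF] by measurable
      show "\<bar>2 * (c + primitive F t)\<bar> \<le> 2 * (\<bar>c\<bar> + (\<integral>s. \<bar>F s\<bar> \<partial>lborel))" for t
        using primitive_bounded[OF iFF, of t] abs_triangle_ineq[of c "primitive F t"] by (subst abs_mult) simp
    qed
    fix s t :: real assume "s \<le> t"
    then show "(c + primitive F t)\<^sup>2 - (c + primitive F s)\<^sup>2 = (\<integral>\<tau>. indicator {s..<t} \<tau> * (2 * (c + primitive F \<tau>) * F \<tau>) \<partial>lborel)"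
      by (rule primitive_square[OF iFF bF C])
  qed
qed

lemma weak_constraint:
  fixes A :: "real \<Rightarrow> real^3 \<Rightarrow> real"
  assumes T: "T > 0"
    and mA: "(\<lambda>z. A (fst z) (snd z)) \<in> borel_measurable (cylinder T)"
    and iA: "AE t in lborel. t \<in> {0<..<T} \<longrightarrow> \<bar>\<integral>x. A t x \<partial>torus\<bar> \<le> C"
    and weak: "\<And>\<eta>. time_test T \<eta> \<Longrightarrow> (LINT t:{0<..<T}|lborel. LINT x:cell|lborel. \<eta> t * A t x) = 0"
  shows "AE t in lborel. t \<in> {0<..<T} \<longrightarrow> (\<integral>x. A t x \<partial>torus) = 0"
proof -
  let ?a = "\<lambda>t. indicator {0<..<T} t * (\<integral>x. A t x \<partial>torus)"
  have "AE t in lborel. ?a t = 0"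
  proof (rule fundamental_lemma[where T = T])
    show "integrable lborel ?a"
      by (rule integrable_time_bounded[OF T borel_measurable_torus_integral[OF mA] iA])
    fix \<eta> assume \<eta>: "time_test T \<eta>"
    have "(\<integral>t. \<eta> t * ?a t \<partial>lborel) = (LINT t:{0<..<T}|lborel. LINT x:cell|lborel. \<eta> t * A t x)"
      unfolding set_lebesgue_integral_def[of lborel "{0<..<T}"] integral_torus[symmetric] by (simp add: mult_ac)
    then show "(\<integral>t. \<eta> t * ?a t \<partial>lborel) = 0" using weak[OF \<eta>] by simp
  qed simp
  then show ?thesis by eventually_elim (auto simp: indicator_def)
qed

section \<open>Energy conservation\<close>

lemma AE_lebesgue_on_time:
  "(AE t in lebesgue_on {0<..<T}. P t) \<longleftrightarrow> (AE t in lborel. t \<in> {0<..<T} \<longrightarrow> P t)" for T :: real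
  by (simp add: AE_restrict_space_iff AE_completion_iff)

lemma Lq_norm_square: "(Lq_norm 2 f)\<^sup>2 = (\<integral>x. (norm (f x))\<^sup>2 \<partial>torus)"
proof -
  have I: "(LINT x:cell|lborel. norm (f x) powr 2) = (\<integral>x. (norm (f x))\<^sup>2 \<partial>torus)"
    unfolding integral_torus[symmetric] by simp
  have "0 \<le> (\<integral>x. (norm (f x))\<^sup>2 \<partial>torus)" by (intro integral_nonneg_AE) auto
  then show ?thesis unfolding Lq_norm_def I
    by (cases "(\<integral>x. (norm (f x))\<^sup>2 \<partial>torus) = 0") (simp_all add: powr_power)
qed

lemma Lq_2_components:
  fixes f :: "real^3 \<Rightarrow> real^3"
  assumes "Lq 2 f"
  shows "(\<lambda>x. f x $ j) \<in> borel_measurable borel" "torus_periodic (\<lambda>x. f x $ j)" "integrable torus (\<lambda>x. (f x $ j)\<^sup>2)"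
    "integrable torus (\<lambda>x. (norm (f x))\<^sup>2)" "(Lq_norm 2 f)\<^sup>2 = (\<Sum>j\<in>UNIV. \<integral>x. (f x $ j)\<^sup>2 \<partial>torus)"
    "(\<integral>x. (f x $ j)\<^sup>2 \<partial>torus) \<le> (Lq_norm 2 f)\<^sup>2"
proof -
  have m: "f \<in> borel_measurable borel" and p: "torus_periodic f" and i: "integrable torus (\<lambda>x. (norm (f x))\<^sup>2)"
    using assms by (auto simp: Lq_def integrable_torus[symmetric])
  show mj: "(\<lambda>x. f x $ j) \<in> borel_measurable borel" for j by (rule borel_measurable_vec_component[OF m])
  show "torus_periodic (\<lambda>x. f x $ j)" using p by (simp add: torus_periodic_def)
  have le: "\<bar>(f x $ j)\<^sup>2\<bar> \<le> (norm (f x))\<^sup>2" for x j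
    using power_mono[OF component_le_norm_cart[of "f x" j] abs_ge_zero, of 2] by simp
  show ij: "integrable torus (\<lambda>x. (f x $ j)\<^sup>2)" for j
    by (rule integrable_torus_dominated[OF i _ le]) (use borel_measurable_torus[OF mj] in measurable)
  show "integrable torus (\<lambda>x. (norm (f x))\<^sup>2)" by fact
  have "(norm (f x))\<^sup>2 = (\<Sum>j\<in>UNIV. (f x $ j)\<^sup>2)" for x
    by (simp add: norm_vec_def L2_set_def sum_nonneg)
  then show "(Lq_norm 2 f)\<^sup>2 = (\<Sum>j\<in>UNIV. \<integral>x. (f x $ j)\<^sup>2 \<partial>torus)"
    unfolding Lq_norm_square using ij by simp
  show "(\<integral>x. (f x $ j)\<^sup>2 \<partial>torus) \<le> (Lq_norm 2 f)\<^sup>2"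
    unfolding Lq_norm_square using le by (intro integral_mono ij i) auto
qed

lemma Lq_1_integrable:
  fixes f :: "real^3 \<Rightarrow> real"
  assumes "Lq 1 f"
  shows "integrable torus f" "(\<integral>x. \<bar>f x\<bar> \<partial>torus) = Lq_norm 1 f"
proof -
  have i: "integrable torus (\<lambda>x. \<bar>f x\<bar>)" and m: "f \<in> borel_measurable borel"
    using assms by (auto simp: Lq_def integrable_torus[symmetric])
  show "integrable torus f" by (rule integrable_torus_dominated[OF i borel_measurable_torus[OF m]]) simp
  have "0 \<le> (\<integral>x. \<bar>f x\<bar> \<partial>torus)" by (intro integral_nonneg_AE) auto
  then show "(\<integral>x. \<bar>f x\<bar> \<partial>torus) = Lq_norm 1 f" by (simp add: Lq_norm_def integral_torus[symmetric])
qed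

lemma partial_wave: "partial i (\<lambda>x. (c * wave k \<theta> x) *\<^sub>R w) x = (c * (2 * pi * k$i * wave k (\<theta> + pi / 2) x)) *\<^sub>R w"
proof -
  have "((\<lambda>x. (c * wave k \<theta> x) *\<^sub>R w) has_derivative (\<lambda>h. (c * (2 * pi * (k \<bullet> h) * wave k (\<theta> + pi / 2) x)) *\<^sub>R w)) (at x)"
    by (intro has_derivative_scaleR_left has_derivative_mult_right wave_has_derivative)
  then show ?thesis
    unfolding partial_def by (simp add: frechet_derivative_at[symmetric] inner_axis)
qed

lemma laplacian_wave: "laplacian (wave k \<theta>) x = - ((2 * pi)\<^sup>2 * (k \<bullet> k)) * wave k \<theta> x"
proof -
  have p: "partial i (\<lambda>x. c * wave k \<phi> x) = (\<lambda>x. (c * (2 * pi * k$i)) * wave k (\<phi> + pi / 2) x)" for i c \<phi>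
    using partial_wave[of i c k \<phi> "1::real"] by (simp add: fun_eq_iff)
  have w: "wave k (\<theta> + pi / 2 + pi / 2) x = - wave k \<theta> x" using wave_pi[of k \<theta> x] by (simp add: add.assoc)
  have "partial i (partial i (wave k \<theta>)) x = - ((2 * pi)\<^sup>2 * (k$i * k$i)) * wave k \<theta> x" for i
    using p[of i 1 \<theta>] p[of i "1 * (2 * pi * k$i)" "\<theta> + pi / 2"] w by (simp add: power2_eq_square)
  then show ?thesis
    by (simp add: laplacian_def inner_vec_def sum_distrib_left sum_distrib_right sum_negf)
qed

text \<open>
  Waves are eigenfunctions of the Laplacian and admissible test functions.
\<close>

lemma helmholtz_inverse_waves:
  assumes h: "helmholtz_inverse \<alpha> w u" and w: "Lq 2 w"
  shows "helmholtz_waves \<alpha> (\<lambda>x. u x $ j) (\<lambda>x. w x $ j)"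
  unfolding helmholtz_waves_def
proof (intro ballI allI)
  fix k \<theta> assume k: "k \<in> lattice"
  have u: "Lq 2 u" using h by (simp add: helmholtz_inverse_def)
  let ?c = "1 + \<alpha>\<^sup>2 * (2 * pi)\<^sup>2 * (k \<bullet> k)"
  have vi: "integrable torus (\<lambda>x. (c * wave k \<theta> x) *\<^sub>R f x)" if "Lq 2 f" for f :: "real^3 \<Rightarrow> real^3" and c
  proof (rule Bochner_Integration.integrable_bound[where f = "\<lambda>x. \<bar>c\<bar> * (1 + (norm (f x))\<^sup>2)"])
    show "integrable torus (\<lambda>x. \<bar>c\<bar> * (1 + (norm (f x))\<^sup>2))"
      using Lq_2_components(4)[OF that] by simp
    have "f \<in> borel_measurable borel" using that by (simp add: Lq_def)
    then show "(\<lambda>x. (c * wave k \<theta> x) *\<^sub>R f x) \<in> borel_measurable torus"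
      by (intro borel_measurable_torus) measurable
    show "AE x in torus. norm ((c * wave k \<theta> x) *\<^sub>R f x) \<le> norm (\<bar>c\<bar> * (1 + (norm (f x))\<^sup>2))"
    proof (rule AE_I2)
      fix x
      have "2 * norm (f x) \<le> 1 + (norm (f x))\<^sup>2"
        using zero_le_power2[of "norm (f x) - 1"] by (simp add: power2_diff)
      then have "norm (f x) \<le> 1 + (norm (f x))\<^sup>2" using norm_ge_zero[of "f x"] by linarith
      then have "\<bar>c\<bar> * \<bar>wave k \<theta> x\<bar> * norm (f x) \<le> \<bar>c\<bar> * 1 * (1 + (norm (f x))\<^sup>2)"
        using abs_wave_le[of k \<theta> x] by (intro mult_mono) auto
      then show "norm ((c * wave k \<theta> x) *\<^sub>R f x) \<le> norm (\<bar>c\<bar> * (1 + (norm (f x))\<^sup>2))"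
        by (simp add: abs_mult)
    qed
  qed
  have comp: "(\<integral>x. (c * wave k \<theta> x) *\<^sub>R f x \<partial>torus) $ j = c * (\<integral>x. f x $ j * wave k \<theta> x \<partial>torus)"
    if "Lq 2 f" for f :: "real^3 \<Rightarrow> real^3" and c
  proof -
    have "(\<integral>x. (c * wave k \<theta> x) *\<^sub>R f x \<partial>torus) $ j = (\<integral>x. (c * wave k \<theta> x) *\<^sub>R f x \<partial>torus) \<bullet> axis j 1"
      by (simp add: inner_axis)
    also have "\<dots> = (\<integral>x. ((c * wave k \<theta> x) *\<^sub>R f x) \<bullet> axis j 1 \<partial>torus)"
      using vi[OF that] by (intro integral_inner_left[symmetric]) auto
    also have "\<dots> = (\<integral>x. c * (f x $ j * wave k \<theta> x) \<partial>torus)"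
      by (intro Bochner_Integration.integral_cong refl) (simp add: inner_axis mult_ac)
    finally show ?thesis by simp
  qed
  have "(LINT x:cell|lborel. (wave k \<theta> x - \<alpha>\<^sup>2 * laplacian (wave k \<theta>) x) *\<^sub>R u x) = (LINT x:cell|lborel. wave k \<theta> x *\<^sub>R w x)"
    using h smooth_wave torus_periodic_wave[OF k] unfolding helmholtz_inverse_def by blast
  moreover have "wave k \<theta> x - \<alpha>\<^sup>2 * laplacian (wave k \<theta>) x = ?c * wave k \<theta> x" for x
    by (simp add: laplacian_wave algebra_simps)
  ultimately have "(\<integral>x. (?c * wave k \<theta> x) *\<^sub>R u x \<partial>torus) = (\<integral>x. (1 * wave k \<theta> x) *\<^sub>R w x \<partial>torus)"
    by (simp add: integral_torus)
  then have "(\<integral>x. (?c * wave k \<theta> x) *\<^sub>R u x \<partial>torus) $ j = (\<integral>x. (1 * wave k \<theta> x) *\<^sub>R w x \<partial>torus) $ j" by (rule arg_cong)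
  then have "?c * (\<integral>x. u x $ j * wave k \<theta> x \<partial>torus) = 1 * (\<integral>x. w x $ j * wave k \<theta> x \<partial>torus)"
    unfolding comp[OF u] comp[OF w] .
  then show "?c * (\<integral>x. u x $ j * wave k \<theta> x \<partial>torus) = (\<integral>x. w x $ j * wave k \<theta> x \<partial>torus)" by simp
qed

lemma nikolskii_mono:
  assumes "nikolskii \<sigma> N f" "N \<le> N'" shows "nikolskii \<sigma> N' f"
proof -
  have N: "0 \<le> N" using assms by (simp add: nikolskii_def)
  have "N ^ 3 \<le> N' ^ 3" "(N * t) ^ 3 \<le> (N' * t) ^ 3" if "t \<ge> 0" for t
    using assms(2) N that by (auto intro!: power_mono mult_right_mono)
  then show ?thesis using assms N unfolding nikolskii_def by (meson order_trans powr_ge_zero)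
qed

lemma torus_field_measurable:
  "torus_field T f \<Longrightarrow> (\<lambda>z. f (fst z) (snd z)) \<in> borel_measurable (cylinder T)"
  by (simp add: torus_field_def case_prod_unfold)

lemma wave_measurable_cylinder: "(\<lambda>z. wave k \<theta> (snd z)) \<in> borel_measurable (cylinder T)"
  by (intro measurable_restrict_space1 borel_measurable_continuous_onI continuous_on_compose2[OF continuous_wave[of UNIV]] continuous_intros) auto

lemma frequency_sum_bound:
  fixes k :: "real^3"
  assumes "\<And>i. \<bar>X i\<bar> \<le> C"
  shows "\<bar>\<Sum>i\<in>UNIV. k$i * X i\<bar> \<le> 3 * norm k * C"
proof -
  have "\<bar>\<Sum>i\<in>UNIV. k$i * X i\<bar> \<le> (\<Sum>i\<in>(UNIV :: 3 set). norm k * C)"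
    by (intro order_trans[OF sum_abs] sum_mono) (auto simp: abs_mult intro!: mult_mono assms component_le_norm_cart)
  then show ?thesis by simp
qed

lemma abs_two_pi_le: "\<bar>x\<bar> \<le> c \<Longrightarrow> \<bar>2 * pi * x\<bar> \<le> 2 * pi * c"
  by (simp add: abs_mult)

lemma abs_combine_le:
  fixes x y z :: real
  shows "\<bar>x\<bar> \<le> a \<Longrightarrow> \<bar>y\<bar> \<le> b \<Longrightarrow> \<bar>x + y\<bar> \<le> a + b" "\<bar>x\<bar> \<le> a \<Longrightarrow> \<bar>y\<bar> \<le> b \<Longrightarrow> \<bar>x - y\<bar> \<le> a + b"
  by linarith+

lemma square_pairing_bound:
  assumes f: "f \<in> borel_measurable torus" "integrable torus (\<lambda>x. (f x)\<^sup>2)" "(\<integral>x. (f x)\<^sup>2 \<partial>torus) \<le> M"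
    and g: "g \<in> borel_measurable torus" "integrable torus (\<lambda>x. (g x)\<^sup>2)" "(\<integral>x. (g x)\<^sup>2 \<partial>torus) \<le> M"
  shows "integrable torus (\<lambda>x. f x * g x)" "\<bar>\<integral>x. f x * g x * wave k \<theta> x \<partial>torus\<bar> \<le> 2 * M"
proof -
  have le: "\<bar>f x * g x\<bar> \<le> (f x)\<^sup>2 + (g x)\<^sup>2" for x
  proof -
    have "2 * (\<bar>f x\<bar> * \<bar>g x\<bar>) \<le> (f x)\<^sup>2 + (g x)\<^sup>2"
      using zero_le_power2[of "\<bar>f x\<bar> - \<bar>g x\<bar>"] by (simp add: power2_diff)
    moreover have "0 \<le> \<bar>f x\<bar> * \<bar>g x\<bar>" by simp
    ultimately show ?thesis unfolding abs_mult by linarith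
  qed
  have isq: "integrable torus (\<lambda>x. (f x)\<^sup>2 + (g x)\<^sup>2)" using f g by simp
  show i: "integrable torus (\<lambda>x. f x * g x)"
    by (rule integrable_torus_dominated[OF isq _ le]) (use f g in measurable)
  have "\<bar>\<integral>x. f x * g x * wave k \<theta> x \<partial>torus\<bar> \<le> (\<integral>x. \<bar>f x * g x * wave k \<theta> x\<bar> \<partial>torus)" by (rule integral_abs_bound)
  also have "\<dots> \<le> (\<integral>x. (f x)\<^sup>2 + (g x)\<^sup>2 \<partial>torus)"
  proof (rule integral_mono[OF _ isq])
    show "integrable torus (\<lambda>x. \<bar>f x * g x * wave k \<theta> x\<bar>)" using integrable_mult_wave[OF i] by simp
    show "\<bar>f x * g x * wave k \<theta> x\<bar> \<le> (f x)\<^sup>2 + (g x)\<^sup>2" for x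
      using mult_left_le[OF abs_wave_le[of k \<theta> x], of "\<bar>f x * g x\<bar>"] le[of x] by (simp add: abs_mult)
  qed
  also have "\<dots> \<le> 2 * M" using f g by simp
  finally show "\<bar>\<integral>x. f x * g x * wave k \<theta> x \<partial>torus\<bar> \<le> 2 * M" .
qed

lemma wave_pairing_bound:
  assumes "integrable torus f" "(\<integral>x. \<bar>f x\<bar> \<partial>torus) \<le> M"
  shows "\<bar>\<integral>x. f x * wave k \<theta> x \<partial>torus\<bar> \<le> M"
proof -
  have "\<bar>\<integral>x. f x * wave k \<theta> x \<partial>torus\<bar> \<le> (\<integral>x. \<bar>f x * wave k \<theta> x\<bar> \<partial>torus)" by (rule integral_abs_bound)
  also have "\<dots> \<le> (\<integral>x. \<bar>f x\<bar> \<partial>torus)"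
  proof (rule integral_mono)
    show "\<bar>f x * wave k \<theta> x\<bar> \<le> \<bar>f x\<bar>" for x
      using mult_left_le[OF abs_wave_le[of k \<theta> x], of "\<bar>f x\<bar>"] by (simp add: abs_mult)
  qed (use assms integrable_mult_wave[OF assms(1)] in auto)
  finally show ?thesis using assms(2) by simp
qed

text \<open>
  Two phases span all of them, so being divergence-free amounts to countably many
  equations and can be inferred for almost every time at once.
\<close>

lemma div_free_of_countable:
  assumes i: "\<And>i. integrable torus (W i)"
    and z: "\<And>k \<theta>. k \<in> lattice \<Longrightarrow> \<theta> \<in> {0, pi / 2} \<Longrightarrow> (\<Sum>i\<in>UNIV. k$i * (\<integral>x. W i x * wave k \<theta> x \<partial>torus)) = 0"
  shows "div_free W"
  unfolding div_free_def
proof (intro ballI allI)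
  fix k \<theta> assume k: "k \<in> lattice"
  have w: "wave k \<theta> x = cos \<theta> * wave k 0 x + sin \<theta> * wave k (pi / 2) x" for x
    unfolding wave_values by (simp add: wave_def cos_add)
  have "(\<integral>x. W i x * wave k \<theta> x \<partial>torus) = cos \<theta> * (\<integral>x. W i x * wave k 0 x \<partial>torus) + sin \<theta> * (\<integral>x. W i x * wave k (pi / 2) x \<partial>torus)" for i
  proof -
    have "(\<integral>x. W i x * wave k \<theta> x \<partial>torus) = (\<integral>x. cos \<theta> * (W i x * wave k 0 x) + sin \<theta> * (W i x * wave k (pi / 2) x) \<partial>torus)"
      unfolding w by (simp add: algebra_simps)
    then show ?thesis using integrable_mult_wave[OF i] by simp
  qed
  then have "(\<Sum>i\<in>UNIV. k$i * (\<integral>x. W i x * wave k \<theta> x \<partial>torus))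
     = cos \<theta> * (\<Sum>i\<in>UNIV. k$i * (\<integral>x. W i x * wave k 0 x \<partial>torus)) + sin \<theta> * (\<Sum>i\<in>UNIV. k$i * (\<integral>x. W i x * wave k (pi / 2) x \<partial>torus))"
    by (simp add: sum.distrib sum_distrib_left algebra_simps)
  then show "(\<Sum>i\<in>UNIV. k$i * (\<integral>x. W i x * wave k \<theta> x \<partial>torus)) = 0" using z[OF k] by simp
qed

lemma countable_lattice: "countable lattice"
proof -
  have "lattice \<subseteq> range (\<lambda>n :: 3 \<Rightarrow> int. \<chi> i. of_int (n i))"
  proof
    fix k assume "k \<in> lattice"
    then have "(\<chi> i. of_int \<lfloor>k$i\<rfloor>) = k" by (simp add: lattice_def vec_eq_iff)
    moreover have "(\<chi> i. of_int \<lfloor>k$i\<rfloor>) \<in> range (\<lambda>n :: 3 \<Rightarrow> int. (\<chi> i. of_int (n i)) :: real^3)"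
      by (rule range_eqI[of _ _ "\<lambda>i. \<lfloor>k$i\<rfloor>"]) simp
    ultimately show "k \<in> range (\<lambda>n :: 3 \<Rightarrow> int. \<chi> i. of_int (n i))" by simp
  qed
  then show ?thesis by (rule countable_subset) simp
qed

text \<open>
  The regularity enters through a common bound \<open>N t\<close> of both fields at time \<open>t\<close> and an
  integrable majorant \<open>K\<close> of its cube, rather than through Besov norms, because \<open>\<sigma>\<close> and \<open>\<rho>\<close>
  may be lower than the orders of regularity of the solution.
\<close>

locale leray_alpha_mhd =
  fixes \<alpha> T \<sigma> \<rho> M :: real and u v B :: "real \<Rightarrow> real^3 \<Rightarrow> real^3" and p :: "real \<Rightarrow> real^3 \<Rightarrow> real"
    and N K :: "real \<Rightarrow> real"
  assumes \<alpha>: "\<alpha> > 0" and T: "T > 0" and weak: "weak_solution \<alpha> T u v B p"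
    and \<sigma>: "0 < \<sigma>" "\<sigma> < 1" and \<rho>: "0 < \<rho>" "\<rho> < 1" and \<sigma>\<rho>: "\<sigma> + 2 * \<rho> > 1" and M: "M \<ge> 1"
    and bounds: "AE t in lborel. t \<in> {0<..<T} \<longrightarrow> Lq 2 (v t) \<and> Lq 2 (B t) \<and> Lq 1 (p t) \<and>
      (Lq_norm 2 (v t))\<^sup>2 \<le> M \<and> (Lq_norm 2 (B t))\<^sup>2 \<le> M \<and> Lq_norm 1 (p t) \<le> M"
    and regular: "AE t in lborel. t \<in> {0<..<T} \<longrightarrow>
      (\<forall>j. nikolskii \<sigma> (N t) (\<lambda>x. v t x $ j)) \<and> (\<forall>j. nikolskii \<rho> (N t) (\<lambda>x. B t x $ j)) \<and> N t ^ 3 \<le> K t"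
    and K: "integrable (lebesgue_on {0<..<T}) K"
begin

abbreviation V :: "real \<Rightarrow> 3 \<Rightarrow> real^3 \<Rightarrow> real" where "V t j x \<equiv> v t x $ j"
abbreviation U :: "real \<Rightarrow> 3 \<Rightarrow> real^3 \<Rightarrow> real" where "U t j x \<equiv> u t x $ j"
abbreviation H :: "real \<Rightarrow> 3 \<Rightarrow> real^3 \<Rightarrow> real" where "H t j x \<equiv> B t x $ j"

definition total_pressure :: "real \<Rightarrow> real^3 \<Rightarrow> real" where
  "total_pressure t x = p t x + 1 / 2 * (norm (B t x))\<^sup>2"

definition regular_time :: "real \<Rightarrow> bool" where
  "regular_time t \<longleftrightarrow> Lq 2 (u t) \<and> Lq 2 (v t) \<and> Lq 2 (B t) \<and> Lq 1 (p t) \<and>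
      (Lq_norm 2 (v t))\<^sup>2 \<le> M \<and> (Lq_norm 2 (B t))\<^sup>2 \<le> M \<and> Lq_norm 1 (p t) \<le> M \<and>
      (\<forall>j. helmholtz_waves \<alpha> (U t j) (V t j)) \<and>
      (\<forall>j. nikolskii \<sigma> (N t) (V t j)) \<and> (\<forall>j. nikolskii \<rho> (N t) (H t j)) \<and> N t ^ 3 \<le> K t"

lemma AE_regular_time: "AE t in lborel. t \<in> {0<..<T} \<longrightarrow> regular_time t"
proof -
  have "AE t in lborel. t \<in> {0<..<T} \<longrightarrow> helmholtz_inverse \<alpha> (v t) (u t)"
    using weak by (simp add: weak_solution_def AE_lebesgue_on_time)
  then show ?thesis using bounds regular
  proof eventually_elim
    case (elim t)
    show ?case
    proof
      assume t: "t \<in> {0<..<T}"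
      with elim have h: "helmholtz_inverse \<alpha> (v t) (u t)" and v2: "Lq 2 (v t)" by auto
      have "Lq 2 (u t)" using h by (simp add: helmholtz_inverse_def)
      then show "regular_time t"
        using elim t helmholtz_inverse_waves[OF h v2] by (auto simp: regular_time_def)
    qed
  qed
qed

lemma regular_timeD:
  assumes "regular_time t"
  shows "U t j \<in> borel_measurable borel" "torus_periodic (U t j)" "integrable torus (\<lambda>x. (U t j x)\<^sup>2)"
    "L3 (V t j)" "L3 (H t j)" "nikolskii \<sigma> (N t) (V t j)" "nikolskii \<rho> (N t) (H t j)"
    "helmholtz_waves \<alpha> (U t j) (V t j)"
    "integrable torus (\<lambda>x. (V t j x)\<^sup>2)" "integrable torus (\<lambda>x. (H t j x)\<^sup>2)"
    "(\<integral>x. (V t j x)\<^sup>2 \<partial>torus) \<le> M" "(\<integral>x. (H t j x)\<^sup>2 \<partial>torus) \<le> M"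
    "integrable torus (total_pressure t)" "(\<integral>x. \<bar>total_pressure t x\<bar> \<partial>torus) \<le> 2 * M"
    "integrable torus (U t j)"
proof -
  note r = assms[unfolded regular_time_def]
  have u2: "Lq 2 (u t)" and v2: "Lq 2 (v t)" and B2: "Lq 2 (B t)" and p1: "Lq 1 (p t)" using r by auto
  show "U t j \<in> borel_measurable borel" "torus_periodic (U t j)" "integrable torus (\<lambda>x. (U t j x)\<^sup>2)"
    by (rule Lq_2_components[OF u2])+
  show "integrable torus (U t j)"
    by (rule integrable_of_square[OF borel_measurable_torus[OF Lq_2_components(1)[OF u2]] Lq_2_components(3)[OF u2]])
  show "nikolskii \<sigma> (N t) (V t j)" "nikolskii \<rho> (N t) (H t j)" "helmholtz_waves \<alpha> (U t j) (V t j)" using r by auto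
  then show "L3 (V t j)" "L3 (H t j)" by (auto simp: nikolskii_def)
  show "integrable torus (\<lambda>x. (V t j x)\<^sup>2)" by (rule Lq_2_components[OF v2])
  show "integrable torus (\<lambda>x. (H t j x)\<^sup>2)" by (rule Lq_2_components[OF B2])
  show "(\<integral>x. (V t j x)\<^sup>2 \<partial>torus) \<le> M" using Lq_2_components(6)[OF v2, of j] r by linarith
  show "(\<integral>x. (H t j x)\<^sup>2 \<partial>torus) \<le> M" using Lq_2_components(6)[OF B2, of j] r by linarith
  note ip = Lq_1_integrable[OF p1] and iB = Lq_2_components(4)[OF B2]
  show ti: "integrable torus (total_pressure t)"
    unfolding total_pressure_def[abs_def] using ip iB by simp
  have "(\<integral>x. \<bar>total_pressure t x\<bar> \<partial>torus) \<le> (\<integral>x. \<bar>p t x\<bar> + 1 / 2 * (norm (B t x))\<^sup>2 \<partial>torus)"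
  proof (rule integral_mono)
    show "\<bar>total_pressure t x\<bar> \<le> \<bar>p t x\<bar> + 1 / 2 * (norm (B t x))\<^sup>2" for x
      using abs_triangle_ineq[of "p t x" "1 / 2 * (norm (B t x))\<^sup>2"] by (simp add: total_pressure_def)
  qed (use ti ip iB in auto)
  also have "\<dots> = Lq_norm 1 (p t) + 1 / 2 * (Lq_norm 2 (B t))\<^sup>2"
    unfolding Lq_norm_square using ip iB by simp
  also have "\<dots> \<le> 2 * M" using r M by linarith
  finally show "(\<integral>x. \<bar>total_pressure t x\<bar> \<partial>torus) \<le> 2 * M" .
qed

lemma fields_measurable:
  "(\<lambda>z. V (fst z) j (snd z)) \<in> borel_measurable (cylinder T)" "(\<lambda>z. U (fst z) j (snd z)) \<in> borel_measurable (cylinder T)"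
  "(\<lambda>z. H (fst z) j (snd z)) \<in> borel_measurable (cylinder T)" "(\<lambda>z. total_pressure (fst z) (snd z)) \<in> borel_measurable (cylinder T)"
proof -
  have f: "torus_field T v" "torus_field T u" "torus_field T B" "torus_field T p"
    using weak by (auto simp: weak_solution_def Linf_Lq_def)
  note m = f(1,2,3)[THEN torus_field_measurable] and mp = torus_field_measurable[OF f(4)]
  show "(\<lambda>z. V (fst z) j (snd z)) \<in> borel_measurable (cylinder T)" "(\<lambda>z. U (fst z) j (snd z)) \<in> borel_measurable (cylinder T)"
    "(\<lambda>z. H (fst z) j (snd z)) \<in> borel_measurable (cylinder T)"
    by (rule borel_measurable_vec_component, rule m)+
  show "(\<lambda>z. total_pressure (fst z) (snd z)) \<in> borel_measurable (cylinder T)"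
    unfolding total_pressure_def using m(3) mp by measurable
qed

text \<open>
  Products with \<open>u\<close> are controlled through \<open>v\<close>, the others by the inequality between
  means. That the bound is uniform in time matters: the rates of change of the modes have to be
  bounded for the chain rule.
\<close>

lemma transport_mode_bound:
  assumes r: "regular_time t" and k: "k \<in> lattice"
  shows "\<bar>\<integral>x. U t i x * V t j x * wave k \<theta> x \<partial>torus\<bar> \<le> 2 * M" "\<bar>\<integral>x. U t i x * H t j x * wave k \<theta> x \<partial>torus\<bar> \<le> 2 * M"
    "integrable torus (\<lambda>x. U t i x * V t j x)" "integrable torus (\<lambda>x. U t i x * H t j x)"
    "integrable torus (\<lambda>x. H t i x * H t j x)" "integrable torus (\<lambda>x. H t i x * V t j x)"
    "\<bar>\<integral>x. H t i x * H t j x * wave k \<theta> x \<partial>torus\<bar> \<le> 2 * M" "\<bar>\<integral>x. H t i x * V t j x * wave k \<theta> x \<partial>torus\<bar> \<le> 2 * M"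
    "\<bar>\<integral>x. total_pressure t x * wave k \<theta> x \<partial>torus\<bar> \<le> 2 * M"
proof -
  note d = regular_timeD[OF r]
  have fr: "frequencies [(1, k, \<theta>)] \<subseteq> lattice" using k by simp
  have b: "\<bar>trig [(1, k, \<theta>)] x\<bar> \<le> 1" for x using abs_wave_le by simp
  have "\<bar>\<integral>x. U t i x * (f x * trig [(1, k, \<theta>)] x) \<partial>torus\<bar> \<le> 2 * M"
    if "nikolskii s n f" "0 < s" "s < 1" "(\<integral>x. (f x)\<^sup>2 \<partial>torus) \<le> M" for f s n
    using transport_pairing_bound[OF \<alpha> d(1)[of i] d(2)[of i] d(3)[of i] d(8)[of i] d(4)[of i] that(1,2) _ fr b] that d(11)[of i] by simp
  from this[OF d(6) \<sigma> d(11)] this[OF d(7) \<rho> d(12)]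
  show "\<bar>\<integral>x. U t i x * V t j x * wave k \<theta> x \<partial>torus\<bar> \<le> 2 * M" "\<bar>\<integral>x. U t i x * H t j x * wave k \<theta> x \<partial>torus\<bar> \<le> 2 * M"
    by (simp_all add: mult.assoc)
  have m: "U t i \<in> borel_measurable torus" "V t j \<in> borel_measurable torus" "H t j \<in> borel_measurable torus" for i j
    using borel_measurable_torus[OF d(1)] L3D(4)[OF d(4)] L3D(4)[OF d(5)] by auto
  show "integrable torus (\<lambda>x. U t i x * V t j x)"
    by (rule square_pairing_bound(1)[OF m(1) d(3) order_refl[THEN order_trans, OF max.cobounded1] m(2) d(9) max.cobounded2])
  show "integrable torus (\<lambda>x. U t i x * H t j x)"
    by (rule square_pairing_bound(1)[OF m(1) d(3) order_refl[THEN order_trans, OF max.cobounded1] m(3) d(10) max.cobounded2])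
  show "integrable torus (\<lambda>x. H t i x * H t j x)" "integrable torus (\<lambda>x. H t i x * V t j x)"
    by (rule L3_integrable_mult[OF d(5) d(5)] L3_integrable_mult[OF d(5) d(4)])+
  show "\<bar>\<integral>x. H t i x * H t j x * wave k \<theta> x \<partial>torus\<bar> \<le> 2 * M"
    by (rule square_pairing_bound(2)[OF m(3) d(10,12) m(3) d(10,12)])
  show "\<bar>\<integral>x. H t i x * V t j x * wave k \<theta> x \<partial>torus\<bar> \<le> 2 * M"
    by (rule square_pairing_bound(2)[OF m(3) d(10,12) m(2) d(9,11)])
  show "\<bar>\<integral>x. total_pressure t x * wave k \<theta> x \<partial>torus\<bar> \<le> 2 * M"
    by (rule wave_pairing_bound[OF d(13,14)])
qed

lemma field_mode_bound:
  assumes r: "regular_time t"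
  shows "\<bar>\<integral>x. V t j x * wave k \<theta> x \<partial>torus\<bar> \<le> 2 * M" "\<bar>\<integral>x. H t j x * wave k \<theta> x \<partial>torus\<bar> \<le> 2 * M"
proof -
  note d = regular_timeD[OF r]
  have one: "integrable torus (\<lambda>x. (1::real)\<^sup>2)" "(\<integral>x. (1::real)\<^sup>2 \<partial>torus) \<le> M" using M by auto
  show "\<bar>\<integral>x. V t j x * wave k \<theta> x \<partial>torus\<bar> \<le> 2 * M"
    using square_pairing_bound(2)[OF L3D(4)[OF d(4)[of j]] d(9)[of j] d(11)[of j] _ one, of k \<theta>] by simp
  show "\<bar>\<integral>x. H t j x * wave k \<theta> x \<partial>torus\<bar> \<le> 2 * M"
    using square_pairing_bound(2)[OF L3D(4)[OF d(5)[of j]] d(10)[of j] d(12)[of j] _ one, of k \<theta>] by simp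
qed

text \<open>
  The constraints hold for almost every \<open>t\<close> separately for each mode, hence for almost
  every \<open>t\<close> for all modes. For \<open>v\<close> no constraint is assumed, but its modes are multiples of
  those of \<open>u\<close> with a factor depending on the frequency only.
\<close>

lemma div_free_fields:
  "AE t in lborel. t \<in> {0<..<T} \<longrightarrow> div_free (U t) \<and> div_free (V t) \<and> div_free (H t)"
proof -
  have mode: "AE t in lborel. t \<in> {0<..<T} \<longrightarrow> (\<Sum>i\<in>UNIV. k$i * (\<integral>x. f t x $ i * wave k \<theta> x \<partial>torus)) = 0"
    if k: "k \<in> lattice" and m: "\<And>i. (\<lambda>z. f (fst z) (snd z) $ i) \<in> borel_measurable (cylinder T)"
      and w: "\<And>\<psi> :: real \<Rightarrow> real^3 \<Rightarrow> real. test_function T \<psi> \<Longrightarrow>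
         (LINT t:{0<..<T}|lborel. LINT x:cell|lborel. (\<Sum>i\<in>UNIV. f t x $ i * partial i (\<psi> t) x)) = 0"
      and i: "AE t in lborel. t \<in> {0<..<T} \<longrightarrow> (\<forall>j. integrable torus (\<lambda>x. f t x $ j) \<and> \<bar>\<integral>x. f t x $ j * wave k \<theta> x \<partial>torus\<bar> \<le> 2 * M)"
    for k \<theta> and f :: "real \<Rightarrow> real^3 \<Rightarrow> real^3"
  proof -
    define A where "A t x = (\<Sum>i\<in>UNIV. k$i * (f t x $ i * wave k \<theta> x))" for t x
    have A: "(\<integral>x. A t x \<partial>torus) = (\<Sum>i\<in>UNIV. k$i * (\<integral>x. f t x $ i * wave k \<theta> x \<partial>torus))"
      if "\<forall>j. integrable torus (\<lambda>x. f t x $ j)" for t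
      unfolding A_def using integrable_mult_wave that by simp
    have "AE t in lborel. t \<in> {0<..<T} \<longrightarrow> (\<integral>x. A t x \<partial>torus) = 0"
    proof (rule weak_constraint[OF T])
      show "(\<lambda>z. A (fst z) (snd z)) \<in> borel_measurable (cylinder T)"
        unfolding A_def using m wave_measurable_cylinder by measurable
      show "AE t in lborel. t \<in> {0<..<T} \<longrightarrow> \<bar>\<integral>x. A t x \<partial>torus\<bar> \<le> 3 * norm k * (2 * M)"
        using i
      proof eventually_elim
        case (elim t)
        show ?case
        proof
          assume "t \<in> {0<..<T}"
          with elim have e: "\<forall>j. integrable torus (\<lambda>x. f t x $ j)" "\<And>j. \<bar>\<integral>x. f t x $ j * wave k \<theta> x \<partial>torus\<bar> \<le> 2 * M" by auto
          show "\<bar>\<integral>x. A t x \<partial>torus\<bar> \<le> 3 * norm k * (2 * M)" unfolding A[OF e(1)] by (rule frequency_sum_bound[OF e(2)])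
        qed
      qed
      fix \<eta> assume \<eta>: "time_test T \<eta>"
      \<comment> \<open>The phase is turned back so that its derivative has phase \<open>\<theta>\<close>.\<close>
      define \<psi> where "\<psi> = (\<lambda>t x. (\<eta> t * wave k (\<theta> - pi / 2) x) *\<^sub>R (1 / (2 * pi)))"
      have "test_function T \<psi>" unfolding \<psi>_def by (rule test_function_wave[OF \<eta> k])
      from w[OF this] have "(LINT t:{0<..<T}|lborel. LINT x:cell|lborel. (\<Sum>i\<in>UNIV. f t x $ i * partial i (\<psi> t) x)) = 0" .
      moreover have "(\<Sum>i\<in>UNIV. f t x $ i * partial i (\<psi> t) x) = \<eta> t * A t x" for t x
        unfolding \<psi>_def partial_wave A_def by (simp add: sum_distrib_left mult_ac)
      ultimately show "(LINT t:{0<..<T}|lborel. LINT x:cell|lborel. \<eta> t * A t x) = 0" by simp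
    qed
    then show ?thesis using i by eventually_elim (auto simp: A)
  qed
  have iu: "AE t in lborel. t \<in> {0<..<T} \<longrightarrow> (\<forall>j. integrable torus (U t j) \<and> \<bar>\<integral>x. U t j x * wave k \<theta> x \<partial>torus\<bar> \<le> 2 * M)"
    if k: "k \<in> lattice" for k \<theta>
    using AE_regular_time
  proof eventually_elim
    case (elim t)
    show ?case
    proof (intro impI allI conjI)
      fix j assume "t \<in> {0<..<T}"
      with elim have r: "regular_time t" by simp
      show "integrable torus (U t j)" by (rule regular_timeD[OF r])
      let ?c = "1 + \<alpha>\<^sup>2 * (2 * pi)\<^sup>2 * (k \<bullet> k)"
      have c: "?c \<ge> 1" by simp
      have "?c * (\<integral>x. U t j x * wave k \<theta> x \<partial>torus) = (\<integral>x. V t j x * wave k \<theta> x \<partial>torus)"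
        using regular_timeD(8)[OF r] k by (simp add: helmholtz_waves_def)
      then have "\<bar>?c * (\<integral>x. U t j x * wave k \<theta> x \<partial>torus)\<bar> \<le> 2 * M"
        using field_mode_bound(1)[OF r, of j k \<theta>] by (simp only:)
      then have "?c * \<bar>\<integral>x. U t j x * wave k \<theta> x \<partial>torus\<bar> \<le> 2 * M"
        using c by (simp only: abs_mult abs_of_nonneg[OF order_trans[OF zero_le_one c]])
      moreover have "1 * \<bar>\<integral>x. U t j x * wave k \<theta> x \<partial>torus\<bar> \<le> ?c * \<bar>\<integral>x. U t j x * wave k \<theta> x \<partial>torus\<bar>"
        using c by (intro mult_right_mono) auto
      ultimately show "\<bar>\<integral>x. U t j x * wave k \<theta> x \<partial>torus\<bar> \<le> 2 * M" by linarith
    qed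
  qed
  have iB: "AE t in lborel. t \<in> {0<..<T} \<longrightarrow> (\<forall>j. integrable torus (H t j) \<and> \<bar>\<integral>x. H t j x * wave k \<theta> x \<partial>torus\<bar> \<le> 2 * M)" for k \<theta>
    using AE_regular_time by eventually_elim (auto intro: L3_integrable regular_timeD field_mode_bound)
  have wu: "test_function T \<psi> \<Longrightarrow> (LINT t:{0<..<T}|lborel. LINT x:cell|lborel. (\<Sum>i\<in>UNIV. u t x $ i * partial i (\<psi> t) x)) = 0"
    and wB: "test_function T \<psi> \<Longrightarrow> (LINT t:{0<..<T}|lborel. LINT x:cell|lborel. (\<Sum>i\<in>UNIV. B t x $ i * partial i (\<psi> t) x)) = 0"
    for \<psi> :: "real \<Rightarrow> real^3 \<Rightarrow> real"
    using weak unfolding weak_solution_def by blast+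
  \<comment> \<open>Countability lets almost everywhere and the quantifier over modes be exchanged.\<close>
  have cl: "countable (lattice \<times> {0, pi / 2})" by (intro countable_SIGMA countable_lattice) simp
  have "AE t in lborel. \<forall>z\<in>lattice \<times> {0, pi / 2}. t \<in> {0<..<T} \<longrightarrow>
      (\<Sum>i\<in>UNIV. fst z $ i * (\<integral>x. U t i x * wave (fst z) (snd z) x \<partial>torus)) = 0"
    unfolding AE_ball_countable[OF cl]
  proof
    fix z :: "(real^3) \<times> real" assume "z \<in> lattice \<times> {0, pi / 2}"
    then have "fst z \<in> lattice" by (simp add: mem_Times_iff)
    from mode[OF this fields_measurable(2) wu iu[OF this]]
    show "AE t in lborel. t \<in> {0<..<T} \<longrightarrow> (\<Sum>i\<in>UNIV. fst z $ i * (\<integral>x. U t i x * wave (fst z) (snd z) x \<partial>torus)) = 0" .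
  qed
  moreover have "AE t in lborel. \<forall>z\<in>lattice \<times> {0, pi / 2}. t \<in> {0<..<T} \<longrightarrow>
      (\<Sum>i\<in>UNIV. fst z $ i * (\<integral>x. H t i x * wave (fst z) (snd z) x \<partial>torus)) = 0"
    unfolding AE_ball_countable[OF cl]
  proof
    fix z :: "(real^3) \<times> real" assume "z \<in> lattice \<times> {0, pi / 2}"
    then have "fst z \<in> lattice" by (simp add: mem_Times_iff)
    from mode[OF this fields_measurable(3) wB iB]
    show "AE t in lborel. t \<in> {0<..<T} \<longrightarrow> (\<Sum>i\<in>UNIV. fst z $ i * (\<integral>x. H t i x * wave (fst z) (snd z) x \<partial>torus)) = 0" .
  qed
  ultimately show ?thesis using AE_regular_time
  proof eventually_elim
    case (elim t)
    show ?case
    proof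
      assume t: "t \<in> {0<..<T}"
      with elim have r: "regular_time t" by simp
      note d = regular_timeD[OF r]
      have dU: "div_free (U t)"
      proof (rule div_free_of_countable[OF d(15)])
        fix k \<theta> assume "k \<in> lattice" "\<theta> \<in> {0, pi / 2}"
        then show "(\<Sum>i\<in>UNIV. k$i * (\<integral>x. U t i x * wave k \<theta> x \<partial>torus)) = 0"
          using bspec[OF elim(1), of "(k, \<theta>)"] t by auto
      qed
      have dH: "div_free (H t)"
      proof (rule div_free_of_countable[OF L3_integrable[OF d(5)]])
        fix k \<theta> assume "k \<in> lattice" "\<theta> \<in> {0, pi / 2}"
        then show "(\<Sum>i\<in>UNIV. k$i * (\<integral>x. H t i x * wave k \<theta> x \<partial>torus)) = 0"
          using bspec[OF elim(2), of "(k, \<theta>)"] t by auto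
      qed
      have dV: "div_free (V t)"
        unfolding div_free_def
      proof (intro ballI allI)
        fix k \<theta> assume k: "k \<in> lattice"
        have "(\<integral>x. V t i x * wave k \<theta> x \<partial>torus) = (1 + \<alpha>\<^sup>2 * (2 * pi)\<^sup>2 * (k \<bullet> k)) * (\<integral>x. U t i x * wave k \<theta> x \<partial>torus)" for i
          using d(8) k by (simp add: helmholtz_waves_def)
        then have "(\<Sum>i\<in>UNIV. k$i * (\<integral>x. V t i x * wave k \<theta> x \<partial>torus))
          = (1 + \<alpha>\<^sup>2 * (2 * pi)\<^sup>2 * (k \<bullet> k)) * (\<Sum>i\<in>UNIV. k$i * (\<integral>x. U t i x * wave k \<theta> x \<partial>torus))"
          by (simp only: sum_distrib_left mult.left_commute)
        then show "(\<Sum>i\<in>UNIV. k$i * (\<integral>x. V t i x * wave k \<theta> x \<partial>torus)) = 0"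
          using dU k by (simp add: div_free_def)
      qed
      show "div_free (U t) \<and> div_free (V t) \<and> div_free (H t)" using dU dV dH by simp
    qed
  qed
qed

lemma test_derivatives:
  assumes "\<And>t. (\<eta> has_real_derivative \<eta>' t) (at t)" and \<psi>: "\<psi> = (\<lambda>t x. (\<eta> t * wave k \<theta> x) *\<^sub>R axis j 1)"
  shows "w \<bullet> time_deriv \<psi> t x = \<eta>' t * (w $ j * wave k \<theta> x)"
    "partial i (\<psi> t) x $ l = (if l = j then \<eta> t * (2 * pi * k$i * wave k (\<theta> + pi / 2) x) else 0)"
    "divergence (\<psi> t) x = \<eta> t * (2 * pi * k$j * wave k (\<theta> + pi / 2) x)"
proof -
  have "((\<lambda>\<tau>. (\<eta> \<tau> * wave k \<theta> x) *\<^sub>R (axis j 1 :: real^3)) has_vector_derivative (\<eta>' t * wave k \<theta> x) *\<^sub>R axis j 1) (at t)"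
    using assms(1)[of t] by (auto simp: has_real_derivative_iff_has_vector_derivative intro!: derivative_eq_intros)
  then have "time_deriv \<psi> t x = (\<eta>' t * wave k \<theta> x) *\<^sub>R axis j 1"
    unfolding time_deriv_def \<psi> by (rule vector_derivative_at)
  then show "w \<bullet> time_deriv \<psi> t x = \<eta>' t * (w $ j * wave k \<theta> x)" by (simp add: inner_axis)
  show p: "partial i (\<psi> t) x $ l = (if l = j then \<eta> t * (2 * pi * k$i * wave k (\<theta> + pi / 2) x) else 0)" for i l
    unfolding \<psi> partial_wave by (simp add: axis_def)
  show "divergence (\<psi> t) x = \<eta> t * (2 * pi * k$j * wave k (\<theta> + pi / 2) x)"
    unfolding divergence_def p by simp
qed

lemma momentum_evolves:
  assumes k: "k \<in> lattice"
  shows "evolves T (\<lambda>t. (\<integral>x. V t j x * wave k \<theta> x \<partial>torus)\<^sup>2)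
     (\<lambda>t. 2 * (\<integral>x. V t j x * wave k \<theta> x \<partial>torus) * momentum_rate (U t) (V t) (H t) (total_pressure t) k \<theta> j)"
proof -
  let ?e = "wave k (\<theta> + pi / 2)"
  define A where "A t x = V t j x * wave k \<theta> x" for t x
  define \<Phi> where "\<Phi> t x = 2 * pi * ((\<Sum>i\<in>UNIV. k$i * (U t i x * V t j x * ?e x)) + k$j * (total_pressure t x * ?e x)
     - (\<Sum>i\<in>UNIV. k$i * (H t i x * H t j x * ?e x)))" for t x
  define C where "C = 2 * M + 2 * pi * (3 * norm k * (2 * M) + norm k * (2 * M) + 3 * norm k * (2 * M))"
  have \<Phi>: "integrable torus (\<Phi> t)" "(\<integral>x. \<Phi> t x \<partial>torus) = momentum_rate (U t) (V t) (H t) (total_pressure t) k \<theta> j"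
    if r: "regular_time t" for t
  proof -
    note i = transport_mode_bound[OF r k] regular_timeD[OF r]
    note iw = integrable_mult_wave[OF i(3)] integrable_mult_wave[OF i(5)] integrable_mult_wave[OF regular_timeD(13)[OF r]]
    show "integrable torus (\<Phi> t)"
      unfolding \<Phi>_def[abs_def] using iw
      by (intro integrable_mult_right Bochner_Integration.integrable_add Bochner_Integration.integrable_diff Bochner_Integration.integrable_sum)
    show "(\<integral>x. \<Phi> t x \<partial>torus) = momentum_rate (U t) (V t) (H t) (total_pressure t) k \<theta> j"
      unfolding \<Phi>_def momentum_rate_def using iw by simp
  qed
  have ev: "evolves T (\<lambda>t. (\<integral>x. A t x \<partial>torus)\<^sup>2) (\<lambda>t. 2 * (\<integral>x. A t x \<partial>torus) * (\<integral>x. \<Phi> t x \<partial>torus))"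
  proof (rule weak_time_derivative[OF T])
    show "0 \<le> C" using M by (simp add: C_def)
    note m = fields_measurable wave_measurable_cylinder
    show "(\<lambda>z. A (fst z) (snd z)) \<in> borel_measurable (cylinder T)" unfolding A_def using m by measurable
    show "(\<lambda>z. \<Phi> (fst z) (snd z)) \<in> borel_measurable (cylinder T)" unfolding \<Phi>_def using m by measurable
    show "AE t in lborel. t \<in> {0<..<T} \<longrightarrow> integrable torus (A t) \<and> \<bar>\<integral>x. A t x \<partial>torus\<bar> \<le> C"
      using AE_regular_time
    proof eventually_elim
      case (elim t)
      show ?case
      proof
        assume "t \<in> {0<..<T}"
        with elim have r: "regular_time t" by simp
        have "2 * M \<le> C" using M by (simp add: C_def)
        then show "integrable torus (A t) \<and> \<bar>\<integral>x. A t x \<partial>torus\<bar> \<le> C"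
          unfolding A_def using integrable_mult_wave[OF L3_integrable[OF regular_timeD(4)[OF r]]] field_mode_bound(1)[OF r, of j k \<theta>] by auto
      qed
    qed
    show "AE t in lborel. t \<in> {0<..<T} \<longrightarrow> integrable torus (\<Phi> t) \<and> \<bar>\<integral>x. \<Phi> t x \<partial>torus\<bar> \<le> C"
      using AE_regular_time
    proof eventually_elim
      case (elim t)
      show ?case
      proof
        assume "t \<in> {0<..<T}"
        with elim have r: "regular_time t" by simp
        note b = transport_mode_bound[OF r k]
        have 1: "\<bar>\<Sum>i\<in>UNIV. k$i * (\<integral>x. U t i x * V t j x * ?e x \<partial>torus)\<bar> \<le> 3 * norm k * (2 * M)"
          by (intro frequency_sum_bound b(1))
        have 2: "\<bar>\<Sum>i\<in>UNIV. k$i * (\<integral>x. H t i x * H t j x * ?e x \<partial>torus)\<bar> \<le> 3 * norm k * (2 * M)"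
          by (intro frequency_sum_bound b(7))
        have 3: "\<bar>k$j * (\<integral>x. total_pressure t x * ?e x \<partial>torus)\<bar> \<le> norm k * (2 * M)"
          unfolding abs_mult by (intro mult_mono b(9) component_le_norm_cart) auto
        have "\<bar>momentum_rate (U t) (V t) (H t) (total_pressure t) k \<theta> j\<bar> \<le> 2 * pi * (3 * norm k * (2 * M) + norm k * (2 * M) + 3 * norm k * (2 * M))"
          unfolding momentum_rate_def by (intro abs_two_pi_le abs_combine_le 1 2 3)
        then show "integrable torus (\<Phi> t) \<and> \<bar>\<integral>x. \<Phi> t x \<partial>torus\<bar> \<le> C"
          using \<Phi>[OF r] M by (simp add: C_def)
      qed
    qed
    fix \<eta> \<eta>' assume \<eta>: "time_test T \<eta>" "\<And>t. (\<eta> has_real_derivative \<eta>' t) (at t)" "time_test T \<eta>'"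
    define \<psi> where "\<psi> = (\<lambda>t x. (\<eta> t * wave k \<theta> x) *\<^sub>R (axis j 1 :: real^3))"
    note td = test_derivatives[OF \<eta>(2) \<psi>_def]
    have "test_function T \<psi>" unfolding \<psi>_def by (rule test_function_wave[OF \<eta>(1) k])
    then have W: "(LINT t:{0<..<T}|lborel. LINT x:cell|lborel.
           v t x \<bullet> time_deriv \<psi> t x
           + (\<Sum>i\<in>UNIV. \<Sum>j\<in>UNIV. v t x $ j * u t x $ i * partial i (\<psi> t) x $ j)
           + p t x * divergence (\<psi> t) x
           + 1 / 2 * (norm (B t x))\<^sup>2 * divergence (\<psi> t) x
           - (\<Sum>i\<in>UNIV. \<Sum>j\<in>UNIV. B t x $ i * B t x $ j * partial i (\<psi> t) x $ j)) = 0"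
      using weak unfolding weak_solution_def by blast
    have eq: "v t x \<bullet> time_deriv \<psi> t x
           + (\<Sum>i\<in>UNIV. \<Sum>j\<in>UNIV. v t x $ j * u t x $ i * partial i (\<psi> t) x $ j)
           + p t x * divergence (\<psi> t) x
           + 1 / 2 * (norm (B t x))\<^sup>2 * divergence (\<psi> t) x
           - (\<Sum>i\<in>UNIV. \<Sum>j\<in>UNIV. B t x $ i * B t x $ j * partial i (\<psi> t) x $ j) = \<eta>' t * A t x + \<eta> t * \<Phi> t x" for t x
    proof -
      have s: "(\<Sum>l\<in>UNIV. f l * (if l = j then c else 0)) = f j * c" for f :: "3 \<Rightarrow> real" and c
        by (simp add: if_distrib[of "\<lambda>z. _ * z"] cong: if_cong)
      show ?thesis
        unfolding td s A_def \<Phi>_def total_pressure_def by (simp add: sum_3 algebra_simps)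
    qed
    show "(LINT t:{0<..<T}|lborel. LINT x:cell|lborel. \<eta>' t * A t x + \<eta> t * \<Phi> t x) = 0"
      using W unfolding eq .
  qed
  show ?thesis
    by (rule evolves_cong[OF ev]) (use AE_regular_time in \<open>auto elim!: eventually_mono simp: A_def \<Phi>\<close>)
qed

lemma induction_evolves:
  assumes k: "k \<in> lattice"
  shows "evolves T (\<lambda>t. (\<integral>x. H t j x * wave k \<theta> x \<partial>torus)\<^sup>2)
     (\<lambda>t. 2 * (\<integral>x. H t j x * wave k \<theta> x \<partial>torus) * induction_rate (U t) (V t) (H t) k \<theta> j)"
proof -
  let ?e = "wave k (\<theta> + pi / 2)"
  define A where "A t x = H t j x * wave k \<theta> x" for t x
  define \<Phi> where "\<Phi> t x = 2 * pi * ((\<Sum>i\<in>UNIV. k$i * (U t i x * H t j x * ?e x))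
     - (\<Sum>i\<in>UNIV. k$i * (H t i x * V t j x * ?e x)))" for t x
  define C where "C = 2 * M + 2 * pi * (3 * norm k * (2 * M) + 3 * norm k * (2 * M))"
  have \<Phi>: "integrable torus (\<Phi> t)" "(\<integral>x. \<Phi> t x \<partial>torus) = induction_rate (U t) (V t) (H t) k \<theta> j"
    if r: "regular_time t" for t
  proof -
    note i = transport_mode_bound[OF r k]
    note iw = integrable_mult_wave[OF i(4)] integrable_mult_wave[OF i(6)]
    show "integrable torus (\<Phi> t)"
      unfolding \<Phi>_def[abs_def] using iw
      by (intro integrable_mult_right Bochner_Integration.integrable_add Bochner_Integration.integrable_diff Bochner_Integration.integrable_sum)
    show "(\<integral>x. \<Phi> t x \<partial>torus) = induction_rate (U t) (V t) (H t) k \<theta> j"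
      unfolding \<Phi>_def induction_rate_def using iw by simp
  qed
  have ev: "evolves T (\<lambda>t. (\<integral>x. A t x \<partial>torus)\<^sup>2) (\<lambda>t. 2 * (\<integral>x. A t x \<partial>torus) * (\<integral>x. \<Phi> t x \<partial>torus))"
  proof (rule weak_time_derivative[OF T])
    show "0 \<le> C" using M by (simp add: C_def)
    note m = fields_measurable wave_measurable_cylinder
    show "(\<lambda>z. A (fst z) (snd z)) \<in> borel_measurable (cylinder T)" unfolding A_def using m by measurable
    show "(\<lambda>z. \<Phi> (fst z) (snd z)) \<in> borel_measurable (cylinder T)" unfolding \<Phi>_def using m by measurable
    show "AE t in lborel. t \<in> {0<..<T} \<longrightarrow> integrable torus (A t) \<and> \<bar>\<integral>x. A t x \<partial>torus\<bar> \<le> C"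
      using AE_regular_time
    proof eventually_elim
      case (elim t)
      show ?case
      proof
        assume "t \<in> {0<..<T}"
        with elim have r: "regular_time t" by simp
        have "2 * M \<le> C" using M by (simp add: C_def)
        then show "integrable torus (A t) \<and> \<bar>\<integral>x. A t x \<partial>torus\<bar> \<le> C"
          unfolding A_def using integrable_mult_wave[OF L3_integrable[OF regular_timeD(5)[OF r]]] field_mode_bound(2)[OF r, of j k \<theta>] by auto
      qed
    qed
    show "AE t in lborel. t \<in> {0<..<T} \<longrightarrow> integrable torus (\<Phi> t) \<and> \<bar>\<integral>x. \<Phi> t x \<partial>torus\<bar> \<le> C"
      using AE_regular_time
    proof eventually_elim
      case (elim t)
      show ?case
      proof
        assume "t \<in> {0<..<T}"
        with elim have r: "regular_time t" by simp
        note b = transport_mode_bound[OF r k]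
        have 1: "\<bar>\<Sum>i\<in>UNIV. k$i * (\<integral>x. U t i x * H t j x * ?e x \<partial>torus)\<bar> \<le> 3 * norm k * (2 * M)"
          by (intro frequency_sum_bound b(2))
        have 2: "\<bar>\<Sum>i\<in>UNIV. k$i * (\<integral>x. H t i x * V t j x * ?e x \<partial>torus)\<bar> \<le> 3 * norm k * (2 * M)"
          by (intro frequency_sum_bound b(8))
        have "\<bar>induction_rate (U t) (V t) (H t) k \<theta> j\<bar> \<le> 2 * pi * (3 * norm k * (2 * M) + 3 * norm k * (2 * M))"
          unfolding induction_rate_def by (intro abs_two_pi_le abs_combine_le 1 2)
        then show "integrable torus (\<Phi> t) \<and> \<bar>\<integral>x. \<Phi> t x \<partial>torus\<bar> \<le> C"
          using \<Phi>[OF r] M by (simp add: C_def)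
      qed
    qed
    fix \<eta> \<eta>' assume \<eta>: "time_test T \<eta>" "\<And>t. (\<eta> has_real_derivative \<eta>' t) (at t)" "time_test T \<eta>'"
    define \<psi> where "\<psi> = (\<lambda>t x. (\<eta> t * wave k \<theta> x) *\<^sub>R (axis j 1 :: real^3))"
    note td = test_derivatives[OF \<eta>(2) \<psi>_def]
    have "test_function T \<psi>" unfolding \<psi>_def by (rule test_function_wave[OF \<eta>(1) k])
    then have W: "(LINT t:{0<..<T}|lborel. LINT x:cell|lborel.
           B t x \<bullet> time_deriv \<psi> t x
           + (\<Sum>i\<in>UNIV. \<Sum>j\<in>UNIV. B t x $ j * u t x $ i * partial i (\<psi> t) x $ j)
           - (\<Sum>i\<in>UNIV. \<Sum>j\<in>UNIV. v t x $ j * B t x $ i * partial i (\<psi> t) x $ j)) = 0"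
      using weak unfolding weak_solution_def by blast
    have eq: "B t x \<bullet> time_deriv \<psi> t x
           + (\<Sum>i\<in>UNIV. \<Sum>j\<in>UNIV. B t x $ j * u t x $ i * partial i (\<psi> t) x $ j)
           - (\<Sum>i\<in>UNIV. \<Sum>j\<in>UNIV. v t x $ j * B t x $ i * partial i (\<psi> t) x $ j) = \<eta>' t * A t x + \<eta> t * \<Phi> t x" for t x
    proof -
      have s: "(\<Sum>l\<in>UNIV. f l * (if l = j then c else 0)) = f j * c" for f :: "3 \<Rightarrow> real" and c
        by (simp add: if_distrib[of "\<lambda>z. _ * z"] cong: if_cong)
      show ?thesis
        unfolding td s A_def \<Phi>_def by (simp add: sum_3 algebra_simps)
    qed
    show "(LINT t:{0<..<T}|lborel. LINT x:cell|lborel. \<eta>' t * A t x + \<eta> t * \<Phi> t x) = 0"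
      using W unfolding eq .
  qed
  show ?thesis
    by (rule evolves_cong[OF ev]) (use AE_regular_time in \<open>auto elim!: eventually_mono simp: A_def \<Phi>\<close>)
qed

definition mollified_energy :: "nat \<Rightarrow> real \<Rightarrow> real" where
  "mollified_energy n t = (\<Sum>j\<in>UNIV. (\<integral>x. V t j x * trig (mollify (cos_kernel n) (V t j)) x \<partial>torus)
     + (\<integral>x. H t j x * trig (mollify (cos_kernel n) (H t j)) x \<partial>torus))"

definition mollified_flux :: "nat \<Rightarrow> real \<Rightarrow> real" where
  "mollified_flux n t = (\<Sum>j\<in>UNIV. flux (cos_kernel n) (U t) (V t j) (V t j) + flux (cos_kernel n) (U t) (H t j) (H t j)
     - 2 * flux (cos_kernel n) (H t) (V t j) (H t j))"

text \<open>
  A finite combination of the evolutions of single modes, whose rates \<open>energy_flux\<close> sums.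
\<close>

lemma mollified_energy_evolves: "evolves T (mollified_energy n) (mollified_flux n)"
proof -
  let ?L = "cos_kernel n"
  let ?v = "\<lambda>t j k \<theta>. \<integral>x. V t j x * wave k \<theta> x \<partial>torus" and ?b = "\<lambda>t j k \<theta>. \<integral>x. H t j x * wave k \<theta> x \<partial>torus"
  let ?R = "\<lambda>t k \<theta> j. momentum_rate (U t) (V t) (H t) (total_pressure t) k \<theta> j" and ?S = "\<lambda>t k \<theta> j. induction_rate (U t) (V t) (H t) k \<theta> j"
  have ev: "evolves T (\<lambda>t. \<Sum>z\<leftarrow>?L. (case z of (a, k, \<phi>) \<Rightarrow> a * (\<Sum>\<theta>\<in>{0, - pi / 2}. \<Sum>j\<in>UNIV. (?v t j k \<theta>)\<^sup>2 + (?b t j k \<theta>)\<^sup>2)))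
     (\<lambda>t. \<Sum>z\<leftarrow>?L. (case z of (a, k, \<phi>) \<Rightarrow> a * (\<Sum>\<theta>\<in>{0, - pi / 2}. \<Sum>j\<in>UNIV. 2 * ?v t j k \<theta> * ?R t k \<theta> j + 2 * ?b t j k \<theta> * ?S t k \<theta> j)))"
  proof (rule evolves_sum_list)
    fix z assume z: "z \<in> set ?L"
    obtain a k \<phi> where zz: "z = (a, k, \<phi>)" by (cases z)
    have k: "k \<in> lattice" using z cos_kernel(1)[of n] by (force simp: zz frequencies_def)
    show "evolves T (\<lambda>t. case z of (a, k, \<phi>) \<Rightarrow> a * (\<Sum>\<theta>\<in>{0, - pi / 2}. \<Sum>j\<in>UNIV. (?v t j k \<theta>)\<^sup>2 + (?b t j k \<theta>)\<^sup>2))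
       (\<lambda>t. case z of (a, k, \<phi>) \<Rightarrow> a * (\<Sum>\<theta>\<in>{0, - pi / 2}. \<Sum>j\<in>UNIV. 2 * ?v t j k \<theta> * ?R t k \<theta> j + 2 * ?b t j k \<theta> * ?S t k \<theta> j))"
      unfolding zz case_prod_conv
      by (intro evolves_cmult evolves_sum evolves_add momentum_evolves[OF k] induction_evolves[OF k] finite.intros finite_class.finite_UNIV)
  qed
  show ?thesis
  proof (rule evolves_cong[OF ev])
    show "AE t in lborel. t \<in> {0<..<T} \<longrightarrow>
       (\<Sum>z\<leftarrow>?L. (case z of (a, k, \<phi>) \<Rightarrow> a * (\<Sum>\<theta>\<in>{0, - pi / 2}. \<Sum>j\<in>UNIV. (?v t j k \<theta>)\<^sup>2 + (?b t j k \<theta>)\<^sup>2))) = mollified_energy n t \<and>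
       (\<Sum>z\<leftarrow>?L. (case z of (a, k, \<phi>) \<Rightarrow> a * (\<Sum>\<theta>\<in>{0, - pi / 2}. \<Sum>j\<in>UNIV. 2 * ?v t j k \<theta> * ?R t k \<theta> j + 2 * ?b t j k \<theta> * ?S t k \<theta> j)))
         = mollified_flux n t"
      using AE_regular_time div_free_fields
    proof eventually_elim
      case (elim t)
      show ?case
      proof (intro impI conjI)
        assume "t \<in> {0<..<T}"
        with elim have r: "regular_time t" and d: "div_free (V t)" by auto
        note rd = regular_timeD[OF r] and b = transport_mode_bound[OF r lattice_0]
        have swap: "(\<Sum>z\<leftarrow>L. (case z of (a, k, \<phi>) \<Rightarrow> a * (\<Sum>\<theta>\<in>{0, - pi / 2}. \<Sum>j\<in>UNIV. f j k \<theta> + g j k \<theta>)))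
          = (\<Sum>j\<in>UNIV. (\<Sum>(a, k, \<phi>)\<leftarrow>L. a * (\<Sum>\<theta>\<in>{0, - pi / 2}. f j k \<theta>)) + (\<Sum>(a, k, \<phi>)\<leftarrow>L. a * (\<Sum>\<theta>\<in>{0, - pi / 2}. g j k \<theta>)))"
          for f g :: "3 \<Rightarrow> real^3 \<Rightarrow> real \<Rightarrow> real" and L :: "waves"
        proof (induction L)
          case (Cons z L)
          obtain a k \<phi> where z: "z = (a, k, \<phi>)" by (cases z)
          have "a * (\<Sum>\<theta>\<in>{0, - pi / 2}. \<Sum>j\<in>UNIV. f j k \<theta> + g j k \<theta>)
            = (\<Sum>j\<in>UNIV. a * (\<Sum>\<theta>\<in>{0, - pi / 2}. f j k \<theta>) + a * (\<Sum>\<theta>\<in>{0, - pi / 2}. g j k \<theta>))"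
            unfolding sum_phases sum_3 by (simp add: algebra_simps)
          then show ?case unfolding z list.map sum_list.Cons case_prod_conv Cons.IH by (simp only: sum.distrib)
        qed simp
        show "(\<Sum>z\<leftarrow>?L. (case z of (a, k, \<phi>) \<Rightarrow> a * (\<Sum>\<theta>\<in>{0, - pi / 2}. \<Sum>j\<in>UNIV. (?v t j k \<theta>)\<^sup>2 + (?b t j k \<theta>)\<^sup>2))) = mollified_energy n t"
          unfolding mollified_energy_def energy_mode_sum[OF L3_integrable[OF rd(4)]] energy_mode_sum[OF L3_integrable[OF rd(5)]]
          by (rule swap)
        show "(\<Sum>z\<leftarrow>?L. (case z of (a, k, \<phi>) \<Rightarrow> a * (\<Sum>\<theta>\<in>{0, - pi / 2}. \<Sum>j\<in>UNIV. 2 * ?v t j k \<theta> * ?R t k \<theta> j + 2 * ?b t j k \<theta> * ?S t k \<theta> j)))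
         = mollified_flux n t"
          unfolding mollified_flux_def
          by (rule energy_flux[OF rd(4) rd(5) b(3) b(4) d cos_kernel(1)])
      qed
    qed
  qed
qed

text \<open>
  The two transport terms have orders \<open>1 + 2\<sigma>\<close> and \<open>1 + 2\<rho>\<close>, the magnetic one has
  order \<open>\<sigma> + 2\<rho>\<close>; the factor 720 is 240 for each of the three components.
\<close>

definition flux_decay :: "nat \<Rightarrow> real" where
  "flux_decay n = 720 * pi * ((1 + 3 / \<alpha>) * real (Suc n) powr (- \<sigma>) + (1 + 3 / \<alpha>) * real (Suc n) powr (- \<rho>)
     + 2 * real (Suc n) powr ((1 - (\<rho> + \<sigma> + \<rho>)) / 2))"

lemma flux_decay_nonneg: "flux_decay n \<ge> 0"
  unfolding flux_decay_def using \<alpha> by (intro mult_nonneg_nonneg add_nonneg_nonneg) auto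

lemma flux_decay_tendsto_0: "flux_decay \<longlonglongrightarrow> 0"
proof -
  have "- \<sigma> < 0" "- \<rho> < 0" "(1 - (\<rho> + \<sigma> + \<rho>)) / 2 < 0" using \<sigma> \<rho> \<sigma>\<rho> by auto
  note p = this[THEN powr_tendsto_0]
  have "flux_decay \<longlonglongrightarrow> 720 * pi * ((1 + 3 / \<alpha>) * 0 + (1 + 3 / \<alpha>) * 0 + 2 * 0)"
    unfolding flux_decay_def[abs_def] by (intro tendsto_mult tendsto_add tendsto_const p)
  then show ?thesis by simp
qed

lemma mollified_flux_bound:
  assumes r: "regular_time t" and d: "div_free (U t)" "div_free (H t)"
  shows "\<bar>mollified_flux n t\<bar> \<le> flux_decay n * K t"
proof -
  note rd = regular_timeD[OF r]
  have N: "N t \<ge> 0" and K: "N t ^ 3 \<le> K t" using r by (auto simp: regular_time_def nikolskii_def)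
  have V3: "(\<integral>x. \<bar>V t j x\<bar> ^ 3 \<partial>torus) \<le> N t ^ 3" for j using rd(6) by (simp add: nikolskii_def)
  let ?c = "1 + 3 / \<alpha>" and ?p = "\<lambda>e. real (Suc n) powr e"
  let ?e = "(1 - (\<rho> + \<sigma> + \<rho>)) / 2"
  have 1: "\<bar>flux (cos_kernel n) (U t) (V t j) (V t j)\<bar> \<le> 240 * pi * ?p (- \<sigma>) * (N t * ?c * N t * N t)" for j
    by (rule transport_flux_bound[OF \<alpha> rd(1-3) d(1) rd(8) rd(4) N V3 rd(6)]) (use \<sigma> in auto)
  have 2: "\<bar>flux (cos_kernel n) (U t) (H t j) (H t j)\<bar> \<le> 240 * pi * ?p (- \<rho>) * (N t * ?c * N t * N t)" for j
    by (rule transport_flux_bound[OF \<alpha> rd(1-3) d(1) rd(8) rd(4) N V3 rd(7)]) (use \<rho> in auto)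
  have 3: "\<bar>flux (cos_kernel n) (H t) (V t j) (H t j)\<bar> \<le> 240 * pi * ?p ?e * (N t * N t * N t)" for j
    by (rule flux_bound[OF d(2) rd(7) rd(6) rd(7)]) (use \<sigma> \<rho> in auto)
  have "\<bar>mollified_flux n t\<bar> \<le> (\<Sum>j\<in>(UNIV :: 3 set). 240 * pi * ?p (- \<sigma>) * (N t * ?c * N t * N t)
      + 240 * pi * ?p (- \<rho>) * (N t * ?c * N t * N t) + 2 * (240 * pi * ?p ?e * (N t * N t * N t)))"
    unfolding mollified_flux_def
  proof (intro order_trans[OF sum_abs] sum_mono abs_combine_le 1 2)
    fix j show "\<bar>2 * flux (cos_kernel n) (H t) (V t j) (H t j)\<bar> \<le> 2 * (240 * pi * ?p ?e * (N t * N t * N t))"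
    proof -
      have "\<bar>2 * flux (cos_kernel n) (H t) (V t j) (H t j)\<bar> = 2 * \<bar>flux (cos_kernel n) (H t) (V t j) (H t j)\<bar>" by (simp add: abs_mult)
      also have "\<dots> \<le> 2 * (240 * pi * ?p ?e * (N t * N t * N t))" by (intro mult_left_mono 3) simp
      finally show ?thesis .
    qed
  qed
  also have "\<dots> = flux_decay n * N t ^ 3"
    unfolding sum_3 flux_decay_def by (simp add: power3_eq_cube algebra_simps del: of_nat_Suc)
  also have "\<dots> \<le> flux_decay n * K t" by (intro mult_left_mono K flux_decay_nonneg)
  finally show ?thesis .
qed

text \<open>
  The mollified energies at two times differ by the time integral of a flux that tends to
  zero, and they converge to the energies.
\<close>

lemma energy_conserved:
  "AE t1 in lebesgue_on {0<..<T}. AE t2 in lebesgue_on {0<..<T}.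
     (Lq_norm 2 (v t1))\<^sup>2 + (Lq_norm 2 (B t1))\<^sup>2 = (Lq_norm 2 (v t2))\<^sup>2 + (Lq_norm 2 (B t2))\<^sup>2"
proof -
  have "\<forall>n. \<exists>G X. integrable lborel X \<and> (AE t in lborel. t \<in> {0<..<T} \<longrightarrow> mollified_energy n t = G t \<and> mollified_flux n t = X t) \<and>
     (\<forall>s t. s \<le> t \<longrightarrow> G t - G s = (\<integral>\<tau>. indicator {s..<t} \<tau> * X \<tau> \<partial>lborel))"
    using mollified_energy_evolves unfolding evolves_def by blast
  from choice[OF this] obtain G where "\<forall>n. \<exists>X. integrable lborel X \<and> (AE t in lborel. t \<in> {0<..<T} \<longrightarrow> mollified_energy n t = G n t \<and> mollified_flux n t = X t) \<and>
     (\<forall>s t. s \<le> t \<longrightarrow> G n t - G n s = (\<integral>\<tau>. indicator {s..<t} \<tau> * X \<tau> \<partial>lborel))" by blast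
  from choice[OF this] obtain X where GX': "\<forall>n. integrable lborel (X n) \<and> (AE t in lborel. t \<in> {0<..<T} \<longrightarrow> mollified_energy n t = G n t \<and> mollified_flux n t = X n t) \<and>
     (\<forall>s t. s \<le> t \<longrightarrow> G n t - G n s = (\<integral>\<tau>. indicator {s..<t} \<tau> * X n \<tau> \<partial>lborel))" by blast
  then have iX: "\<And>n. integrable lborel (X n)"
    and G: "\<And>n. AE t in lborel. t \<in> {0<..<T} \<longrightarrow> mollified_energy n t = G n t \<and> mollified_flux n t = X n t"
    and GX: "\<And>n s t. s \<le> t \<Longrightarrow> G n t - G n s = (\<integral>\<tau>. indicator {s..<t} \<tau> * X n \<tau> \<partial>lborel)"
    by blast+
  define Z where "Z t \<longleftrightarrow> regular_time t \<and> (\<forall>n. mollified_energy n t = G n t)" for t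
  have Z: "AE t in lborel. t \<in> {0<..<T} \<longrightarrow> Z t"
  proof -
    have "AE t in lborel. \<forall>n. t \<in> {0<..<T} \<longrightarrow> mollified_energy n t = G n t \<and> mollified_flux n t = X n t"
      using G by (subst AE_all_countable) auto
    then show ?thesis using AE_regular_time by eventually_elim (auto simp: Z_def)
  qed
  define I where "I = (\<integral>\<tau>. K \<tau> \<partial>lebesgue_on {0<..<T})"
  have bound: "(\<integral>\<tau>. indicator {0<..<T} \<tau> * \<bar>X n \<tau>\<bar> \<partial>lborel) \<le> flux_decay n * I" for n
  proof -
    have mX: "X n \<in> borel_measurable borel" using iX by auto
    have "(\<integral>\<tau>. indicator {0<..<T} \<tau> * \<bar>X n \<tau>\<bar> \<partial>lborel) = (\<integral>\<tau>. indicator {0<..<T} \<tau> *\<^sub>R \<bar>X n \<tau>\<bar> \<partial>lebesgue)"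
      using mX by (subst integral_completion) auto
    also have "\<dots> = (\<integral>\<tau>. \<bar>X n \<tau>\<bar> \<partial>lebesgue_on {0<..<T})"
      by (rule integral_restrict_space[symmetric]) simp
    also have "\<dots> \<le> (\<integral>\<tau>. flux_decay n * K \<tau> \<partial>lebesgue_on {0<..<T})"
    proof (rule integral_mono_AE)
      have "integrable lborel (\<lambda>\<tau>. indicator {0<..<T} \<tau> *\<^sub>R \<bar>X n \<tau>\<bar>)"
        using iX by (intro integrable_mult_indicator) auto
      then have "integrable lebesgue (\<lambda>\<tau>. indicator {0<..<T} \<tau> *\<^sub>R \<bar>X n \<tau>\<bar>)"
        using mX by (subst integrable_completion) auto
      then show "integrable (lebesgue_on {0<..<T}) (\<lambda>\<tau>. \<bar>X n \<tau>\<bar>)"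
        by (subst integrable_restrict_space) auto
      show "integrable (lebesgue_on {0<..<T}) (\<lambda>\<tau>. flux_decay n * K \<tau>)" using K by simp
      show "AE \<tau> in lebesgue_on {0<..<T}. \<bar>X n \<tau>\<bar> \<le> flux_decay n * K \<tau>"
        unfolding AE_lebesgue_on_time using G[of n] AE_regular_time div_free_fields
      proof eventually_elim
        case (elim t)
        show ?case
        proof
          assume "t \<in> {0<..<T}"
          with elim have "mollified_flux n t = X n t" "regular_time t" "div_free (U t)" "div_free (H t)" by auto
          then show "\<bar>X n t\<bar> \<le> flux_decay n * K t" using mollified_flux_bound[of t n] by simp
        qed
      qed
    qed
    finally show ?thesis by (simp add: I_def)
  qed
  have diff: "\<bar>mollified_energy n t - mollified_energy n s\<bar> \<le> flux_decay n * I"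
    if "Z s" "Z t" "s \<in> {0<..<T}" "t \<in> {0<..<T}" "s \<le> t" for n s t
  proof -
    have "\<bar>mollified_energy n t - mollified_energy n s\<bar> = \<bar>\<integral>\<tau>. indicator {s..<t} \<tau> * X n \<tau> \<partial>lborel\<bar>"
      using that GX[of s t n] by (simp add: Z_def)
    also have "\<dots> \<le> (\<integral>\<tau>. \<bar>indicator {s..<t} \<tau> * X n \<tau>\<bar> \<partial>lborel)" by (rule integral_abs_bound)
    also have "\<dots> \<le> (\<integral>\<tau>. indicator {0<..<T} \<tau> * \<bar>X n \<tau>\<bar> \<partial>lborel)"
    proof (rule integral_mono)
      show "integrable lborel (\<lambda>\<tau>. \<bar>indicator {s..<t} \<tau> * X n \<tau>\<bar>)"
        using integrable_indicator_mult[OF iX, of "{s..<t}"] by simp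
      show "integrable lborel (\<lambda>\<tau>. indicator {0<..<T} \<tau> * \<bar>X n \<tau>\<bar>)"
        using iX by (intro integrable_indicator_mult) auto
    qed (use that in \<open>auto simp: indicator_def\<close>)
    also have "\<dots> \<le> flux_decay n * I" by (rule bound)
    finally show ?thesis .
  qed
  have lim: "(\<lambda>n. mollified_energy n t) \<longlonglongrightarrow> (Lq_norm 2 (v t))\<^sup>2 + (Lq_norm 2 (B t))\<^sup>2" if "Z t" for t
  proof -
    have r: "regular_time t" using that by (simp add: Z_def)
    note rd = regular_timeD[OF r]
    have "(\<lambda>n. mollified_energy n t) \<longlonglongrightarrow> (\<Sum>j\<in>UNIV. (\<integral>x. (V t j x)\<^sup>2 \<partial>torus) + (\<integral>x. (H t j x)\<^sup>2 \<partial>torus))"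
      unfolding mollified_energy_def
      by (intro tendsto_sum tendsto_add kernel_energy_limit[OF rd(6)] kernel_energy_limit[OF rd(7)]) (use \<sigma> \<rho> in auto)
    moreover have "Lq 2 (v t)" "Lq 2 (B t)" using r by (auto simp: regular_time_def)
    ultimately show ?thesis by (simp add: Lq_2_components(5) sum.distrib)
  qed
  have eq: "(Lq_norm 2 (v t))\<^sup>2 + (Lq_norm 2 (B t))\<^sup>2 = (Lq_norm 2 (v s))\<^sup>2 + (Lq_norm 2 (B s))\<^sup>2"
    if "Z s" "Z t" "s \<in> {0<..<T}" "t \<in> {0<..<T}" "s \<le> t" for s t
  proof -
    have "(\<lambda>n. flux_decay n * I) \<longlonglongrightarrow> 0 * I" by (intro tendsto_mult flux_decay_tendsto_0 tendsto_const)
    then have z: "(\<lambda>n. flux_decay n * I) \<longlonglongrightarrow> 0" by simp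
    have "(\<lambda>n. mollified_energy n t - mollified_energy n s) \<longlonglongrightarrow> 0"
      using diff[OF that] unfolding real_norm_def[symmetric]
      by (intro Lim_null_comparison[OF _ z] always_eventually allI)
    from LIMSEQ_unique[OF tendsto_diff[OF lim[OF that(2)] lim[OF that(1)]] this] show ?thesis by simp
  qed
  have eq': "(Lq_norm 2 (v s))\<^sup>2 + (Lq_norm 2 (B s))\<^sup>2 = (Lq_norm 2 (v t))\<^sup>2 + (Lq_norm 2 (B t))\<^sup>2"
    if "Z s" "Z t" "s \<in> {0<..<T}" "t \<in> {0<..<T}" for s t
    using eq[of s t] eq[of t s] that by (cases "s \<le> t") auto
  show ?thesis
    unfolding AE_lebesgue_on_time using Z
  proof eventually_elim
    case (elim s)
    show ?case
    proof
      assume s: "s \<in> {0<..<T}"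
      show "AE t in lborel. t \<in> {0<..<T} \<longrightarrow>
        (Lq_norm 2 (v s))\<^sup>2 + (Lq_norm 2 (B s))\<^sup>2 = (Lq_norm 2 (v t))\<^sup>2 + (Lq_norm 2 (B t))\<^sup>2"
        using Z by eventually_elim (use eq' elim s in blast)
    qed
  qed
qed

end

theorem theoremC6:
  fixes \<alpha> T s r :: real
    and u v B :: "real \<Rightarrow> real^3 \<Rightarrow> real^3"
    and p :: "real \<Rightarrow> real^3 \<Rightarrow> real"
  assumes "\<alpha> > 0" and "T > 0"
    and "weak_solution \<alpha> T u v B p"
    and "s > 0" and "r > 0" and "s + 2 * r > 1"
    and "L3_besov T s v" and "L3_besov T r B"
  shows "AE t1 in lebesgue_on {0<..<T}. AE t2 in lebesgue_on {0<..<T}.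
           (Lq_norm 2 (v t1))\<^sup>2 + (Lq_norm 2 (B t1))\<^sup>2 =
           (Lq_norm 2 (v t2))\<^sup>2 + (Lq_norm 2 (B t2))\<^sup>2"
proof -
  \<comment> \<open>With \<open>\<sigma> = 1 - \<rho>\<close> the sum \<open>\<sigma> + 2 \<rho>\<close> is \<open>1 + \<rho>\<close>; where the cap \<open>3 / 4\<close> is attained, \<open>2 \<rho>\<close> exceeds one by itself and \<open>1 - \<rho>\<close> is still positive.\<close>
  define \<rho> \<sigma> where "\<rho> = min r (3 / 4)" and "\<sigma> = min s (1 - \<rho>)"
  have \<rho>: "0 < \<rho>" "\<rho> < 1" "\<rho> \<le> r" and \<sigma>: "0 < \<sigma>" "\<sigma> < 1" "\<sigma> \<le> s" and \<sigma>\<rho>: "\<sigma> + 2 * \<rho> > 1"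
    using assms(4-6) by (auto simp: \<rho>_def \<sigma>_def min_def)
  obtain c where c: "c \<ge> 0" "\<And>f :: real^3 \<Rightarrow> real^3. besov s f \<Longrightarrow> besov_norm s f \<ge> 0 \<and> (\<forall>j. nikolskii \<sigma> (c * besov_norm s f) (\<lambda>x. f x $ j))"
    using besov_nikolskii[OF \<sigma>] by blast
  obtain d where d: "d \<ge> 0" "\<And>f :: real^3 \<Rightarrow> real^3. besov r f \<Longrightarrow> besov_norm r f \<ge> 0 \<and> (\<forall>j. nikolskii \<rho> (d * besov_norm r f) (\<lambda>x. f x $ j))"
    using besov_nikolskii[OF \<rho>] by blast
  define N K where "N t = c * besov_norm s (v t) + d * besov_norm r (B t)"
    and "K t = 4 * (c ^ 3 * besov_norm s (v t) ^ 3 + d ^ 3 * besov_norm r (B t) ^ 3)" for t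
  have "Linf_Lq T 2 v" "Linf_Lq T 2 B" "Linf_Lq T 1 p" using assms(3) by (auto simp: weak_solution_def)
  then obtain c1 c2 c3 where c123: "AE t in lebesgue_on {0<..<T}. Lq 2 (v t) \<and> Lq_norm 2 (v t) \<le> c1"
    "AE t in lebesgue_on {0<..<T}. Lq 2 (B t) \<and> Lq_norm 2 (B t) \<le> c2"
    "AE t in lebesgue_on {0<..<T}. Lq 1 (p t) \<and> Lq_norm 1 (p t) \<le> c3" unfolding Linf_Lq_def by blast
  define M where "M = 1 + c1\<^sup>2 + c2\<^sup>2 + \<bar>c3\<bar>"
  have bounds: "AE t in lborel. t \<in> {0<..<T} \<longrightarrow> Lq 2 (v t) \<and> Lq 2 (B t) \<and> Lq 1 (p t) \<and>
      (Lq_norm 2 (v t))\<^sup>2 \<le> M \<and> (Lq_norm 2 (B t))\<^sup>2 \<le> M \<and> Lq_norm 1 (p t) \<le> M"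
    using c123 unfolding AE_lebesgue_on_time
  proof eventually_elim
    case (elim t)
    have sq: "(Lq_norm 2 f)\<^sup>2 \<le> a\<^sup>2" if "Lq_norm 2 f \<le> a" for f :: "real^3 \<Rightarrow> real^3" and a
      using that by (intro power_mono) (auto simp: Lq_norm_def)
    have le: "c1\<^sup>2 \<le> M" "c2\<^sup>2 \<le> M" "c3 \<le> M"
      unfolding M_def using zero_le_power2[of c1] zero_le_power2[of c2] by linarith+
    show ?case using elim sq le by (blast intro: order_trans)
  qed
  have B: "AE t in lebesgue_on {0<..<T}. besov s (v t)" "AE t in lebesgue_on {0<..<T}. besov r (B t)"
    and K: "integrable (lebesgue_on {0<..<T}) K"
    using assms(7,8) unfolding L3_besov_def K_def[abs_def] by auto
  have "AE t in lborel. t \<in> {0<..<T} \<longrightarrow>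
      (\<forall>j. nikolskii \<sigma> (N t) (\<lambda>x. v t x $ j)) \<and> (\<forall>j. nikolskii \<rho> (N t) (\<lambda>x. B t x $ j)) \<and> N t ^ 3 \<le> K t"
    using B unfolding AE_lebesgue_on_time
  proof eventually_elim
    case (elim t)
    show ?case
    proof
      assume "t \<in> {0<..<T}"
      with elim have b: "besov s (v t)" "besov r (B t)" by auto
      define X Y where "X = c * besov_norm s (v t)" and "Y = d * besov_norm r (B t)"
      have XY: "X \<ge> 0" "Y \<ge> 0" unfolding X_def Y_def using c(1) d(1) c(2)[OF b(1)] d(2)[OF b(2)] by auto
      \<comment> \<open>This is \<open>(X + Y)\<^sup>3 \<le> 4 (X\<^sup>3 + Y\<^sup>3)\<close>, the origin of the factor 4 in \<open>K\<close>.\<close>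
      have "0 \<le> 3 * ((X + Y) * (X - Y)\<^sup>2)" using XY by simp
      also have "3 * ((X + Y) * (X - Y)\<^sup>2) = 4 * (X ^ 3 + Y ^ 3) - (X + Y) ^ 3"
        by (simp add: power2_eq_square power3_eq_cube algebra_simps)
      finally have "N t ^ 3 \<le> K t"
        by (simp add: N_def K_def X_def Y_def power_mult_distrib)
      moreover have "X \<le> N t" "Y \<le> N t" using XY by (auto simp: N_def X_def Y_def)
      ultimately show "(\<forall>j. nikolskii \<sigma> (N t) (\<lambda>x. v t x $ j)) \<and> (\<forall>j. nikolskii \<rho> (N t) (\<lambda>x. B t x $ j)) \<and> N t ^ 3 \<le> K t"
        using c(2)[OF b(1)] d(2)[OF b(2)] unfolding X_def Y_def by (blast intro: nikolskii_mono)
    qed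
  qed
  moreover have "M \<ge> 1" by (simp add: M_def)
  ultimately have "leray_alpha_mhd \<alpha> T \<sigma> \<rho> M u v B p N K"
    using assms(1-3) \<rho> \<sigma> \<sigma>\<rho> bounds K by (intro leray_alpha_mhd.intro)
  then show ?thesis by (rule leray_alpha_mhd.energy_conserved)
qed

end
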